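(* Let $G$ be a countable row-finite directed graph without sinks, with adjacency matrix $A=(A_{vw})_{v,w\in V_G}$, and let $\beta\in\mathbb R$. There is a bijective correspondence between the $\beta$-KMS weights $\psi$ for the gauge action on $C^*(G)$ and the non-zero elements $\xi\in\mathbb R^{V_G}$ satisfying a') $\xi_v\ge0$, and b') $\sum_{w\in V_G}A_{vw}\xi_w=e^{\beta}\xi_v$ for all $v\in V_G$; the correspondence is given by $\xi_v=\psi(1_{C_v})$, $v\in V_G$.
   Context: **Graphs.** $G$ is a directed graph with countable vertex set $V_G$ and countable edge set $E_G$; $s(e)$ and $r(e)$ are the source and range of an edge $e$. Row-finite: each vertex emits finitely many edges. No sinks: each vertex emits at least one edge. $A_{vw}=\#\{e\in E_G:s(e)=v,\ r(e)=w\}$. $\mathbb R^{V_G}$ is the space of all functions $V_G\to\mathbb R$. $P(G)$ is the set of infinite paths $p=(p_i)_{i\ge1}\in E_G^{\mathbb N}$, $r(p_i)=s(p_{i+1})$, with $s(p)=s(p_1)$ and the topology having as base the cylinders $Z(e_1\cdots e_n)=\{p:p_i=e_i,\ 1\le i\le n\}$; it is totally disconnected, second countable, locally compact Hausdorff. $C_v=\{p\in P(G):s(p)=v\}$, a compact open set, with characteristic function $1_{C_v}\in C_c(P(G))$. **The algebra $C^*(G)$ and the gauge action.** $\sigma$ is the shift on $P(G)$, $\sigma(p_1p_2p_3\cdots)=p_2p_3\cdots$, a local homeomorphism. $\Gamma_\sigma=\{(p,k,q)\in P(G)\times\mathbb Z\times P(G):\exists n,m\in\mathbb N,\ k=n-m,\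 \sigma^n(p)=\sigma^m(q)\}$ is a groupoid with $(p,k,q)(q,k',q')=(p,k+k',q')$, $(p,k,q)^{-1}=(q,-k,p)$, $r(p,k,q)=p$, $s(p,k,q)=q$, unit space identified with $P(G)$ via $p\mapsto(p,0,p)$ (so $C_c(P(G))\subseteq C_c(\Gamma_\sigma)$). The set $\Gamma_\sigma(k,n)=\{(p,k,q):\sigma^{k+n}(p)=\sigma^n(q)\}$ has the relative topology from $P(G)\times\mathbb Z\times P(G)$, $\Gamma_\sigma(k)=\bigcup_n\Gamma_\sigma(k,n)$ the inductive limit topology, and each $\Gamma_\sigma(k)$ is open and closed in $\Gamma_\sigma=\bigcup_k\Gamma_\sigma(k)$; this makes $\Gamma_\sigma$ an étale second countable locally compact Hausdorff groupoid. $C^*(G)$ is the reduced groupoid $C^*$-algebra $C^*_r(\Gamma_\sigma)$. The gauge action $\gamma=(\gamma_t)_{t\in\mathbb R}$ is determined by $\gamma_t(f)(p,k,q)=e^{ikt}f(p,k,q)$ for $f\in C_c(\Gamma_\sigma)$. **KMS weights.** A weight on a $C^*$-algebra $A$ is a map $\psi:A_+\to[0,\infty]$ with $\psi(a+b)=\psi(a)+\psi(b)$, $\psi(\lambda a)=\lambda\psi(a)$ for $\lambda>0$. It is proper when it is non-zero, densely defined ($\{a\in A_+:\psi(a)<\infty\}$ is dense in $A_+$) and lower semi-continuous ($\{a\in A_+:\psi(a)\le\alpha\}$ is closed for all $\alpha\ge0$). For proper $\psi$ put $\mathcal N_\psi=\{a\in A:\psi(a^*a)<\infty\}$; $\psi$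 extends uniquely to a linear functional, also denoted $\psi$, on $\mathrm{Span}\{a^*b:a,b\in\mathcal N_\psi\}$. For a point-wise norm-continuous one-parameter group $\alpha$ of automorphisms of $A$ and $\beta\in\mathbb R$, a proper weight $\psi$ is a $\beta$-KMS weight for $\alpha$ when (i) $\psi\circ\alpha_t=\psi$ for all $t\in\mathbb R$, and (ii) for all $a,b\in\mathcal N_\psi\cap\mathcal N_\psi^*$ there is a continuous bounded function $F$ on the closed strip $D_\beta$ of complex numbers with imaginary part between $0$ and $\beta$, holomorphic in its interior, with $F(t)=\psi(a\alpha_t(b))$ and $F(t+i\beta)=\psi(\alpha_t(b)a)$ for all $t\in\mathbb R$. *)

theory Defs
  imports "HOL-Analysis.Analysis" "Graph_Theory.Digraph"
begin

section \<open>The Hilbert space of square summable complex functions\<close>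

definition square_summable :: "('i \<Rightarrow> complex) \<Rightarrow> bool" where
  "square_summable f \<longleftrightarrow> (\<lambda>i. (cmod (f i))\<^sup>2) summable_on UNIV"

typedef 'i ell2 = "{f :: 'i \<Rightarrow> complex. square_summable f}"
  by (rule exI[of _ "\<lambda>_. 0"]) (simp add: square_summable_def)

setup_lifting type_definition_ell2

lemma square_summable_add:
  assumes "square_summable f" "square_summable g"
  shows "square_summable (\<lambda>i. f i + g i)"
proof -
  have s: "(\<lambda>i. 2 * (cmod (f i))\<^sup>2 + 2 * (cmod (g i))\<^sup>2) summable_on UNIV"
    using assms unfolding square_summable_def
    by (intro summable_on_add summable_on_cmult_right)
  have "(cmod (f i + g i))\<^sup>2 \<le> 2 * (cmod (f i))\<^sup>2 + 2 * (cmod (g i))\<^sup>2" for i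
  proof -
    have "(cmod (f i + g i))\<^sup>2 \<le> (cmod (f i) + cmod (g i))\<^sup>2"
      by (intro power_mono norm_triangle_ineq) simp
    also have "\<dots> \<le> 2 * (cmod (f i))\<^sup>2 + 2 * (cmod (g i))\<^sup>2"
      using sum_squares_bound[of "cmod (f i)" "cmod (g i)"] by (simp add: power2_sum)
    finally show ?thesis .
  qed
  then show ?thesis
    unfolding square_summable_def
    by (intro summable_on_comparison_test[OF s]) auto
qed

lemma square_summable_cmult:
  "square_summable f \<Longrightarrow> square_summable (\<lambda>i. c * f i)"
  unfolding square_summable_def
  by (simp add: norm_mult power_mult_distrib summable_on_cmult_right)

lemma summable_on_cmod_mult:
  assumes "square_summable f" "square_summable g"
  shows "(\<lambda>i. cmod (f i) * cmod (g i)) summable_on UNIV"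
proof (rule summable_on_comparison_test)
  show "(\<lambda>i. (cmod (f i))\<^sup>2 + (cmod (g i))\<^sup>2) summable_on UNIV"
    using assms unfolding square_summable_def by (rule summable_on_add)
  show "cmod (f i) * cmod (g i) \<le> (cmod (f i))\<^sup>2 + (cmod (g i))\<^sup>2" for i
  proof -
    have "0 \<le> cmod (f i) * cmod (g i)" by simp
    then show ?thesis
      using sum_squares_bound[of "cmod (f i)" "cmod (g i)"] by linarith
  qed
qed simp

lemma summable_on_inner:
  assumes "square_summable f" "square_summable g"
  shows "(\<lambda>i. f i \<bullet> g i) summable_on UNIV"
proof (rule abs_summable_summable, rule summable_on_comparison_test)
  show "(\<lambda>i. cmod (f i) * cmod (g i)) summable_on UNIV"
    by (rule summable_on_cmod_mult[OF assms])
  show "norm (f i \<bullet> g i) \<le> cmod (f i) * cmod (g i)" for i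
    using Cauchy_Schwarz_ineq2[of "f i" "g i"] by simp
qed simp

text \<open>The real inner product is the real part of the complex one; the latter is
  \<open>cinner_ell2\<close> below, conjugate linear in the first variable.\<close>

instantiation ell2 :: (type) real_vector
begin

lift_definition zero_ell2 :: "'a ell2" is "\<lambda>_. 0"
  by (simp add: square_summable_def)

lift_definition plus_ell2 :: "'a ell2 \<Rightarrow> 'a ell2 \<Rightarrow> 'a ell2" is "\<lambda>f g i. f i + g i"
  by (rule square_summable_add)

lift_definition uminus_ell2 :: "'a ell2 \<Rightarrow> 'a ell2" is "\<lambda>f i. - f i"
  by (simp add: square_summable_def)

lift_definition minus_ell2 :: "'a ell2 \<Rightarrow> 'a ell2 \<Rightarrow> 'a ell2" is "\<lambda>f g i. f i - g i"
  using square_summable_add[of _ "\<lambda>i. - _ i"] by (simp add: square_summable_def)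

lift_definition scaleR_ell2 :: "real \<Rightarrow> 'a ell2 \<Rightarrow> 'a ell2" is "\<lambda>r f i. of_real r * f i"
  by (rule square_summable_cmult)

instance
proof
  fix x y z :: "'a ell2" and a b :: real
  show "x + y + z = x + (y + z)" by transfer (simp add: add.assoc)
  show "x + y = y + x" by transfer (simp add: add.commute)
  show "0 + x = x" by transfer simp
  show "- x + x = 0" by transfer simp
  show "x - y = x + - y" by transfer simp
  show "a *\<^sub>R (x + y) = a *\<^sub>R x + a *\<^sub>R y" by transfer (simp add: distrib_left)
  show "(a + b) *\<^sub>R x = a *\<^sub>R x + b *\<^sub>R x" by transfer (simp add: distrib_right)
  show "a *\<^sub>R b *\<^sub>R x = (a * b) *\<^sub>R x" by transfer (simp add: mult.assoc)
  show "1 *\<^sub>R x = x" by transfer simp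
qed

end

instantiation ell2 :: (type) real_inner
begin

lift_definition inner_ell2 :: "'a ell2 \<Rightarrow> 'a ell2 \<Rightarrow> real" is "\<lambda>f g. \<Sum>\<^sub>\<infinity>i. f i \<bullet> g i" .

definition norm_ell2 :: "'a ell2 \<Rightarrow> real" where
  "norm_ell2 x = sqrt (x \<bullet> x)"

definition dist_ell2 :: "'a ell2 \<Rightarrow> 'a ell2 \<Rightarrow> real" where
  "dist_ell2 x y = norm (x - y)"

definition sgn_ell2 :: "'a ell2 \<Rightarrow> 'a ell2" where
  "sgn_ell2 x = inverse (norm x) *\<^sub>R x"

definition uniformity_ell2 :: "('a ell2 \<times> 'a ell2) filter" where
  "uniformity_ell2 = (INF e\<in>{0 <..}. principal {(x, y). dist x y < e})"

definition open_ell2 :: "'a ell2 set \<Rightarrow> bool" where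
  "open_ell2 U \<longleftrightarrow> (\<forall>x\<in>U. eventually (\<lambda>(x', y). x' = x \<longrightarrow> y \<in> U) uniformity)"

instance
proof
  fix x y z :: "'a ell2" and a b :: real
  show "dist x y = norm (x - y)" by (rule dist_ell2_def)
  show "sgn x = x /\<^sub>R norm x" by (rule sgn_ell2_def)
  show "uniformity = (INF e\<in>{0 <..}. principal {(x :: 'a ell2, y). dist x y < e})"
    by (rule uniformity_ell2_def)
  show "open U \<longleftrightarrow> (\<forall>x\<in>U. eventually (\<lambda>(x', y). x' = x \<longrightarrow> y \<in> U) uniformity)"
    for U :: "'a ell2 set" by (rule open_ell2_def)
  show "x \<bullet> y = y \<bullet> x" by transfer (simp add: inner_commute)
  show "(x + y) \<bullet> z = x \<bullet> z + y \<bullet> z"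
  proof transfer
    fix f g h :: "'a \<Rightarrow> complex"
    assume "square_summable f" "square_summable g" "square_summable h"
    then show "(\<Sum>\<^sub>\<infinity>i. (f i + g i) \<bullet> h i) = (\<Sum>\<^sub>\<infinity>i. f i \<bullet> h i) + (\<Sum>\<^sub>\<infinity>i. g i \<bullet> h i)"
      by (simp add: inner_add_left infsum_add summable_on_inner)
  qed
  show "(a *\<^sub>R x) \<bullet> y = a * (x \<bullet> y)"
  proof transfer
    fix r :: real and f g :: "'a \<Rightarrow> complex"
    have "(of_real r * f i) \<bullet> g i = r * (f i \<bullet> g i)" for i
      by (metis inner_scaleR_left scaleR_conv_of_real)
    then show "(\<Sum>\<^sub>\<infinity>i. (of_real r * f i) \<bullet> g i) = r * (\<Sum>\<^sub>\<infinity>i. f i \<bullet> g i)"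
      by (simp add: infsum_cmult_right')
  qed
  show "0 \<le> x \<bullet> x" by transfer (simp add: infsum_nonneg)
  show "x \<bullet> x = 0 \<longleftrightarrow> x = 0"
  proof transfer
    fix f :: "'a \<Rightarrow> complex"
    assume f: "square_summable f"
    show "(\<Sum>\<^sub>\<infinity>i. f i \<bullet> f i) = 0 \<longleftrightarrow> f = (\<lambda>_. 0)"
    proof
      assume 0: "(\<Sum>\<^sub>\<infinity>i. f i \<bullet> f i) = 0"
      have "f i = 0" for i
      proof -
        have "sum (\<lambda>i. f i \<bullet> f i) {i} \<le> (\<Sum>\<^sub>\<infinity>i. f i \<bullet> f i)"
          by (rule finite_sum_le_infsum[OF summable_on_inner[OF f f]]) auto
        with 0 show ?thesis
          by (simp add: power2_norm_eq_inner[symmetric])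
      qed
      then show "f = (\<lambda>_. 0)" by auto
    qed simp
  qed
  show "norm x = sqrt (x \<bullet> x)" by (rule norm_ell2_def)
qed

end

lemma norm_ell2_sq: "(norm x)\<^sup>2 = (\<Sum>\<^sub>\<infinity>i. (cmod (Rep_ell2 x i))\<^sup>2)"
  by (simp add: power2_norm_eq_inner inner_ell2.rep_eq)

lemma finite_sum_le_norm_ell2:
  assumes "finite F"
  shows "(\<Sum>i\<in>F. (cmod (Rep_ell2 x i))\<^sup>2) \<le> (norm x)\<^sup>2"
  unfolding norm_ell2_sq using assms Rep_ell2[of x]
  by (intro finite_sum_le_infsum) (auto simp: square_summable_def)

instance ell2 :: (type) complete_space
proof
  fix X :: "nat \<Rightarrow> 'a ell2"
  assume X: "Cauchy X"
  have coord: "cmod (Rep_ell2 x i) \<le> norm x" for x :: "'a ell2" and i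
    using finite_sum_le_norm_ell2[of "{i}" x] by (simp add: power2_le_iff_abs_le)
  have "Cauchy (\<lambda>n. Rep_ell2 (X n) i)" for i
  proof (rule metric_CauchyI)
    fix e :: real assume "e > 0"
    with X obtain M where M: "\<And>m n. m \<ge> M \<Longrightarrow> n \<ge> M \<Longrightarrow> norm (X m - X n) < e"
      using CauchyD by blast
    have "dist (Rep_ell2 (X m) i) (Rep_ell2 (X n) i) < e" if "m \<ge> M" "n \<ge> M" for m n
      using coord[of "X m - X n" i] M[OF that] by (simp add: dist_norm minus_ell2.rep_eq)
    then show "\<exists>M. \<forall>m\<ge>M. \<forall>n\<ge>M. dist (Rep_ell2 (X m) i) (Rep_ell2 (X n) i) < e" by blast
  qed
  then have "\<forall>i. \<exists>l. (\<lambda>n. Rep_ell2 (X n) i) \<longlonglongrightarrow> l"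
    by (simp add: Cauchy_convergent_iff convergent_def)
  from choice[OF this] obtain f where f: "\<And>i. (\<lambda>n. Rep_ell2 (X n) i) \<longlonglongrightarrow> f i"
    by blast
  have tail: "\<exists>M. \<forall>n\<ge>M. \<forall>F. finite F \<longrightarrow> (\<Sum>i\<in>F. (cmod (f i - Rep_ell2 (X n) i))\<^sup>2) \<le> e\<^sup>2"
    if e: "e > 0" for e :: real
  proof -
    from X e obtain M where M: "\<And>m n. m \<ge> M \<Longrightarrow> n \<ge> M \<Longrightarrow> norm (X m - X n) < e"
      using CauchyD by blast
    have "(\<Sum>i\<in>F. (cmod (f i - Rep_ell2 (X n) i))\<^sup>2) \<le> e\<^sup>2" if n: "n \<ge> M" and F: "finite F" for n F
    proof (rule LIMSEQ_le_const2)
      show "(\<lambda>m. \<Sum>i\<in>F. (cmod (Rep_ell2 (X m) i - Rep_ell2 (X n) i))\<^sup>2)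
              \<longlonglongrightarrow> (\<Sum>i\<in>F. (cmod (f i - Rep_ell2 (X n) i))\<^sup>2)"
        by (intro tendsto_intros f)
      have "(\<Sum>i\<in>F. (cmod (Rep_ell2 (X m) i - Rep_ell2 (X n) i))\<^sup>2) \<le> e\<^sup>2" if "m \<ge> M" for m
      proof -
        have "(\<Sum>i\<in>F. (cmod (Rep_ell2 (X m) i - Rep_ell2 (X n) i))\<^sup>2) \<le> (norm (X m - X n))\<^sup>2"
          using finite_sum_le_norm_ell2[OF F, of "X m - X n"] by (simp add: minus_ell2.rep_eq)
        also have "\<dots> \<le> e\<^sup>2"
          using M[OF that n] by (intro power_mono) auto
        finally show ?thesis .
      qed
      then show "\<exists>N. \<forall>m\<ge>N. (\<Sum>i\<in>F. (cmod (Rep_ell2 (X m) i - Rep_ell2 (X n) i))\<^sup>2) \<le> e\<^sup>2"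
        by blast
    qed
    then show ?thesis by blast
  qed
  have sqI: "square_summable g"
    if "\<And>F. finite F \<Longrightarrow> (\<Sum>i\<in>F. (cmod (g i))\<^sup>2) \<le> c" for g :: "'a \<Rightarrow> complex" and c
    unfolding square_summable_def
  proof (rule nonneg_bdd_above_summable_on)
    show "bdd_above (sum (\<lambda>i. (cmod (g i))\<^sup>2) ` {F. F \<subseteq> UNIV \<and> finite F})"
      by (rule bdd_aboveI2[where M = c]) (use that in blast)
  qed simp
  obtain M where "\<forall>n\<ge>M. \<forall>F. finite F \<longrightarrow> (\<Sum>i\<in>F. (cmod (f i - Rep_ell2 (X n) i))\<^sup>2) \<le> 1\<^sup>2"
    using tail[OF zero_less_one] by blast
  then have "square_summable (\<lambda>i. f i - Rep_ell2 (X M) i)"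
    by (intro sqI[of _ "1\<^sup>2"]) blast
  from square_summable_add[OF this, of "Rep_ell2 (X M)"] Rep_ell2[of "X M"]
  have f_sq: "square_summable f" by simp
  define x where "x = Abs_ell2 f"
  have x: "Rep_ell2 x = f"
    unfolding x_def using f_sq by (simp add: Abs_ell2_inverse)
  have "X \<longlonglongrightarrow> x"
  proof (rule metric_LIMSEQ_I)
    fix r :: real assume r: "r > 0"
    then obtain M where M: "\<And>n F. n \<ge> M \<Longrightarrow> finite F \<Longrightarrow>
        (\<Sum>i\<in>F. (cmod (f i - Rep_ell2 (X n) i))\<^sup>2) \<le> (r/2)\<^sup>2"
      using tail[of "r/2"] half_gt_zero by blast
    have "dist (X n) x < r" if "n \<ge> M" for n
    proof -
      have "(norm (x - X n))\<^sup>2 \<le> (r/2)\<^sup>2"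
        unfolding norm_ell2_sq
      proof (rule infsum_le_finite_sums)
        show "(\<lambda>i. (cmod (Rep_ell2 (x - X n) i))\<^sup>2) summable_on UNIV"
          using Rep_ell2[of "x - X n"] by (simp add: square_summable_def)
        show "(\<Sum>i\<in>F. (cmod (Rep_ell2 (x - X n) i))\<^sup>2) \<le> (r/2)\<^sup>2" if "finite F" for F
          using M[OF \<open>n \<ge> M\<close> that] by (simp only: minus_ell2.rep_eq x)
      qed
      then have "norm (x - X n) \<le> r/2"
        using r by (simp add: power2_le_iff_abs_le)
      with r show ?thesis by (simp add: dist_norm norm_minus_commute)
    qed
    then show "\<exists>no. \<forall>n\<ge>no. dist (X n) x < r" by blast
  qed
  then show "convergent X" by (auto simp: convergent_def)
qed

definition cinner_ell2 :: "'i ell2 \<Rightarrow> 'i ell2 \<Rightarrow> complex" where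
  "cinner_ell2 x y = (\<Sum>\<^sub>\<infinity>i. cnj (Rep_ell2 x i) * Rep_ell2 y i)"

lift_definition cscale_ell2 :: "complex \<Rightarrow> 'i ell2 \<Rightarrow> 'i ell2" is "\<lambda>c f i. c * f i"
  by (rule square_summable_cmult)

lemma norm_cscale_ell2: "norm (cscale_ell2 c x) = cmod c * norm x"
proof -
  have "(norm (cscale_ell2 c x))\<^sup>2 = (cmod c * norm x)\<^sup>2"
    by (simp add: norm_ell2_sq power_mult_distrib cscale_ell2.rep_eq norm_mult infsum_cmult_right')
  then show ?thesis by (simp add: power2_eq_iff_nonneg)
qed

lemma bounded_linear_cscale_ell2: "bounded_linear (cscale_ell2 c)"
proof (rule bounded_linear_intro)
  show "cscale_ell2 c (x + y) = cscale_ell2 c x + cscale_ell2 c y" for x y :: "'a ell2"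
    by transfer (simp add: distrib_left)
  show "cscale_ell2 c (r *\<^sub>R x) = r *\<^sub>R cscale_ell2 c x" for r and x :: "'a ell2"
    by transfer (simp add: mult.left_commute)
  show "norm (cscale_ell2 c x) \<le> norm x * cmod c" for x :: "'a ell2"
    by (simp add: norm_cscale_ell2 mult.commute)
qed


section \<open>Operators and weights\<close>

text \<open>Bounded operators are bounded real linear maps; all operators in the
  \<open>C\<^sup>*\<close>-algebras considered are complex linear.\<close>

type_synonym 'i operator = "'i ell2 \<Rightarrow>\<^sub>L 'i ell2"

definition cscale_op :: "complex \<Rightarrow> 'i operator \<Rightarrow> 'i operator" where
  "cscale_op c T = Blinfun (cscale_ell2 c) o\<^sub>L T"

lemma cscale_op_apply: "blinfun_apply (cscale_op c T) x = cscale_ell2 c (blinfun_apply T x)"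
  by (simp add: cscale_op_def bounded_linear_Blinfun_apply bounded_linear_cscale_ell2)

interpretation complex_op: vector_space "cscale_op :: complex \<Rightarrow> 'i operator \<Rightarrow> 'i operator"
proof
  fix a b :: complex and S T :: "'i operator"
  have "cscale_ell2 a (x + y) = cscale_ell2 a x + cscale_ell2 a y" for x y :: "'i ell2"
    by transfer (simp add: distrib_left)
  then show "cscale_op a (S + T) = cscale_op a S + cscale_op a T"
    by (intro blinfun_eqI) (simp add: cscale_op_apply blinfun.add_left)
  have "cscale_ell2 (a + b) x = cscale_ell2 a x + cscale_ell2 b x" for x :: "'i ell2"
    by transfer (simp add: distrib_right)
  then show "cscale_op (a + b) T = cscale_op a T + cscale_op b T"
    by (intro blinfun_eqI) (simp add: cscale_op_apply blinfun.add_left)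
  have "cscale_ell2 a (cscale_ell2 b x) = cscale_ell2 (a * b) x" for x :: "'i ell2"
    by transfer (simp add: mult.assoc)
  then show "cscale_op a (cscale_op b T) = cscale_op (a * b) T"
    by (intro blinfun_eqI) (simp add: cscale_op_apply)
  have "cscale_ell2 1 x = x" for x :: "'i ell2"
    by transfer simp
  then show "cscale_op 1 T = T"
    by (intro blinfun_eqI) (simp add: cscale_op_apply)
qed

definition adj_op :: "'i operator \<Rightarrow> 'i operator" where
  "adj_op T = (THE S. \<forall>x y. cinner_ell2 (blinfun_apply S x) y = cinner_ell2 x (blinfun_apply T y))"

text \<open>In the following \<open>A\<close> is a norm closed \<open>*\<close>-algebra of operators.\<close>

definition positive_part :: "'i operator set \<Rightarrow> 'i operator set" where
  "positive_part A = {adj_op a o\<^sub>L a | a. a \<in> A}"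

text \<open>A weight is only a function on the positive elements; it is made a total function
  by the value \<^const>\<open>undefined\<close> elsewhere.\<close>

definition weight :: "'i operator set \<Rightarrow> ('i operator \<Rightarrow> ennreal) \<Rightarrow> bool" where
  "weight A \<psi> \<longleftrightarrow>
     \<psi> \<in> extensional (positive_part A) \<and>
     (\<forall>a\<in>positive_part A. \<forall>b\<in>positive_part A. \<psi> (a + b) = \<psi> a + \<psi> b) \<and>
     (\<forall>a\<in>positive_part A. \<forall>c::real. 0 < c \<longrightarrow> \<psi> (c *\<^sub>R a) = ennreal c * \<psi> a)"

definition proper_weight :: "'i operator set \<Rightarrow> ('i operator \<Rightarrow> ennreal) \<Rightarrow> bool" where
  "proper_weight A \<psi> \<longleftrightarrow>
     weight A \<psi> \<and>
     (\<exists>a\<in>positive_part A. \<psi> a \<noteq> 0) \<and>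
     positive_part A \<subseteq> closure {a \<in> positive_part A. \<psi> a < \<infinity>} \<and>
     (\<forall>c::real. 0 \<le> c \<longrightarrow> closed {a \<in> positive_part A. \<psi> a \<le> ennreal c})"

definition weight_N :: "'i operator set \<Rightarrow> ('i operator \<Rightarrow> ennreal) \<Rightarrow> 'i operator set" where
  "weight_N A \<psi> = {a \<in> A. \<psi> (adj_op a o\<^sub>L a) < \<infinity>}"

definition weight_M :: "'i operator set \<Rightarrow> ('i operator \<Rightarrow> ennreal) \<Rightarrow> 'i operator set" where
  "weight_M A \<psi> = complex_op.span {adj_op a o\<^sub>L b | a b. a \<in> weight_N A \<psi> \<and> b \<in> weight_N A \<psi>}"

text \<open>The unique complex linear functional on \<open>weight_M A \<psi>\<close> extending \<open>\<psi>\<close>.\<close>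

definition weight_functional ::
    "'i operator set \<Rightarrow> ('i operator \<Rightarrow> ennreal) \<Rightarrow> 'i operator \<Rightarrow> complex" where
  "weight_functional A \<psi> = (THE \<phi>.
     \<phi> \<in> extensional (weight_M A \<psi>) \<and>
     (\<forall>a\<in>weight_M A \<psi>. \<forall>b\<in>weight_M A \<psi>. \<phi> (a + b) = \<phi> a + \<phi> b) \<and>
     (\<forall>a\<in>weight_M A \<psi>. \<forall>c. \<phi> (cscale_op c a) = c * \<phi> a) \<and>
     (\<forall>a\<in>positive_part A. \<psi> a < \<infinity> \<longrightarrow> \<phi> a = complex_of_real (enn2real (\<psi> a))))"

definition strip :: "real \<Rightarrow> complex set" where
  "strip \<beta> = {z. min 0 \<beta> \<le> Im z \<and> Im z \<le> max 0 \<beta>}"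

definition KMS_weight ::
    "'i operator set \<Rightarrow> (real \<Rightarrow> 'i operator \<Rightarrow> 'i operator) \<Rightarrow> real
      \<Rightarrow> ('i operator \<Rightarrow> ennreal) \<Rightarrow> bool" where
  "KMS_weight A \<alpha> \<beta> \<psi> \<longleftrightarrow>
     proper_weight A \<psi> \<and>
     (\<forall>t. \<forall>a\<in>positive_part A. \<psi> (\<alpha> t a) = \<psi> a) \<and>
     (\<forall>a\<in>A. \<forall>b\<in>A.
        a \<in> weight_N A \<psi> \<longrightarrow> adj_op a \<in> weight_N A \<psi> \<longrightarrow>
        b \<in> weight_N A \<psi> \<longrightarrow> adj_op b \<in> weight_N A \<psi> \<longrightarrow>
        (\<exists>F. continuous_on (strip \<beta>) F \<and> bounded (F ` strip \<beta>) \<and>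
             F holomorphic_on interior (strip \<beta>) \<and>
             (\<forall>t::real.
                F (of_real t) = weight_functional A \<psi> (a o\<^sub>L \<alpha> t b) \<and>
                F (of_real t + \<i> * of_real \<beta>) = weight_functional A \<psi> (\<alpha> t b o\<^sub>L a))))"


section \<open>Graphs and their path groupoids\<close>

definition row_finite :: "('v, 'e) pre_digraph \<Rightarrow> bool" where
  "row_finite G \<longleftrightarrow> (\<forall>v\<in>verts G. finite (out_arcs G v))"

definition no_sinks :: "('v, 'e) pre_digraph \<Rightarrow> bool" where
  "no_sinks G \<longleftrightarrow> (\<forall>v\<in>verts G. out_arcs G v \<noteq> {})"

definition adjacency :: "('v, 'e) pre_digraph \<Rightarrow> 'v \<Rightarrow> 'v \<Rightarrow> nat" where
  "adjacency G v w = card {e \<in> arcs G. tail G e = v \<and> head G e = w}"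

text \<open>Paths are indexed from \<open>0\<close>: the first edge of \<open>p\<close> is \<open>p 0\<close>.\<close>

type_synonym 'e path = "nat \<Rightarrow> 'e"

definition paths :: "('v, 'e) pre_digraph \<Rightarrow> 'e path set" where
  "paths G = {p. \<forall>i. p i \<in> arcs G \<and> head G (p i) = tail G (p (Suc i))}"

definition path_source :: "('v, 'e) pre_digraph \<Rightarrow> 'e path \<Rightarrow> 'v" where
  "path_source G p = tail G (p 0)"

definition cylinder :: "('v, 'e) pre_digraph \<Rightarrow> 'e list \<Rightarrow> 'e path set" where
  "cylinder G es = {p \<in> paths G. \<forall>i<length es. p i = es ! i}"

definition path_topology :: "('v, 'e) pre_digraph \<Rightarrow> 'e path topology" where
  "path_topology G = topology_generated_by {cylinder G es | es. es \<noteq> []}"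

lemma topspace_path_topology: "topspace (path_topology G) = paths G"
proof -
  have "cylinder G es \<subseteq> paths G" for es
    by (auto simp: cylinder_def)
  moreover have "p \<in> cylinder G [p 0]" if "p \<in> paths G" for p
    using that by (auto simp: cylinder_def)
  ultimately show ?thesis
    unfolding path_topology_def topology_generated_by_topspace by blast
qed

lemma openin_path_topology_iff:
  "openin (path_topology G) U \<longleftrightarrow>
     U \<subseteq> paths G \<and> (\<forall>p\<in>U. \<exists>es. es \<noteq> [] \<and> p \<in> cylinder G es \<and> cylinder G es \<subseteq> U)"
  (is "_ \<longleftrightarrow> ?base U")
proof
  assume "openin (path_topology G) U"
  then have "generate_topology_on {cylinder G es | es. es \<noteq> []} U"
    unfolding path_topology_def by (rule openin_topology_generated_by)
  then show "?base U"
  proof induction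
    case (Int a b)
    have "\<exists>es. es \<noteq> [] \<and> p \<in> cylinder G es \<and> cylinder G es \<subseteq> a \<inter> b" if "p \<in> a \<inter> b" for p
    proof -
      from Int.IH that obtain es fs where
        es: "es \<noteq> []" "p \<in> cylinder G es" "cylinder G es \<subseteq> a" and
        fs: "fs \<noteq> []" "p \<in> cylinder G fs" "cylinder G fs \<subseteq> b" by blast
      have "cylinder G es \<subseteq> cylinder G fs \<or> cylinder G fs \<subseteq> cylinder G es"
        using es(2) fs(2) unfolding cylinder_def by (cases "length es \<le> length fs") auto
      with es fs show ?thesis by blast
    qed
    with Int.IH show ?case by blast
  next
    case (UN K)
    show ?case
    proof (intro conjI ballI)
      show "\<Union>K \<subseteq> paths G" using UN.IH by blast
      fix p assume "p \<in> \<Union>K"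
      then obtain k where "k \<in> K" "p \<in> k" by blast
      with UN.IH[of k] show "\<exists>es. es \<noteq> [] \<and> p \<in> cylinder G es \<and> cylinder G es \<subseteq> \<Union>K"
        by (meson Union_upper order_trans)
    qed
  next
    case (Basis s)
    then show ?case by (auto simp: cylinder_def)
  qed simp
next
  assume U: "?base U"
  then have "U = \<Union>{cylinder G es | es. es \<noteq> [] \<and> cylinder G es \<subseteq> U}" by blast
  moreover have "openin (path_topology G) (\<Union>{cylinder G es | es. es \<noteq> [] \<and> cylinder G es \<subseteq> U})"
    unfolding path_topology_def
    by (rule openin_Union) (auto intro: topology_generated_by_Basis)
  ultimately show "openin (path_topology G) U" by simp
qed

definition shift :: "'e path \<Rightarrow> 'e path" where
  "shift p = (\<lambda>i. p (Suc i))"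

type_synonym 'e arrow = "'e path \<times> int \<times> 'e path"

definition groupoid :: "('v, 'e) pre_digraph \<Rightarrow> 'e arrow set" where
  "groupoid G = {(p, k, q). p \<in> paths G \<and> q \<in> paths G \<and>
     (\<exists>n m. k = int n - int m \<and> (shift ^^ n) p = (shift ^^ m) q)}"

fun arrow_mult :: "'e arrow \<Rightarrow> 'e arrow \<Rightarrow> 'e arrow" where
  "arrow_mult (p, k, q) (q', k', r) = (p, k + k', r)"

fun arrow_inv :: "'e arrow \<Rightarrow> 'e arrow" where
  "arrow_inv (p, k, q) = (q, - k, p)"

fun arrow_range :: "'e arrow \<Rightarrow> 'e path" where
  "arrow_range (p, k, q) = p"

fun arrow_source :: "'e arrow \<Rightarrow> 'e path" where
  "arrow_source (p, k, q) = q"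

text \<open>\<open>groupoid_piece G k n\<close> is \<open>\<Gamma>\<^sub>\<sigma>(k,n)\<close>; it is empty unless \<open>k + n \<ge> 0\<close>.\<close>

definition groupoid_piece :: "('v, 'e) pre_digraph \<Rightarrow> int \<Rightarrow> nat \<Rightarrow> 'e arrow set" where
  "groupoid_piece G k n = {(p, l, q). p \<in> paths G \<and> q \<in> paths G \<and> l = k \<and>
     0 \<le> k + int n \<and> (shift ^^ nat (k + int n)) p = (shift ^^ n) q}"

text \<open>Since the sets \<open>\<Gamma>\<^sub>\<sigma>(k)\<close> are open and closed and carry the inductive limit topologies,
  a subset of the groupoid is open iff its intersection with every \<open>\<Gamma>\<^sub>\<sigma>(k,n)\<close> is
  relatively open in the product topology.\<close>

definition groupoid_open :: "('v, 'e) pre_digraph \<Rightarrow> 'e arrow set \<Rightarrow> bool" where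
  "groupoid_open G U \<longleftrightarrow> U \<subseteq> groupoid G \<and>
     (\<forall>k n. openin
        (subtopology
          (prod_topology (path_topology G)
            (prod_topology (discrete_topology UNIV) (path_topology G)))
          (groupoid_piece G k n))
        (U \<inter> groupoid_piece G k n))"

definition groupoid_topology :: "('v, 'e) pre_digraph \<Rightarrow> 'e arrow topology" where
  "groupoid_topology G = topology (groupoid_open G)"

lemma openin_groupoid_topology: "openin (groupoid_topology G) = groupoid_open G"
proof -
  have "istopology (groupoid_open G)"
    unfolding istopology_def
  proof (intro conjI allI impI)
    fix S T assume S: "groupoid_open G S" and T: "groupoid_open G T"
    have "S \<inter> T \<inter> P = (S \<inter> P) \<inter> (T \<inter> P)" for P by blast
    with S T show "groupoid_open G (S \<inter> T)"
      unfolding groupoid_open_def by (simp only:) (blast intro: openin_Int)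
  next
    fix \<K> assume K: "\<forall>K\<in>\<K>. groupoid_open G K"
    have "\<Union>\<K> \<inter> P = (\<Union>K\<in>\<K>. K \<inter> P)" for P by blast
    with K show "groupoid_open G (\<Union>\<K>)"
      unfolding groupoid_open_def by (simp only:) (blast intro: openin_Union)
  qed
  then show ?thesis
    unfolding groupoid_topology_def by (rule topology_inverse')
qed

lemma groupoid_piece_subset: "groupoid_piece G k n \<subseteq> groupoid G"
proof
  fix x assume "x \<in> groupoid_piece G k n"
  then obtain p q where x: "x = (p, k, q)" and pq: "p \<in> paths G" "q \<in> paths G"
    and k: "0 \<le> k + int n" and eq: "(shift ^^ nat (k + int n)) p = (shift ^^ n) q"
    by (auto simp: groupoid_piece_def)
  have "k = int (nat (k + int n)) - int n" using k by simp
  with pq eq show "x \<in> groupoid G" unfolding x groupoid_def by blast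
qed

lemma topspace_groupoid_topology: "topspace (groupoid_topology G) = groupoid G"
proof -
  have "groupoid G \<inter> groupoid_piece G k n = groupoid_piece G k n" for k n
    using groupoid_piece_subset[of G k n] by blast
  moreover have "groupoid_piece G k n \<subseteq> paths G \<times> UNIV \<times> paths G" for k n
    unfolding groupoid_piece_def by blast
  ultimately have "groupoid_open G (groupoid G)"
    unfolding groupoid_open_def
    by (simp add: openin_subtopology_refl topspace_path_topology)
  then have "groupoid G \<subseteq> topspace (groupoid_topology G)"
    by (intro openin_subset) (simp add: openin_groupoid_topology)
  moreover have "groupoid_open G (topspace (groupoid_topology G))"
    by (metis openin_groupoid_topology openin_topspace)
  then have "topspace (groupoid_topology G) \<subseteq> groupoid G"
    unfolding groupoid_open_def by (rule conjunct1)
  ultimately show ?thesis by (rule equalityI[rotated])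
qed


section \<open>The reduced groupoid algebra and the gauge action\<close>

text \<open>Elements of \<open>C\<^sub>c(\<Gamma>\<^sub>\<sigma>)\<close>, extended by zero outside the groupoid.\<close>

definition Cc :: "('v, 'e) pre_digraph \<Rightarrow> ('e arrow \<Rightarrow> complex) set" where
  "Cc G = {f. continuous_map (groupoid_topology G) euclidean f \<and>
     compactin (groupoid_topology G) (groupoid_topology G closure_of {\<gamma> \<in> groupoid G. f \<gamma> \<noteq> 0}) \<and>
     (\<forall>\<gamma>. \<gamma> \<notin> groupoid G \<longrightarrow> f \<gamma> = 0)}"

text \<open>Convolution by \<open>f\<close> on the left; for \<open>f \<in> Cc G\<close> the sum has finitely many non-zero
  terms. It maps each \<open>\<ell>\<^sup>2(s\<^sup>-\<^sup>1(x))\<close>, \<open>x \<in> paths G\<close>, into itself and restricts there to the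
  operator \<open>\<pi>\<^sub>x(f)\<close> of the regular representation at \<open>x\<close>. As \<open>\<ell>\<^sup>2\<close> of the groupoid is the direct
  sum of the \<open>\<ell>\<^sup>2(s\<^sup>-\<^sup>1(x))\<close>, the operator norm of \<open>regular_rep G f\<close> is the reduced norm
  \<open>sup\<^sub>x \<parallel>\<pi>\<^sub>x(f)\<parallel>\<close>. Coordinates outside the groupoid are annihilated.\<close>

definition left_convolution ::
    "('v, 'e) pre_digraph \<Rightarrow> ('e arrow \<Rightarrow> complex) \<Rightarrow> ('e arrow \<Rightarrow> complex) \<Rightarrow> 'e arrow \<Rightarrow> complex" where
  "left_convolution G f \<xi> \<gamma> =
     (if \<gamma> \<in> groupoid G
      then \<Sum>\<^sub>\<infinity>\<eta> \<in> {\<eta> \<in> groupoid G. arrow_range \<eta> = arrow_range \<gamma>}. f \<eta> * \<xi> (arrow_mult (arrow_inv \<eta>) \<gamma>)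
      else 0)"

definition regular_rep ::
    "('v, 'e) pre_digraph \<Rightarrow> ('e arrow \<Rightarrow> complex) \<Rightarrow> 'e arrow operator" where
  "regular_rep G f = Blinfun (\<lambda>x. Abs_ell2 (left_convolution G f (Rep_ell2 x)))"

text \<open>The completion of \<open>C\<^sub>c(\<Gamma>\<^sub>\<sigma>)\<close> in the reduced norm.\<close>

definition graph_algebra :: "('v, 'e) pre_digraph \<Rightarrow> 'e arrow operator set" where
  "graph_algebra G = closure (regular_rep G ` Cc G)"

definition gauge_Cc :: "real \<Rightarrow> ('e arrow \<Rightarrow> complex) \<Rightarrow> 'e arrow \<Rightarrow> complex" where
  "gauge_Cc t f = (\<lambda>(p, k, q). exp (\<i> * of_int k * of_real t) * f (p, k, q))"

text \<open>The continuous extension of \<open>gauge_Cc t\<close> from \<open>C\<^sub>c(\<Gamma>\<^sub>\<sigma>)\<close> to its completion.\<close>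

definition gauge_action ::
    "('v, 'e) pre_digraph \<Rightarrow> real \<Rightarrow> 'e arrow operator \<Rightarrow> 'e arrow operator" where
  "gauge_action G t a = (THE b. \<exists>f :: nat \<Rightarrow> 'e arrow \<Rightarrow> complex.
     (\<forall>n. f n \<in> Cc G) \<and>
     (\<lambda>n. regular_rep G (f n)) \<longlonglongrightarrow> a \<and>
     (\<lambda>n. regular_rep G (gauge_Cc t (f n))) \<longlonglongrightarrow> b)"

text \<open>The inclusion of \<open>C\<^sub>c(P(G))\<close> into \<open>C\<^sub>c(\<Gamma>\<^sub>\<sigma>)\<close> given by \<open>p \<mapsto> (p, 0, p)\<close>.\<close>

definition unit_space_fun ::
    "('v, 'e) pre_digraph \<Rightarrow> ('e path \<Rightarrow> complex) \<Rightarrow> 'e arrow \<Rightarrow> complex" where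
  "unit_space_fun G h = (\<lambda>(p, k, q). if p \<in> paths G \<and> k = 0 \<and> q = p then h p else 0)"

definition source_set :: "('v, 'e) pre_digraph \<Rightarrow> 'v \<Rightarrow> 'e path set" where
  "source_set G v = {p \<in> paths G. path_source G p = v}"

definition vertex_projection :: "('v, 'e) pre_digraph \<Rightarrow> 'v \<Rightarrow> 'e arrow operator" where
  "vertex_projection G v = regular_rep G (unit_space_fun G (indicator (source_set G v)))"

end

theory Submission
  imports Defs "HOL-Probability.Probability" "HOL-Complex_Analysis.Complex_Analysis"
begin

text \<open>Uniqueness: comparing the function \<open>F\<close> of the KMS condition with \<open>F(0) e\<^sup>i\<^sup>k\<^sup>z\<close> by Schwarz
  reflection gives \<open>\<psi>(ba) = e\<^sup>-\<^sup>k\<^sup>\<beta> \<psi>(ab)\<close> for \<open>b\<close> of gauge degree \<open>k\<close>. Together with averaging over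
  the gauge action and lower semi-continuity this shows that the \<open>1\<^bsub>C\<^sub>v\<^esub>\<close> have finite weight, that
  \<open>\<psi>\<close> vanishes on the partial isometries \<open>S\<^sub>g S\<^sub>f\<^sup>*\<close> with \<open>g \<noteq> f\<close>, and that
  \<open>\<psi>(S\<^sub>g S\<^sub>g\<^sup>*) = e\<^bsup>-\<beta>\<bar>g\<bar>\<^esup> \<xi>\<^bsub>r(g)\<^esub>\<close>. Since \<open>1\<^bsub>C\<^sub>v\<^esub>\<close> is the sum of the \<open>S\<^sub>a S\<^sub>a\<^sup>*\<close> over the edges \<open>a\<close> out of \<open>v\<close>, the
  eigenvalue equation follows; compressing by finite sums of the \<open>1\<^bsub>C\<^sub>v\<^esub>\<close> shows that \<open>\<xi>\<close> determines \<open>\<psi>\<close>.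

  Existence: the transition probabilities \<open>e\<^sup>-\<^sup>\<beta> \<xi>\<^bsub>r(a)\<^esub> / \<xi>\<^bsub>s(a)\<^esub>\<close> define a Markov chain, hence a
  measure \<open>\<mu>\<close> on infinite paths with \<open>\<mu>(Z(g)) = e\<^bsup>-\<beta>\<bar>g\<bar>\<^esup> \<xi>\<^bsub>r(g)\<^esub>\<close>, and \<open>\<psi>(a)\<close> is the \<open>\<mu>\<close>-integral of the
  diagonal matrix coefficients of \<open>a\<close>. Every arrow is \<open>(gp, \<bar>g\<bar> - \<bar>f\<bar>, fp)\<close> for unique finite paths
  \<open>g\<close>, \<open>f\<close> without common last edge, so that \<open>\<psi>(c\<^sup>* d)\<close> is a series over the pairs \<open>(g, f)\<close> of
  \<open>e\<^bsup>-\<beta>\<bar>f\<bar>\<^esup>\<close> times an integral over \<open>p\<close>. Inserting the factor \<open>e\<^bsup>i(\<bar>g\<bar> - \<bar>f\<bar>)z\<^esup>\<close> into the series for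
  \<open>\<psi>(ab)\<close> gives \<open>F\<close>, and exchanging \<open>g\<close> and \<open>f\<close> gives its value at \<open>i\<beta>\<close>.\<close>

text \<open>Three definitions shape the work. Positive elements are those of the form
  \<open>adj_op a o\<^sub>L a\<close>, so that even their closure under sums needs square roots, in
  an algebra that may lack a unit. \<open>weight_functional\<close> and \<open>gauge_action\<close>
  are definite descriptions: the first is resolved by writing elements as combinations of four
  elements of finite weight, the second by unitaries \<open>U t\<close>, whose conjugation makes
  sense for all operators. \<open>graph_algebra\<close> is a closure, so statements stable under
  norm limits are reduced by \<open>A_induct\<close> to the operators \<open>S g v f\<close>.
  Averages over roots of unity avoid an operator valued integral. The obstacle to uniqueness is that
  density yields elements of finite weight only near the projection of a vertex;
  \<open>p_finite\<close> reaches the projection itself by the trace property on invariant elements.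
  The functional need not be norm continuous; continuity is recovered on the corners cut out by the
  projections \<open>pe n\<close> of finite weight, and lower semi-continuity removes the corner
  again.\<close>

instance ell2 :: (type) banach ..

section \<open>Operators on square summable functions\<close>

lemma square_summable_Rep_ell2: "square_summable (Rep_ell2 x)"
  using Rep_ell2[of x] by simp

lemma Rep_ell2_Abs_ell2: "square_summable f \<Longrightarrow> Rep_ell2 (Abs_ell2 f) = f"
  by (simp add: Abs_ell2_inverse)

lemma ell2_eqI: "(\<And>i. Rep_ell2 x i = Rep_ell2 y i) \<Longrightarrow> x = y"
  by (metis Rep_ell2_inject ext)

lemma cinner_summable: "(\<lambda>i. cnj (Rep_ell2 x i) * Rep_ell2 y i) summable_on UNIV"
proof (rule abs_summable_summable)
  show "(\<lambda>i. cmod (cnj (Rep_ell2 x i) * Rep_ell2 y i)) summable_on UNIV"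
    using summable_on_cmod_mult[OF square_summable_Rep_ell2 square_summable_Rep_ell2, of x y]
    by (simp add: norm_mult)
qed

lemma cinner_add_left: "cinner_ell2 (x + y) z = cinner_ell2 x z + cinner_ell2 y z"
  unfolding cinner_ell2_def
  by (subst infsum_add[symmetric, OF cinner_summable cinner_summable])
    (simp add: plus_ell2.rep_eq distrib_right)

lemma cinner_add_right: "cinner_ell2 z (x + y) = cinner_ell2 z x + cinner_ell2 z y"
  unfolding cinner_ell2_def
  by (subst infsum_add[symmetric, OF cinner_summable cinner_summable])
    (simp add: plus_ell2.rep_eq distrib_left)

lemma cinner_cscale_left: "cinner_ell2 (cscale_ell2 c x) y = cnj c * cinner_ell2 x y"
  unfolding cinner_ell2_def
  by (simp add: cscale_ell2.rep_eq infsum_cmult_right' mult.assoc)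

lemma cinner_cscale_right: "cinner_ell2 x (cscale_ell2 c y) = c * cinner_ell2 x y"
  unfolding cinner_ell2_def
  by (subst infsum_cmult_right'[symmetric]) (simp add: cscale_ell2.rep_eq mult.left_commute)

lemma cscale_of_real: "cscale_ell2 (of_real r) x = r *\<^sub>R x"
  by transfer simp

lemma cinner_scaleR_left: "cinner_ell2 (r *\<^sub>R x) y = of_real r * cinner_ell2 x y"
  using cinner_cscale_left[of "of_real r" x y] by (simp add: cscale_of_real)

lemma cinner_scaleR_right: "cinner_ell2 x (r *\<^sub>R y) = of_real r * cinner_ell2 x y"
  using cinner_cscale_right[of x "of_real r" y] by (simp add: cscale_of_real)

lemma cinner_minus_left: "cinner_ell2 (- x) z = - cinner_ell2 x z"
  using cinner_scaleR_left[of "-1" x z] by simp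

lemma cinner_minus_right: "cinner_ell2 z (- x) = - cinner_ell2 z x"
  using cinner_scaleR_right[of z "-1" x] by simp

lemma cinner_diff_left: "cinner_ell2 (x - y) z = cinner_ell2 x z - cinner_ell2 y z"
  using cinner_add_left[of x "- y" z] by (simp add: cinner_minus_left)

lemma cinner_diff_right: "cinner_ell2 z (x - y) = cinner_ell2 z x - cinner_ell2 z y"
  using cinner_add_right[of z x "- y"] by (simp add: cinner_minus_right)

lemma cinner_commute: "cinner_ell2 x y = cnj (cinner_ell2 y x)"
  unfolding cinner_ell2_def
  by (subst infsum_cnj[symmetric]) (simp add: mult.commute)

lemma Re_cinner: "Re (cinner_ell2 x y) = x \<bullet> y"
proof -
  have "Re (cinner_ell2 x y) = (\<Sum>\<^sub>\<infinity>i. Re (cnj (Rep_ell2 x i) * Rep_ell2 y i))"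
    unfolding cinner_ell2_def
    by (rule infsum_Re[OF cinner_summable, symmetric])
  also have "\<dots> = x \<bullet> y"
    unfolding inner_ell2.rep_eq by (rule infsum_cong) (simp add: inner_complex_def)
  finally show ?thesis .
qed

lemma cinner_self: "cinner_ell2 x x = of_real ((norm x)\<^sup>2)"
proof (rule complex_eqI)
  show "Im (cinner_ell2 x x) = Im (complex_of_real ((norm x)\<^sup>2))"
    using arg_cong[OF cinner_commute[of x x], of Im] by simp
qed (simp add: Re_cinner power2_norm_eq_inner)

text \<open>A unimodular factor \<open>c\<close> rotates the inner product onto the positive axis,
  which reduces the claim to the real Cauchy-Schwarz inequality.\<close>

lemma cmod_cinner_le: "cmod (cinner_ell2 x y) \<le> norm x * norm y"
proof (cases "cinner_ell2 x y = 0")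
  case False
  let ?z = "cinner_ell2 x y"
  define c where "c = cnj ?z / cmod ?z"
  have c: "cmod c = 1" using False by (simp add: c_def norm_divide)
  have "c * ?z = of_real (cmod ?z)"
    using False unfolding c_def
    by (simp add: field_simps complex_norm_square[symmetric] power2_eq_square[symmetric])
  then have "cmod ?z = Re (cinner_ell2 x (cscale_ell2 c y))"
    by (simp add: cinner_cscale_right)
  also have "\<dots> \<le> norm x * norm (cscale_ell2 c y)"
    unfolding Re_cinner by (rule norm_cauchy_schwarz)
  finally show ?thesis by (simp add: norm_cscale_ell2 c)
qed simp

lemma bounded_bilinear_cinner: "bounded_bilinear cinner_ell2"
  by unfold_locales
    (auto simp: cinner_add_left cinner_add_right cinner_scaleR_left cinner_scaleR_right
      scaleR_conv_of_real intro!: exI[of _ 1] cmod_cinner_le)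

lemmas tendsto_cinner = bounded_bilinear.tendsto[OF bounded_bilinear_cinner]

lemma cinner_zero_left [simp]: "cinner_ell2 0 y = 0"
  by (rule bounded_bilinear.zero_left[OF bounded_bilinear_cinner])

lemma cinner_zero_right [simp]: "cinner_ell2 y 0 = 0"
  by (rule bounded_bilinear.zero_right[OF bounded_bilinear_cinner])

lemma cinner_ext_left: "(\<And>y. cinner_ell2 x y = cinner_ell2 x' y) \<Longrightarrow> x = x'"
  using cinner_self[of "x - x'"] by (simp add: cinner_diff_left)

lemma cinner_ext_right: "(\<And>y. cinner_ell2 y x = cinner_ell2 y x') \<Longrightarrow> x = x'"
  using cinner_self[of "x - x'"] by (simp add: cinner_diff_right)

lemma square_summable_delta: "square_summable (\<lambda>j. if j = i then c else 0)"
  unfolding square_summable_def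
  by (rule finite_nonzero_values_imp_summable_on, rule finite_subset[of _ "{i}"]) auto

definition ket :: "'i \<Rightarrow> 'i ell2" where
  "ket i = Abs_ell2 (\<lambda>j. if j = i then 1 else 0)"

lemma Rep_ket: "Rep_ell2 (ket i) j = (if j = i then 1 else 0)"
  unfolding ket_def by (subst Rep_ell2_Abs_ell2[OF square_summable_delta]) simp

lemma infsum_single_complex:
  fixes f :: "'a \<Rightarrow> complex"
  assumes "\<And>j. j \<noteq> i \<Longrightarrow> f j = 0"
  shows "infsum f UNIV = f i"
proof -
  have "infsum f UNIV = infsum f {i}"
    by (rule infsum_cong_neutral) (use assms in auto)
  then show ?thesis by simp
qed

lemma cinner_ket_left: "cinner_ell2 (ket i) x = Rep_ell2 x i"
  unfolding cinner_ell2_def by (subst infsum_single_complex[of i]) (auto simp: Rep_ket)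

lemma norm_ket [simp]: "norm (ket i) = 1"
proof -
  have "cinner_ell2 (ket i) (ket i) = 1" by (simp add: cinner_ket_left Rep_ket)
  then have "complex_of_real ((norm (ket i))\<^sup>2) = of_real 1" unfolding cinner_self by simp
  then have "(norm (ket i))\<^sup>2 = 1" using of_real_eq_iff by blast
  then show ?thesis by (smt (verit) norm_ge_zero power2_eq_1_iff)
qed

text \<open>Operators are merely real linear, so an adjoint for \<open>cinner_ell2\<close> may fail
  to exist and \<open>adj_op\<close>, a definite description, would then be meaningless. Existence
  is therefore carried as a predicate that survives the algebraic operations and norm
  limits.\<close>

definition adjointable :: "'i operator \<Rightarrow> bool" where
  "adjointable T \<longleftrightarrow> (\<exists>S. \<forall>x y. cinner_ell2 (blinfun_apply S x) y = cinner_ell2 x (blinfun_apply T y))"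

lemma adj_op_eqI:
  assumes "\<And>x y. cinner_ell2 (blinfun_apply S x) y = cinner_ell2 x (blinfun_apply T y)"
  shows "adj_op T = S"
  unfolding adj_op_def
proof (rule the_equality)
  fix R assume "\<forall>x y. cinner_ell2 (blinfun_apply R x) y = cinner_ell2 x (blinfun_apply T y)"
  with assms show "R = S" by (intro blinfun_eqI cinner_ext_left) simp
qed (use assms in blast)

lemma adjointableI:
  "(\<And>x y. cinner_ell2 (blinfun_apply S x) y = cinner_ell2 x (blinfun_apply T y)) \<Longrightarrow> adjointable T"
  unfolding adjointable_def by blast

lemma cinner_adj_left:
  assumes "adjointable T"
  shows "cinner_ell2 (blinfun_apply (adj_op T) x) y = cinner_ell2 x (blinfun_apply T y)"
  using assms adj_op_eqI unfolding adjointable_def by metis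

lemma cinner_adj_right:
  assumes "adjointable T"
  shows "cinner_ell2 x (blinfun_apply (adj_op T) y) = cinner_ell2 (blinfun_apply T x) y"
  by (metis assms cinner_adj_left cinner_commute)

lemma adjointable_adj: "adjointable T \<Longrightarrow> adjointable (adj_op T)"
  by (rule adjointableI[of T]) (simp add: cinner_adj_right)

lemma adj_adj: "adjointable T \<Longrightarrow> adj_op (adj_op T) = T"
  by (rule adj_op_eqI) (simp add: cinner_adj_right)

lemma adjointable_add: "adjointable S \<Longrightarrow> adjointable T \<Longrightarrow> adjointable (S + T)"
  by (rule adjointableI[of "adj_op S + adj_op T"])
    (simp add: cinner_adj_left blinfun.add_left cinner_add_left cinner_add_right)

lemma adj_add: "adjointable S \<Longrightarrow> adjointable T \<Longrightarrow> adj_op (S + T) = adj_op S + adj_op T"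
  by (rule adj_op_eqI)
    (simp add: cinner_adj_left blinfun.add_left cinner_add_left cinner_add_right)

lemma adjointable_diff: "adjointable S \<Longrightarrow> adjointable T \<Longrightarrow> adjointable (S - T)"
  by (rule adjointableI[of "adj_op S - adj_op T"])
    (simp add: cinner_adj_left blinfun.diff_left cinner_diff_left cinner_diff_right)

lemma adj_diff: "adjointable S \<Longrightarrow> adjointable T \<Longrightarrow> adj_op (S - T) = adj_op S - adj_op T"
  by (rule adj_op_eqI)
    (simp add: cinner_adj_left blinfun.diff_left cinner_diff_left cinner_diff_right)

lemma adjointable_cscale: "adjointable T \<Longrightarrow> adjointable (cscale_op c T)"
  by (rule adjointableI[of "cscale_op (cnj c) (adj_op T)"])
    (simp add: cinner_adj_left cscale_op_apply cinner_cscale_left cinner_cscale_right)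

lemma adj_cscale: "adjointable T \<Longrightarrow> adj_op (cscale_op c T) = cscale_op (cnj c) (adj_op T)"
  by (rule adj_op_eqI)
    (simp add: cinner_adj_left cscale_op_apply cinner_cscale_left cinner_cscale_right)

lemma adjointable_compose: "adjointable S \<Longrightarrow> adjointable T \<Longrightarrow> adjointable (S o\<^sub>L T)"
  by (rule adjointableI[of "adj_op T o\<^sub>L adj_op S"]) (simp add: cinner_adj_left)

lemma adj_compose:
  "adjointable S \<Longrightarrow> adjointable T \<Longrightarrow> adj_op (S o\<^sub>L T) = adj_op T o\<^sub>L adj_op S"
  by (rule adj_op_eqI) (simp add: cinner_adj_left)

lemma adjointable_zero [simp]: "adjointable 0" and adj_zero [simp]: "adj_op 0 = 0"
  by (rule adjointableI[of 0], simp) (rule adj_op_eqI, simp)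

lemma adjointable_id [simp]: "adjointable id_blinfun" and adj_id [simp]: "adj_op id_blinfun = id_blinfun"
  by (rule adjointableI[of id_blinfun], simp) (rule adj_op_eqI, simp)

lemma cscale_op_of_real: "cscale_op (of_real r) T = r *\<^sub>R T"
  by (rule blinfun_eqI) (simp add: cscale_op_apply cscale_of_real blinfun.scaleR_left)

lemma adjointable_scaleR: "adjointable T \<Longrightarrow> adjointable (r *\<^sub>R T)"
  using adjointable_cscale[of T "of_real r"] by (simp add: cscale_op_of_real)

lemma adj_scaleR: "adjointable T \<Longrightarrow> adj_op (r *\<^sub>R T) = r *\<^sub>R adj_op T"
  using adj_cscale[of T "of_real r"] by (simp add: cscale_op_of_real)

text \<open>Moving the operator to the other side of the inner product frees the scalar, so an
  adjoint forces complex linearity.\<close>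

lemma adjointable_apply_cscale:
  assumes "adjointable T"
  shows "blinfun_apply T (cscale_ell2 c x) = cscale_ell2 c (blinfun_apply T x)"
  by (rule cinner_ext_right)
    (simp add: cinner_adj_left[OF assms, symmetric] cinner_cscale_right)

lemma norm_adj_le:
  assumes "adjointable T"
  shows "norm (adj_op T) \<le> norm T"
proof (rule norm_blinfun_bound)
  fix x
  let ?y = "blinfun_apply (adj_op T) x"
  have "(norm ?y)\<^sup>2 = cmod (cinner_ell2 ?y ?y)" by (simp add: cinner_self norm_power)
  also have "\<dots> = cmod (cinner_ell2 x (blinfun_apply T ?y))" by (simp add: cinner_adj_left[OF assms])
  also have "\<dots> \<le> norm x * norm (blinfun_apply T ?y)" by (rule cmod_cinner_le)
  also have "\<dots> \<le> norm x * (norm T * norm ?y)" by (intro mult_left_mono norm_blinfun) simp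
  finally have "norm ?y * norm ?y \<le> (norm T * norm x) * norm ?y"
    by (simp add: power2_eq_square mult_ac)
  then show "norm ?y \<le> norm T * norm x"
    by (cases "?y = 0") (auto dest: mult_right_le_imp_le)
qed simp

lemma norm_adj: "adjointable T \<Longrightarrow> norm (adj_op T) = norm T"
  by (metis adj_adj adjointable_adj norm_adj_le order_antisym)

lemma norm_cscale_op_le: "norm (cscale_op c T) \<le> cmod c * norm T"
  by (rule norm_blinfun_bound)
    (auto simp: cscale_op_apply norm_cscale_ell2 mult.assoc intro!: mult_left_mono norm_blinfun)

lemma tendsto_cscale_op:
  "(f \<longlongrightarrow> T) F \<Longrightarrow> ((\<lambda>n. cscale_op c (f n)) \<longlongrightarrow> cscale_op c T) F"
  unfolding cscale_op_def
  by (intro bounded_bilinear.tendsto[OF bounded_bilinear_blinfun_compose] tendsto_const)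

lemma tendsto_compose_op:
  "(f \<longlongrightarrow> S) F \<Longrightarrow> (g \<longlongrightarrow> T) F \<Longrightarrow> ((\<lambda>n. f n o\<^sub>L g n) \<longlongrightarrow> S o\<^sub>L T) F"
  by (rule bounded_bilinear.tendsto[OF bounded_bilinear_blinfun_compose])

lemma tendsto_apply_op:
  "(f \<longlongrightarrow> S) F \<Longrightarrow> ((\<lambda>n. blinfun_apply (f n) x) \<longlongrightarrow> blinfun_apply S x) F"
  by (intro tendsto_intros)

text \<open>Taking adjoints is isometric, so the adjoints form a Cauchy sequence; its limit
  satisfies the adjoint relation by continuity of the inner product.\<close>

lemma adjointable_limit:
  assumes lim: "f \<longlonglongrightarrow> T" and adj: "\<And>n. adjointable (f n)"
  shows "adjointable T" and "(\<lambda>n. adj_op (f n)) \<longlonglongrightarrow> adj_op T"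
proof -
  have d: "dist (adj_op (f m)) (adj_op (f n)) = dist (f m) (f n)" for m n
    by (metis adj adj_diff adjointable_diff dist_norm norm_adj)
  have "Cauchy f" using lim LIMSEQ_imp_Cauchy by blast
  then have "Cauchy (\<lambda>n. adj_op (f n))" unfolding Cauchy_def d .
  then obtain S where S: "(\<lambda>n. adj_op (f n)) \<longlonglongrightarrow> S"
    using Cauchy_convergent_iff convergent_def by blast
  have eq: "cinner_ell2 (blinfun_apply S x) y = cinner_ell2 x (blinfun_apply T y)" for x y
  proof (rule LIMSEQ_unique)
    show "(\<lambda>n. cinner_ell2 (blinfun_apply (adj_op (f n)) x) y) \<longlonglongrightarrow> cinner_ell2 (blinfun_apply S x) y"
      by (intro tendsto_cinner tendsto_apply_op S tendsto_const)
    show "(\<lambda>n. cinner_ell2 (blinfun_apply (adj_op (f n)) x) y) \<longlonglongrightarrow> cinner_ell2 x (blinfun_apply T y)"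
      unfolding cinner_adj_left[OF adj] by (intro tendsto_cinner tendsto_apply_op lim tendsto_const)
  qed
  from adjointableI[OF eq] show "adjointable T" .
  from S adj_op_eqI[OF eq] show "(\<lambda>n. adj_op (f n)) \<longlonglongrightarrow> adj_op T" by simp
qed

section \<open>Nonnegative operators\<close>

definition nonneg_op :: "'i operator \<Rightarrow> bool" where
  "nonneg_op T \<longleftrightarrow> (\<forall>x. Im (cinner_ell2 x (blinfun_apply T x)) = 0 \<and>
     0 \<le> Re (cinner_ell2 x (blinfun_apply T x)))"

lemma nonneg_op_adj_compose: "adjointable a \<Longrightarrow> nonneg_op (adj_op a o\<^sub>L a)"
  unfolding nonneg_op_def by (simp add: cinner_adj_right cinner_self)

lemma nonneg_op_add: "nonneg_op S \<Longrightarrow> nonneg_op T \<Longrightarrow> nonneg_op (S + T)"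
  unfolding nonneg_op_def by (simp add: blinfun.add_left cinner_add_right)

lemma nonneg_op_scaleR: "nonneg_op S \<Longrightarrow> 0 \<le> r \<Longrightarrow> nonneg_op (r *\<^sub>R S)"
  unfolding nonneg_op_def by (simp add: blinfun.scaleR_left cinner_scaleR_right)

lemma nonneg_op_limit:
  assumes lim: "f \<longlonglongrightarrow> T" and "\<And>n. nonneg_op (f n)"
  shows "nonneg_op T"
  unfolding nonneg_op_def
proof (intro allI conjI)
  fix x
  have l: "(\<lambda>n. cinner_ell2 x (blinfun_apply (f n) x)) \<longlonglongrightarrow> cinner_ell2 x (blinfun_apply T x)"
    by (intro tendsto_cinner tendsto_apply_op lim tendsto_const)
  from tendsto_Im[OF l] assms(2) show "Im (cinner_ell2 x (blinfun_apply T x)) = 0"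
    unfolding nonneg_op_def by (simp add: LIMSEQ_const_iff)
  from tendsto_Re[OF l] assms(2) show "0 \<le> Re (cinner_ell2 x (blinfun_apply T x))"
    unfolding nonneg_op_def by (intro LIMSEQ_le_const) auto
qed

text \<open>Polarization: reality of the quadratic form at \<open>x + y\<close> and at x + i y fixes
  the imaginary and the real part of q(y,x) as those of the conjugate of q(x,y).\<close>

lemma nonneg_op_self_adjoint:
  assumes T: "adjointable T" and nn: "nonneg_op T"
  shows "adj_op T = T"
proof (rule adj_op_eqI)
  fix x y
  let ?q = "\<lambda>u v. cinner_ell2 u (blinfun_apply T v)"
  have im: "Im (?q u u) = 0" for u using nn unfolding nonneg_op_def by blast
  from im[of "x + y"] im[of x] im[of y] have 1: "Im (?q x y) + Im (?q y x) = 0"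
    by (simp add: blinfun.add_right cinner_add_left cinner_add_right)
  from im[of "x + cscale_ell2 \<i> y"] im[of x] im[of y] have 2: "Re (?q x y) - Re (?q y x) = 0"
    by (simp add: blinfun.add_right cinner_add_left cinner_add_right
        adjointable_apply_cscale[OF T] cinner_cscale_left cinner_cscale_right)
  have "?q y x = cnj (?q x y)"
    using 1 2 by (simp add: complex_eq_iff)
  then show "cinner_ell2 (blinfun_apply T x) y = cinner_ell2 x (blinfun_apply T y)"
    by (metis cinner_commute complex_cnj_cnj)
qed

text \<open>This is the operator inequality that T squared is at most \<open>norm T\<close> times T.
  The quadratic form is evaluated at x - s T x, and s = 1 / \<open>norm T\<close> minimises the
  resulting polynomial.\<close>

lemma nonneg_op_cauchy_schwarz:
  assumes T: "adjointable T" and nn: "nonneg_op T"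
  shows "(norm (blinfun_apply T x))\<^sup>2 \<le> norm T * Re (cinner_ell2 x (blinfun_apply T x))"
proof -
  let ?q = "\<lambda>u v. Re (cinner_ell2 u (blinfun_apply T v))"
  let ?y = "blinfun_apply T x"
  have sym: "?q u v = ?q v u" for u v
    using cinner_adj_left[OF T, of u v] nonneg_op_self_adjoint[OF T nn] cinner_commute[of v]
    by simp
  have pos: "0 \<le> ?q u u" for u using nn unfolding nonneg_op_def by blast
  have qy: "?q ?y x = (norm ?y)\<^sup>2" by (simp add: cinner_self)
  have le: "?q ?y ?y \<le> norm T * (norm ?y)\<^sup>2"
  proof -
    have "?q ?y ?y \<le> cmod (cinner_ell2 ?y (blinfun_apply T ?y))" by (rule complex_Re_le_cmod)
    also have "\<dots> \<le> norm ?y * norm (blinfun_apply T ?y)" by (rule cmod_cinner_le)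
    also have "\<dots> \<le> norm ?y * (norm T * norm ?y)" by (intro mult_left_mono norm_blinfun) simp
    finally show ?thesis by (simp add: power2_eq_square mult_ac)
  qed
  have quad: "0 \<le> ?q x x - 2 * s * (norm ?y)\<^sup>2 + s\<^sup>2 * (norm T * (norm ?y)\<^sup>2)" for s :: real
  proof -
    have "0 \<le> ?q (x - s *\<^sub>R ?y) (x - s *\<^sub>R ?y)" by (rule pos)
    also have "\<dots> = ?q x x - 2 * s * (norm ?y)\<^sup>2 + s\<^sup>2 * ?q ?y ?y"
      using sym[of x ?y] qy
      by (simp add: blinfun.diff_right blinfun.scaleR_right cinner_diff_left cinner_diff_right
          cinner_scaleR_left cinner_scaleR_right power2_eq_square algebra_simps)
    also have "\<dots> \<le> ?q x x - 2 * s * (norm ?y)\<^sup>2 + s\<^sup>2 * (norm T * (norm ?y)\<^sup>2)"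
      by (intro add_left_mono mult_left_mono le) simp
    finally show ?thesis .
  qed
  show ?thesis
  proof (cases "norm T = 0")
    case True then show ?thesis by simp
  next
    case False
    then have p: "norm T > 0" by simp
    from quad[of "1 / norm T"] have "0 \<le> ?q x x - (norm ?y)\<^sup>2 / norm T"
      using p by (simp add: power2_eq_square field_simps)
    then show ?thesis using p by (simp add: field_simps)
  qed
qed

text \<open>For a contraction the previous inequality gives norm (T x) squared at most <x, T x>;
  expanding norm (x - T x) squared then leaves at most norm x squared. It bounds the operator
  \<open>S\<close> that drives the square root iteration.\<close>

lemma norm_id_minus_le_one:
  assumes T: "adjointable T" and nn: "nonneg_op T" and le: "norm T \<le> 1"
  shows "norm (id_blinfun - T) \<le> 1"
proof (rule norm_blinfun_bound)
  fix x
  let ?r = "Re (cinner_ell2 x (blinfun_apply T x))"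
  have r: "0 \<le> ?r" using nn unfolding nonneg_op_def by blast
  have "(norm (blinfun_apply T x))\<^sup>2 \<le> norm T * ?r" by (rule nonneg_op_cauchy_schwarz[OF T nn])
  also have "\<dots> \<le> ?r" using mult_right_mono[OF le r] by simp
  finally have 1: "(norm (blinfun_apply T x))\<^sup>2 \<le> ?r" .
  have "(norm (x - blinfun_apply T x))\<^sup>2 = (norm x)\<^sup>2 - 2 * ?r + (norm (blinfun_apply T x))\<^sup>2"
    by (simp add: power2_norm_eq_inner Re_cinner inner_diff_left inner_diff_right inner_commute)
  also have "\<dots> \<le> (norm x)\<^sup>2" using 1 r by linarith
  finally have "norm (x - blinfun_apply T x) \<le> norm x" by (simp add: power2_le_iff_abs_le)
  then show "norm (blinfun_apply (id_blinfun - T) x) \<le> 1 * norm x" by (simp add: blinfun.diff_left)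
qed simp

subsection \<open>Positive elements and square roots\<close>

locale star_algebra =
  fixes A :: "'i operator set"
  assumes closed: "closed A"
    and zero: "0 \<in> A"
    and add: "a \<in> A \<Longrightarrow> b \<in> A \<Longrightarrow> a + b \<in> A"
    and cscale: "a \<in> A \<Longrightarrow> cscale_op c a \<in> A"
    and compose: "a \<in> A \<Longrightarrow> b \<in> A \<Longrightarrow> a o\<^sub>L b \<in> A"
    and adjointable: "a \<in> A \<Longrightarrow> adjointable a"
    and adj: "a \<in> A \<Longrightarrow> adj_op a \<in> A"
begin

lemma scaleR: "a \<in> A \<Longrightarrow> r *\<^sub>R a \<in> A"
  using cscale[of a "of_real r"] by (simp add: cscale_op_of_real)

lemma diff: "a \<in> A \<Longrightarrow> b \<in> A \<Longrightarrow> a - b \<in> A"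
  using add[of a "(-1) *\<^sub>R b"] scaleR[of b "-1"] by simp

lemma limit: "f \<longlonglongrightarrow> T \<Longrightarrow> (\<And>n. f n \<in> A) \<Longrightarrow> T \<in> A"
  using closed by (meson closed_sequentially)

text \<open>With \<open>S = 1 - T\<close>, the iteration \<open>Y \<mapsto> (S + Y\<^sup>2)/2\<close> from \<open>0\<close> converges in norm to
  \<open>Y\<close> with \<open>(1 - Y)\<^sup>2 = T\<close>, being dominated by the scalar iteration \<open>y \<mapsto> (1 + y\<^sup>2)/2\<close>. The unit
  need not lie in \<open>A\<close>, but \<open>y - Y\<close> does at every step, and \<open>y\<close> tends to \<open>1\<close>.\<close>

lemma square_root_contraction:
  assumes T: "T \<in> A" and nn: "nonneg_op T" and le: "norm T \<le> 1"
  shows "\<exists>b\<in>A. adj_op b = b \<and> b o\<^sub>L b = T"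
proof -
  define S where "S = id_blinfun - T"
  have S1: "norm S \<le> 1" unfolding S_def by (rule norm_id_minus_le_one[OF adjointable[OF T] nn le])
  have Sadj: "adjointable S" "adj_op S = S"
    unfolding S_def using adjointable[OF T] nonneg_op_self_adjoint[OF adjointable[OF T] nn]
    by (auto simp: adjointable_diff adj_diff)
  define y where "y = rec_nat (0::real) (\<lambda>_ z. (1 + z\<^sup>2) / 2)"
  have y0: "y 0 = 0" and ySuc: "y (Suc n) = (1 + (y n)\<^sup>2) / 2" for n by (auto simp: y_def)
  define Y where "Y = rec_nat (0 :: 'i operator) (\<lambda>_ Z. (1/2) *\<^sub>R (S + (Z o\<^sub>L Z)))"
  have Y0: "Y 0 = 0" and YSuc: "Y (Suc n) = (1/2) *\<^sub>R (S + (Y n o\<^sub>L Y n))" for n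
    by (auto simp: Y_def)
  have y_bd: "0 \<le> y n \<and> y n \<le> 1" for n
  proof (induction n)
    case (Suc n)
    then have "(y n)\<^sup>2 \<le> 1" by (simp add: power2_le_iff_abs_le abs_le_square_iff[symmetric] power_le_one)
    with Suc show ?case unfolding ySuc by auto
  qed (simp add: y0)
  have y_inc: "y n \<le> y (Suc n)" for n
    using zero_le_power2[of "1 - y n"] unfolding ySuc by (simp add: power2_eq_square algebra_simps)
  have "incseq y" using y_inc by (rule incseq_SucI)
  then have "\<exists>l. y \<longlonglongrightarrow> l" using y_bd incseq_convergent[of y 1] by metis
  then obtain l where l: "y \<longlonglongrightarrow> l" ..
  have "(\<lambda>n. y (Suc n)) \<longlonglongrightarrow> (1 + l\<^sup>2) / 2" unfolding ySuc by (intro tendsto_intros l) simp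
  with LIMSEQ_Suc[OF l] have "l = (1 + l\<^sup>2) / 2" using LIMSEQ_unique by blast
  then have "(l - 1)\<^sup>2 = 0" by (simp add: power2_eq_square algebra_simps)
  then have l1: "l = 1" by simp
  have comm_S: "S o\<^sub>L Y n = Y n o\<^sub>L S" for n
  proof (induction n)
    case (Suc n)
    have *: "blinfun_apply S (blinfun_apply (Y n) x) = blinfun_apply (Y n) (blinfun_apply S x)" for x
      using Suc by (metis blinfun_apply_blinfun_compose)
    show ?case unfolding YSuc
      by (rule blinfun_eqI)
        (simp add: * blinfun.add_left blinfun.add_right blinfun.scaleR_left blinfun.scaleR_right)
  qed (simp add: Y0)
  \<comment> \<open>Commutation of the iterates lets the difference of consecutive squares factor as
    \<open>?D o\<^sub>L ?E\<close> in \<open>step\<close>.\<close>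
  have comm: "Y m o\<^sub>L Y n = Y n o\<^sub>L Y m" for m n
  proof (induction n)
    case (Suc n)
    have *: "blinfun_apply (Y m) (blinfun_apply (Y n) x) = blinfun_apply (Y n) (blinfun_apply (Y m) x)"
      and **: "blinfun_apply S (blinfun_apply (Y m) x) = blinfun_apply (Y m) (blinfun_apply S x)" for x
      using Suc comm_S[of m] by (metis blinfun_apply_blinfun_compose)+
    show ?case unfolding YSuc
      by (rule blinfun_eqI)
        (simp add: * ** blinfun.add_left blinfun.add_right blinfun.scaleR_left blinfun.scaleR_right)
  qed (simp add: Y0)
  have Yn: "norm (Y n) \<le> y n" for n
  proof (induction n)
    case (Suc n)
    have "norm (Y n o\<^sub>L Y n) \<le> y n * y n"
      by (rule order_trans[OF norm_blinfun_compose]) (intro mult_mono Suc norm_ge_zero, use y_bd in auto)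
    then have "norm (S + (Y n o\<^sub>L Y n)) \<le> 1 + (y n)\<^sup>2"
      using norm_triangle_ineq[of S "Y n o\<^sub>L Y n"] S1 by (simp add: power2_eq_square)
    then show ?case by (simp add: YSuc ySuc)
  qed (simp add: Y0 y0)
  have step: "norm (Y (Suc n) - Y n) \<le> y (Suc n) - y n" for n
  proof (induction n)
    case 0
    show ?case using Yn[of "Suc 0"] by (simp add: Y0 y0)
  next
    case (Suc n)
    let ?D = "Y (Suc n) - Y n" and ?E = "Y (Suc n) + Y n"
    have "Y (Suc (Suc n)) - Y (Suc n) = (1/2) *\<^sub>R (?D o\<^sub>L ?E)"
    proof (rule blinfun_eqI)
      fix x
      have "blinfun_apply (Y n) (blinfun_apply (Y (Suc n)) x) =
          blinfun_apply (Y (Suc n)) (blinfun_apply (Y n) x)"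
        using comm[of n "Suc n"] by (metis blinfun_apply_blinfun_compose)
      then show "blinfun_apply (Y (Suc (Suc n)) - Y (Suc n)) x = blinfun_apply ((1/2) *\<^sub>R (?D o\<^sub>L ?E)) x"
        unfolding YSuc[of "Suc n"]
        by (subst (2) YSuc)
          (simp add: blinfun.diff_left blinfun.add_left blinfun.add_right blinfun.scaleR_left
            scaleR_add_right[symmetric] scaleR_diff_right[symmetric])
    qed
    then have "norm (Y (Suc (Suc n)) - Y (Suc n)) \<le> (1/2) * (norm ?D * norm ?E)"
      using norm_blinfun_compose[of ?D ?E] by simp
    also have "\<dots> \<le> (1/2) * ((y (Suc n) - y n) * (y (Suc n) + y n))"
      by (intro mult_left_mono mult_mono Suc order_trans[OF norm_triangle_ineq] add_mono Yn)
        (use y_inc y_bd in \<open>auto simp: add_nonneg_nonneg\<close>)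
    also have "\<dots> = y (Suc (Suc n)) - y (Suc n)"
      by (subst (3) ySuc, subst (4) ySuc) (simp add: ySuc[of "Suc n"] power2_eq_square algebra_simps)
    finally show ?case .
  qed
  have tail: "norm (Y (m + n) - Y m) \<le> y (m + n) - y m" for m n
  proof (induction n)
    case (Suc n)
    show ?case
      using norm_triangle_ineq[of "Y (Suc (m + n)) - Y (m + n)" "Y (m + n) - Y m"] Suc step[of "m + n"]
      by simp
  qed simp
  have "Cauchy Y"
  proof (rule metric_CauchyI)
    fix e :: real assume "e > 0"
    with l have "\<forall>\<^sub>F n in sequentially. dist (y n) l < e / 2" by (intro tendstoD) auto
    then obtain N where N: "dist (y N) l < e / 2" using eventually_happens' sequentially_bot by metis
    have "dist (Y n) (Y N) < e / 2" if "n \<ge> N" for n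
      using tail[of N "n - N"] that y_bd[of n] y_bd[of N] N l1
      by (auto simp: dist_norm dist_real_def abs_if split: if_splits)
    then show "\<exists>M. \<forall>m\<ge>M. \<forall>n\<ge>M. dist (Y m) (Y n) < e"
      by (meson dist_commute_lessI dist_triangle_half_l dist_triangle_half_r)
  qed
  then obtain Z where Z: "Y \<longlonglongrightarrow> Z" using Cauchy_convergent_iff convergent_def by blast
  have YZ: "(\<lambda>n. Y (Suc n)) \<longlonglongrightarrow> (1/2) *\<^sub>R (S + (Z o\<^sub>L Z))"
    unfolding YSuc by (intro tendsto_intros tendsto_compose_op Z)
  with LIMSEQ_Suc[OF Z] have Zeq: "Z = (1/2) *\<^sub>R (S + (Z o\<^sub>L Z))" using LIMSEQ_unique by blast
  define b where "b = id_blinfun - Z"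
  have sa: "adjointable (Y n) \<and> adj_op (Y n) = Y n" for n
    by (induction n)
      (auto simp: Y0 YSuc Sadj adjointable_scaleR adjointable_add adjointable_compose adj_scaleR adj_add adj_compose)
  then have "(\<lambda>n. adj_op (Y n)) \<longlonglongrightarrow> adj_op Z" by (intro adjointable_limit(2)[OF Z]) blast
  then have "Y \<longlonglongrightarrow> adj_op Z" using sa by simp
  from LIMSEQ_unique[OF this Z] have Zadj: "adjointable Z" "adj_op Z = Z"
    using adjointable_limit(1)[OF Z] sa by blast+
  have "y n *\<^sub>R id_blinfun - Y n \<in> A" for n
  proof (induction n)
    case 0 then show ?case by (simp add: y0 Y0 zero)
  next
    case (Suc n)
    let ?W = "y n *\<^sub>R id_blinfun - Y n"
    \<comment> \<open>Substituting \<open>S = id_blinfun - T\<close> and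
      \<open>Y n = y n *\<^sub>R id_blinfun - ?W\<close> into the recursion cancels every multiple
      of the unit, so only elements of \<open>A\<close> remain.\<close>
    have "y (Suc n) *\<^sub>R id_blinfun - Y (Suc n) = (1/2) *\<^sub>R (T + (2 * y n) *\<^sub>R ?W - (?W o\<^sub>L ?W))"
    proof (rule blinfun_eqI)
      fix x
      have *: "((1 + r\<^sup>2) / 2) *\<^sub>R x - (1/2) *\<^sub>R (x - t + u) =
          (1/2) *\<^sub>R (t + (2 * r) *\<^sub>R (r *\<^sub>R x - v) - (r *\<^sub>R (r *\<^sub>R x - v) - (r *\<^sub>R v - u)))"
        for r and x t u v :: "'i ell2"
        by (simp add: algebra_simps power2_eq_square add_divide_distrib) (simp flip: scaleR_add_left)
      show "blinfun_apply (y (Suc n) *\<^sub>R id_blinfun - Y (Suc n)) x =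
          blinfun_apply ((1/2) *\<^sub>R (T + (2 * y n) *\<^sub>R ?W - (?W o\<^sub>L ?W))) x"
        using *[of "y n" x "blinfun_apply T x" "blinfun_apply (Y n) (blinfun_apply (Y n) x)" "blinfun_apply (Y n) x"]
        unfolding YSuc ySuc S_def
        by (simp add: blinfun.diff_left blinfun.diff_right blinfun.add_left blinfun.scaleR_left blinfun.scaleR_right)
    qed
    then show ?case
      by (simp only:) (rule scaleR[OF diff[OF add[OF T scaleR[OF Suc]] compose[OF Suc Suc]]])
  qed
  moreover have "(\<lambda>n. y n *\<^sub>R id_blinfun - Y n) \<longlonglongrightarrow> b"
    unfolding b_def using tendsto_diff[OF tendsto_scaleR[OF l tendsto_const] Z, of id_blinfun] l1 by simp
  ultimately have "b \<in> A" by (rule limit[rotated])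
  moreover have "adj_op b = b" unfolding b_def using Zadj by (simp add: adj_diff)
  moreover have "b o\<^sub>L b = T"
  proof -
    have ZZ: "Z o\<^sub>L Z = 2 *\<^sub>R Z - S" by (subst (3) Zeq) simp
    have "blinfun_apply Z (blinfun_apply Z x) = 2 *\<^sub>R blinfun_apply Z x - (x - blinfun_apply T x)" for x
      using arg_cong[OF ZZ, of "\<lambda>f. blinfun_apply f x"]
      by (simp add: S_def blinfun.diff_left blinfun.scaleR_left)
    then show ?thesis unfolding b_def
      by (intro blinfun_eqI) (simp add: blinfun.diff_left blinfun.diff_right scaleR_2)
  qed
  ultimately show ?thesis by blast
qed

lemma square_root:
  assumes T: "T \<in> A" and nn: "nonneg_op T"
  shows "\<exists>b\<in>A. adj_op b = b \<and> b o\<^sub>L b = T"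
proof (cases "T = 0")
  case True
  then show ?thesis using zero by (intro bexI[of _ 0]) auto
next
  case False
  then have p: "norm T > 0" by simp
  have "\<exists>b\<in>A. adj_op b = b \<and> b o\<^sub>L b = (1 / norm T) *\<^sub>R T"
    by (rule square_root_contraction) (use p T nn in \<open>auto intro!: scaleR nonneg_op_scaleR\<close>)
  then obtain b where b: "b \<in> A" "adj_op b = b" "b o\<^sub>L b = (1 / norm T) *\<^sub>R T" by blast
  let ?b = "sqrt (norm T) *\<^sub>R b"
  have "?b o\<^sub>L ?b = norm T *\<^sub>R (b o\<^sub>L b)"
    by (rule blinfun_eqI) (simp add: blinfun.scaleR_left blinfun.scaleR_right)
  with b p have "?b o\<^sub>L ?b = T" by simp
  with b show ?thesis by (intro bexI[of _ ?b]) (auto intro: scaleR simp: adj_scaleR adjointable)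
qed

text \<open>The square root gives the inclusion from right to left. In the form
  \<open>nonneg_op\<close>, positivity is visibly stable under sums, limits and conjugation.\<close>

lemma positive_part_eq: "positive_part A = {a \<in> A. nonneg_op a}"
proof (intro equalityI subsetI)
  fix a assume "a \<in> positive_part A"
  then show "a \<in> {a \<in> A. nonneg_op a}"
    unfolding positive_part_def by (auto intro: compose adj nonneg_op_adj_compose adjointable)
next
  fix a assume "a \<in> {a \<in> A. nonneg_op a}"
  then show "a \<in> positive_part A" unfolding positive_part_def using square_root[of a] by force
qed

end

section \<open>Weights\<close>

lemmas compose_add_left = bounded_bilinear.add_left[OF bounded_bilinear_blinfun_compose]
  and compose_add_right = bounded_bilinear.add_right[OF bounded_bilinear_blinfun_compose]
  and compose_diff_left = bounded_bilinear.diff_left[OF bounded_bilinear_blinfun_compose]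
  and compose_diff_right = bounded_bilinear.diff_right[OF bounded_bilinear_blinfun_compose]
  and compose_scaleR_left = bounded_bilinear.scaleR_left[OF bounded_bilinear_blinfun_compose]
  and compose_scaleR_right = bounded_bilinear.scaleR_right[OF bounded_bilinear_blinfun_compose]
  and compose_zero_left = bounded_bilinear.zero_left[OF bounded_bilinear_blinfun_compose]
  and compose_zero_right = bounded_bilinear.zero_right[OF bounded_bilinear_blinfun_compose]

lemma compose_cscale_left: "cscale_op c S o\<^sub>L T = cscale_op c (S o\<^sub>L T)"
  by (rule blinfun_eqI) (simp add: cscale_op_apply)

lemma compose_cscale_right: "adjointable S \<Longrightarrow> S o\<^sub>L cscale_op c T = cscale_op c (S o\<^sub>L T)"
  by (rule blinfun_eqI) (simp add: cscale_op_apply adjointable_apply_cscale)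

lemma compose_assoc: "(R o\<^sub>L S) o\<^sub>L T = R o\<^sub>L (S o\<^sub>L T)"
  by (rule blinfun_eqI) simp

context star_algebra
begin

lemma pos_in: "a \<in> positive_part A \<Longrightarrow> a \<in> A"
  by (simp add: positive_part_eq)

lemma pos_self_adjoint: "a \<in> positive_part A \<Longrightarrow> adj_op a = a"
  by (simp add: positive_part_eq adjointable nonneg_op_self_adjoint)

lemma pos_add: "a \<in> positive_part A \<Longrightarrow> b \<in> positive_part A \<Longrightarrow> a + b \<in> positive_part A"
  by (simp add: positive_part_eq add nonneg_op_add)

lemma pos_scaleR: "a \<in> positive_part A \<Longrightarrow> 0 \<le> r \<Longrightarrow> r *\<^sub>R a \<in> positive_part A"
  by (simp add: positive_part_eq scaleR nonneg_op_scaleR)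

lemma pos_zero: "0 \<in> positive_part A"
  by (simp add: positive_part_eq zero nonneg_op_def)

lemma pos_adj_compose: "a \<in> A \<Longrightarrow> adj_op a o\<^sub>L a \<in> positive_part A"
  unfolding positive_part_def by blast

end

lemma nonneg_op_conj:
  assumes "adjointable x" "nonneg_op h"
  shows "nonneg_op (adj_op x o\<^sub>L h o\<^sub>L x)"
  using assms(2) unfolding nonneg_op_def by (simp add: cinner_adj_right[OF assms(1)])

text \<open>The unit may lie outside the algebra; the inequality is used only after conjugation by
  \<open>nonneg_op_conj\<close>, which brings it back inside.\<close>

lemma nonneg_op_norm_bound:
  assumes a: "adjointable a"
  shows "nonneg_op ((norm a)\<^sup>2 *\<^sub>R id_blinfun - (adj_op a o\<^sub>L a))"
  unfolding nonneg_op_def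
proof (intro allI conjI)
  fix x
  have eq: "cinner_ell2 x (blinfun_apply ((norm a)\<^sup>2 *\<^sub>R id_blinfun - (adj_op a o\<^sub>L a)) x) =
     of_real ((norm a)\<^sup>2 * (norm x)\<^sup>2 - (norm (blinfun_apply a x))\<^sup>2)"
    by (simp add: blinfun.diff_left blinfun.scaleR_left cinner_diff_right cinner_scaleR_right
        cinner_adj_right[OF a] cinner_self)
  show "Im (cinner_ell2 x (blinfun_apply ((norm a)\<^sup>2 *\<^sub>R id_blinfun - (adj_op a o\<^sub>L a)) x)) = 0"
    unfolding eq by simp
  have "(norm (blinfun_apply a x))\<^sup>2 \<le> (norm a * norm x)\<^sup>2"
    by (intro power_mono norm_blinfun) simp
  then show "0 \<le> Re (cinner_ell2 x (blinfun_apply ((norm a)\<^sup>2 *\<^sub>R id_blinfun - (adj_op a o\<^sub>L a)) x))"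
    unfolding eq by (simp add: power_mult_distrib)
qed

lemma nonneg_op_self_adjoint_bound:
  assumes h: "adjointable h" "adj_op h = h"
  shows "nonneg_op (norm h *\<^sub>R id_blinfun + h)"
  unfolding nonneg_op_def
proof (intro allI conjI)
  fix x
  have "cinner_ell2 x (blinfun_apply h x) = cnj (cinner_ell2 x (blinfun_apply h x))"
    using cinner_adj_left[OF h(1), of x x] h(2) cinner_commute by metis
  then have "Im (cinner_ell2 x (blinfun_apply h x)) = 0"
    by (metis Reals_cnj_iff complex_is_Real_iff)
  then show "Im (cinner_ell2 x (blinfun_apply (norm h *\<^sub>R id_blinfun + h) x)) = 0"
    by (simp add: blinfun.add_left blinfun.scaleR_left cinner_add_right cinner_scaleR_right cinner_self)
  have "cmod (cinner_ell2 x (blinfun_apply h x)) \<le> norm x * (norm h * norm x)"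
    by (rule order_trans[OF cmod_cinner_le]) (intro mult_left_mono norm_blinfun norm_ge_zero)
  then have "- Re (cinner_ell2 x (blinfun_apply h x)) \<le> norm h * (norm x)\<^sup>2"
    using abs_Re_le_cmod[of "cinner_ell2 x (blinfun_apply h x)"] by (simp add: power2_eq_square mult_ac)
  then show "0 \<le> Re (cinner_ell2 x (blinfun_apply (norm h *\<^sub>R id_blinfun + h) x))"
    by (simp add: blinfun.add_left blinfun.scaleR_left cinner_add_right cinner_scaleR_right cinner_self)
qed

section \<open>The linear functional of a weight\<close>

locale proper_weight_on = star_algebra A for A :: "'i operator set" +
  fixes \<psi> :: "'i operator \<Rightarrow> ennreal"
  assumes proper: "proper_weight A \<psi>"
begin

abbreviation "\<phi> \<equiv> weight_functional A \<psi>"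
abbreviation "N \<equiv> weight_N A \<psi>"
abbreviation "M \<equiv> weight_M A \<psi>"

text \<open>The hereditary cone of finite weight; its complex span turns out to be
  \<open>M\<close>.\<close>

definition K :: "'i operator set" where
  "K = {a \<in> positive_part A. \<psi> a < \<infinity>}"

lemma weight_add: "a \<in> positive_part A \<Longrightarrow> b \<in> positive_part A \<Longrightarrow> \<psi> (a + b) = \<psi> a + \<psi> b"
  using proper unfolding proper_weight_def weight_def by blast

lemma weight_scale: "a \<in> positive_part A \<Longrightarrow> 0 < c \<Longrightarrow> \<psi> (c *\<^sub>R a) = ennreal c * \<psi> a"
  using proper unfolding proper_weight_def weight_def by blast

lemma weight_dense: "positive_part A \<subseteq> closure K"
  using proper unfolding proper_weight_def K_def by blast

text \<open>Homogeneity is postulated for positive scalars only. Density provides some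
  \<open>a\<close> of finite weight, and its weight can be cancelled from the additivity relation
  for a + 0.\<close>

lemma weight_zero: "\<psi> 0 = 0"
proof -
  have "K \<noteq> {}" using weight_dense pos_zero by auto
  then obtain a where a: "a \<in> positive_part A" "\<psi> a < \<infinity>" unfolding K_def by blast
  have "\<psi> a + 0 = \<psi> a + \<psi> 0" using weight_add[OF a(1) pos_zero] by simp
  then show ?thesis using a(2) by (metis ennreal_add_left_cancel infinity_ennreal_def less_irrefl)
qed

lemma weight_scale0: "a \<in> positive_part A \<Longrightarrow> 0 \<le> c \<Longrightarrow> \<psi> (c *\<^sub>R a) = ennreal c * \<psi> a"
  using weight_scale[of a c] weight_zero by (cases "c = 0") auto

lemma weight_mono:
  assumes "a \<in> positive_part A" "b \<in> A" "nonneg_op (b - a)"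
  shows "\<psi> a \<le> \<psi> b"
proof -
  have "b - a \<in> positive_part A" using assms by (auto simp: positive_part_eq diff)
  from weight_add[OF assms(1) this] show ?thesis by simp
qed

lemma weight_lsc:
  assumes lim: "f \<longlonglongrightarrow> a" and f: "\<And>n. f n \<in> positive_part A" and le: "\<And>n. \<psi> (f n) \<le> c"
  shows "\<psi> a \<le> c"
proof (cases "c = \<infinity>")
  case False
  then obtain r where r: "0 \<le> r" "c = ennreal r" by (metis ennreal_cases infinity_ennreal_def)
  have "closed {a \<in> positive_part A. \<psi> a \<le> ennreal r}"
    using proper r(1) unfolding proper_weight_def by blast
  then have "a \<in> {a \<in> positive_part A. \<psi> a \<le> ennreal r}"
    by (rule closed_sequentially[OF _ _ lim]) (use f le r in auto)
  then show ?thesis using r by simp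
qed simp

lemma K_add: "a \<in> K \<Longrightarrow> b \<in> K \<Longrightarrow> a + b \<in> K"
  unfolding K_def by (auto simp: pos_add weight_add)

lemma K_scale: "a \<in> K \<Longrightarrow> 0 \<le> r \<Longrightarrow> r *\<^sub>R a \<in> K"
  unfolding K_def by (auto simp: pos_scaleR weight_scale0 ennreal_mult_less_top)

lemma K_zero: "0 \<in> K"
  unfolding K_def by (simp add: pos_zero weight_zero)

lemma K_hereditary:
  assumes "b \<in> K" "a \<in> A" "nonneg_op a" "nonneg_op (b - a)"
  shows "a \<in> K"
  using assms weight_mono[of a b] unfolding K_def
  by (auto simp: positive_part_eq intro: le_less_trans)

lemma N_iff: "a \<in> N \<longleftrightarrow> a \<in> A \<and> adj_op a o\<^sub>L a \<in> K"
  unfolding weight_N_def K_def using pos_adj_compose by auto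

lemma N_in: "a \<in> N \<Longrightarrow> a \<in> A"
  by (simp add: N_iff)

text \<open>Conjugating the norm bound for \<open>a\<close> by \<open>b\<close> dominates the square
  of the product by a multiple of \<open>adj_op b o\<^sub>L b\<close>, and \<open>K\<close> is
  hereditary.\<close>

lemma N_left_ideal:
  assumes a: "a \<in> A" and b: "b \<in> N"
  shows "a o\<^sub>L b \<in> N"
proof -
  have bA: "b \<in> A" using b by (simp add: N_iff)
  have eq: "adj_op (a o\<^sub>L b) o\<^sub>L (a o\<^sub>L b) = adj_op b o\<^sub>L (adj_op a o\<^sub>L a) o\<^sub>L b"
    using a bA by (simp add: adj_compose adjointable compose_assoc)
  have "(norm a)\<^sup>2 *\<^sub>R (adj_op b o\<^sub>L b) - (adj_op b o\<^sub>L (adj_op a o\<^sub>L a) o\<^sub>L b) =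
      adj_op b o\<^sub>L ((norm a)\<^sup>2 *\<^sub>R id_blinfun - (adj_op a o\<^sub>L a)) o\<^sub>L b"
    by (rule blinfun_eqI) (simp add: blinfun.diff_left blinfun.diff_right blinfun.scaleR_left blinfun.scaleR_right)
  then have nn: "nonneg_op ((norm a)\<^sup>2 *\<^sub>R (adj_op b o\<^sub>L b) - (adj_op (a o\<^sub>L b) o\<^sub>L (a o\<^sub>L b)))"
    unfolding eq using nonneg_op_conj[OF adjointable[OF bA] nonneg_op_norm_bound[OF adjointable[OF a]]] by simp
  have "adj_op (a o\<^sub>L b) o\<^sub>L (a o\<^sub>L b) \<in> K"
    by (rule K_hereditary[OF _ _ _ nn])
      (use b a bA in \<open>auto simp: N_iff intro!: K_scale compose adj nonneg_op_adj_compose adjointable\<close>)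
  then show ?thesis using a bA by (simp add: N_iff compose)
qed

lemma N_cscale: "a \<in> N \<Longrightarrow> cscale_op c a \<in> N"
proof -
  assume a: "a \<in> N"
  have "cnj c * c = of_real ((cmod c)\<^sup>2)"
    by (metis complex_norm_square mult.commute)
  with a have "adj_op (cscale_op c a) o\<^sub>L cscale_op c a = (cmod c)\<^sup>2 *\<^sub>R (adj_op a o\<^sub>L a)"
    by (simp add: N_iff adj_cscale adjointable adj compose_cscale_left compose_cscale_right
        cscale_op_of_real[symmetric] del: of_real_power)
  with a show ?thesis by (simp add: N_iff cscale K_scale)
qed

text \<open>Parallelogram law: twice the sum of the two squares exceeds the square of
  \<open>a + b\<close> by exactly the square of \<open>a - b\<close>.\<close>

lemma N_add: 
  assumes a: "a \<in> N" and b: "b \<in> N"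
  shows "a + b \<in> N"
proof -
  have A: "a \<in> A" "b \<in> A" using a b by (auto simp: N_iff)
  have eq: "2 *\<^sub>R (adj_op a o\<^sub>L a) + 2 *\<^sub>R (adj_op b o\<^sub>L b) - (adj_op (a + b) o\<^sub>L (a + b)) =
     adj_op (a - b) o\<^sub>L (a - b)"
    using A by (simp add: adj_add adj_diff adjointable compose_add_left compose_add_right
        compose_diff_left compose_diff_right scaleR_2)
  have "nonneg_op (2 *\<^sub>R (adj_op a o\<^sub>L a) + 2 *\<^sub>R (adj_op b o\<^sub>L b) - (adj_op (a + b) o\<^sub>L (a + b)))"
    unfolding eq by (intro nonneg_op_adj_compose adjointable diff A)
  then have "adj_op (a + b) o\<^sub>L (a + b) \<in> K"
    by (rule K_hereditary[rotated 3])
      (use a b A in \<open>auto simp: N_iff intro!: K_add K_scale compose adj add nonneg_op_adj_compose adjointable\<close>)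
  then show ?thesis using A by (simp add: N_iff add)
qed

lemma N_diff: "a \<in> N \<Longrightarrow> b \<in> N \<Longrightarrow> a - b \<in> N"
  using N_add[of a "cscale_op (-1) b"] N_cscale[of b "-1"] cscale_op_of_real[of "-1" b] by simp

definition quad :: "'i operator \<Rightarrow> 'i operator \<Rightarrow> 'i operator \<Rightarrow> 'i operator \<Rightarrow> 'i operator" where
  "quad a b c d = (a - b) + cscale_op \<i> (c - d)"

definition quad_val :: "'i operator \<Rightarrow> 'i operator \<Rightarrow> 'i operator \<Rightarrow> 'i operator \<Rightarrow> complex" where
  "quad_val a b c d = Complex (enn2real (\<psi> a) - enn2real (\<psi> b)) (enn2real (\<psi> c) - enn2real (\<psi> d))"

text \<open>The graph of the functional to be constructed. It starts as a relation because the
  decomposition of an element into four members of \<open>K\<close> is not unique;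
  \<open>quads_unique\<close> shows that the value is.\<close>

definition quads :: "('i operator \<times> complex) set" where
  "quads = {(quad a b c d, quad_val a b c d) | a b c d. a \<in> K \<and> b \<in> K \<and> c \<in> K \<and> d \<in> K}"

lemma enn_weight_add: "a \<in> K \<Longrightarrow> b \<in> K \<Longrightarrow> enn2real (\<psi> (a + b)) = enn2real (\<psi> a) + enn2real (\<psi> b)"
  unfolding K_def by (simp add: weight_add enn2real_plus)

lemma enn_weight_scale: "a \<in> K \<Longrightarrow> 0 \<le> r \<Longrightarrow> enn2real (\<psi> (r *\<^sub>R a)) = r * enn2real (\<psi> a)"
  unfolding K_def by (simp add: weight_scale0 enn2real_mult)

lemma quads_add: "(x, z) \<in> quads \<Longrightarrow> (x', z') \<in> quads \<Longrightarrow> (x + x', z + z') \<in> quads"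
proof -
  assume "(x, z) \<in> quads" "(x', z') \<in> quads"
  then obtain a b c d a' b' c' d' where
    1: "x = quad a b c d" "z = quad_val a b c d" "a \<in> K" "b \<in> K" "c \<in> K" "d \<in> K" and
    2: "x' = quad a' b' c' d'" "z' = quad_val a' b' c' d'" "a' \<in> K" "b' \<in> K" "c' \<in> K" "d' \<in> K"
    unfolding quads_def by blast
  have "x + x' = quad (a + a') (b + b') (c + c') (d + d')"
    unfolding 1 2 quad_def by (simp add: complex_op.scale_right_diff_distrib complex_op.scale_right_distrib)
  moreover have "z + z' = quad_val (a + a') (b + b') (c + c') (d + d')"
    unfolding 1 2 quad_val_def using 1 2 by (simp add: enn_weight_add complex_eq_iff)
  ultimately show ?thesis unfolding quads_def using 1 2 K_add by blast
qed

lemma quads_scaleR: 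
  assumes "(x, z) \<in> quads" "0 \<le> r" shows "(cscale_op (of_real r) x, of_real r * z) \<in> quads"
proof -
  obtain a b c d where
    1: "x = quad a b c d" "z = quad_val a b c d" "a \<in> K" "b \<in> K" "c \<in> K" "d \<in> K"
    using assms unfolding quads_def by blast
  have "cscale_op (of_real r) x = quad (r *\<^sub>R a) (r *\<^sub>R b) (r *\<^sub>R c) (r *\<^sub>R d)"
    unfolding 1 quad_def
    by (simp add: complex_op.scale_right_diff_distrib complex_op.scale_right_distrib
        cscale_op_of_real[symmetric] mult.commute)
  moreover have "of_real r * z = quad_val (r *\<^sub>R a) (r *\<^sub>R b) (r *\<^sub>R c) (r *\<^sub>R d)"
    unfolding 1 quad_val_def using 1 assms(2) by (simp add: enn_weight_scale complex_eq_iff algebra_simps)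
  ultimately show ?thesis unfolding quads_def using 1 K_scale[OF _ assms(2)] by blast
qed

lemma quads_uminus:
  assumes "(x, z) \<in> quads" shows "(- x, - z) \<in> quads"
proof -
  obtain a b c d where
    1: "x = quad a b c d" "z = quad_val a b c d" "a \<in> K" "b \<in> K" "c \<in> K" "d \<in> K"
    using assms unfolding quads_def by blast
  have "- x = quad b a d c"
    unfolding 1 quad_def by (simp add: complex_op.scale_right_diff_distrib)
  moreover have "- z = quad_val b a d c"
    unfolding 1 quad_val_def by (simp add: complex_eq_iff)
  ultimately show ?thesis unfolding quads_def using 1 by blast
qed

lemma quads_imag:
  assumes "(x, z) \<in> quads" shows "(cscale_op \<i> x, \<i> * z) \<in> quads"
proof -
  obtain a b c d where
    1: "x = quad a b c d" "z = quad_val a b c d" "a \<in> K" "b \<in> K" "c \<in> K" "d \<in> K"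
    using assms unfolding quads_def by blast
  have m: "cscale_op (-1) y = - y" for y :: "'i operator"
    using complex_op.scale_minus_left[of 1 y] by simp
  have "cscale_op \<i> x = quad d c a b"
    unfolding 1 quad_def by (simp add: complex_op.scale_right_diff_distrib complex_op.scale_right_distrib m)
  moreover have "\<i> * z = quad_val d c a b"
    unfolding 1 quad_val_def by (simp add: complex_eq_iff)
  ultimately show ?thesis unfolding quads_def using 1 by blast
qed

lemma quads_cscale:
  assumes "(x, z) \<in> quads" shows "(cscale_op w x, w * z) \<in> quads"
proof -
  have real: "(cscale_op (of_real r) x, of_real r * z) \<in> quads" if "(x, z) \<in> quads" for r x z
  proof (cases "0 \<le> r")
    case False
    then have "(- cscale_op (of_real (- r)) x, - (of_real (- r) * z)) \<in> quads"
      by (intro quads_uminus quads_scaleR that) simp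
    then show ?thesis by (simp add: complex_op.scale_minus_left)
  qed (use that quads_scaleR in blast)
  have "(cscale_op (of_real (Re w)) x + cscale_op (of_real (Im w)) (cscale_op \<i> x),
      of_real (Re w) * z + of_real (Im w) * (\<i> * z)) \<in> quads"
    by (intro quads_add real quads_imag assms)
  moreover have "cscale_op (of_real (Re w)) x + cscale_op (of_real (Im w)) (cscale_op \<i> x) = cscale_op w x"
    using complex_eq[of w]
    by (simp add: complex_op.scale_left_distrib[symmetric] mult.commute del: complex_of_real_def)
  moreover have "of_real (Re w) * z + of_real (Im w) * (\<i> * z) = w * z"
    using complex_eq[of w] by (metis distrib_right mult.assoc mult.commute)
  ultimately show ?thesis by simp
qed

text \<open>The elements of \<open>K\<close> are self-adjoint, so comparing with the adjoint
  separates the real and the imaginary part. An equality of differences becomes an equality of sums,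
  to which additivity of the weight applies.\<close>

lemma quads_unique:
  assumes "(x, z) \<in> quads" "(x, z') \<in> quads"
  shows "z = z'"
proof -
  obtain a b c d a' b' c' d' where
    1: "x = quad a b c d" "z = quad_val a b c d" "a \<in> K" "b \<in> K" "c \<in> K" "d \<in> K" and
    2: "x = quad a' b' c' d'" "z' = quad_val a' b' c' d'" "a' \<in> K" "b' \<in> K" "c' \<in> K" "d' \<in> K"
    using assms unfolding quads_def by blast
  have adjs: "adj_op (quad a b c d) = (a - b) - cscale_op \<i> (c - d)"
    if "a \<in> K" "b \<in> K" "c \<in> K" "d \<in> K" for a b c d
    using that unfolding quad_def K_def
    by (simp add: adj_add adj_diff adj_cscale adjointable_add adjointable_diff adjointable_cscale
        adjointable pos_in pos_self_adjoint complex_op.scale_minus_left)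
  have e1: "(a - b) + cscale_op \<i> (c - d) = (a' - b') + cscale_op \<i> (c' - d')"
    using 1(1) 2(1) unfolding quad_def by simp
  have e2: "(a - b) - cscale_op \<i> (c - d) = (a' - b') - cscale_op \<i> (c' - d')"
    using 1(1) 2(1) adjs[OF 1(3-6)] adjs[OF 2(3-6)] by simp
  have "2 *\<^sub>R (a - b) = 2 *\<^sub>R (a' - b')"
    using arg_cong2[OF e1 e2, of "(+)"] by (simp add: scaleR_2)
  then have r: "a - b = a' - b'" by simp
  then have "cscale_op \<i> (c - d) = cscale_op \<i> (c' - d')" using e1 by simp
  then have i: "c - d = c' - d'" by simp
  have "enn2real (\<psi> a) + enn2real (\<psi> b') = enn2real (\<psi> a') + enn2real (\<psi> b)"
    using r 1 2 by (simp add: enn_weight_add[symmetric] algebra_simps)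
  moreover have "enn2real (\<psi> c) + enn2real (\<psi> d') = enn2real (\<psi> c') + enn2real (\<psi> d)"
    using i 1 2 by (simp add: enn_weight_add[symmetric] algebra_simps)
  ultimately show ?thesis unfolding 1 2 quad_val_def by simp
qed

lemma quads_K: "a \<in> K \<Longrightarrow> (a, of_real (enn2real (\<psi> a))) \<in> quads"
  unfolding quads_def quad_def quad_val_def
  by (rule CollectI, intro exI[of _ a] exI[of _ 0]) (simp add: K_zero weight_zero complex_eq_iff)

definition polar :: "'i operator \<Rightarrow> 'i operator \<Rightarrow> nat \<Rightarrow> 'i operator" where
  "polar a b k = b + cscale_op (\<i> ^ k) a"

lemma polarization:
  assumes a: "a \<in> A" and b: "b \<in> A"
  shows "adj_op a o\<^sub>L b = (\<Sum>k<4. cscale_op (\<i> ^ k / 4) (adj_op (polar a b k) o\<^sub>L polar a b k))"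
proof -
  have i: "\<i> ^ k = (if k = 0 then 1 else if k = 1 then \<i> else if k = 2 then -1 else - \<i>)" if "k < 4" for k
    using that by (auto simp: less_Suc_eq numeral_eq_Suc)
  \<comment> \<open>Over the fourth roots of unity \<open>w\<close> the coefficients w, the square
    of w, and w w cnj w sum to zero, while w cnj w = 1 sums to 4; only
    \<open>adj_op a o\<^sub>L b\<close> survives.\<close>
  have expand: "cscale_op (w / 4) (adj_op (b + cscale_op w a) o\<^sub>L (b + cscale_op w a)) =
      cscale_op (w / 4) (adj_op b o\<^sub>L b) + cscale_op (w\<^sup>2 / 4) (adj_op b o\<^sub>L a) +
      cscale_op (w * cnj w / 4) (adj_op a o\<^sub>L b) + cscale_op (w * w * cnj w / 4) (adj_op a o\<^sub>L a)" for w
    using a b by (simp add: adj_add adj_cscale adjointable adj adjointable_cscale compose_add_left compose_add_right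
        compose_cscale_left compose_cscale_right complex_op.scale_right_distrib power2_eq_square mult_ac)
  show ?thesis
    unfolding polar_def expand
    by (simp add: numeral_eq_Suc complex_op.scale_left_distrib[symmetric] algebra_simps)
qed

lemma polar_N: "a \<in> N \<Longrightarrow> b \<in> N \<Longrightarrow> polar a b k \<in> N"
  unfolding polar_def by (intro N_add N_cscale)

text \<open>The polarization formula read through the weight. The explicit form is needed again when
  the functional is expanded into a series.\<close>

definition polar_val :: "'i operator \<Rightarrow> 'i operator \<Rightarrow> complex" where
  "polar_val a b = (\<Sum>k<4. \<i> ^ k / 4 * of_real (enn2real (\<psi> (adj_op (polar a b k) o\<^sub>L polar a b k))))"

lemma quads_sum:
  "finite I \<Longrightarrow> (\<And>i. i \<in> I \<Longrightarrow> (f i, g i) \<in> quads) \<Longrightarrow> (sum f I, sum g I) \<in> quads"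
proof (induction I rule: finite_induct)
  case empty
  show ?case using quads_K[OF K_zero] by (simp add: weight_zero)
next
  case (insert i I)
  then show ?case by (simp add: quads_add)
qed

lemma quads_adj_compose: "a \<in> N \<Longrightarrow> b \<in> N \<Longrightarrow> (adj_op a o\<^sub>L b, polar_val a b) \<in> quads"
  unfolding polarization[OF N_in N_in] polar_val_def
  by (intro quads_sum quads_cscale quads_K) (use polar_N in \<open>auto simp: N_iff\<close>)

lemma quads_M: "x \<in> M \<Longrightarrow> \<exists>z. (x, z) \<in> quads"
  unfolding weight_M_def
proof (induction rule: complex_op.span_induct_alt)
  case base
  show ?case using quads_K[OF K_zero] by blast
next
  case (step c x y)
  then show ?case using quads_adj_compose quads_add quads_cscale by blast
qed

lemma K_root: 
  assumes "k \<in> K" obtains b where "b \<in> N" "adj_op b = b" "b o\<^sub>L b = k"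
proof -
  obtain b where b: "b \<in> A" "adj_op b = b" "b o\<^sub>L b = k"
    using square_root[of k] assms unfolding K_def positive_part_eq by blast
  with assms have "b \<in> N" by (simp add: N_iff)
  with b that show ?thesis by blast
qed

lemma M_adj_compose: "a \<in> N \<Longrightarrow> b \<in> N \<Longrightarrow> adj_op a o\<^sub>L b \<in> M"
  unfolding weight_M_def by (rule complex_op.span_base) blast

lemma M_add: "a \<in> M \<Longrightarrow> b \<in> M \<Longrightarrow> a + b \<in> M"
  unfolding weight_M_def by (rule complex_op.span_add)

lemma M_cscale: "a \<in> M \<Longrightarrow> cscale_op c a \<in> M"
  unfolding weight_M_def by (rule complex_op.span_scale)

lemma K_in_M: "k \<in> K \<Longrightarrow> k \<in> M"
  by (metis K_root M_adj_compose)

text \<open>This resolves the definite description in \<open>weight_functional\<close>: the relation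
  \<open>quads\<close> yields a functional with all the required properties, and any other agrees
  with it because both are linear and prescribed on \<open>K\<close>, whose combinations exhaust
  \<open>M\<close>.\<close>

lemma functional_eqI:
  assumes "(x, z) \<in> quads" shows "\<phi> x = z" 
proof -
  have quads_in_M: "x \<in> M" if q: "(x, z) \<in> quads" for x z
  proof -
    obtain a b c d where 1: "x = quad a b c d" "a \<in> K" "b \<in> K" "c \<in> K" "d \<in> K"
      using q unfolding quads_def by blast
    have "cscale_op (-1) y = - y" for y :: "'i operator"
      using complex_op.scale_minus_left[of 1 y] by simp
    then have m: "- y \<in> M" if "y \<in> M" for y using M_cscale[OF that, of "-1"] by simp
    have "(a + - b) + cscale_op \<i> (c + - d) \<in> M"
      by (intro M_add M_cscale m K_in_M 1)
    then show ?thesis unfolding 1 quad_def by simp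
  qed
  define \<phi>\<^sub>0 where "\<phi>\<^sub>0 = (\<lambda>x. if x \<in> M then THE z. (x, z) \<in> quads else undefined)"
  have val: "\<phi>\<^sub>0 x = z" if "(x, z) \<in> quads" for x z
    unfolding \<phi>\<^sub>0_def using quads_in_M[OF that] quads_unique that by auto
  define good where "good \<phi> \<longleftrightarrow> \<phi> \<in> extensional M \<and>
     (\<forall>a\<in>M. \<forall>b\<in>M. \<phi> (a + b) = \<phi> a + \<phi> b) \<and>
     (\<forall>a\<in>M. \<forall>c. \<phi> (cscale_op c a) = c * \<phi> a) \<and>
     (\<forall>a\<in>positive_part A. \<psi> a < \<infinity> \<longrightarrow> \<phi> a = complex_of_real (enn2real (\<psi> a)))" for \<phi> :: "'i operator \<Rightarrow> complex"
  have "good \<phi>\<^sub>0"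
    unfolding good_def
  proof (intro conjI ballI allI impI)
    show "\<phi>\<^sub>0 \<in> extensional M" by (simp add: \<phi>\<^sub>0_def extensional_def)
    show "\<phi>\<^sub>0 (a + b) = \<phi>\<^sub>0 a + \<phi>\<^sub>0 b" if "a \<in> M" "b \<in> M" for a b
      using quads_M[OF that(1)] quads_M[OF that(2)] quads_add val by metis
    show "\<phi>\<^sub>0 (cscale_op c a) = c * \<phi>\<^sub>0 a" if "a \<in> M" for a c
      using quads_M[OF that] quads_cscale val by metis
    show "\<phi>\<^sub>0 a = complex_of_real (enn2real (\<psi> a))" if "a \<in> positive_part A" "\<psi> a < \<infinity>" for a
      by (rule val, rule quads_K) (use that K_def in auto)
  qed
  moreover have "\<phi>' = \<phi>\<^sub>0" if g: "good \<phi>'" for \<phi>'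
  proof
    fix x
    show "\<phi>' x = \<phi>\<^sub>0 x"
    proof (cases "x \<in> M")
      case False
      then show ?thesis using g \<open>good \<phi>\<^sub>0\<close> unfolding good_def extensional_def by auto
    next
      case True
      then obtain z where z: "(x, z) \<in> quads" using quads_M by blast
      then obtain a b c d where 1: "x = quad a b c d" "z = quad_val a b c d" "a \<in> K" "b \<in> K" "c \<in> K" "d \<in> K"
        unfolding quads_def by blast
      have m: "y - y' = y + cscale_op (-1) y'" for y y' :: "'i operator"
        using complex_op.scale_minus_left[of 1 y'] by simp
      have val': "\<phi>' k = of_real (enn2real (\<psi> k))" if "k \<in> K" for k
        using g that unfolding good_def K_def by auto
      have add': "\<phi>' (p + q) = \<phi>' p + \<phi>' q" if "p \<in> M" "q \<in> M" for p q
        using g that unfolding good_def by auto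
      have scale': "\<phi>' (cscale_op w p) = w * \<phi>' p" if "p \<in> M" for p w
        using g that unfolding good_def by auto
      have diff': "y - y' \<in> M" "\<phi>' (y - y') = \<phi>' y - \<phi>' y'" if "y \<in> K" "y' \<in> K" for y y'
      proof -
        show "y - y' \<in> M" unfolding m by (intro M_add M_cscale K_in_M that)
        have "\<phi>' (y + cscale_op (-1) y') = \<phi>' y + (-1) * \<phi>' y'"
          unfolding add'[OF K_in_M[OF that(1)] M_cscale[OF K_in_M[OF that(2)]]] scale'[OF K_in_M[OF that(2)]] ..
        then show "\<phi>' (y - y') = \<phi>' y - \<phi>' y'" unfolding m by simp
      qed
      have "\<phi>' x = (\<phi>' a - \<phi>' b) + \<i> * (\<phi>' c - \<phi>' d)"
        unfolding 1 quad_def using 1 by (simp add: add' scale' M_cscale diff' del: complex_op.scale_right_diff_distrib)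
      then have "\<phi>' x = z"
        unfolding 1 quad_val_def using 1 by (simp add: val' complex_eq_iff)
      then show ?thesis using val[OF z] by simp
    qed
  qed
  ultimately have "\<phi> = \<phi>\<^sub>0"
    unfolding weight_functional_def good_def[symmetric] by (rule the_equality)
  then show ?thesis using val[OF assms] by simp
qed

lemma functional_add: "a \<in> M \<Longrightarrow> b \<in> M \<Longrightarrow> \<phi> (a + b) = \<phi> a + \<phi> b"
  by (metis functional_eqI quads_M quads_add)

lemma functional_cscale: "a \<in> M \<Longrightarrow> \<phi> (cscale_op c a) = c * \<phi> a"
  by (metis functional_eqI quads_M quads_cscale)

lemma functional_K: "a \<in> K \<Longrightarrow> \<phi> a = of_real (enn2real (\<psi> a))"
  by (rule functional_eqI) (rule quads_K)

lemma functional_adj_compose: "a \<in> N \<Longrightarrow> b \<in> N \<Longrightarrow> \<phi> (adj_op a o\<^sub>L b) = polar_val a b"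
  by (rule functional_eqI) (rule quads_adj_compose)

end

section \<open>Finite paths and basic bisections\<close>

abbreviation \<sigma> :: "'e path \<Rightarrow> 'e path" where
  "\<sigma> \<equiv> Defs.shift"

primrec cat :: "'e list \<Rightarrow> 'e path \<Rightarrow> 'e path" where
  "cat [] p = p"
| "cat (a # e) p = case_nat a (cat e p)"

definition pre :: "'e path \<Rightarrow> nat \<Rightarrow> 'e list" where
  "pre x n = map x [0..<n]"

lemma length_pre [simp]: "length (pre x n) = n"
  by (simp add: pre_def)

lemma nth_pre [simp]: "i < n \<Longrightarrow> pre x n ! i = x i"
  by (simp add: pre_def)

lemma pre_0 [simp]: "pre x 0 = []"
  by (simp add: pre_def)

lemma pre_Suc: "pre x (Suc n) = pre x n @ [x n]"
  by (simp add: pre_def)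

lemma shift_funpow: "(\<sigma> ^^ n) p i = p (i + n)"
  by (induction n arbitrary: i) (simp_all add: Defs.shift_def)

lemma cat_nth: "cat e p i = (if i < length e then e ! i else p (i - length e))"
proof (induction e arbitrary: i)
  case (Cons a e)
  then show ?case by (cases i) simp_all
qed simp

lemma cat_append: "cat (e @ g) p = cat e (cat g p)"
  by (induction e) simp_all

lemma shift_cat: "(\<sigma> ^^ length e) (cat e p) = p"
  by (rule ext) (simp add: shift_funpow cat_nth)

lemma pre_cat: "pre (cat e p) (length e) = e"
  by (rule nth_equalityI) (simp_all add: cat_nth)

lemma cat_pre: "cat (pre x n) ((\<sigma> ^^ n) x) = x"
  by (rule ext) (simp add: shift_funpow cat_nth)

lemma cat_inject: "length e = length e' \<Longrightarrow> cat e p = cat e' p' \<longleftrightarrow> e = e' \<and> p = p'"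
  by (metis pre_cat shift_cat)

lemma cat_eq_longer:
  assumes "cat e p = cat e' p'" "length e \<le> length e'"
  shows "\<exists>g. e' = e @ g \<and> p = cat g p'"
proof -
  obtain e1 g where g: "e' = e1 @ g" "length e1 = length e"
    using assms(2) by (metis append_take_drop_id length_take min.absorb2)
  then have "cat e p = cat e1 (cat g p')" using assms(1) by (simp add: cat_append)
  with g show ?thesis by (auto simp: cat_inject)
qed

text \<open>The initial vertex of a finite path ending in \<open>v\<close>; for the path of length 0
  the end vertex is the only information available.\<close>

definition vsrc :: "('v, 'e) pre_digraph \<Rightarrow> 'e list \<Rightarrow> 'v \<Rightarrow> 'v" where
  "vsrc G e v = (if e = [] then v else tail G (hd e))"

lemma vsrc_Nil [simp]: "vsrc G [] v = v" and vsrc_Cons [simp]: "vsrc G (a # e) v = tail G a"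
  by (simp_all add: vsrc_def)

lemma vsrc_append: "vsrc G (e @ g) w = vsrc G e (vsrc G g w)"
  by (simp add: vsrc_def)

text \<open>Finite paths are edge lists; the second argument is the final vertex, so that
  the path of length \<open>0\<close> at a vertex is represented.\<close>

fun fpath :: "('v, 'e) pre_digraph \<Rightarrow> 'e list \<Rightarrow> 'v \<Rightarrow> bool" where
  "fpath G [] v \<longleftrightarrow> v \<in> verts G"
| "fpath G (a # e) v \<longleftrightarrow> a \<in> arcs G \<and> fpath G e v \<and> head G a = vsrc G e v"

lemma fpath_append: "fpath G (e @ g) w \<longleftrightarrow> fpath G e (vsrc G g w) \<and> fpath G g w"
  if "wf_digraph G"
proof (induction e)
  case Nil
  have "fpath G g w \<Longrightarrow> vsrc G g w \<in> verts G"
    using that wf_digraph.tail_in_verts by (cases g) auto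
  then show ?case by auto
qed (auto simp: vsrc_append)

definition th :: "'e list \<Rightarrow> 'e list \<Rightarrow> 'e path \<Rightarrow> 'e arrow" where
  "th e f p = (cat e p, int (length e) - int (length f), cat f p)"

text \<open>The basic compact open bisections of the path groupoid. They are indexed by pairs of
  finite paths with common end vertex \<open>v\<close> and parametrised by the common tail.\<close>

definition Z :: "('v, 'e) pre_digraph \<Rightarrow> 'e list \<Rightarrow> 'v \<Rightarrow> 'e list \<Rightarrow> 'e arrow set" where
  "Z G e v f = th e f ` source_set G v"

lemma inj_th: "inj (th e f)"
  by (simp add: inj_on_def th_def cat_inject)

lemma th_append: "th (e @ g) (f @ g) p = th e f (cat g p)"
  by (simp add: th_def cat_append)

section \<open>Finite paths, basic bisections and their tree structure\<close>

locale path_graph = wf_digraph G for G :: "('v, 'e) pre_digraph" +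
  assumes countable_verts: "countable (verts G)" and countable_arcs: "countable (arcs G)"
    and row_finite: "row_finite G" and no_sinks: "no_sinks G"
begin

abbreviation "C \<equiv> source_set G"
abbreviation "fp \<equiv> fpath G"
abbreviation "vs \<equiv> vsrc G"
abbreviation "ZZ \<equiv> Z G"
abbreviation "\<Gamma> \<equiv> groupoid G"

lemma C_def: "C v = {p \<in> paths G. tail G (p 0) = v}"
  by (simp add: source_set_def path_source_def)

lemma C_paths: "p \<in> C v \<Longrightarrow> p \<in> paths G"
  by (simp add: C_def)

lemma paths_C: "p \<in> paths G \<Longrightarrow> p \<in> C (tail G (p 0))"
  by (simp add: C_def)

lemma fp_append: "fp (e @ g) w \<longleftrightarrow> fp e (vs g w) \<and> fp g w"
  by (rule fpath_append) unfold_locales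

lemma fp_verts: "fp e v \<Longrightarrow> v \<in> verts G"
  by (induction e) auto

lemma cat_C:
  assumes "fp e v" "p \<in> C v" shows "cat e p \<in> C (vs e v)"
  using assms(1)
proof (induction e)
  case Nil
  then show ?case using assms by simp
next
  case (Cons a e)
  then have "cat e p \<in> C (head G a)" "a \<in> arcs G" by auto
  then show ?case by (auto simp: C_def paths_def split: nat.splits)
qed

lemma cat_paths: "fp e v \<Longrightarrow> p \<in> C v \<Longrightarrow> cat e p \<in> paths G"
  using cat_C C_paths by blast

lemma shift_C: "x \<in> paths G \<Longrightarrow> (\<sigma> ^^ n) x \<in> C (tail G (x n))"
  by (auto simp: C_def paths_def shift_funpow)

lemma shift_paths: "x \<in> paths G \<Longrightarrow> (\<sigma> ^^ n) x \<in> paths G"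
  using shift_C C_paths by blast

lemma fp_pre:
  assumes "x \<in> paths G"
  shows "fp (pre x n) (tail G (x n))" and "vs (pre x n) (tail G (x n)) = tail G (x 0)"
proof -
  have x: "x i \<in> arcs G" "head G (x i) = tail G (x (Suc i))" for i
    using assms by (auto simp: paths_def)
  show 1: "vs (pre x n) (tail G (x n)) = tail G (x 0)" for n
    by (cases n) (auto simp: vsrc_def pre_def hd_map simp del: upt_Suc)
  show "fp (pre x n) (tail G (x n))"
    by (induction n) (use x in \<open>auto simp: pre_Suc fp_append\<close>)
qed

lemma C_eq: "p \<in> C v \<Longrightarrow> p \<in> C w \<Longrightarrow> v = w"
  by (auto simp: C_def)

lemma finite_out_arcs: "v \<in> verts G \<Longrightarrow> finite (out_arcs G v)"
  using row_finite unfolding row_finite_def by blast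

lemma th_groupoid: "fp e v \<Longrightarrow> fp f v \<Longrightarrow> p \<in> C v \<Longrightarrow> th e f p \<in> \<Gamma>"
  unfolding th_def groupoid_def using shift_cat[of e p] shift_cat[of f p]
  by (simp add: cat_paths) metis

lemma Z_groupoid: "fp e v \<Longrightarrow> fp f v \<Longrightarrow> ZZ e v f \<subseteq> \<Gamma>"
  unfolding Z_def using th_groupoid by blast

lemma Z_extend: "fp g w \<Longrightarrow> vs g w = v \<Longrightarrow> ZZ (e @ g) w (f @ g) \<subseteq> ZZ e v f"
  unfolding Z_def th_append using cat_C by blast

text \<open>Equal ranges make \<open>e'\<close> an extension of \<open>e\<close>, equal sources make
  \<open>f'\<close> an extension of \<open>f\<close>. The common degree gives both extensions the
  same length, and then they are prefixes of the same tail, hence equal.\<close>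

lemma Z_nested:
  assumes "\<gamma> \<in> ZZ e v f" "\<gamma> \<in> ZZ e' v' f'" "length e \<le> length e'" "fp e' v'"
  shows "\<exists>g. e' = e @ g \<and> f' = f @ g \<and> fp g v' \<and> vs g v' = v"
proof -
  obtain p p' where p: "p \<in> C v" "p' \<in> C v'" "th e f p = th e' f' p'"
    using assms(1,2) unfolding Z_def by auto
  then have eq: "cat e p = cat e' p'" "cat f p = cat f' p'"
      "int (length e) - int (length f) = int (length e') - int (length f')"
    by (auto simp: th_def)
  obtain g where g: "e' = e @ g" "p = cat g p'"
    using cat_eq_longer[OF eq(1) assms(3)] by blast
  have "length f \<le> length f'" using eq(3) assms(3) by linarith
  then obtain g' where g': "f' = f @ g'" "p = cat g' p'"
    using cat_eq_longer[OF eq(2)] by blast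
  have "length g = length g'" using eq(3) g(1) g'(1) by simp
  then have "g = g'" using g(2) g'(2) by (simp add: cat_inject)
  moreover have fg: "fp g v'" using assms(4) g(1) fp_append by simp
  moreover have "vs g v' = v" using cat_C[OF fg p(2)] p(1) g(2) C_eq by blast
  ultimately show ?thesis using g(1) g'(1) by blast
qed

text \<open>A common arrow forces nesting, in the direction decided by the lengths. This later turns
  a finite cover by bisections into a disjoint one.\<close>

lemma Z_laminar:
  assumes "fp e v" "fp f v" "fp e' v'" "fp f' v'"
  shows "ZZ e v f \<inter> ZZ e' v' f' = {} \<or> ZZ e v f \<subseteq> ZZ e' v' f' \<or> ZZ e' v' f' \<subseteq> ZZ e v f"
proof (cases "ZZ e v f \<inter> ZZ e' v' f' = {}")
  case False
  then obtain \<gamma> where \<gamma>: "\<gamma> \<in> ZZ e v f" "\<gamma> \<in> ZZ e' v' f'" by blast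
  show ?thesis
  proof (cases "length e \<le> length e'")
    case True
    from Z_nested[OF \<gamma> True assms(3)] show ?thesis using Z_extend by blast
  next
    case False
    then have "length e' \<le> length e" by simp
    from Z_nested[OF \<gamma>(2,1) this assms(1)] show ?thesis using Z_extend by blast
  qed
qed simp

text \<open>Splitting by the first edge of the tail; row-finiteness makes this a finite union, which
  is the inductive step of the arguments by \<open>bar_induct\<close>.\<close>

lemma Z_children:
  assumes "v \<in> verts G"
  shows "ZZ e v f = (\<Union>a\<in>out_arcs G v. ZZ (e @ [a]) (head G a) (f @ [a]))"
proof (intro equalityI subsetI)
  fix \<gamma> assume "\<gamma> \<in> ZZ e v f"
  then obtain p where p: "p \<in> C v" "\<gamma> = th e f p" unfolding Z_def by blast
  have P: "p \<in> paths G" using p(1) by (rule C_paths)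
  have "p = cat [p 0] ((\<sigma> ^^ 1) p)" using cat_pre[of p 1] by (simp add: pre_def)
  then have "\<gamma> = th (e @ [p 0]) (f @ [p 0]) ((\<sigma> ^^ 1) p)"
    unfolding th_append using p(2) by simp
  moreover have "(\<sigma> ^^ 1) p \<in> C (head G (p 0))" using shift_C[OF P, of 1] P by (simp add: paths_def)
  moreover have "p 0 \<in> out_arcs G v" using p(1) P by (auto simp: C_def paths_def)
  ultimately show "\<gamma> \<in> (\<Union>a\<in>out_arcs G v. ZZ (e @ [a]) (head G a) (f @ [a]))"
    unfolding Z_def by blast
next
  fix \<gamma> assume "\<gamma> \<in> (\<Union>a\<in>out_arcs G v. ZZ (e @ [a]) (head G a) (f @ [a]))"
  then obtain a where a: "a \<in> out_arcs G v" "\<gamma> \<in> ZZ (e @ [a]) (head G a) (f @ [a])" by blast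
  then have "fp [a] (head G a)" "vs [a] (head G a) = v" by auto
  from Z_extend[OF this] a(2) show "\<gamma> \<in> ZZ e v f" by blast
qed

lemma Z_children_disjoint:
  assumes "a \<noteq> b"
  shows "ZZ (e @ [a]) w (f @ [a]) \<inter> ZZ (e @ [b]) w' (f @ [b]) = {}"
  using assms unfolding Z_def th_def by (auto simp: cat_inject)

lemma Z_pre:
  assumes "p \<in> C v"
  shows "th e f p \<in> ZZ (e @ pre p n) (tail G (p n)) (f @ pre p n)"
  unfolding Z_def th_append using shift_C[OF C_paths[OF assms]]
  by (intro image_eqI[where x = "(\<sigma> ^^ n) p"]) (simp_all add: cat_pre)

lemma Z_pre_subset:
  assumes p: "p \<in> C v" and e: "fp e v" and \<gamma>: "th e f p \<in> ZZ e' v' f'"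
    and le: "length e' \<le> length e + n"
  shows "ZZ (e @ pre p n) (tail G (p n)) (f @ pre p n) \<subseteq> ZZ e' v' f'"
proof -
  have "fp (e @ pre p n) (tail G (p n))"
    using fp_pre[OF C_paths[OF p]] e p by (simp add: fp_append C_def)
  from Z_nested[OF \<gamma> Z_pre[OF p] _ this] le obtain g where
    "e @ pre p n = e' @ g" "f @ pre p n = f' @ g" "fp g (tail G (p n))" "vs g (tail G (p n)) = v'"
    by auto
  then show ?thesis using Z_extend by metis
qed

text \<open>Bar induction on the tree of finite paths from \<open>v\<close> replaces the compactness of the
  space of infinite paths from \<open>v\<close>.\<close>

lemma bar_induct:
  assumes v: "v \<in> verts G"
    and step: "\<And>g w. fp g w \<Longrightarrow> vs g w = v \<Longrightarrow>
      (\<And>a. a \<in> out_arcs G w \<Longrightarrow> P (g @ [a]) (head G a)) \<Longrightarrow> P g w"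
    and bar: "\<And>p. p \<in> C v \<Longrightarrow> \<exists>n. P (pre p n) (tail G (p n))"
  shows "P [] v"
proof (rule ccontr)
  assume neg: "\<not> P [] v"
  define bad where "bad = (\<lambda>(g, w). fp g w \<and> vs g w = v \<and> \<not> P g w)"
  \<comment> \<open>A bad node has a bad successor by \<open>step\<close>. Following such successors
    from the root produces an infinite path whose prefixes are all bad, against the bar.\<close>
  have "\<exists>a. bad s \<longrightarrow> a \<in> out_arcs G (snd s) \<and> bad (fst s @ [a], head G a)" for s
  proof (cases "bad s")
    case True
    then obtain g w where s: "s = (g, w)" "fp g w" "vs g w = v" "\<not> P g w" by (auto simp: bad_def)
    then obtain a where a: "a \<in> out_arcs G w" "\<not> P (g @ [a]) (head G a)" using step by blast
    then have "bad (g @ [a], head G a)"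
      using s by (auto simp: bad_def fp_append vsrc_append)
    with a s show ?thesis by auto
  qed simp
  then obtain ch where ch: "\<And>s. bad s \<Longrightarrow> ch s \<in> out_arcs G (snd s) \<and> bad (fst s @ [ch s], head G (ch s))"
    by metis
  define st where "st = rec_nat ([], v) (\<lambda>_ s. (fst s @ [ch s], head G (ch s)))"
  have st: "st 0 = ([], v)" "st (Suc n) = (fst (st n) @ [ch (st n)], head G (ch (st n)))" for n
    by (auto simp: st_def)
  have bad: "bad (st n)" for n
  proof (induction n)
    case 0
    show ?case using neg v by (simp add: st bad_def)
  next
    case (Suc n)
    then show ?case using ch by (simp add: st)
  qed
  define p where "p n = ch (st n)" for n
  have p: "p n \<in> arcs G" "tail G (p n) = snd (st n)" for n
    using ch[OF bad[of n]] by (auto simp: p_def)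
  have "p \<in> C v" using p by (auto simp: C_def paths_def st) (simp add: p_def st)
  then obtain n where n: "P (pre p n) (tail G (p n))" using bar by blast
  have "fst (st n) = pre p n" for n
    by (induction n) (simp_all add: st pre_Suc p_def)
  then have "st n = (pre p n, tail G (p n))" by (simp add: prod_eq_iff p)
  then show False using n bad[of n] by (simp add: bad_def)
qed

subsection \<open>The groupoid topology\<close>

lemma openin_cylinder: "es \<noteq> [] \<Longrightarrow> openin (path_topology G) (cylinder G es)"
  unfolding path_topology_def by (rule topology_generated_by_Basis) blast

lemma groupoid_open_Z:
  assumes e: "fp e v" and f: "fp f v"
  shows "groupoid_open G (ZZ e v f)"
  unfolding groupoid_open_def
proof (intro conjI allI)
  show "ZZ e v f \<subseteq> \<Gamma>" by (rule Z_groupoid[OF e f])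
  fix k n
  let ?T = "subtopology (prod_topology (path_topology G)
       (prod_topology (discrete_topology UNIV) (path_topology G))) (groupoid_piece G k n)"
  show "openin ?T (ZZ e v f \<inter> groupoid_piece G k n)"
  proof (subst openin_subopen, intro ballI)
    fix \<gamma> assume \<gamma>: "\<gamma> \<in> ZZ e v f \<inter> groupoid_piece G k n"
    then obtain p where p: "p \<in> C v" "\<gamma> = th e f p" unfolding Z_def by blast
    define x y where "x = cat e p" and "y = cat f p"
    have \<gamma>_eq: "\<gamma> = (x, k, y)" "k = int (length e) - int (length f)"
      using p \<gamma> by (auto simp: th_def x_def y_def groupoid_piece_def)
    have xy: "x \<in> paths G" "y \<in> paths G" using cat_paths e f p by (auto simp: x_def y_def)
    \<comment> \<open>The prefixes must cover \<open>e\<close> and \<open>f\<close>, and the indices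
      where the piece relation, which only compares edges from position \<open>n\<close> of the
      source on, is silent. The successor also fixes the first edge of the tail, hence its vertex,
      and makes the prefixes non-empty.\<close>
    define m where "m = Suc (n + length e + length f)"
    let ?W = "(cylinder G (pre x m) \<times> {k} \<times> cylinder G (pre y m)) \<inter> groupoid_piece G k n"
    have "openin ?T ?W"
      unfolding openin_subtopology
      by (rule exI[of _ "cylinder G (pre x m) \<times> {k} \<times> cylinder G (pre y m)"])
        (auto simp: openin_prod_Times_iff m_def pre_def intro!: openin_cylinder simp del: upt_Suc)
    moreover have "\<gamma> \<in> ?W"
      using \<gamma> xy unfolding \<gamma>_eq by (auto simp: cylinder_def)
    moreover have "?W \<subseteq> ZZ e v f \<inter> groupoid_piece G k n"
    proof
      fix \<delta> assume "\<delta> \<in> ?W"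
      then obtain x' y' where \<delta>: "\<delta> = (x', k, y')" and x': "x' \<in> paths G" "\<And>i. i < m \<Longrightarrow> x' i = x i"
        and y': "y' \<in> paths G" "\<And>i. i < m \<Longrightarrow> y' i = y i"
        and piece: "\<delta> \<in> groupoid_piece G k n" by (auto simp: cylinder_def)
      from piece have k: "0 \<le> k + int n" and sh: "(\<sigma> ^^ nat (k + int n)) x' = (\<sigma> ^^ n) y'"
        unfolding \<delta> by (auto simp: groupoid_piece_def)
      have "x' (j + length e) = y' (j + length f)" for j
      proof (cases "n \<le> j + length f")
        case True
        have "(\<sigma> ^^ nat (k + int n)) x' (j + length f - n) = (\<sigma> ^^ n) y' (j + length f - n)"
          using sh by simp
        moreover have "j + length f - n + nat (k + int n) = j + length e"
          using True k unfolding \<gamma>_eq(2) by linarith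
        ultimately show ?thesis using True by (simp add: shift_funpow)
      next
        case False
        then have "x' (j + length e) = x (j + length e)" by (intro x') (simp add: m_def)
        moreover have "y' (j + length f) = y (j + length f)" using False by (intro y') (simp add: m_def)
        ultimately show ?thesis by (simp add: x_def y_def cat_nth)
      qed
      then have eq: "(\<sigma> ^^ length e) x' = (\<sigma> ^^ length f) y'"
        by (intro ext) (simp add: shift_funpow)
      have ex: "pre x' (length e) = e" "pre y' (length f) = f"
        by (rule nth_equalityI; simp add: x' y' x_def y_def m_def cat_nth)+
      have "x' (length e) = x (length e)" by (intro x') (simp add: m_def)
      then have "tail G (x' (length e)) = v" using p(1) by (simp add: x_def cat_nth C_def)
      then have C: "(\<sigma> ^^ length e) x' \<in> C v" using shift_C[OF x'(1), of "length e"] by simp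
      have "\<delta> = th e f ((\<sigma> ^^ length e) x')"
        unfolding \<delta> th_def \<gamma>_eq(2) using cat_pre[of x' "length e"] cat_pre[of y' "length f"] ex eq by simp
      with C piece show "\<delta> \<in> ZZ e v f \<inter> groupoid_piece G k n" unfolding Z_def by blast
    qed
    ultimately show "\<exists>W. openin ?T W \<and> \<gamma> \<in> W \<and> W \<subseteq> ZZ e v f \<inter> groupoid_piece G k n" by blast
  qed
qed

lemma groupoid_open_base:
  assumes U: "groupoid_open G U" and \<gamma>: "\<gamma> \<in> U"
  shows "\<exists>e v f. fp e v \<and> fp f v \<and> \<gamma> \<in> ZZ e v f \<and> ZZ e v f \<subseteq> U"
proof -
  have "\<gamma> \<in> \<Gamma>" using U \<gamma> unfolding groupoid_open_def by blast
  then obtain x y n m where \<gamma>_eq: "\<gamma> = (x, int n - int m, y)" and xy: "x \<in> paths G" "y \<in> paths G"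
    and sh: "(\<sigma> ^^ n) x = (\<sigma> ^^ m) y" by (auto simp: groupoid_def)
  define k where "k = int n - int m"
  have nk: "nat (k + int m) = n" "0 \<le> k + int m" by (auto simp: k_def)
  let ?P = "prod_topology (path_topology G) (prod_topology (discrete_topology UNIV) (path_topology G))"
  have piece: "\<gamma> \<in> groupoid_piece G k m"
    unfolding \<gamma>_eq k_def[symmetric] groupoid_piece_def using xy sh nk by simp
  have "openin (subtopology ?P (groupoid_piece G k m)) (U \<inter> groupoid_piece G k m)"
    using U unfolding groupoid_open_def by blast
  then obtain T where T: "openin ?P T" "U \<inter> groupoid_piece G k m = T \<inter> groupoid_piece G k m"
    unfolding openin_subtopology by blast
  have "(x, (k, y)) \<in> T" using T(2) \<gamma> piece unfolding \<gamma>_eq k_def by blast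
  with T(1) obtain W1 W2 where W: "openin (path_topology G) W1" "x \<in> W1"
      "openin (prod_topology (discrete_topology UNIV) (path_topology G)) W2" "(k, y) \<in> W2" "W1 \<times> W2 \<subseteq> T"
    unfolding openin_prod_topology_alt by meson
  from W(3,4) obtain W3 W4 where W': "k \<in> W3" "openin (path_topology G) W4" "y \<in> W4" "W3 \<times> W4 \<subseteq> W2"
    unfolding openin_prod_topology_alt by meson
  obtain es where es: "x \<in> cylinder G es" "cylinder G es \<subseteq> W1"
    using W(1,2) unfolding openin_path_topology_iff by blast
  obtain fs where fs: "y \<in> cylinder G fs" "cylinder G fs \<subseteq> W4"
    using W'(2,3) unfolding openin_path_topology_iff by blast
  \<comment> \<open>Lengthening both prefixes by the same amount keeps the degree and makes them at
    least as long as \<open>es\<close> and \<open>fs\<close>, so that the whole bisection lies over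
    the two cylinders.\<close>
  define L where "L = length es + length fs"
  define e f v where "e = pre x (n + L)" and "f = pre y (m + L)" and "v = tail G (x (n + L))"
  have shL: "x (i + n) = y (i + m)" for i using fun_cong[OF sh, of i] by (simp add: shift_funpow)
  have v': "v = tail G (y (m + L))" unfolding v_def using shL[of L] by (simp add: add.commute)
  have ef: "fp e v" "fp f v"
    unfolding e_def f_def using fp_pre(1)[OF xy(1), of "n + L"] fp_pre(1)[OF xy(2), of "m + L"] v'
    by (simp_all add: v_def)
  have k_ef: "k = int (length e) - int (length f)" by (simp add: k_def e_def f_def)
  have "(\<sigma> ^^ (n + L)) x = (\<sigma> ^^ (m + L)) y"
    by (rule ext) (use shL in \<open>simp add: shift_funpow add.assoc[symmetric] add.commute[of _ L] add.left_commute\<close>)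
  then have "cat e ((\<sigma> ^^ (n + L)) x) = x" "cat f ((\<sigma> ^^ (n + L)) x) = y"
    unfolding e_def f_def using cat_pre by metis+
  then have "\<gamma> = th e f ((\<sigma> ^^ (n + L)) x)"
    unfolding \<gamma>_eq k_def[symmetric] th_def k_ef[symmetric] by simp
  moreover have "(\<sigma> ^^ (n + L)) x \<in> C v" unfolding v_def by (rule shift_C[OF xy(1)])
  ultimately have "\<gamma> \<in> ZZ e v f" unfolding Z_def by blast
  moreover have "ZZ e v f \<subseteq> U"
  proof
    fix \<delta> assume "\<delta> \<in> ZZ e v f"
    then obtain p where p: "p \<in> C v" "\<delta> = th e f p" unfolding Z_def by blast
    have "cat e p \<in> cylinder G es"
      using es(1) cat_paths[OF ef(1) p(1)] by (auto simp: cylinder_def cat_nth e_def L_def)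
    moreover have "cat f p \<in> cylinder G fs"
      using fs(1) cat_paths[OF ef(2) p(1)] by (auto simp: cylinder_def cat_nth f_def L_def)
    ultimately have "\<delta> \<in> T"
      using p(2) es(2) fs(2) W(5) W'(1,4) unfolding th_def k_ef[symmetric] by blast
    moreover have "(\<sigma> ^^ n) (cat e p) = (\<sigma> ^^ m) (cat f p)"
    proof
      fix i
      show "(\<sigma> ^^ n) (cat e p) i = (\<sigma> ^^ m) (cat f p) i"
        using shL[of i] by (auto simp: shift_funpow cat_nth e_def f_def)
    qed
    then have "\<delta> \<in> groupoid_piece G k m"
      unfolding p(2) th_def k_ef[symmetric] groupoid_piece_def
      using nk cat_paths[OF ef(1) p(1)] cat_paths[OF ef(2) p(1)] by simp
    ultimately show "\<delta> \<in> U" using T(2) by blast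
  qed
  ultimately show ?thesis using ef by blast
qed

lemma openin_Z: "fp e v \<Longrightarrow> fp f v \<Longrightarrow> openin (groupoid_topology G) (ZZ e v f)"
  by (simp add: openin_groupoid_topology groupoid_open_Z)

lemma open_contains_pre:
  assumes U: "openin (groupoid_topology G) U" and p: "p \<in> C v" and ef: "fp e v" "fp f v"
    and in_U: "th e f p \<in> U"
  shows "\<exists>n. ZZ (e @ pre p n) (tail G (p n)) (f @ pre p n) \<subseteq> U"
proof -
  obtain e' v' f' where *: "fp e' v'" "fp f' v'" "th e f p \<in> ZZ e' v' f'" "ZZ e' v' f' \<subseteq> U"
    using groupoid_open_base[OF U[unfolded openin_groupoid_topology] in_U] by blast
  show ?thesis
    using Z_pre_subset[OF p ef(1) *(3), of "length e'"] *(4) by (intro exI[of _ "length e'"]) auto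
qed

lemma groupoid_eq_th:
  assumes "\<gamma> \<in> \<Gamma>" obtains e v f p where "fp e v" "fp f v" "p \<in> C v" "\<gamma> = th e f p"
proof -
  have "groupoid_open G \<Gamma>"
    by (metis openin_groupoid_topology openin_topspace topspace_groupoid_topology)
  from groupoid_open_base[OF this assms] that show ?thesis unfolding Z_def by blast
qed

text \<open>Having a finite subcover passes from the finitely many children to the parent, and an
  open set around an arrow contains a whole bisection around it, which supplies the bar.\<close>

lemma compactin_Z:
  assumes ef: "fp e v" "fp f v"
  shows "compactin (groupoid_topology G) (ZZ e v f)"
  unfolding compactin_def
proof (intro conjI allI impI)
  show "ZZ e v f \<subseteq> topspace (groupoid_topology G)"
    unfolding topspace_groupoid_topology by (rule Z_groupoid[OF ef])
  fix \<U> assume U: "Ball \<U> (openin (groupoid_topology G)) \<and> ZZ e v f \<subseteq> \<Union>\<U>"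
  define P where "P g w \<longleftrightarrow> (\<exists>\<F>. finite \<F> \<and> \<F> \<subseteq> \<U> \<and> ZZ (e @ g) w (f @ g) \<subseteq> \<Union>\<F>)" for g w
  have "P [] v"
  proof (rule bar_induct)
    show "v \<in> verts G" using ef fp_verts by blast
  next
    fix g w assume gw: "fp g w" and IH: "\<And>a. a \<in> out_arcs G w \<Longrightarrow> P (g @ [a]) (head G a)"
    have w: "w \<in> verts G" using gw fp_verts by blast
    from IH obtain \<F> where F: "\<And>a. a \<in> out_arcs G w \<Longrightarrow> finite (\<F> a) \<and> \<F> a \<subseteq> \<U> \<and>
        ZZ (e @ g @ [a]) (head G a) (f @ g @ [a]) \<subseteq> \<Union>(\<F> a)"
      unfolding P_def by metis
    have "ZZ (e @ g) w (f @ g) \<subseteq> \<Union>(\<Union>a\<in>out_arcs G w. \<F> a)"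
      unfolding Z_children[OF w, of "e @ g" "f @ g"] using F by fastforce
    then show "P g w" unfolding P_def using F finite_out_arcs[OF w]
      by (intro exI[of _ "\<Union>a\<in>out_arcs G w. \<F> a"]) blast
  next
    fix p assume p: "p \<in> C v"
    then have "th e f p \<in> \<Union>\<U>" using U unfolding Z_def by blast
    then obtain V where V: "V \<in> \<U>" "th e f p \<in> V" by blast
    then obtain n where "ZZ (e @ pre p n) (tail G (p n)) (f @ pre p n) \<subseteq> V"
      using open_contains_pre[OF _ p ef] U by blast
    with V show "\<exists>n. P (pre p n) (tail G (p n))"
      unfolding P_def by (intro exI[of _ n] exI[of _ "{V}"]) auto
  qed
  then show "\<exists>\<F>. finite \<F> \<and> \<F> \<subseteq> \<U> \<and> ZZ e v f \<subseteq> \<Union>\<F>" by (simp add: P_def)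
qed

lemma closedin_Z:
  assumes ef: "fp e v" "fp f v"
  shows "closedin (groupoid_topology G) (ZZ e v f)"
  unfolding closedin_def topspace_groupoid_topology
proof (intro conjI)
  show "ZZ e v f \<subseteq> \<Gamma>" by (rule Z_groupoid[OF ef])
  show "openin (groupoid_topology G) (\<Gamma> - ZZ e v f)"
  proof (subst openin_subopen, intro ballI)
    fix \<gamma> assume \<gamma>: "\<gamma> \<in> \<Gamma> - ZZ e v f"
    then obtain e' v' f' p where *: "fp e' v'" "fp f' v'" "p \<in> C v'" "\<gamma> = th e' f' p"
      using groupoid_eq_th by blast
    \<comment> \<open>After \<open>length e\<close> further edges the first path is at least as long
      as \<open>e\<close>; a common arrow could then only put the small bisection inside
      \<open>ZZ e v f\<close>, which \<open>\<gamma>\<close> excludes.\<close>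
    let ?n = "length e"
    let ?W = "ZZ (e' @ pre p ?n) (tail G (p ?n)) (f' @ pre p ?n)"
    have P: "fp (e' @ pre p ?n) (tail G (p ?n))" "fp (f' @ pre p ?n) (tail G (p ?n))"
      using fp_pre[OF C_paths[OF *(3)]] * by (auto simp: fp_append C_def)
    have "?W \<inter> ZZ e v f = {}"
    proof (rule ccontr)
      assume "?W \<inter> ZZ e v f \<noteq> {}"
      then obtain \<delta> where d: "\<delta> \<in> ZZ e v f" "\<delta> \<in> ?W" by blast
      from Z_nested[OF d _ P(1)] obtain g where "e' @ pre p ?n = e @ g" "f' @ pre p ?n = f @ g"
        "fp g (tail G (p ?n))" "vs g (tail G (p ?n)) = v" by auto
      then have "?W \<subseteq> ZZ e v f" using Z_extend by metis
      moreover have "\<gamma> \<in> ?W" unfolding *(4) by (rule Z_pre[OF *(3)])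
      ultimately show False using \<gamma> by blast
    qed
    then show "\<exists>T. openin (groupoid_topology G) T \<and> \<gamma> \<in> T \<and> T \<subseteq> \<Gamma> - ZZ e v f"
      using openin_Z[OF P] Z_groupoid[OF P] Z_pre[OF *(3)] *(4) by (intro exI[of _ ?W]) blast
  qed
qed

end

section \<open>The operator algebra of the path groupoid\<close>

lemma ell2_bound:
  assumes "\<And>F. finite F \<Longrightarrow> (\<Sum>i\<in>F. (cmod (g i))\<^sup>2) \<le> B\<^sup>2" "0 \<le> B"
  shows "square_summable g" "norm (Abs_ell2 g) \<le> B"
proof -
  show s: "square_summable g"
    unfolding square_summable_def
  proof (rule nonneg_bdd_above_summable_on)
    show "bdd_above (sum (\<lambda>i. (cmod (g i))\<^sup>2) ` {F. F \<subseteq> UNIV \<and> finite F})"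
      by (rule bdd_aboveI2[where M = "B\<^sup>2"]) (use assms in blast)
  qed simp
  have "(norm (Abs_ell2 g))\<^sup>2 \<le> B\<^sup>2"
    unfolding norm_ell2_sq Rep_ell2_Abs_ell2[OF s]
    by (rule infsum_le_finite_sums) (use s assms in \<open>auto simp: square_summable_def\<close>)
  then show "norm (Abs_ell2 g) \<le> B" using assms(2) by (simp add: power2_le_iff_abs_le)
qed

lemma Abs_ell2_add:
  assumes "square_summable a" "square_summable b"
  shows "Abs_ell2 (\<lambda>i. a i + b i) = Abs_ell2 a + Abs_ell2 b"
  by (rule ell2_eqI)
    (simp add: plus_ell2.rep_eq Rep_ell2_Abs_ell2 assms square_summable_add)

lemma Abs_ell2_cscale:
  assumes "square_summable a"
  shows "Abs_ell2 (\<lambda>i. c * a i) = cscale_ell2 c (Abs_ell2 a)"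
  by (rule ell2_eqI)
    (simp add: cscale_ell2.rep_eq Rep_ell2_Abs_ell2 assms square_summable_cmult)

lemma star_algebra_closure:
  fixes B :: "'i operator set"
  assumes zero: "0 \<in> B" and add: "\<And>a b. a \<in> B \<Longrightarrow> b \<in> B \<Longrightarrow> a + b \<in> B"
    and cscale: "\<And>a c. a \<in> B \<Longrightarrow> cscale_op c a \<in> B"
    and compose: "\<And>a b. a \<in> B \<Longrightarrow> b \<in> B \<Longrightarrow> a o\<^sub>L b \<in> B"
    and adjointable: "\<And>a. a \<in> B \<Longrightarrow> adjointable a" and adj: "\<And>a. a \<in> B \<Longrightarrow> adj_op a \<in> B"
  shows "star_algebra (closure B)"
proof
  show "closed (closure B)" by simp
  show "0 \<in> closure B" using zero closure_subset by blast
next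
  fix a b assume "a \<in> closure B" "b \<in> closure B"
  then obtain s t where st: "\<And>n. s n \<in> B" "s \<longlonglongrightarrow> a" "\<And>n. t n \<in> B" "t \<longlonglongrightarrow> b"
    unfolding closure_sequential by blast
  show "a + b \<in> closure B"
    unfolding closure_sequential
    by (rule exI[of _ "\<lambda>n. s n + t n"]) (use st add in \<open>auto intro: tendsto_add\<close>)
  show "a o\<^sub>L b \<in> closure B"
    unfolding closure_sequential
    by (rule exI[of _ "\<lambda>n. s n o\<^sub>L t n"]) (use st compose in \<open>auto intro: tendsto_compose_op\<close>)
next
  fix a c assume "a \<in> closure B"
  then obtain s where s: "\<And>n. s n \<in> B" "s \<longlonglongrightarrow> a" unfolding closure_sequential by blast
  show "cscale_op c a \<in> closure B"
    unfolding closure_sequential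
    by (rule exI[of _ "\<lambda>n. cscale_op c (s n)"]) (use s cscale in \<open>auto intro: tendsto_cscale_op\<close>)
  show "adjointable a" by (rule adjointable_limit(1)[OF s(2)]) (use s adjointable in blast)
  show "adj_op a \<in> closure B"
    unfolding closure_sequential
    by (rule exI[of _ "\<lambda>n. adj_op (s n)"]) (use s adj adjointable adjointable_limit(2)[OF s(2)] in blast)
qed

section \<open>Partial translations and convolution by basic bisections\<close>

context path_graph
begin

text \<open>On \<open>D e v\<close> this is left multiplication by the inverse of the arrow of the
  bisection with the same range: the prefix \<open>e\<close> of the range is exchanged for
  \<open>f\<close>.\<close>

definition \<tau> :: "'e list \<Rightarrow> 'e list \<Rightarrow> 'e arrow \<Rightarrow> 'e arrow" where
  "\<tau> e f = (\<lambda>(x, k, z). (cat f ((\<sigma> ^^ length e) x), k - int (length e) + int (length f), z))"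

definition D :: "'e list \<Rightarrow> 'v \<Rightarrow> 'e arrow set" where
  "D e v = {\<gamma> \<in> \<Gamma>. fst \<gamma> \<in> cat e ` C v}"

lemma D_iff: "\<gamma> \<in> D e v \<longleftrightarrow> (\<exists>p k z. p \<in> C v \<and> \<gamma> = (cat e p, k, z) \<and> \<gamma> \<in> \<Gamma>)"
  unfolding D_def by (cases \<gamma>) auto

lemma \<tau>_cat: "\<tau> e f (cat e p, k, z) = (cat f p, k - int (length e) + int (length f), z)"
  by (simp add: \<tau>_def shift_cat)

lemma groupoid_replace:
  assumes "(cat e p, k, z) \<in> \<Gamma>" "fp f v" "p \<in> C v"
  shows "(cat f p, k - int (length e) + int (length f), z) \<in> \<Gamma>"
proof -
  obtain n m where nm: "k = int n - int m" "(\<sigma> ^^ n) (cat e p) = (\<sigma> ^^ m) z" "z \<in> paths G"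
    using assms(1) by (auto simp: groupoid_def)
  have "(\<sigma> ^^ (n + length f)) (cat f p) = (\<sigma> ^^ n) p"
    by (simp add: funpow_add shift_cat)
  also have "\<dots> = (\<sigma> ^^ (length e + n)) (cat e p)"
    by (subst add.commute) (simp add: funpow_add shift_cat)
  also have "\<dots> = (\<sigma> ^^ (length e + m)) z"
    using nm(2) by (simp add: funpow_add)
  finally have eq: "(\<sigma> ^^ (n + length f)) (cat f p) = (\<sigma> ^^ (length e + m)) z" .
  have "k - int (length e) + int (length f) = int (n + length f) - int (length e + m)"
    using nm(1) by simp
  with eq nm(3) cat_paths[OF assms(2,3)] show ?thesis unfolding groupoid_def by blast
qed

lemma \<tau>_D: "\<gamma> \<in> D e v \<Longrightarrow> fp f v \<Longrightarrow> \<tau> e f \<gamma> \<in> D f v"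
  unfolding D_iff using groupoid_replace by (fastforce simp: \<tau>_cat)

lemma \<tau>_inverse: "\<gamma> \<in> D e v \<Longrightarrow> \<tau> f e (\<tau> e f \<gamma>) = \<gamma>"
  unfolding D_iff by (auto simp: \<tau>_cat)

lemma bij_\<tau>: "fp e v \<Longrightarrow> fp f v \<Longrightarrow> bij_betw (\<tau> e f) (D e v) (D f v)"
  by (rule bij_betw_byWitness[where f' = "\<tau> f e"]) (auto simp: \<tau>_inverse intro: \<tau>_D)

subsection \<open>Convolution operators\<close>

abbreviation "lc \<equiv> left_convolution G"
abbreviation "reg \<equiv> regular_rep G"

definition fiber_finite :: "('e arrow \<Rightarrow> complex) \<Rightarrow> bool" where
  "fiber_finite h \<longleftrightarrow> (\<forall>x. finite {\<eta> \<in> \<Gamma>. arrow_range \<eta> = x \<and> h \<eta> \<noteq> 0})"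

text \<open>\<open>regular_rep\<close> applies \<open>Blinfun\<close> to a map whose boundedness is
  not known in advance. The predicate collects what is needed to evaluate it: finite sums on range
  fibres, square summability and a norm bound.\<close>

definition conv_bounded :: "('e arrow \<Rightarrow> complex) \<Rightarrow> real \<Rightarrow> bool" where
  "conv_bounded h c \<longleftrightarrow> fiber_finite h \<and> (\<forall>\<xi>. square_summable (lc h (Rep_ell2 \<xi>)) \<and>
     norm (Abs_ell2 (lc h (Rep_ell2 \<xi>))) \<le> c * norm \<xi>)"

lemma lc_summable:
  assumes "fiber_finite h"
  shows "(\<lambda>\<eta>. h \<eta> * X \<eta>) summable_on {\<eta> \<in> \<Gamma>. arrow_range \<eta> = x}"
proof (rule finite_nonzero_values_imp_summable_on, rule finite_subset)
  show "finite {\<eta> \<in> \<Gamma>. arrow_range \<eta> = x \<and> h \<eta> \<noteq> 0}"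
    using assms unfolding fiber_finite_def by blast
qed auto

lemma fiber_finite_add: "fiber_finite h \<Longrightarrow> fiber_finite h' \<Longrightarrow> fiber_finite (\<lambda>\<gamma>. h \<gamma> + h' \<gamma>)"
  unfolding fiber_finite_def
proof
  fix x
  assume "\<forall>x. finite {\<eta> \<in> \<Gamma>. arrow_range \<eta> = x \<and> h \<eta> \<noteq> 0}" "\<forall>x. finite {\<eta> \<in> \<Gamma>. arrow_range \<eta> = x \<and> h' \<eta> \<noteq> 0}"
  then have "finite ({\<eta> \<in> \<Gamma>. arrow_range \<eta> = x \<and> h \<eta> \<noteq> 0} \<union> {\<eta> \<in> \<Gamma>. arrow_range \<eta> = x \<and> h' \<eta> \<noteq> 0})" by simp
  then show "finite {\<eta> \<in> \<Gamma>. arrow_range \<eta> = x \<and> h \<eta> + h' \<eta> \<noteq> 0}"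
    by (rule finite_subset[rotated]) auto
qed

lemma lc_add:
  assumes "fiber_finite h" "fiber_finite h'"
  shows "lc (\<lambda>\<gamma>. h \<gamma> + h' \<gamma>) \<xi> \<gamma> = lc h \<xi> \<gamma> + lc h' \<xi> \<gamma>"
  unfolding left_convolution_def
  by (simp add: distrib_right infsum_add lc_summable assms)

lemma lc_cmult: "lc (\<lambda>\<gamma>. c * h \<gamma>) \<xi> \<gamma> = c * lc h \<xi> \<gamma>"
  unfolding left_convolution_def by (simp add: mult.assoc infsum_cmult_right')

lemma lc_add_right:
  assumes "fiber_finite h"
  shows "lc h (\<lambda>\<gamma>. \<xi> \<gamma> + \<xi>' \<gamma>) \<gamma> = lc h \<xi> \<gamma> + lc h \<xi>' \<gamma>"
  unfolding left_convolution_def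
  by (simp add: distrib_left infsum_add lc_summable assms)

lemma lc_cmult_right: "lc h (\<lambda>\<gamma>. c * \<xi> \<gamma>) \<gamma> = c * lc h \<xi> \<gamma>"
  unfolding left_convolution_def by (simp add: mult.left_commute infsum_cmult_right')

lemma reg_apply:
  assumes "conv_bounded h c"
  shows "blinfun_apply (reg h) \<xi> = Abs_ell2 (lc h (Rep_ell2 \<xi>))"
proof -
  have ff: "fiber_finite h" and ss: "\<And>\<xi>. square_summable (lc h (Rep_ell2 \<xi>))"
    and nb: "\<And>\<xi>. norm (Abs_ell2 (lc h (Rep_ell2 \<xi>))) \<le> c * norm \<xi>"
    using assms unfolding conv_bounded_def by auto
  have "bounded_linear (\<lambda>x. Abs_ell2 (lc h (Rep_ell2 x)))"
  proof (rule bounded_linear_intro)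
    fix x y :: "'e arrow ell2"
    have "lc h (Rep_ell2 (x + y)) = (\<lambda>i. lc h (Rep_ell2 x) i + lc h (Rep_ell2 y) i)"
      by (rule ext) (simp add: plus_ell2.rep_eq lc_add_right[OF ff])
    then show "Abs_ell2 (lc h (Rep_ell2 (x + y))) = Abs_ell2 (lc h (Rep_ell2 x)) + Abs_ell2 (lc h (Rep_ell2 y))"
      by (simp add: Abs_ell2_add ss)
  next
    fix r :: real and x :: "'e arrow ell2"
    have "lc h (Rep_ell2 (r *\<^sub>R x)) = (\<lambda>i. of_real r * lc h (Rep_ell2 x) i)"
      by (rule ext) (simp add: scaleR_ell2.rep_eq lc_cmult_right)
    then show "Abs_ell2 (lc h (Rep_ell2 (r *\<^sub>R x))) = r *\<^sub>R Abs_ell2 (lc h (Rep_ell2 x))"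
      by (simp add: Abs_ell2_cscale ss cscale_of_real)
  next
    fix x :: "'e arrow ell2"
    show "norm (Abs_ell2 (lc h (Rep_ell2 x))) \<le> norm x * c" using nb[of x] by (simp add: mult.commute)
  qed
  then show ?thesis unfolding regular_rep_def by (simp add: bounded_linear_Blinfun_apply)
qed

lemma Rep_reg:
  assumes "conv_bounded h c"
  shows "Rep_ell2 (blinfun_apply (reg h) \<xi>) = lc h (Rep_ell2 \<xi>)"
  using assms unfolding reg_apply[OF assms] by (simp add: Rep_ell2_Abs_ell2 conv_bounded_def)

lemma norm_reg_le:
  assumes "conv_bounded h c" "0 \<le> c"
  shows "norm (reg h) \<le> c"
  using assms unfolding conv_bounded_def
  by (intro norm_blinfun_bound) (auto simp: reg_apply[OF assms(1)])

lemma conv_bounded_add: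
  assumes "conv_bounded h c" "conv_bounded h' c'"
  shows "conv_bounded (\<lambda>\<gamma>. h \<gamma> + h' \<gamma>) (c + c')"
  unfolding conv_bounded_def
proof (intro conjI allI)
  have ff: "fiber_finite h" "fiber_finite h'" using assms unfolding conv_bounded_def by auto
  then show "fiber_finite (\<lambda>\<gamma>. h \<gamma> + h' \<gamma>)" by (rule fiber_finite_add)
  fix \<xi> :: "'e arrow ell2"
  have eq: "lc (\<lambda>\<gamma>. h \<gamma> + h' \<gamma>) (Rep_ell2 \<xi>) = (\<lambda>i. lc h (Rep_ell2 \<xi>) i + lc h' (Rep_ell2 \<xi>) i)"
    by (rule ext) (rule lc_add[OF ff])
  have ss: "square_summable (lc h (Rep_ell2 \<xi>))" "square_summable (lc h' (Rep_ell2 \<xi>))"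
    and n: "norm (Abs_ell2 (lc h (Rep_ell2 \<xi>))) \<le> c * norm \<xi>" "norm (Abs_ell2 (lc h' (Rep_ell2 \<xi>))) \<le> c' * norm \<xi>"
    using assms unfolding conv_bounded_def by auto
  show "square_summable (lc (\<lambda>\<gamma>. h \<gamma> + h' \<gamma>) (Rep_ell2 \<xi>))"
    unfolding eq by (rule square_summable_add[OF ss])
  show "norm (Abs_ell2 (lc (\<lambda>\<gamma>. h \<gamma> + h' \<gamma>) (Rep_ell2 \<xi>))) \<le> (c + c') * norm \<xi>"
    unfolding eq Abs_ell2_add[OF ss] distrib_right
    by (rule order_trans[OF norm_triangle_ineq add_mono[OF n]])
qed

lemma conv_bounded_cmult:
  assumes "conv_bounded h c"
  shows "conv_bounded (\<lambda>\<gamma>. w * h \<gamma>) (cmod w * c)"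
  unfolding conv_bounded_def
proof (intro conjI allI)
  show "fiber_finite (\<lambda>\<gamma>. w * h \<gamma>)"
    unfolding fiber_finite_def
  proof
    fix x
    have "finite {\<eta> \<in> \<Gamma>. arrow_range \<eta> = x \<and> h \<eta> \<noteq> 0}"
      using assms unfolding conv_bounded_def fiber_finite_def by blast
    then show "finite {\<eta> \<in> \<Gamma>. arrow_range \<eta> = x \<and> w * h \<eta> \<noteq> 0}" by (rule finite_subset[rotated]) auto
  qed
  fix \<xi> :: "'e arrow ell2"
  have eq: "lc (\<lambda>\<gamma>. w * h \<gamma>) (Rep_ell2 \<xi>) = (\<lambda>i. w * lc h (Rep_ell2 \<xi>) i)"
    by (rule ext) (rule lc_cmult)
  have ss: "square_summable (lc h (Rep_ell2 \<xi>))"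
    and n: "norm (Abs_ell2 (lc h (Rep_ell2 \<xi>))) \<le> c * norm \<xi>"
    using assms unfolding conv_bounded_def by auto
  show "square_summable (lc (\<lambda>\<gamma>. w * h \<gamma>) (Rep_ell2 \<xi>))"
    unfolding eq by (rule square_summable_cmult[OF ss])
  show "norm (Abs_ell2 (lc (\<lambda>\<gamma>. w * h \<gamma>) (Rep_ell2 \<xi>))) \<le> cmod w * c * norm \<xi>"
    unfolding eq Abs_ell2_cscale[OF ss] norm_cscale_ell2 mult.assoc
    by (rule mult_left_mono[OF n norm_ge_zero])
qed

lemma reg_add:
  assumes "conv_bounded h c" "conv_bounded h' c'"
  shows "reg (\<lambda>\<gamma>. h \<gamma> + h' \<gamma>) = reg h + reg h'"
proof (rule blinfun_eqI, rule ell2_eqI)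
  fix \<xi> :: "'e arrow ell2" and i
  show "Rep_ell2 (blinfun_apply (reg (\<lambda>\<gamma>. h \<gamma> + h' \<gamma>)) \<xi>) i = Rep_ell2 (blinfun_apply (reg h + reg h') \<xi>) i"
    using assms by (simp add: blinfun.add_left plus_ell2.rep_eq Rep_reg[OF assms(1)] Rep_reg[OF assms(2)]
        Rep_reg[OF conv_bounded_add[OF assms]] lc_add conv_bounded_def)
qed

lemma reg_cmult:
  assumes "conv_bounded h c"
  shows "reg (\<lambda>\<gamma>. w * h \<gamma>) = cscale_op w (reg h)"
proof (rule blinfun_eqI, rule ell2_eqI)
  fix \<xi> :: "'e arrow ell2" and i
  show "Rep_ell2 (blinfun_apply (reg (\<lambda>\<gamma>. w * h \<gamma>)) \<xi>) i = Rep_ell2 (blinfun_apply (cscale_op w (reg h)) \<xi>) i"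
    by (simp add: cscale_op_apply cscale_ell2.rep_eq Rep_reg[OF assms] Rep_reg[OF conv_bounded_cmult[OF assms]] lc_cmult)
qed

lemma conv_bounded_zero: "conv_bounded (\<lambda>_. 0) 0"
proof -
  have "lc (\<lambda>_. 0) X = (\<lambda>_. 0)" for X by (rule ext) (simp add: left_convolution_def)
  moreover have "Abs_ell2 (\<lambda>_. 0) = (0 :: 'e arrow ell2)" by (simp add: zero_ell2_def)
  ultimately show ?thesis unfolding conv_bounded_def fiber_finite_def by (simp add: square_summable_def)
qed

lemma reg_zero: "reg (\<lambda>_. 0) = 0"
  using norm_reg_le[OF conv_bounded_zero] by simp

text \<open>A basic bisection meets every range fibre at most once, so that the convolution has at
  most one term.\<close>

lemma lc_Z:
  assumes supp: "\<And>\<gamma>. \<gamma> \<notin> ZZ e v f \<Longrightarrow> h \<gamma> = 0" and e: "fp e v" "fp f v" and \<gamma>: "\<gamma> \<in> \<Gamma>"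
  shows "lc h \<xi> \<gamma> = (if \<gamma> \<in> D e v then h (th e f ((\<sigma> ^^ length e) (fst \<gamma>))) * \<xi> (\<tau> e f \<gamma>) else 0)"
proof (cases "\<gamma> \<in> D e v")
  case True
  then obtain p k z where p: "p \<in> C v" "\<gamma> = (cat e p, k, z)" unfolding D_iff by blast
  let ?\<eta> = "th e f p"
  have "lc h \<xi> \<gamma> = (\<Sum>\<^sub>\<infinity>\<eta>\<in>{?\<eta>}. h \<eta> * \<xi> (arrow_mult (arrow_inv \<eta>) \<gamma>))"
    unfolding left_convolution_def using \<gamma>
  proof (simp only: if_True, intro infsum_cong_neutral)
    fix \<eta> assume \<eta>: "\<eta> \<in> {\<eta> \<in> \<Gamma>. arrow_range \<eta> = arrow_range \<gamma>} - {?\<eta>}"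
    have "\<eta> \<notin> ZZ e v f"
    proof
      assume "\<eta> \<in> ZZ e v f"
      then obtain q where q: "\<eta> = th e f q" unfolding Z_def by blast
      then have "cat e q = cat e p" using \<eta> p(2) by (simp add: th_def)
      then have "q = p" by (simp add: cat_inject)
      then show False using \<eta> q by simp
    qed
    then show "h \<eta> * \<xi> (arrow_mult (arrow_inv \<eta>) \<gamma>) = 0" using supp by simp
  next
    fix \<eta> assume "\<eta> \<in> {?\<eta>} - {\<eta> \<in> \<Gamma>. arrow_range \<eta> = arrow_range \<gamma>}"
    then show "h \<eta> * \<xi> (arrow_mult (arrow_inv \<eta>) \<gamma>) = 0"
      using th_groupoid[OF e p(1)] p(2) by (auto simp: th_def)
  qed simp
  also have "\<dots> = h ?\<eta> * \<xi> (\<tau> e f \<gamma>)"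
    unfolding p(2) \<tau>_cat by (simp add: th_def algebra_simps)
  finally show ?thesis using True p(2) by (simp add: shift_cat)
next
  case False
  have "h \<eta> = 0" if "\<eta> \<in> \<Gamma>" "arrow_range \<eta> = arrow_range \<gamma>" for \<eta>
  proof (rule supp, rule notI)
    assume "\<eta> \<in> ZZ e v f"
    then obtain q where q: "\<eta> = th e f q" "q \<in> C v" unfolding Z_def by blast
    then have "fst \<gamma> = cat e q" using that(2) by (cases \<gamma>) (simp add: th_def)
    then show False using False q(2) \<gamma> unfolding D_def by blast
  qed
  then have "lc h \<xi> \<gamma> = (\<Sum>\<^sub>\<infinity>\<eta>\<in>{\<eta> \<in> \<Gamma>. arrow_range \<eta> = arrow_range \<gamma>}. 0)"
    unfolding left_convolution_def using \<gamma> by (simp only: if_True) (rule infsum_cong, simp)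
  then show ?thesis using False by simp
qed

lemma lc_outside: "\<gamma> \<notin> \<Gamma> \<Longrightarrow> lc h \<xi> \<gamma> = 0"
  by (simp add: left_convolution_def)

text \<open>On one bisection convolution is a weighted partial translation along the injective map
  \<open>\<tau> e f\<close>, so the operator norm is at most the supremum norm of the
  weight.\<close>

lemma conv_bounded_Z:
  assumes supp: "\<And>\<gamma>. \<gamma> \<notin> ZZ e v f \<Longrightarrow> h \<gamma> = 0" and e: "fp e v" "fp f v"
    and bd: "\<And>\<gamma>. cmod (h \<gamma>) \<le> c"
  shows "conv_bounded h c"
  unfolding conv_bounded_def
proof (intro conjI allI)
  have c: "0 \<le> c" using bd[of undefined] norm_ge_zero order_trans by blast
  show "fiber_finite h"
    unfolding fiber_finite_def
  proof
    fix x
    have "{\<eta> \<in> \<Gamma>. arrow_range \<eta> = x \<and> h \<eta> \<noteq> 0} \<subseteq> {th e f ((\<sigma> ^^ length e) x)}"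
    proof
      fix \<eta> assume \<eta>: "\<eta> \<in> {\<eta> \<in> \<Gamma>. arrow_range \<eta> = x \<and> h \<eta> \<noteq> 0}"
      then obtain q where "\<eta> = th e f q" using supp unfolding Z_def by blast
      with \<eta> show "\<eta> \<in> {th e f ((\<sigma> ^^ length e) x)}" by (auto simp: th_def shift_cat)
    qed
    then show "finite {\<eta> \<in> \<Gamma>. arrow_range \<eta> = x \<and> h \<eta> \<noteq> 0}" by (rule finite_subset) simp
  qed
  fix \<xi> :: "'e arrow ell2"
  have "(\<Sum>i\<in>F. (cmod (lc h (Rep_ell2 \<xi>) i))\<^sup>2) \<le> (c * norm \<xi>)\<^sup>2" if F: "finite F" for F
  proof -
    have "(\<Sum>i\<in>F. (cmod (lc h (Rep_ell2 \<xi>) i))\<^sup>2) = (\<Sum>i\<in>F \<inter> D e v. (cmod (lc h (Rep_ell2 \<xi>) i))\<^sup>2)"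
    proof (rule sum.mono_neutral_right[OF F])
      show "\<forall>i\<in>F - F \<inter> D e v. (cmod (lc h (Rep_ell2 \<xi>) i))\<^sup>2 = 0"
      proof
        fix i assume "i \<in> F - F \<inter> D e v"
        then show "(cmod (lc h (Rep_ell2 \<xi>) i))\<^sup>2 = 0"
          by (cases "i \<in> \<Gamma>") (simp_all add: lc_outside lc_Z[of e v f h, OF supp e])
      qed
    qed simp
    also have "\<dots> \<le> (\<Sum>i\<in>F \<inter> D e v. c\<^sup>2 * (cmod (Rep_ell2 \<xi> (\<tau> e f i)))\<^sup>2)"
    proof (rule sum_mono)
      fix i assume i: "i \<in> F \<inter> D e v"
      then have "i \<in> \<Gamma>" by (simp add: D_def)
      with i have "cmod (lc h (Rep_ell2 \<xi>) i) \<le> c * cmod (Rep_ell2 \<xi> (\<tau> e f i))"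
        by (simp add: lc_Z[of e v f h, OF supp e] norm_mult mult_right_mono bd)
      then show "(cmod (lc h (Rep_ell2 \<xi>) i))\<^sup>2 \<le> c\<^sup>2 * (cmod (Rep_ell2 \<xi> (\<tau> e f i)))\<^sup>2"
        by (metis norm_ge_zero power_mono power_mult_distrib)
    qed
    also have "\<dots> = c\<^sup>2 * (\<Sum>j\<in>\<tau> e f ` (F \<inter> D e v). (cmod (Rep_ell2 \<xi> j))\<^sup>2)"
    proof -
      have "inj_on (\<tau> e f) (F \<inter> D e v)"
        by (rule inj_on_inverseI[where g = "\<tau> f e"]) (auto simp: \<tau>_inverse)
      then show ?thesis by (simp add: sum_distrib_left sum.reindex)
    qed
    also have "\<dots> \<le> c\<^sup>2 * (norm \<xi>)\<^sup>2"
      by (intro mult_left_mono finite_sum_le_norm_ell2) (use F in auto)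
    finally show ?thesis by (simp add: power_mult_distrib)
  qed
  from ell2_bound[OF this] c
  show "square_summable (lc h (Rep_ell2 \<xi>))" "norm (Abs_ell2 (lc h (Rep_ell2 \<xi>))) \<le> c * norm \<xi>" by auto
qed

text \<open>The partial isometry that Cuntz-Krieger notation writes as S_e times the adjoint of S_f,
  both paths ending in \<open>v\<close>.\<close>

definition S :: "'e list \<Rightarrow> 'v \<Rightarrow> 'e list \<Rightarrow> 'e arrow operator" where
  "S e v f = reg (indicator (ZZ e v f))"

lemma conv_bounded_indicator: "fp e v \<Longrightarrow> fp f v \<Longrightarrow> conv_bounded (indicator (ZZ e v f)) 1"
  by (rule conv_bounded_Z[of e v f]) (auto simp: indicator_def)

lemma Rep_S:
  assumes e: "fp e v" "fp f v"
  shows "Rep_ell2 (blinfun_apply (S e v f) \<xi>) \<gamma> = (if \<gamma> \<in> D e v then Rep_ell2 \<xi> (\<tau> e f \<gamma>) else 0)"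
proof (cases "\<gamma> \<in> \<Gamma>")
  case True
  have "lc (indicator (ZZ e v f)) (Rep_ell2 \<xi>) \<gamma> = (if \<gamma> \<in> D e v then
      indicator (ZZ e v f) (th e f ((\<sigma> ^^ length e) (fst \<gamma>))) * Rep_ell2 \<xi> (\<tau> e f \<gamma>) else 0)"
    by (rule lc_Z) (use e True in \<open>auto simp: indicator_def\<close>)
  moreover have "th e f ((\<sigma> ^^ length e) (fst \<gamma>)) \<in> ZZ e v f" if "\<gamma> \<in> D e v"
    using that unfolding D_iff Z_def by (auto simp: shift_cat)
  ultimately show ?thesis
    unfolding S_def Rep_reg[OF conv_bounded_indicator[OF e]] by simp
next
  case False
  then show ?thesis
    unfolding S_def Rep_reg[OF conv_bounded_indicator[OF e]] by (simp add: lc_outside D_def)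
qed

lemma S_adjoint:
  assumes e: "fp e v" "fp f v"
  shows "cinner_ell2 (blinfun_apply (S f v e) x) y = cinner_ell2 x (blinfun_apply (S e v f) y)"
proof -
  have "cinner_ell2 x (blinfun_apply (S e v f) y) =
      (\<Sum>\<^sub>\<infinity>\<gamma>\<in>D e v. cnj (Rep_ell2 x \<gamma>) * Rep_ell2 y (\<tau> e f \<gamma>))"
    unfolding cinner_ell2_def by (rule infsum_cong_neutral) (auto simp: Rep_S[OF e])
  also have "\<dots> = (\<Sum>\<^sub>\<infinity>\<gamma>\<in>D e v. cnj (Rep_ell2 x (\<tau> f e (\<tau> e f \<gamma>))) * Rep_ell2 y (\<tau> e f \<gamma>))"
    by (rule infsum_cong) (simp add: \<tau>_inverse)
  also have "\<dots> = (\<Sum>\<^sub>\<infinity>\<gamma>\<in>D f v. cnj (Rep_ell2 x (\<tau> f e \<gamma>)) * Rep_ell2 y \<gamma>)"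
    by (rule infsum_reindex_bij_betw[OF bij_\<tau>[OF e]])
  also have "\<dots> = cinner_ell2 (blinfun_apply (S f v e) x) y"
    unfolding cinner_ell2_def by (rule infsum_cong_neutral) (auto simp: Rep_S[OF e(2,1)])
  finally show ?thesis by simp
qed

lemma adjointable_S: "fp e v \<Longrightarrow> fp f v \<Longrightarrow> adjointable (S e v f)"
  by (rule adjointableI) (rule S_adjoint)

lemma adj_S: "fp e v \<Longrightarrow> fp f v \<Longrightarrow> adj_op (S e v f) = S f v e"
  by (rule adj_op_eqI) (rule S_adjoint)

text \<open>The Cuntz-Krieger product rule when the inner path on the left extends the one on the
  right: the two partial translations compose and the surplus \<open>g\<close> is passed on to
  \<open>f'\<close>. The mirror case follows by taking adjoints.\<close>

lemma S_compose_left: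
  assumes "fp e v" "fp (e' @ g) v" "fp e' v'" "fp f' v'" "vs g v = v'"
  shows "S e v (e' @ g) o\<^sub>L S e' v' f' = S e v (f' @ g)"
proof (rule blinfun_eqI, rule ell2_eqI)
  fix \<xi> and \<gamma> :: "'e arrow"
  have g: "fp g v" using assms(2) by (simp add: fp_append)
  have f'g: "fp (f' @ g) v" using assms g by (simp add: fp_append)
  show "Rep_ell2 (blinfun_apply (S e v (e' @ g) o\<^sub>L S e' v' f') \<xi>) \<gamma> =
      Rep_ell2 (blinfun_apply (S e v (f' @ g)) \<xi>) \<gamma>"
  proof (cases "\<gamma> \<in> D e v")
    case True
    have t: "\<tau> e (e' @ g) \<gamma> \<in> D (e' @ g) v" using \<tau>_D[OF True assms(2)] .
    obtain p k z where p: "p \<in> C v" "\<gamma> = (cat e p, k, z)" "\<gamma> \<in> \<Gamma>" using True unfolding D_iff by blast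
    have "\<tau> e (e' @ g) \<gamma> \<in> D e' v'"
      using t cat_C[OF g p(1)] assms(5) unfolding p(2) \<tau>_cat D_def by (auto simp: cat_append)
    moreover have "\<tau> e' f' (\<tau> e (e' @ g) \<gamma>) = \<tau> e (f' @ g) \<gamma>"
      unfolding p(2) \<tau>_cat by (simp add: cat_append \<tau>_cat)
    ultimately show ?thesis
      using True by (simp add: Rep_S assms f'g)
  qed (simp add: Rep_S assms f'g)
qed

lemma S_compose_right:
  assumes "fp e v" "fp f v" "fp (f @ g) v'" "fp f' v'" "vs g v' = v"
  shows "S e v f o\<^sub>L S (f @ g) v' f' = S (e @ g) v' f'"
proof -
  have eg: "fp (e @ g) v'" using assms by (simp add: fp_append)
  have "adj_op (S e v f o\<^sub>L S (f @ g) v' f') = S f' v' (f @ g) o\<^sub>L S f v e"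
    by (simp add: adj_compose adjointable_S adj_S assms)
  also have "\<dots> = S f' v' (e @ g)"
    by (rule S_compose_left) (use assms in auto)
  finally have "adj_op (adj_op (S e v f o\<^sub>L S (f @ g) v' f')) = adj_op (S f' v' (e @ g))" by simp
  then show ?thesis
    by (simp add: adj_adj adjointable_compose adjointable_S adj_S assms eg)
qed

lemma S_compose_zero:
  assumes "fp e v" "fp f v" "fp e' v'" "fp f' v'"
    and "\<And>p p'. p \<in> C v \<Longrightarrow> p' \<in> C v' \<Longrightarrow> cat f p \<noteq> cat e' p'"
  shows "S e v f o\<^sub>L S e' v' f' = 0"
proof (rule blinfun_eqI, rule ell2_eqI)
  fix \<xi> and \<gamma> :: "'e arrow"
  have "\<gamma> \<in> D e v \<Longrightarrow> \<tau> e f \<gamma> \<notin> D e' v'"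
    using assms(5) unfolding D_iff by (auto simp: \<tau>_cat)
  then show "Rep_ell2 (blinfun_apply (S e v f o\<^sub>L S e' v' f') \<xi>) \<gamma> = Rep_ell2 (blinfun_apply 0 \<xi>) \<gamma>"
    by (simp add: Rep_S assms zero_ell2.rep_eq)
qed

section \<open>The algebra spanned by the partial isometries\<close>

definition gens :: "'e arrow operator set" where
  "gens = {S e v f | e v f. fp e v \<and> fp f v}"

text \<open>If the two inner paths have a common infinite extension, one is a prefix of the other
  and a product rule applies; otherwise the product vanishes.\<close>

lemma gens_compose:
  assumes "a \<in> gens" "b \<in> gens" shows "a o\<^sub>L b \<in> insert 0 gens"
proof -
  obtain e v f e' v' f' where a: "a = S e v f" "fp e v" "fp f v" and b: "b = S e' v' f'" "fp e' v'" "fp f' v'"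
    using assms unfolding gens_def by blast
  show ?thesis
  proof (cases "\<exists>p\<in>C v. \<exists>p'\<in>C v'. cat f p = cat e' p'")
    case False
    then have "a o\<^sub>L b = 0" unfolding a(1) b(1) by (intro S_compose_zero a b) auto
    then show ?thesis by simp
  next
    case True
    then obtain p p' where p: "p \<in> C v" "p' \<in> C v'" "cat f p = cat e' p'" by blast
    show ?thesis
    proof (cases "length f \<le> length e'")
      case True
      obtain g where g: "e' = f @ g" "p = cat g p'" using cat_eq_longer[OF p(3) True] by blast
      have fg: "fp g v'" using b(2) g(1) by (simp add: fp_append)
      have vg: "vs g v' = v" using cat_C[OF fg p(2)] p(1) g(2) C_eq by blast
      have "a o\<^sub>L b = S (e @ g) v' f'"
        unfolding a(1) b(1) g(1) by (rule S_compose_right) (use a b g vg in auto)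
      moreover have "fp (e @ g) v'" using a fg vg by (simp add: fp_append)
      ultimately show ?thesis using b unfolding gens_def by blast
    next
      case False
      then obtain g where g: "f = e' @ g" "p' = cat g p" using cat_eq_longer[OF p(3)[symmetric]] by auto
      have fg: "fp g v" using a(3) g(1) by (simp add: fp_append)
      have vg: "vs g v = v'" using cat_C[OF fg p(1)] p(2) g(2) C_eq by blast
      have "a o\<^sub>L b = S e v (f' @ g)"
        unfolding a(1) b(1) g(1) by (rule S_compose_left) (use a b g vg in auto)
      moreover have "fp (f' @ g) v" using b fg vg by (simp add: fp_append)
      ultimately show ?thesis using a unfolding gens_def by blast
    qed
  qed
qed

abbreviation "A0 \<equiv> complex_op.span gens"

lemma gens_compose_A0:
  assumes x: "x \<in> gens" and b: "b \<in> A0"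
  shows "x o\<^sub>L b \<in> A0"
  using b
proof (induction b rule: complex_op.span_induct_alt)
  case base
  then show ?case by (simp add: complex_op.span_zero compose_zero_right)
next
  case (step d u w)
  have "adjointable x" using x adjointable_S unfolding gens_def by blast
  moreover have "x o\<^sub>L u \<in> A0"
    using gens_compose[OF x step(1)] by (auto simp: complex_op.span_zero intro: complex_op.span_base)
  ultimately show ?case using step
    by (simp add: compose_add_right compose_cscale_right complex_op.span_add complex_op.span_scale)
qed

lemma A0_compose:
  assumes a: "a \<in> A0" and b: "b \<in> A0"
  shows "a o\<^sub>L b \<in> A0"
  using a
proof (induction a rule: complex_op.span_induct_alt)
  case base
  then show ?case by (simp add: complex_op.span_zero compose_zero_left)
next
  case (step c x y)
  with gens_compose_A0[OF _ b] show ?case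
    by (simp add: compose_add_left compose_cscale_left complex_op.span_add complex_op.span_scale)
qed

lemma A0_adjoint: "a \<in> A0 \<Longrightarrow> adjointable a \<and> adj_op a \<in> A0"
proof (induction a rule: complex_op.span_induct_alt)
  case base
  then show ?case by (simp add: complex_op.span_zero)
next
  case (step c x y)
  then obtain e v f where "x = S e v f" "fp e v" "fp f v" unfolding gens_def by blast
  then have "adjointable x" "adj_op x \<in> A0"
    using adjointable_S adj_S by (auto simp: gens_def intro!: complex_op.span_base)
  with step show ?case
    by (simp add: adjointable_add adjointable_cscale adj_add adj_cscale complex_op.span_add complex_op.span_scale)
qed

lemma star_algebra_A0: "star_algebra (closure A0)"
  by (rule star_algebra_closure)
    (auto simp: complex_op.span_zero complex_op.span_add complex_op.span_scale A0_compose A0_adjoint)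

end

subsection \<open>Density of the generators\<close>

context path_graph
begin

text \<open>Locally constant functions built one bisection at a time, so that membership in
  \<open>Cc\<close> and the value of \<open>reg\<close> are both obtained by rule induction.\<close>

inductive simple :: "('e arrow \<Rightarrow> complex) \<Rightarrow> bool" where
  zero: "simple (\<lambda>_. 0)"
| step: "simple s \<Longrightarrow> fp e v \<Longrightarrow> fp f v \<Longrightarrow> simple (\<lambda>\<gamma>. s \<gamma> + c * indicator (ZZ e v f) \<gamma>)"

lemma simple_add: "simple t \<Longrightarrow> simple s \<Longrightarrow> simple (\<lambda>\<gamma>. s \<gamma> + t \<gamma>)"
proof (induction t rule: simple.induct)
  case (step t e v f c)
  then have "simple (\<lambda>\<gamma>. (s \<gamma> + t \<gamma>) + c * indicator (ZZ e v f) \<gamma>)"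
    by (intro simple.step) auto
  then show ?case by (simp add: add.assoc)
qed simp

lemma simple_sum: "finite I \<Longrightarrow> (\<And>i. i \<in> I \<Longrightarrow> simple (s i)) \<Longrightarrow> simple (\<lambda>\<gamma>. \<Sum>i\<in>I. s i \<gamma>)"
proof (induction I rule: finite_induct)
  case (insert i I)
  then have "simple (\<lambda>\<gamma>. s i \<gamma> + (\<Sum>i\<in>I. s i \<gamma>))" by (intro simple_add) auto
  with insert show ?case by simp
qed (simp add: simple.zero)

lemma simple_single: "fp e v \<Longrightarrow> fp f v \<Longrightarrow> simple (\<lambda>\<gamma>. c * indicator (ZZ e v f) \<gamma>)"
  using simple.step[OF simple.zero, of e v f c] by simp

lemma simple_reg: "simple s \<Longrightarrow> (\<exists>c. conv_bounded s c) \<and> reg s \<in> A0"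
proof (induction rule: simple.induct)
  case zero
  show ?case using conv_bounded_zero reg_zero complex_op.span_zero by metis
next
  case (step s e v f c)
  then obtain b where b: "conv_bounded s b" "reg s \<in> A0" by blast
  note 1 = conv_bounded_cmult[OF conv_bounded_indicator[OF step(2,3)], of c]
  have "reg (\<lambda>\<gamma>. s \<gamma> + c * indicator (ZZ e v f) \<gamma>) = reg s + cscale_op c (S e v f)"
    by (simp add: reg_add[OF b(1) 1] reg_cmult[OF conv_bounded_indicator[OF step(2,3)]] S_def)
  moreover have "S e v f \<in> A0" using step by (intro complex_op.span_base) (auto simp: gens_def)
  ultimately show ?case
    using conv_bounded_add[OF b(1) 1] b(2) by (auto intro: complex_op.span_add complex_op.span_scale)
qed

lemma simple_Cc: "simple s \<Longrightarrow> s \<in> Cc G"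
proof (induction rule: simple.induct)
  case zero
  show ?case unfolding Cc_def by (simp add: closure_of_empty)
next
  case (step s e v f c)
  let ?X = "groupoid_topology G" and ?Z = "ZZ e v f"
  let ?h = "\<lambda>\<gamma>. s \<gamma> + c * indicator ?Z \<gamma>"
  have Zsub: "?Z \<subseteq> \<Gamma>" using Z_groupoid step by blast
  have "continuous_map ?X euclidean (\<lambda>\<gamma>. c * indicator ?Z \<gamma>)"
    unfolding continuous_map_def
  proof (intro conjI allI impI)
    fix U :: "complex set"
    have "{\<gamma> \<in> topspace ?X. c * indicator ?Z \<gamma> \<in> U} =
       (if c \<in> U then ?Z else {}) \<union> (if 0 \<in> U then \<Gamma> - ?Z else {})"
      using Zsub by (auto simp: topspace_groupoid_topology indicator_def)
    moreover have "openin ?X (\<Gamma> - ?Z)"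
      using closedin_Z[OF step(2,3)] by (simp add: closedin_def topspace_groupoid_topology)
    ultimately show "openin ?X {\<gamma> \<in> topspace ?X. c * indicator ?Z \<gamma> \<in> U}"
      using openin_Z[OF step(2,3)] by (simp only:) (intro openin_Un; simp)
  qed simp
  then have "continuous_map ?X euclidean ?h"
    using step by (intro continuous_map_add) (auto simp: Cc_def)
  moreover have "compactin ?X (?X closure_of {\<gamma> \<in> \<Gamma>. ?h \<gamma> \<noteq> 0})"
  proof (rule closed_compactin)
    show "compactin ?X ((?X closure_of {\<gamma> \<in> \<Gamma>. s \<gamma> \<noteq> 0}) \<union> ?Z)"
      using step compactin_Z by (intro compactin_Un) (auto simp: Cc_def)
    have "?X closure_of {\<gamma> \<in> \<Gamma>. ?h \<gamma> \<noteq> 0} \<subseteq> ?X closure_of ({\<gamma> \<in> \<Gamma>. s \<gamma> \<noteq> 0} \<union> ?Z)"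
      by (rule closure_of_mono) (auto simp: indicator_def)
    also have "\<dots> = (?X closure_of {\<gamma> \<in> \<Gamma>. s \<gamma> \<noteq> 0}) \<union> ?Z"
      by (simp add: closure_of_Un closure_of_closedin closedin_Z step)
    finally show "?X closure_of {\<gamma> \<in> \<Gamma>. ?h \<gamma> \<noteq> 0} \<subseteq> (?X closure_of {\<gamma> \<in> \<Gamma>. s \<gamma> \<noteq> 0}) \<union> ?Z" .
  qed simp
  moreover have "?h \<gamma> = 0" if "\<gamma> \<notin> \<Gamma>" for \<gamma>
  proof -
    have "s \<gamma> = 0" using step that unfolding Cc_def by blast
    with that Zsub show ?thesis by (auto simp: indicator_def)
  qed
  ultimately show ?case unfolding Cc_def by blast
qed

lemma A0_simple: "a \<in> A0 \<Longrightarrow> \<exists>s. simple s \<and> reg s = a"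
proof (induction a rule: complex_op.span_induct_alt)
  case base
  then show ?case using simple.zero reg_zero by blast
next
  case (step c x y)
  then obtain s e v f where s: "simple s" "reg s = y" and x: "x = S e v f" "fp e v" "fp f v"
    unfolding gens_def by blast
  obtain b where b: "conv_bounded s b" using simple_reg s by blast
  note 1 = conv_bounded_cmult[OF conv_bounded_indicator[OF x(2,3)], of c]
  have "reg (\<lambda>\<gamma>. s \<gamma> + c * indicator (ZZ e v f) \<gamma>) = cscale_op c x + y"
    using s by (simp add: reg_add[OF b(1) 1] reg_cmult[OF conv_bounded_indicator[OF x(2,3)]] x(1) S_def)
  with simple.step[OF s(1) x(2,3)] show ?case by blast
qed

text \<open>Continuity supplies the bar, a constant being a good approximation on a small enough
  bisection. In the inductive step the approximations on the children are added; their supports are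
  disjoint, so the errors do not accumulate.\<close>

lemma simple_approx:
  assumes h: "continuous_map (groupoid_topology G) euclidean h" and \<epsilon>: "0 < \<epsilon>"
    and ef: "fp e v" "fp f v"
  shows "\<exists>s. simple s \<and> (\<forall>\<gamma>\<in>ZZ e v f. cmod (h \<gamma> - s \<gamma>) < \<epsilon>) \<and> (\<forall>\<gamma>. \<gamma> \<notin> ZZ e v f \<longrightarrow> s \<gamma> = 0)"
proof -
  define P where "P g w \<longleftrightarrow> (\<exists>s. simple s \<and> (\<forall>\<gamma>\<in>ZZ (e @ g) w (f @ g). cmod (h \<gamma> - s \<gamma>) < \<epsilon>) \<and>
      (\<forall>\<gamma>. \<gamma> \<notin> ZZ (e @ g) w (f @ g) \<longrightarrow> s \<gamma> = 0))" for g w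
  have "P [] v"
  proof (rule bar_induct)
    show "v \<in> verts G" using ef fp_verts by blast
  next
    fix g w assume gw: "fp g w" and IH: "\<And>a. a \<in> out_arcs G w \<Longrightarrow> P (g @ [a]) (head G a)"
    have w: "w \<in> verts G" using gw fp_verts by blast
    let ?Z = "\<lambda>a. ZZ (e @ g @ [a]) (head G a) (f @ g @ [a])"
    have Zw: "ZZ (e @ g) w (f @ g) = (\<Union>a\<in>out_arcs G w. ?Z a)"
      using Z_children[OF w, of "e @ g" "f @ g"] by simp
    have "\<exists>s. a \<in> out_arcs G w \<longrightarrow> simple s \<and> (\<forall>\<gamma>\<in>?Z a. cmod (h \<gamma> - s \<gamma>) < \<epsilon>) \<and>
        (\<forall>\<gamma>. \<gamma> \<notin> ?Z a \<longrightarrow> s \<gamma> = 0)" for a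
      using IH[of a] unfolding P_def by auto
    then obtain s where s: "\<And>a. a \<in> out_arcs G w \<Longrightarrow> simple (s a) \<and> (\<forall>\<gamma>\<in>?Z a. cmod (h \<gamma> - s a \<gamma>) < \<epsilon>) \<and>
        (\<forall>\<gamma>. \<gamma> \<notin> ?Z a \<longrightarrow> s a \<gamma> = 0)" by metis
    let ?s = "\<lambda>\<gamma>. \<Sum>a\<in>out_arcs G w. s a \<gamma>"
    have fin: "finite (out_arcs G w)" by (rule finite_out_arcs[OF w])
    have "simple ?s" by (rule simple_sum[OF fin]) (use s in blast)
    moreover have "cmod (h \<gamma> - ?s \<gamma>) < \<epsilon>" if in_Z: "\<gamma> \<in> ZZ (e @ g) w (f @ g)" for \<gamma>
    proof -
      from in_Z obtain b where b: "b \<in> out_arcs G w" "\<gamma> \<in> ?Z b" unfolding Zw by blast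
      have "s a \<gamma> = 0" if a: "a \<in> out_arcs G w - {b}" for a
      proof -
        have "\<gamma> \<notin> ?Z a"
          using a b(2) Z_children_disjoint[of a b "e @ g" "head G a" "f @ g" "head G b"] by auto
        then show ?thesis using s a by blast
      qed
      then have "?s \<gamma> = s b \<gamma>"
        using fin b(1) by (subst sum.remove[of _ b]) auto
      then show ?thesis using s b by simp
    qed
    moreover have "?s \<gamma> = 0" if out: "\<gamma> \<notin> ZZ (e @ g) w (f @ g)" for \<gamma>
    proof (intro sum.neutral ballI)
      fix a assume a: "a \<in> out_arcs G w"
      with out have "\<gamma> \<notin> ?Z a" unfolding Zw by blast
      then show "s a \<gamma> = 0" using s[OF a] by blast
    qed
    ultimately show "P g w" unfolding P_def by blast
  next
    fix p assume p: "p \<in> C v"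
    let ?U = "{\<gamma> \<in> topspace (groupoid_topology G). h \<gamma> \<in> ball (h (th e f p)) \<epsilon>}"
    have "openin (groupoid_topology G) ?U"
      using conjunct2[OF h[unfolded continuous_map_def], rule_format, of "ball (h (th e f p)) \<epsilon>"]
      by (simp add: open_openin[symmetric] del: mem_ball)
    moreover have "th e f p \<in> ?U"
      using th_groupoid[OF ef p] \<epsilon> by (simp add: topspace_groupoid_topology)
    ultimately obtain n where n: "ZZ (e @ pre p n) (tail G (p n)) (f @ pre p n) \<subseteq> ?U"
      using open_contains_pre[OF _ p ef] by blast
    let ?Z = "ZZ (e @ pre p n) (tail G (p n)) (f @ pre p n)"
    have fpn: "fp (e @ pre p n) (tail G (p n))" "fp (f @ pre p n) (tail G (p n))"
      using fp_pre[OF C_paths[OF p]] ef p by (auto simp: fp_append C_def)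
    have "cmod (h \<gamma> - h (th e f p) * indicator ?Z \<gamma>) < \<epsilon>" if "\<gamma> \<in> ?Z" for \<gamma>
      using n that by (auto simp: dist_norm norm_minus_commute)
    then have "P (pre p n) (tail G (p n))"
      unfolding P_def
      by (intro exI[of _ "\<lambda>\<gamma>. h (th e f p) * indicator ?Z \<gamma>"] conjI simple_single fpn) auto
    then show "\<exists>n. P (pre p n) (tail G (p n))" ..
  qed
  then show ?thesis by (simp add: P_def)
qed

definition good :: "('e arrow \<Rightarrow> complex) \<Rightarrow> bool" where
  "good h \<longleftrightarrow> (\<exists>c. conv_bounded h c) \<and> reg h \<in> closure A0"

lemma good_sum:
  "finite I \<Longrightarrow> (\<And>i. i \<in> I \<Longrightarrow> good (h i)) \<Longrightarrow> good (\<lambda>\<gamma>. \<Sum>i\<in>I. h i \<gamma>)"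
proof (induction I rule: finite_induct)
  case empty
  then show ?case using simple_reg[OF simple.zero] closure_subset unfolding good_def by auto
next
  case (insert i I)
  interpret star_algebra "closure A0" by (rule star_algebra_A0)
  have "good (h i)" "good (\<lambda>\<gamma>. \<Sum>i\<in>I. h i \<gamma>)" using insert by auto
  then obtain c d where cd: "conv_bounded (h i) c" "conv_bounded (\<lambda>\<gamma>. \<Sum>i\<in>I. h i \<gamma>) d"
    and "reg (h i) \<in> closure A0" "reg (\<lambda>\<gamma>. \<Sum>i\<in>I. h i \<gamma>) \<in> closure A0"
    unfolding good_def by blast
  then show ?case
    unfolding good_def sum.insert[OF insert(1,2)]
    using conv_bounded_add[OF cd] reg_add[OF cd] add by auto
qed

text \<open>For functions carried by a single bisection uniform approximation is norm approximation,
  by \<open>conv_bounded_Z\<close>.\<close>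

lemma good_Z:
  assumes h: "continuous_map (groupoid_topology G) euclidean h" and ef: "fp e v" "fp f v"
  shows "good (\<lambda>\<gamma>. h \<gamma> * indicator (ZZ e v f) \<gamma>)"
proof -
  let ?h = "\<lambda>\<gamma>. h \<gamma> * indicator (ZZ e v f) \<gamma>"
  have ex: "\<exists>s b. simple s \<and> conv_bounded s b \<and> conv_bounded (\<lambda>\<gamma>. ?h \<gamma> + (-1) * s \<gamma>) \<epsilon>" if \<epsilon>: "0 < \<epsilon>" for \<epsilon>
  proof -
    obtain s where s: "simple s" "\<And>\<gamma>. \<gamma> \<in> ZZ e v f \<Longrightarrow> cmod (h \<gamma> - s \<gamma>) < \<epsilon>" "\<And>\<gamma>. \<gamma> \<notin> ZZ e v f \<Longrightarrow> s \<gamma> = 0"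
      using simple_approx[OF h \<epsilon> ef] by blast
    have "conv_bounded (\<lambda>\<gamma>. ?h \<gamma> + (-1) * s \<gamma>) \<epsilon>"
    proof (rule conv_bounded_Z[OF _ ef])
      show "cmod (?h \<gamma> + (-1) * s \<gamma>) \<le> \<epsilon>" for \<gamma>
        using s(2,3)[of \<gamma>] \<epsilon> by (cases "\<gamma> \<in> ZZ e v f") (simp_all add: less_imp_le)
    qed (simp add: s(3))
    with s(1) simple_reg show ?thesis by blast
  qed
  obtain s b where s: "simple s" "conv_bounded s b" "conv_bounded (\<lambda>\<gamma>. ?h \<gamma> + (-1) * s \<gamma>) 1"
    using ex[of 1] by auto
  have cb: "\<exists>c. conv_bounded ?h c" using conv_bounded_add[OF s(3,2)] by auto
  then obtain c where c: "conv_bounded ?h c" ..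
  have "\<exists>y\<in>A0. dist y (reg ?h) < \<epsilon>" if \<epsilon>: "0 < \<epsilon>" for \<epsilon>
  proof -
    obtain s b where s: "simple s" "conv_bounded s b" "conv_bounded (\<lambda>\<gamma>. ?h \<gamma> + (-1) * s \<gamma>) (\<epsilon> / 2)"
      using ex[of "\<epsilon> / 2"] \<epsilon> by auto
    have "reg (\<lambda>\<gamma>. ?h \<gamma> + (-1) * s \<gamma>) = reg ?h + cscale_op (-1) (reg s)"
      by (simp only: reg_add[OF c conv_bounded_cmult[OF s(2)]] reg_cmult[OF s(2)])
    then have "norm (reg ?h - reg s) \<le> \<epsilon> / 2"
      using norm_reg_le[OF s(3)] \<epsilon> cscale_op_of_real[of "-1" "reg s"] by simp
    then show ?thesis
      using simple_reg[OF s(1)] \<epsilon> by (intro bexI[of _ "reg s"]) (auto simp: dist_norm norm_minus_commute)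
  qed
  then have "reg ?h \<in> closure A0" unfolding closure_approachable by blast
  with cb show ?thesis unfolding good_def by blast
qed

text \<open>The support is covered by finitely many bisections, and the function is cut along a
  disjoint subcover into pieces to which \<open>good_Z\<close> applies.\<close>

lemma good_Cc:
  assumes h: "h \<in> Cc G"
  shows "good h"
proof -
  let ?X = "groupoid_topology G"
  let ?K = "?X closure_of {\<gamma> \<in> \<Gamma>. h \<gamma> \<noteq> 0}"
  have cont: "continuous_map ?X euclidean h" and comp: "compactin ?X ?K"
    and out: "\<And>\<gamma>. \<gamma> \<notin> \<Gamma> \<Longrightarrow> h \<gamma> = 0" using h unfolding Cc_def by auto
  define \<Z> where "\<Z> = {ZZ e v f | e v f. fp e v \<and> fp f v}"
  have "\<exists>\<F>. finite \<F> \<and> \<F> \<subseteq> \<Z> \<and> ?K \<subseteq> \<Union>\<F>"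
  proof (rule compactinD[OF comp])
    show "openin ?X U" if "U \<in> \<Z>" for U using that openin_Z unfolding \<Z>_def by auto
    have "\<Gamma> \<subseteq> \<Union>\<Z>" unfolding \<Z>_def Z_def by (blast elim: groupoid_eq_th)
    then show "?K \<subseteq> \<Union>\<Z>" using closure_of_subset_topspace[of ?X] unfolding topspace_groupoid_topology by blast
  qed
  then obtain \<F> where F: "finite \<F>" "\<F> \<subseteq> \<Z>" "?K \<subseteq> \<Union>\<F>" by blast
  \<comment> \<open>The maximal members still cover, and by laminarity any two of them are equal or
    disjoint.\<close>
  define \<M> where "\<M> = {m \<in> \<F>. \<forall>b\<in>\<F>. m \<subseteq> b \<longrightarrow> m = b}"
  have finM: "finite \<M>" unfolding \<M>_def using F(1) by simp
  have supp: "h \<gamma> = 0" if "\<gamma> \<notin> \<Union>\<M>" for \<gamma>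
  proof (rule ccontr)
    assume "h \<gamma> \<noteq> 0"
    then have "\<gamma> \<in> {\<gamma> \<in> \<Gamma>. h \<gamma> \<noteq> 0}" using out by blast
    moreover have "{\<gamma> \<in> \<Gamma>. h \<gamma> \<noteq> 0} \<subseteq> ?K"
      by (rule closure_of_subset) (auto simp: topspace_groupoid_topology)
    ultimately have "\<gamma> \<in> \<Union>\<F>" using F(3) by blast
    then obtain Y where "Y \<in> \<F>" "\<gamma> \<in> Y" by blast
    then obtain m where "m \<in> \<F>" "Y \<subseteq> m" "\<forall>b\<in>\<F>. m \<subseteq> b \<longrightarrow> m = b"
      using finite_has_maximal2[OF F(1)] by blast
    then show False using that \<open>\<gamma> \<in> Y\<close> unfolding \<M>_def by blast
  qed
  have disj: "Y = Y'" if "Y \<in> \<M>" "Y' \<in> \<M>" "\<gamma> \<in> Y" "\<gamma> \<in> Y'" for Y Y' \<gamma>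
  proof -
    have "Y \<in> \<Z>" "Y' \<in> \<Z>" using that F(2) unfolding \<M>_def by auto
    then have "Y \<inter> Y' = {} \<or> Y \<subseteq> Y' \<or> Y' \<subseteq> Y" unfolding \<Z>_def using Z_laminar by blast
    with that show ?thesis unfolding \<M>_def by blast
  qed
  have "h = (\<lambda>\<gamma>. \<Sum>Y\<in>\<M>. h \<gamma> * indicator Y \<gamma>)"
  proof
    fix \<gamma>
    show "h \<gamma> = (\<Sum>Y\<in>\<M>. h \<gamma> * indicator Y \<gamma>)"
    proof (cases "\<gamma> \<in> \<Union>\<M>")
      case True
      then obtain Y where Y: "Y \<in> \<M>" "\<gamma> \<in> Y" by blast
      have "(\<Sum>Y'\<in>\<M>. h \<gamma> * indicator Y' \<gamma>) = h \<gamma> * indicator Y \<gamma> + (\<Sum>Y'\<in>\<M> - {Y}. h \<gamma> * indicator Y' \<gamma>)"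
        by (rule sum.remove[OF finM Y(1)])
      moreover have "(\<Sum>Y'\<in>\<M> - {Y}. h \<gamma> * indicator Y' \<gamma>) = 0"
        using disj[OF Y(1) _ Y(2)] by (intro sum.neutral) (auto simp: indicator_def)
      ultimately show ?thesis using Y by simp
    qed (simp add: supp)
  qed
  moreover have "good (\<lambda>\<gamma>. \<Sum>Y\<in>\<M>. h \<gamma> * indicator Y \<gamma>)"
  proof (rule good_sum[OF finM])
    fix Y assume "Y \<in> \<M>"
    then have "Y \<in> \<Z>" using F(2) unfolding \<M>_def by auto
    then obtain e v f where "Y = ZZ e v f" "fp e v" "fp f v" unfolding \<Z>_def by blast
    then show "good (\<lambda>\<gamma>. h \<gamma> * indicator Y \<gamma>)" using good_Z[OF cont] by simp
  qed
  ultimately show ?thesis by simp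
qed

abbreviation "A \<equiv> graph_algebra G"

lemma graph_algebra_eq: "A = closure A0"
proof
  show "A \<subseteq> closure A0"
    unfolding graph_algebra_def by (rule closure_minimal) (use good_Cc in \<open>auto simp: good_def\<close>)
  have "A0 \<subseteq> reg ` Cc G" using A0_simple simple_Cc by blast
  then show "closure A0 \<subseteq> A" unfolding graph_algebra_def by (rule closure_mono)
qed

lemma star_algebra_A: "star_algebra A"
  unfolding graph_algebra_eq by (rule star_algebra_A0)

sublocale star_algebra "graph_algebra G"
  by (rule star_algebra_A)

lemma S_in: "fp e v \<Longrightarrow> fp f v \<Longrightarrow> S e v f \<in> A"
  unfolding graph_algebra_eq using closure_subset
  by (auto simp: gens_def intro!: subsetD[OF closure_subset] complex_op.span_base)

text \<open>A property of elements of the algebra that respects sums, multiples and norm limits need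
  only be checked on the partial isometries.\<close>

lemma A_induct [consumes 1, case_names zero S add cscale limit]:
  assumes a: "a \<in> A" and zero: "P 0"
    and S: "\<And>e v f. fp e v \<Longrightarrow> fp f v \<Longrightarrow> P (S e v f)"
    and add: "\<And>x y. x \<in> A \<Longrightarrow> y \<in> A \<Longrightarrow> P x \<Longrightarrow> P y \<Longrightarrow> P (x + y)"
    and cscale: "\<And>c x. x \<in> A \<Longrightarrow> P x \<Longrightarrow> P (cscale_op c x)"
    and limit: "\<And>s x. (\<And>n. s n \<in> A) \<Longrightarrow> (\<And>n. P (s n)) \<Longrightarrow> s \<longlonglongrightarrow> x \<Longrightarrow> P x"
  shows "P a"
proof -
  have P: "x \<in> A \<and> P x" if "x \<in> A0" for x
    using that
  proof (induction x rule: complex_op.span_induct_alt)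
    case base
    show ?case using zero star_algebra.zero[OF star_algebra_A] by blast
  next
    case (step c x y)
    then obtain e v f where x: "x = S e v f" "fp e v" "fp f v" unfolding gens_def by blast
    have "P (cscale_op c x)" "cscale_op c x \<in> A"
      unfolding x(1) using cscale[OF S_in S] star_algebra.cscale[OF star_algebra_A S_in] x by auto
    then show ?case using step add star_algebra.add[OF star_algebra_A] by blast
  qed
  obtain s where s: "\<And>n. s n \<in> A0" "s \<longlonglongrightarrow> a"
    using a unfolding graph_algebra_eq closure_sequential by blast
  show ?thesis by (rule limit[OF _ _ s(2)]) (use s(1) P in auto)
qed

subsection \<open>The gauge action\<close>

definition deg :: "'e arrow \<Rightarrow> int" where
  "deg \<gamma> = fst (snd \<gamma>)"

definition phase :: "real \<Rightarrow> int \<Rightarrow> complex" where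
  "phase t k = exp (\<i> * of_int k * of_real t)"

lemma cmod_phase [simp]: "cmod (phase t k) = 1"
  using norm_exp_i_times[of "of_int k * t"] by (simp add: phase_def mult.assoc)

lemma phase_time_add: "phase (s + t) k = phase s k * phase t k"
  by (simp add: phase_def exp_add[symmetric] algebra_simps)

lemma phase_0 [simp]: "phase t 0 = 1" and phase_time_0 [simp]: "phase 0 k = 1"
  by (simp_all add: phase_def)

lemma phase_inverse [simp]: "phase t k * phase (- t) k = 1" "phase (- t) k * phase t k = 1"
  by (simp_all add: phase_time_add[symmetric])

lemma cnj_phase: "cnj (phase t k) = phase (- t) k"
  by (simp add: phase_def exp_cnj)

text \<open>The unitary grading operator, multiplying the coordinates of degree k by the phase of k;
  it implements the gauge action spatially.\<close>

definition U_ell2 :: "real \<Rightarrow> 'e arrow ell2 \<Rightarrow> 'e arrow ell2" where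
  "U_ell2 t x = Abs_ell2 (\<lambda>\<gamma>. phase t (deg \<gamma>) * Rep_ell2 x \<gamma>)"

lemma square_summable_phase:
  "square_summable f \<Longrightarrow> square_summable (\<lambda>\<gamma>. phase t (deg \<gamma>) * f \<gamma>)"
  by (simp add: square_summable_def norm_mult)

lemma Rep_U_ell2: "Rep_ell2 (U_ell2 t x) \<gamma> = phase t (deg \<gamma>) * Rep_ell2 x \<gamma>"
  unfolding U_ell2_def by (simp add: Rep_ell2_Abs_ell2 square_summable_phase square_summable_Rep_ell2)

lemma norm_U_ell2: "norm (U_ell2 t x) = norm x"
proof -
  have "(norm (U_ell2 t x))\<^sup>2 = (norm x)\<^sup>2"
    unfolding norm_ell2_sq by (simp add: Rep_U_ell2 norm_mult)
  then show ?thesis by (simp add: power2_eq_iff_nonneg)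
qed

lemma bounded_linear_U: "bounded_linear (U_ell2 t)"
proof (rule bounded_linear_intro)
  show "U_ell2 t (x + y) = U_ell2 t x + U_ell2 t y" for x y
    by (rule ell2_eqI) (simp add: Rep_U_ell2 plus_ell2.rep_eq distrib_left)
  show "U_ell2 t (r *\<^sub>R x) = r *\<^sub>R U_ell2 t x" for r x
    by (rule ell2_eqI) (simp add: Rep_U_ell2 scaleR_ell2.rep_eq)
  show "norm (U_ell2 t x) \<le> norm x * 1" for x by (simp add: norm_U_ell2)
qed

definition U :: "real \<Rightarrow> 'e arrow operator" where
  "U t = Blinfun (U_ell2 t)"

lemma U_apply: "blinfun_apply (U t) x = U_ell2 t x"
  by (simp add: U_def bounded_linear_Blinfun_apply bounded_linear_U)

lemma Rep_U: "Rep_ell2 (blinfun_apply (U t) x) \<gamma> = phase t (deg \<gamma>) * Rep_ell2 x \<gamma>"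
  by (simp add: U_apply Rep_U_ell2)

lemma U_adjoint: "cinner_ell2 (blinfun_apply (U (- t)) x) y = cinner_ell2 x (blinfun_apply (U t) y)"
  unfolding cinner_ell2_def by (simp add: Rep_U cnj_phase mult_ac)

lemma adjointable_U: "adjointable (U t)"
  by (rule adjointableI) (rule U_adjoint)

lemma adj_U: "adj_op (U t) = U (- t)"
  by (rule adj_op_eqI) (rule U_adjoint)

lemma U_inverse: "U t o\<^sub>L U (- t) = id_blinfun" "U (- t) o\<^sub>L U t = id_blinfun"
  by (rule blinfun_eqI, rule ell2_eqI, simp add: Rep_U mult.assoc[symmetric])+

text \<open>A total formula in place of the definite description \<open>gauge_action\<close>; the
  two agree on the algebra by \<open>gauge_action_eq\<close>.\<close>

definition \<alpha> :: "real \<Rightarrow> 'e arrow operator \<Rightarrow> 'e arrow operator" where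
  "\<alpha> t a = U t o\<^sub>L a o\<^sub>L U (- t)"

text \<open>Degrees add under multiplication of arrows, so the phase at \<open>\<eta>\<close> is the
  phase at \<open>\<gamma>\<close> times the inverse phase at the remaining factor.\<close>

lemma reg_gauge:
  assumes h: "conv_bounded h c"
  shows "reg (gauge_Cc t h) = \<alpha> t (reg h)"
proof -
  have g: "gauge_Cc t h \<gamma> = phase t (deg \<gamma>) * h \<gamma>" for \<gamma>
    by (cases \<gamma>) (simp add: gauge_Cc_def phase_def deg_def)
  have lc: "lc (gauge_Cc t h) (Rep_ell2 x) = (\<lambda>\<gamma>. phase t (deg \<gamma>) * lc h (Rep_ell2 (U_ell2 (- t) x)) \<gamma>)" for x
  proof
    fix \<gamma>
    have eq: "phase t (deg \<eta>) * h \<eta> * Rep_ell2 x (arrow_mult (arrow_inv \<eta>) \<gamma>) =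
       phase t (deg \<gamma>) * (h \<eta> * Rep_ell2 (U_ell2 (- t) x) (arrow_mult (arrow_inv \<eta>) \<gamma>))" for \<eta>
    proof -
      have "deg (arrow_mult (arrow_inv \<eta>) \<gamma>) = deg \<gamma> - deg \<eta>"
        by (cases \<eta>; cases \<gamma>) (simp add: deg_def)
      moreover have "phase t (deg \<eta>) = phase t (deg \<gamma>) * phase (- t) (deg \<gamma> - deg \<eta>)"
        by (simp add: phase_def exp_add[symmetric] algebra_simps)
      ultimately show ?thesis by (simp add: Rep_U_ell2)
    qed
    show "lc (gauge_Cc t h) (Rep_ell2 x) \<gamma> = phase t (deg \<gamma>) * lc h (Rep_ell2 (U_ell2 (- t) x)) \<gamma>"
    proof (cases "\<gamma> \<in> \<Gamma>")
      case True
      then show ?thesis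
        unfolding left_convolution_def by (simp only: if_True g eq infsum_cmult_right')
    qed (simp add: left_convolution_def)
  qed
  have "(\<lambda>x. Abs_ell2 (lc (gauge_Cc t h) (Rep_ell2 x))) = blinfun_apply (\<alpha> t (reg h))"
  proof
    fix x
    have "Abs_ell2 (lc (gauge_Cc t h) (Rep_ell2 x)) = U_ell2 t (blinfun_apply (reg h) (U_ell2 (- t) x))"
      unfolding lc U_ell2_def[of t "blinfun_apply (reg h) _"] Rep_reg[OF h] ..
    then show "Abs_ell2 (lc (gauge_Cc t h) (Rep_ell2 x)) = blinfun_apply (\<alpha> t (reg h)) x"
      by (simp add: \<alpha>_def U_apply)
  qed
  then show ?thesis unfolding regular_rep_def[of G "gauge_Cc t h"] by (simp add: blinfun_apply_inverse)
qed

lemma tendsto_\<alpha>: "(f \<longlongrightarrow> a) F \<Longrightarrow> ((\<lambda>n. \<alpha> t (f n)) \<longlongrightarrow> \<alpha> t a) F"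
  unfolding \<alpha>_def by (intro tendsto_compose_op tendsto_const)

text \<open>Conjugation is norm continuous, so every approximating sequence in \<open>Cc\<close>
  leads to the same limit, which settles existence and uniqueness in the definite
  description.\<close>

lemma gauge_action_eq:
  assumes a: "a \<in> A"
  shows "gauge_action G t a = \<alpha> t a"
  unfolding gauge_action_def
proof (rule the_equality)
  have conv: "(\<lambda>n. reg (gauge_Cc t (f n))) \<longlonglongrightarrow> \<alpha> t a"
    if "\<forall>n. f n \<in> Cc G" "(\<lambda>n. reg (f n)) \<longlonglongrightarrow> a" for f
  proof -
    have "reg (gauge_Cc t (f n)) = \<alpha> t (reg (f n))" for n
      using reg_gauge good_Cc that(1) unfolding good_def by blast
    then show ?thesis using tendsto_\<alpha>[OF that(2)] by simp
  qed
  obtain s where s: "\<forall>n. s n \<in> reg ` Cc G" "s \<longlonglongrightarrow> a"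
    using a unfolding graph_algebra_def closure_sequential by blast
  then have "\<forall>n. \<exists>f. f \<in> Cc G \<and> s n = reg f" by blast
  from choice[OF this] obtain f where f: "\<forall>n. f n \<in> Cc G \<and> s n = reg (f n)" by blast
  then have "s = (\<lambda>n. reg (f n))" by blast
  with s f conv[of f] show "\<exists>f. (\<forall>n. f n \<in> Cc G) \<and> (\<lambda>n. reg (f n)) \<longlonglongrightarrow> a \<and>
      (\<lambda>n. reg (gauge_Cc t (f n))) \<longlonglongrightarrow> \<alpha> t a" by (intro exI[of _ f]) simp
  fix b assume "\<exists>f. (\<forall>n. f n \<in> Cc G) \<and> (\<lambda>n. reg (f n)) \<longlonglongrightarrow> a \<and> (\<lambda>n. reg (gauge_Cc t (f n))) \<longlonglongrightarrow> b"
  then show "b = \<alpha> t a" using conv LIMSEQ_unique by blast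
qed

lemma \<alpha>_add: "\<alpha> t (a + b) = \<alpha> t a + \<alpha> t b"
  by (simp add: \<alpha>_def compose_add_left compose_add_right)

lemma \<alpha>_cscale: "\<alpha> t (cscale_op c a) = cscale_op c (\<alpha> t a)"
  by (simp add: \<alpha>_def compose_cscale_left compose_cscale_right adjointable_U)

lemma \<alpha>_zero: "\<alpha> t 0 = 0"
  by (simp add: \<alpha>_def compose_zero_left compose_zero_right)

lemma \<alpha>_compose: "\<alpha> t (a o\<^sub>L b) = \<alpha> t a o\<^sub>L \<alpha> t b"
proof -
  have "U (- t) o\<^sub>L (U t o\<^sub>L c) = c" for c :: "'e arrow operator"
    by (simp add: compose_assoc[symmetric] U_inverse) (rule blinfun_eqI, simp)
  then show ?thesis by (simp add: \<alpha>_def compose_assoc)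
qed

lemma \<alpha>_adj: "adjointable a \<Longrightarrow> adj_op (\<alpha> t a) = \<alpha> t (adj_op a)"
  by (simp add: \<alpha>_def adjointable_compose adjointable_U adj_compose adj_U compose_assoc)

lemma deg_\<tau>: "\<gamma> \<in> D e v \<Longrightarrow> deg (\<tau> e f \<gamma>) = deg \<gamma> - int (length e) + int (length f)"
  unfolding D_iff by (auto simp: \<tau>_cat deg_def)

lemma \<alpha>_S:
  assumes "fp e v" "fp f v"
  shows "\<alpha> t (S e v f) = cscale_op (phase t (int (length e) - int (length f))) (S e v f)"
proof (rule blinfun_eqI, rule ell2_eqI)
  fix x \<gamma>
  have "phase t (deg \<gamma>) * phase (- t) (deg \<gamma> - int (length e) + int (length f)) =
      phase t (int (length e) - int (length f))"
    by (simp add: phase_def exp_add[symmetric] algebra_simps)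
  then show "Rep_ell2 (blinfun_apply (\<alpha> t (S e v f)) x) \<gamma> =
      Rep_ell2 (blinfun_apply (cscale_op (phase t (int (length e) - int (length f))) (S e v f)) x) \<gamma>"
    by (simp add: \<alpha>_def Rep_U Rep_S assms deg_\<tau> cscale_op_apply cscale_ell2.rep_eq mult.assoc[symmetric])
qed

lemma \<alpha>_in: "a \<in> A \<Longrightarrow> \<alpha> t a \<in> A"
proof (induction a rule: A_induct)
  case (limit s x)
  show ?case by (rule star_algebra.limit[OF star_algebra_A tendsto_\<alpha>[OF limit(2)] limit(3)])
qed (simp_all add: \<alpha>_zero zero \<alpha>_S cscale S_in \<alpha>_add add \<alpha>_cscale)

lemma vertex_projection_eq: "vertex_projection G v = S [] v []"
proof -
  have "unit_space_fun G (indicator (C v)) = indicator (ZZ [] v [])"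
    by (rule ext) (auto simp: unit_space_fun_def Z_def th_def indicator_def C_def)
  then show ?thesis by (simp add: vertex_projection_def S_def)
qed

end

section \<open>Uniqueness of KMS weights\<close>

text \<open>The real axis is on the boundary of the domain, out of reach of the identity theorem.
  Reflection makes it interior, since \<open>F\<close> is real (namely 0) there; the upper edge is
  then reached by continuity.\<close>

lemma strip_identity_pos:
  assumes \<beta>: "0 < \<beta>" and cont: "continuous_on {z. 0 \<le> Im z \<and> Im z \<le> \<beta>} F"
    and hol: "F holomorphic_on {z. 0 < Im z \<and> Im z < \<beta>}"
    and zero: "\<And>t. F (of_real t) = 0"
    and w: "0 \<le> Im w" "Im w \<le> \<beta>"
  shows "F w = 0"
proof -
  let ?S = "{z. - \<beta> < Im z \<and> Im z < \<beta>}"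
  let ?H = "\<lambda>z. if 0 \<le> Im z then F z else cnj (F (cnj z))"
  have S_eq: "?S = {z. - \<beta> < Im z} \<inter> {z. Im z < \<beta>}" by auto
  have S: "open ?S"
    unfolding S_eq by (intro open_Int open_halfspace_Im_lt open_halfspace_Im_gt)
  have "convex ?S"
    unfolding S_eq by (intro convex_Int convex_halfspace_Im_lt convex_halfspace_Im_gt)
  then have conn: "connected ?S" by (rule convex_connected)
  have H: "?H holomorphic_on ?S"
  proof (rule Schwarz_reflection[OF S])
    show "cnj ` ?S \<subseteq> ?S" by auto
    show "F holomorphic_on ?S \<inter> {z. 0 < Im z}"
      by (rule holomorphic_on_subset[OF hol]) auto
    show "continuous_on (?S \<inter> {z. 0 \<le> Im z}) F"
      by (rule continuous_on_subset[OF cont]) auto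
    show "F z \<in> \<real>" if "z \<in> \<real>" for z
      using that zero by (auto simp: Reals_def)
  qed
  have inner: "F z = 0" if "0 \<le> Im z" "Im z < \<beta>" for z
  proof -
    have "?H z = 0"
    proof (rule analytic_continuation[OF H S conn, of "\<real> \<inter> ?S" 0])
      show "\<real> \<inter> ?S \<subseteq> ?S" "0 \<in> ?S" using \<beta> by auto
      show "0 islimpt \<real> \<inter> ?S"
        unfolding islimpt_approachable
      proof (intro allI impI)
        fix e :: real assume "0 < e"
        then show "\<exists>x'\<in>\<real> \<inter> ?S. x' \<noteq> 0 \<and> dist x' 0 < e"
          using \<beta> by (intro bexI[of _ "of_real (e / 2)"]) auto
      qed
      show "?H x = 0" if "x \<in> \<real> \<inter> ?S" for x
        using that zero by (auto simp: Reals_def)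
      show "z \<in> ?S" using that \<beta> by auto
    qed
    with that show ?thesis by simp
  qed
  show ?thesis
  proof (cases "Im w < \<beta>")
    case False
    then have Im: "Im w = \<beta>" using w by simp
    define u where "u n = w - \<i> * of_real (\<beta> / (real n + 1))" for n
    have "(\<lambda>n. \<beta> / (real n + 1)) \<longlonglongrightarrow> 0" by real_asymp
    then have "u \<longlonglongrightarrow> w - \<i> * of_real 0"
      unfolding u_def by (intro tendsto_intros)
    then have lim: "u \<longlonglongrightarrow> w" by simp
    have u: "u n \<in> {z. 0 \<le> Im z \<and> Im z \<le> \<beta>}" "Im (u n) < \<beta>" for n
      using \<beta> Im by (auto simp: u_def divide_le_eq mult_left_le)
    have "(\<lambda>n. F (u n)) \<longlonglongrightarrow> F w"
      using cont lim u(1) w unfolding continuous_on_sequentially by (auto simp: o_def)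
    moreover have "F (u n) = 0" for n using inner[of "u n"] u[of n] by auto
    ultimately show ?thesis by (simp add: LIMSEQ_const_iff)
  qed (use inner w in blast)
qed

lemma interior_strip_pos: "0 < \<beta> \<Longrightarrow> {z. 0 < Im z \<and> Im z < \<beta>} \<subseteq> interior (strip \<beta>)"
proof (rule interior_maximal)
  have "{z. 0 < Im z \<and> Im z < \<beta>} = {z. 0 < Im z} \<inter> {z. Im z < \<beta>}" by auto
  then show "open {z. 0 < Im z \<and> Im z < \<beta>}"
    by (simp add: open_Int open_halfspace_Im_lt open_halfspace_Im_gt)
qed (auto simp: strip_def)

lemma interior_strip_neg: "\<beta> < 0 \<Longrightarrow> {z. \<beta> < Im z \<and> Im z < 0} \<subseteq> interior (strip \<beta>)"
proof (rule interior_maximal)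
  have "{z. \<beta> < Im z \<and> Im z < 0} = {z. \<beta> < Im z} \<inter> {z. Im z < 0}" by auto
  then show "open {z. \<beta> < Im z \<and> Im z < 0}"
    by (simp add: open_Int open_halfspace_Im_lt open_halfspace_Im_gt)
qed (auto simp: strip_def)

text \<open>Negative \<beta> is reduced to the positive case by z mapped to - z; for \<beta> = 0 the
  point in question lies on the real axis.\<close>

lemma strip_identity:
  assumes cont: "continuous_on (strip \<beta>) F" and hol: "F holomorphic_on interior (strip \<beta>)"
    and zero: "\<And>t. F (of_real t) = 0"
  shows "F (\<i> * of_real \<beta>) = 0"
proof (cases \<beta> "0 :: real" rule: linorder_cases)
  case equal
  then show ?thesis using zero[of 0] by simp
next
  case greater
  show ?thesis
  proof (rule strip_identity_pos[OF greater, of F])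
    show "continuous_on {z. 0 \<le> Im z \<and> Im z \<le> \<beta>} F"
      using cont greater by (simp add: strip_def)
    show "F holomorphic_on {z. 0 < Im z \<and> Im z < \<beta>}"
      by (rule holomorphic_on_subset[OF hol interior_strip_pos[OF greater]])
  qed (use zero greater in auto)
next
  case less
  have "(\<lambda>z. F (- z)) (- (\<i> * of_real \<beta>)) = 0"
  proof (rule strip_identity_pos[of "- \<beta>" "\<lambda>z. F (- z)"])
    show "continuous_on {z. 0 \<le> Im z \<and> Im z \<le> - \<beta>} (\<lambda>z. F (- z))"
      by (rule continuous_on_compose2[OF cont]) (use less in \<open>auto simp: strip_def intro!: continuous_intros\<close>)
    have "F \<circ> uminus holomorphic_on {z. 0 < Im z \<and> Im z < - \<beta>}"
      by (rule holomorphic_on_compose_gen[OF _ hol])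
        (use interior_strip_neg[OF less] in \<open>auto intro!: holomorphic_intros subsetD[OF interior_strip_neg[OF less]]\<close>)
    then show "(\<lambda>z. F (- z)) holomorphic_on {z. 0 < Im z \<and> Im z < - \<beta>}" by (simp add: o_def)
    show "F (- complex_of_real t) = 0" for t using zero[of "- t"] by simp
  qed (use less in auto)
  then show ?thesis by simp
qed

section \<open>Bounds on corners\<close>

context proper_weight_on
begin

lemma M_diff: "a \<in> M \<Longrightarrow> b \<in> M \<Longrightarrow> a - b \<in> M"
  unfolding weight_M_def by (rule complex_op.span_diff)

lemma functional_diff: "a \<in> M \<Longrightarrow> b \<in> M \<Longrightarrow> \<phi> (a - b) = \<phi> a - \<phi> b"
  using functional_add[of "a - b" b] M_diff[of a b] by simp

lemma functional_sum:
  "finite I \<Longrightarrow> (\<And>i. i \<in> I \<Longrightarrow> f i \<in> M) \<Longrightarrow> sum f I \<in> M \<and> \<phi> (sum f I) = (\<Sum>i\<in>I. \<phi> (f i))"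
proof (induction I rule: finite_induct)
  case empty
  show ?case using functional_K[OF K_zero] K_in_M[OF K_zero] by (simp add: weight_zero)
qed (simp add: M_add functional_add)

lemma M_compose: "a \<in> A \<Longrightarrow> adj_op a \<in> N \<Longrightarrow> b \<in> N \<Longrightarrow> a o\<^sub>L b \<in> M"
  using M_adj_compose[of "adj_op a" b] by (simp add: adj_adj adjointable)

lemma weight_left_bound:
  assumes a: "a \<in> A" and b: "b \<in> A"
  shows "\<psi> (adj_op (a o\<^sub>L b) o\<^sub>L (a o\<^sub>L b)) \<le> ennreal ((norm a)\<^sup>2) * \<psi> (adj_op b o\<^sub>L b)"
proof -
  have "(norm a)\<^sup>2 *\<^sub>R (adj_op b o\<^sub>L b) - (adj_op (a o\<^sub>L b) o\<^sub>L (a o\<^sub>L b)) =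
      adj_op b o\<^sub>L ((norm a)\<^sup>2 *\<^sub>R id_blinfun - (adj_op a o\<^sub>L a)) o\<^sub>L b"
    using a b by (intro blinfun_eqI) (simp add: adj_compose adjointable blinfun.diff_left blinfun.diff_right
        blinfun.scaleR_left blinfun.scaleR_right)
  then have "nonneg_op ((norm a)\<^sup>2 *\<^sub>R (adj_op b o\<^sub>L b) - (adj_op (a o\<^sub>L b) o\<^sub>L (a o\<^sub>L b)))"
    using nonneg_op_conj[OF adjointable[OF b] nonneg_op_norm_bound[OF adjointable[OF a]]] by simp
  then have "\<psi> (adj_op (a o\<^sub>L b) o\<^sub>L (a o\<^sub>L b)) \<le> \<psi> ((norm a)\<^sup>2 *\<^sub>R (adj_op b o\<^sub>L b))"
    using a b by (intro weight_mono pos_adj_compose scaleR compose adj)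
  then show ?thesis using weight_scale0[OF pos_adj_compose[OF b], of "(norm a)\<^sup>2"] by simp
qed

lemma N_self_adjoint: 
  assumes "k \<in> K"
  shows "k \<in> N"
proof -
  obtain b where b: "b \<in> N" "adj_op b = b" "b o\<^sub>L b = k" using K_root[OF assms] by blast
  then show ?thesis using N_left_ideal[OF N_in b(1)] by blast
qed

lemma corner_M: "e \<in> N \<Longrightarrow> adj_op e = e \<Longrightarrow> x \<in> A \<Longrightarrow> e o\<^sub>L x o\<^sub>L e \<in> M"
  using M_adj_compose[of e "x o\<^sub>L e"] N_left_ideal[of x e] by (simp add: compose_assoc)

text \<open>For self-adjoint h the corner e h e lies between - \<open>norm h\<close> e and
  \<open>norm h\<close> e. Splitting \<open>x\<close> into two self-adjoint parts costs the factor
  2. The point is norm continuity of the functional on the corner of a projection of finite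
  weight.\<close>

lemma corner_bound:
  assumes e: "e \<in> K" "e o\<^sub>L e = e" and x: "x \<in> A"
  shows "cmod (\<phi> (e o\<^sub>L x o\<^sub>L e)) \<le> 2 * norm x * enn2real (\<psi> e)"
proof -
  have eA: "e \<in> A" and eadj: "adj_op e = e" and epos: "e \<in> positive_part A"
    using e(1) by (auto simp: K_def pos_in pos_self_adjoint)
  have eN: "e \<in> N" by (rule N_self_adjoint[OF e(1)])
  have real: "\<bar>Re (\<phi> (e o\<^sub>L h o\<^sub>L e))\<bar> \<le> norm h * enn2real (\<psi> e) \<and> Im (\<phi> (e o\<^sub>L h o\<^sub>L e)) = 0"
    if h: "h \<in> A" "adj_op h = h" for h
  proof -
    have one: "Im (\<phi> (e o\<^sub>L h o\<^sub>L e)) = 0 \<and> - (norm h * enn2real (\<psi> e)) \<le> Re (\<phi> (e o\<^sub>L h o\<^sub>L e))"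
      if h: "h \<in> A" "adj_op h = h" for h
    proof -
      \<comment> \<open>Adding this multiple of \<open>e\<close> makes the corner positive, and it
        stays below twice that multiple; hence it lies in \<open>K\<close>, where the functional is
        the weight.\<close>
      let ?k = "norm h *\<^sub>R e + (e o\<^sub>L h o\<^sub>L e)"
      have eM: "norm h *\<^sub>R e \<in> K" by (rule K_scale[OF e(1)]) simp
      have k_eq: "?k = adj_op e o\<^sub>L (norm h *\<^sub>R id_blinfun + h) o\<^sub>L e"
        unfolding eadj by (subst (1) e(2)[symmetric], rule blinfun_eqI)
          (simp add: blinfun.add_left blinfun.add_right blinfun.scaleR_left blinfun.scaleR_right)
      have nn: "nonneg_op ?k"
        unfolding k_eq by (intro nonneg_op_conj adjointable nonneg_op_self_adjoint_bound h eA)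
      have "nonneg_op ((2 * norm h) *\<^sub>R e - ?k)"
      proof -
        have "(2 * norm h) *\<^sub>R e - ?k = adj_op e o\<^sub>L (norm (- h) *\<^sub>R id_blinfun + (- h)) o\<^sub>L e"
          unfolding eadj by (subst (1 2) e(2)[symmetric], rule blinfun_eqI)
            (simp add: blinfun.add_left blinfun.add_right blinfun.diff_left blinfun.diff_right
              blinfun.minus_left blinfun.minus_right blinfun.scaleR_left blinfun.scaleR_right scaleR_2 flip: scaleR_scaleR)
        moreover have "- h \<in> A" "adj_op (- h) = - h"
          using scaleR[OF h(1), of "-1"] adj_scaleR[OF adjointable[OF h(1)], of "-1"] h(2) by auto
        ultimately show ?thesis
          by (simp only:) (intro nonneg_op_conj adjointable nonneg_op_self_adjoint_bound eA)
      qed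
      then have kK: "?k \<in> K"
        by (intro K_hereditary[OF K_scale[OF e(1), of "2 * norm h"] _ nn])
          (use eA h in \<open>auto intro: add scaleR compose\<close>)
      have "\<phi> ?k = \<phi> (norm h *\<^sub>R e) + \<phi> (e o\<^sub>L h o\<^sub>L e)"
        by (intro functional_add K_in_M eM corner_M eN eadj h)
      then have "\<phi> (e o\<^sub>L h o\<^sub>L e) = of_real (enn2real (\<psi> ?k) - norm h * enn2real (\<psi> e))"
        using functional_K[OF kK] functional_K[OF eM] enn_weight_scale[OF e(1), of "norm h"] by simp
      then show ?thesis by simp
    qed
    have m: "- h \<in> A" "adj_op (- h) = - h"
      using scaleR[OF h(1), of "-1"] adj_scaleR[OF adjointable[OF h(1)], of "-1"] h(2) by auto
    have "e o\<^sub>L (- h) o\<^sub>L e = cscale_op (-1) (e o\<^sub>L h o\<^sub>L e)"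
      using cscale_op_of_real[of "-1" "e o\<^sub>L h o\<^sub>L e"]
      by (simp add: bounded_bilinear.minus_left[OF bounded_bilinear_blinfun_compose]
          bounded_bilinear.minus_right[OF bounded_bilinear_blinfun_compose])
    then have "\<phi> (e o\<^sub>L (- h) o\<^sub>L e) = - \<phi> (e o\<^sub>L h o\<^sub>L e)"
      using functional_cscale[OF corner_M[OF eN eadj h(1)], of "-1"] by simp
    then show ?thesis using one[OF h] one[OF m] by auto
  qed
  define h1 h2 where "h1 = (1/2) *\<^sub>R (x + adj_op x)" and "h2 = cscale_op (- \<i> / 2) (x - adj_op x)"
  have hA: "h1 \<in> A" "h2 \<in> A"
    unfolding h1_def h2_def by (intro scaleR add adj cscale diff x)+
  have adj_h: "adj_op h1 = h1" "adj_op h2 = h2"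
    unfolding h1_def h2_def using x
    by (simp_all add: adj_scaleR adj_cscale adj_add adj_diff adj_adj adjointable adj adjointable_add
        adjointable_diff adjointable_cscale add.commute complex_op.scale_right_diff_distrib complex_op.scale_minus_left)
  have x_eq: "x = h1 + cscale_op \<i> h2"
    unfolding h1_def h2_def
    by (simp add: cscale_op_of_real[of "1/2", symmetric] complex_op.scale_right_distrib
        complex_op.scale_right_diff_distrib complex_op.scale_left_distrib[symmetric])
  have n: "norm h1 \<le> norm x" "norm h2 \<le> norm x"
  proof -
    have "norm (x + adj_op x) \<le> 2 * norm x" "norm (x - adj_op x) \<le> 2 * norm x"
      using norm_triangle_ineq[of x "adj_op x"] norm_triangle_ineq4[of x "adj_op x"] norm_adj[OF adjointable[OF x]]
      by auto
    then show "norm h1 \<le> norm x" "norm h2 \<le> norm x"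
      unfolding h1_def h2_def using norm_cscale_op_le[of "- \<i> / 2" "x - adj_op x"] by (auto simp: norm_divide)
  qed
  have "e o\<^sub>L x o\<^sub>L e = (e o\<^sub>L h1 o\<^sub>L e) + cscale_op \<i> (e o\<^sub>L h2 o\<^sub>L e)"
    by (subst x_eq) (simp add: compose_add_left compose_add_right compose_cscale_left compose_cscale_right adjointable eA)
  then have eq: "\<phi> (e o\<^sub>L x o\<^sub>L e) = \<phi> (e o\<^sub>L h1 o\<^sub>L e) + \<i> * \<phi> (e o\<^sub>L h2 o\<^sub>L e)"
    using corner_M[OF eN eadj] hA by (simp add: functional_add functional_cscale M_cscale)
  have "cmod (\<phi> (e o\<^sub>L h o\<^sub>L e)) \<le> norm x * enn2real (\<psi> e)"
    if "h \<in> A" "adj_op h = h" "norm h \<le> norm x" for h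
  proof -
    have "cmod (\<phi> (e o\<^sub>L h o\<^sub>L e)) \<le> norm h * enn2real (\<psi> e)"
      using real[OF that(1,2)] cmod_le[of "\<phi> (e o\<^sub>L h o\<^sub>L e)"] by simp
    also have "\<dots> \<le> norm x * enn2real (\<psi> e)" by (intro mult_right_mono that) simp
    finally show ?thesis .
  qed
  from this[OF hA(1) adj_h(1) n(1)] this[OF hA(2) adj_h(2) n(2)] show ?thesis
    unfolding eq
    by (intro order_trans[OF norm_triangle_ineq]) (simp add: norm_mult)
qed

end

lemma Rep_ell2_sum: "Rep_ell2 (sum x I) i = (\<Sum>j\<in>I. Rep_ell2 (x j) i)"
  by (induction I rule: infinite_finite_induct) (simp_all add: zero_ell2.rep_eq plus_ell2.rep_eq)

text \<open>Only the heads of edges leaving \<open>v\<close> contribute, and each is counted once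
  for every such edge; this trades the infinite sum over vertices for a finite sum over
  edges.\<close>

lemma (in path_graph) adjacency_sum:
  fixes \<xi> :: "'v \<Rightarrow> real"
  assumes v: "v \<in> verts G"
  shows "(\<Sum>\<^sub>\<infinity>w\<in>verts G. real (adjacency G v w) * \<xi> w) = (\<Sum>a\<in>out_arcs G v. \<xi> (head G a))"
proof -
  let ?O = "out_arcs G v"
  have fin: "finite ?O" by (rule finite_out_arcs[OF v])
  have adj: "adjacency G v w = card {a \<in> ?O. head G a = w}" for w
    unfolding adjacency_def by (rule arg_cong[of _ _ card]) auto
  have "(\<Sum>\<^sub>\<infinity>w\<in>verts G. real (adjacency G v w) * \<xi> w) = (\<Sum>\<^sub>\<infinity>w\<in>head G ` ?O. real (adjacency G v w) * \<xi> w)"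
  proof (rule infsum_cong_neutral)
    fix w assume "w \<in> verts G - head G ` ?O"
    then have "{a \<in> ?O. head G a = w} = {}" by auto
    then show "real (adjacency G v w) * \<xi> w = 0" unfolding adj by (simp only: card.empty of_nat_0 mult_zero_left)
  qed auto
  also have "\<dots> = (\<Sum>w\<in>head G ` ?O. real (adjacency G v w) * \<xi> w)" using fin by simp
  also have "\<dots> = (\<Sum>w\<in>head G ` ?O. \<Sum>a\<in>{a \<in> ?O. head G a = w}. \<xi> (head G a))"
    by (rule sum.cong) (auto simp: adj)
  also have "\<dots> = (\<Sum>a\<in>?O. \<xi> (head G a))"
    by (rule sum.image_gen[OF fin, symmetric])
  finally show ?thesis .
qed

section \<open>Averaging over the gauge action and an approximate unit\<close>

context path_graph
begin

lemma norm_U_le: "norm (U t) \<le> 1"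
  by (rule norm_blinfun_bound) (simp_all add: U_apply norm_U_ell2)

lemma norm_\<alpha>_le: "norm (\<alpha> t a) \<le> norm a"
proof -
  have "norm (\<alpha> t a) \<le> norm (U t o\<^sub>L a) * norm (U (- t))"
    unfolding \<alpha>_def by (rule norm_blinfun_compose)
  also have "\<dots> \<le> (norm (U t) * norm a) * norm (U (- t))"
    by (intro mult_right_mono norm_blinfun_compose) simp
  also have "\<dots> \<le> (1 * norm a) * 1"
    by (intro mult_mono norm_U_le) (auto intro: mult_nonneg_nonneg)
  finally show ?thesis by simp
qed

lemma \<alpha>_diff: "\<alpha> t (a - b) = \<alpha> t a - \<alpha> t b"
  using \<alpha>_add[of t "a - b" b] by simp

lemma \<alpha>_pos: "a \<in> positive_part A \<Longrightarrow> \<alpha> t a \<in> positive_part A"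
  unfolding positive_part_eq
proof (clarsimp simp: \<alpha>_in)
  assume a: "a \<in> A" "nonneg_op a"
  have "\<alpha> t a = adj_op (U (- t)) o\<^sub>L a o\<^sub>L U (- t)"
    by (simp add: \<alpha>_def adj_U)
  then show "nonneg_op (\<alpha> t a)" using nonneg_op_conj[OF adjointable_U a(2)] by simp
qed

text \<open>Averaging over the group of \<open>2\<^sup>m\<close>-th roots of unity: the factor for \<open>\<pi> / 2\<^sup>i\<close> annihilates
  the elements whose degree is an odd multiple of \<open>2\<^sup>i\<close>.\<close>

primrec av :: "nat \<Rightarrow> 'e arrow operator \<Rightarrow> 'e arrow operator" where
  "av 0 a = a"
| "av (Suc m) a = (1/2) *\<^sub>R (av m a + \<alpha> (pi / 2 ^ m) (av m a))"

definition invariant :: "'e arrow operator \<Rightarrow> bool" where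
  "invariant a \<longleftrightarrow> (\<forall>t. \<alpha> t a = a)"

lemma av_add: "av m (a + b) = av m a + av m b"
  by (induction m) (simp_all add: \<alpha>_add algebra_simps)

lemma av_cscale: "av m (cscale_op c a) = cscale_op c (av m a)"
  by (induction m)
    (simp_all add: \<alpha>_cscale cscale_op_of_real[symmetric] complex_op.scale_right_distrib mult.commute)

lemma av_diff: "av m (a - b) = av m a - av m b"
  using av_add[of m "a - b" b] by simp

lemma av_in: "a \<in> A \<Longrightarrow> av m a \<in> A"
  by (induction m) (auto intro: scaleR add \<alpha>_in)

lemma av_pos: "a \<in> positive_part A \<Longrightarrow> av m a \<in> positive_part A"
  by (induction m) (simp_all add: pos_scaleR pos_add \<alpha>_pos)

lemma norm_av_le: "norm (av m a) \<le> norm a"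
proof (induction m)
  case (Suc m)
  have "norm (av m a + \<alpha> (pi / 2 ^ m) (av m a)) \<le> norm (av m a) + norm (av m a)"
    by (rule order_trans[OF norm_triangle_ineq]) (simp add: norm_\<alpha>_le)
  with Suc show ?case by simp
qed simp

lemma av_invariant: "invariant a \<Longrightarrow> av m a = a"
  by (induction m) (simp_all add: invariant_def scaleR_2[symmetric])

lemma av_zero_mono:
  assumes "av m a = 0" "m \<le> n"
  shows "av n a = 0"
  using assms(2,1) by (induction rule: dec_induct) (simp_all add: \<alpha>_zero)

lemma phase_odd: "odd l \<Longrightarrow> phase (pi / 2 ^ m) (2 ^ m * l) = -1"
proof -
  assume "odd l"
  then obtain j where l: "l = 2 * j + 1" by (rule oddE)
  have "phase (pi / 2 ^ m) (2 ^ m * l) = exp (2 * of_int j * of_real pi * \<i> + of_real pi * \<i>)"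
    unfolding phase_def l by (rule arg_cong[of _ _ exp]) (simp add: field_simps)
  also have "\<dots> = exp (2 * of_int j * of_real pi * \<i>) * exp (of_real pi * \<i>)" by (rule exp_add)
  also have "exp (2 * of_int j * of_real pi * \<i>) = 1" by (subst exp_eq_1) auto
  finally show ?thesis by simp
qed

lemma ex_power_odd: "k \<noteq> 0 \<Longrightarrow> \<exists>m l. k = 2 ^ m * l \<and> odd (l :: int)"
proof (induction "nat \<bar>k\<bar>" arbitrary: k rule: less_induct)
  case less
  show ?case
  proof (cases "odd k")
    case True
    then show ?thesis by (intro exI[of _ 0] exI[of _ k]) simp
  next
    case False
    then obtain j where j: "k = 2 * j" by (auto elim: evenE)
    with less.prems have "nat \<bar>j\<bar> < nat \<bar>k\<bar>" "j \<noteq> 0" by (auto simp: abs_mult)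
    then obtain m l where "j = 2 ^ m * l" "odd l" using less.hyps[of j] by auto
    then show ?thesis using j by (intro exI[of _ "Suc m"] exI[of _ l]) simp
  qed
qed

lemma av_degree:
  assumes "\<And>t. \<alpha> t a = cscale_op (phase t k) a"
  shows "\<exists>c. av m a = cscale_op c a"
proof (induction m)
  case 0
  show ?case by (rule exI[of _ 1]) simp
next
  case (Suc m)
  then obtain c where "av m a = cscale_op c a" ..
  then have "av (Suc m) a = cscale_op (of_real (1/2)) (cscale_op c a + cscale_op (c * phase (pi / 2 ^ m) k) a)"
    by (simp only: av.simps cscale_op_of_real \<alpha>_cscale assms complex_op.scale_scale)
  then have "av (Suc m) a = cscale_op (of_real (1/2) * (c + c * phase (pi / 2 ^ m) k)) a"
    by (simp only: complex_op.scale_left_distrib[symmetric] complex_op.scale_scale)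
  then show ?case by blast
qed

lemma av_degree_zero:
  assumes a: "\<And>t. \<alpha> t a = cscale_op (phase t k) a" and k: "k \<noteq> 0"
  shows "\<exists>m. \<forall>n\<ge>m. av n a = 0"
proof -
  obtain m l where ml: "k = 2 ^ m * l" "odd l" using ex_power_odd[OF k] by blast
  obtain c where c: "av m a = cscale_op c a" using av_degree[OF a] by blast
  have "\<alpha> (pi / 2 ^ m) (av m a) = - av m a"
    unfolding c \<alpha>_cscale a ml(1) phase_odd[OF ml(2)] by simp
  then have "av (Suc m) a = 0" by simp
  then show ?thesis using av_zero_mono by blast
qed

text \<open>On a generator the averages are eventually constant: the generator itself in degree 0,
  and zero otherwise once the power of 2 dividing the degree has been passed. Contractivity of
  \<open>av\<close> transfers convergence to norm limits.\<close>

lemma av_limit: "a \<in> A \<Longrightarrow> \<exists>d. (\<lambda>m. av m a) \<longlonglongrightarrow> d \<and> invariant d"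
proof (induction a rule: A_induct)
  case zero
  have "invariant 0" by (simp add: invariant_def \<alpha>_zero)
  then show ?case using av_invariant[of 0] by (intro exI[of _ 0]) simp
next
  case (S e v f)
  let ?k = "int (length e) - int (length f)"
  show ?case
  proof (cases "?k = 0")
    case True
    then have "invariant (S e v f)" using \<alpha>_S[OF S] by (simp add: invariant_def)
    then show ?thesis using av_invariant[of "S e v f"] by (intro exI[of _ "S e v f"]) simp
  next
    case False
    obtain m where "\<forall>n\<ge>m. av n (S e v f) = 0" using av_degree_zero[OF \<alpha>_S[OF S] False] by blast
    then have "\<forall>\<^sub>F n in sequentially. av n (S e v f) = 0" by (auto simp: eventually_sequentially)
    then have "(\<lambda>n. av n (S e v f)) \<longlonglongrightarrow> 0" by (rule tendsto_eventually)
    moreover have "invariant 0" by (simp add: invariant_def \<alpha>_zero)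
    ultimately show ?thesis by blast
  qed
next
  case (add x y)
  then obtain d d' where "(\<lambda>m. av m x) \<longlonglongrightarrow> d" "invariant d" "(\<lambda>m. av m y) \<longlonglongrightarrow> d'" "invariant d'" by blast
  then show ?case unfolding av_add
    by (intro exI[of _ "d + d'"]) (auto intro: tendsto_add simp: invariant_def \<alpha>_add)
next
  case (cscale c x)
  then obtain d where "(\<lambda>m. av m x) \<longlonglongrightarrow> d" "invariant d" by blast
  then show ?case unfolding av_cscale
    by (intro exI[of _ "cscale_op c d"]) (auto intro: tendsto_cscale_op simp: invariant_def \<alpha>_cscale)
next
  case (limit s x)
  then obtain d where d: "\<And>n. (\<lambda>m. av m (s n)) \<longlonglongrightarrow> d n" "\<And>n. invariant (d n)" by metis
  have near: "norm (av m x - av m (s n)) \<le> norm (x - s n)" for m n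
    unfolding av_diff[symmetric] by (rule norm_av_le)
  have "Cauchy (\<lambda>m. av m x)"
  proof (rule metric_CauchyI)
    fix \<epsilon> :: real assume \<epsilon>: "0 < \<epsilon>"
    obtain n where n: "dist (s n) x < \<epsilon> / 3"
      using \<open>s \<longlonglongrightarrow> x\<close> \<epsilon> unfolding lim_sequentially by (meson divide_pos_pos order_refl zero_less_numeral)
    have "Cauchy (\<lambda>m. av m (s n))" using d(1) LIMSEQ_imp_Cauchy by blast
    then obtain M where M: "\<And>i j. i \<ge> M \<Longrightarrow> j \<ge> M \<Longrightarrow> dist (av i (s n)) (av j (s n)) < \<epsilon> / 3"
      using \<epsilon> unfolding Cauchy_def by (meson divide_pos_pos zero_less_numeral)
    have "dist (av i x) (av j x) < \<epsilon>" if "i \<ge> M" "j \<ge> M" for i j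
    proof -
      have "dist (av i x) (av j x) \<le> dist (av i x) (av i (s n)) + dist (av i (s n)) (av j (s n)) + dist (av j (s n)) (av j x)"
        using dist_triangle[of "av i x" "av j x" "av i (s n)"] dist_triangle[of "av i (s n)" "av j x" "av j (s n)"] by linarith
      moreover have "dist (av i x) (av i (s n)) \<le> dist (s n) x" "dist (av j (s n)) (av j x) \<le> dist (s n) x"
        using near[of i n] near[of j n] by (simp_all add: dist_norm norm_minus_commute)
      ultimately show ?thesis using M[OF that] n by linarith
    qed
    then show "\<exists>M. \<forall>i\<ge>M. \<forall>j\<ge>M. dist (av i x) (av j x) < \<epsilon>" by blast
  qed
  then obtain D where D: "(\<lambda>m. av m x) \<longlonglongrightarrow> D" using Cauchy_convergent_iff convergent_def by blast
  have "norm (D - d n) \<le> norm (x - s n)" for n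
  proof (rule LIMSEQ_le_const2)
    show "(\<lambda>m. norm (av m x - av m (s n))) \<longlonglongrightarrow> norm (D - d n)" by (intro tendsto_intros D d)
  qed (use near in blast)
  moreover have "(\<lambda>n. norm (x - s n)) \<longlonglongrightarrow> norm (x - x)" by (intro tendsto_intros limit)
  ultimately have "(\<lambda>n. D - d n) \<longlonglongrightarrow> 0"
    by - (rule Lim_null_comparison[of _ "\<lambda>n. norm (x - s n)"], simp_all)
  from tendsto_diff[OF tendsto_const[of D] this] have dD: "d \<longlonglongrightarrow> D" by simp
  have "\<alpha> t D = D" for t
  proof -
    have "\<alpha> t (d n) = d n" for n using d(2) unfolding invariant_def by blast
    then have "d \<longlonglongrightarrow> \<alpha> t D" using tendsto_\<alpha>[OF dD, of t] by simp
    then show ?thesis using dD by (rule LIMSEQ_unique)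
  qed
  with D show ?case by (auto simp: invariant_def)
qed

lemma p_in: "v \<in> verts G \<Longrightarrow> S [] v [] \<in> A"
  by (intro S_in) auto

lemma S_source_range: "fp e v \<Longrightarrow> fp f v \<Longrightarrow> adj_op (S e v f) o\<^sub>L S e v f = S f v f"
  using S_compose_right[of f v e "[]" v f] by (simp add: adj_S)

lemma p_S: "fp e v \<Longrightarrow> fp f v \<Longrightarrow> S [] (vs e v) [] o\<^sub>L S e v f = S e v f"
  using S_compose_right[of "[]" "vs e v" "[]" e v f] fp_append[of "[]" e v] by simp

lemma p_S_zero: "w \<in> verts G \<Longrightarrow> fp e v \<Longrightarrow> fp f v \<Longrightarrow> w \<noteq> vs e v \<Longrightarrow> S [] w [] o\<^sub>L S e v f = 0"
  by (rule S_compose_zero) (auto dest: cat_C C_eq)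

lemma p_invariant: "v \<in> verts G \<Longrightarrow> invariant (S [] v [])"
  unfolding invariant_def by (simp add: \<alpha>_S)

lemma vs_verts: "fp e v \<Longrightarrow> vs e v \<in> verts G"
  by (cases e) auto

lemma p_pos: "v \<in> verts G \<Longrightarrow> S [] v [] \<in> positive_part A"
  using pos_adj_compose[OF p_in[of v]] S_source_range[of "[]" v "[]"] by simp

text \<open>The Cuntz-Krieger relation at \<open>v\<close>: an arrow whose range starts at
  \<open>v\<close> lies in \<open>D [a] (head G a)\<close> for exactly one edge \<open>a\<close>,
  the first edge of its range.\<close>

lemma p_sum:
  assumes v: "v \<in> verts G"
  shows "S [] v [] = (\<Sum>a\<in>out_arcs G v. S [a] (head G a) [a])"
proof (rule blinfun_eqI, rule ell2_eqI)
  fix x \<gamma>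
  have fin: "finite (out_arcs G v)" by (rule finite_out_arcs[OF v])
  have fpa: "fp [a] (head G a)" if "a \<in> out_arcs G v" for a using that by simp
  have \<tau>: "\<tau> e e \<gamma> = \<gamma>" if "\<gamma> \<in> D e w" for e w
    using that unfolding D_iff by (auto simp: \<tau>_cat)
  have "Rep_ell2 (blinfun_apply (\<Sum>a\<in>out_arcs G v. S [a] (head G a) [a]) x) \<gamma> =
      (\<Sum>a\<in>out_arcs G v. if \<gamma> \<in> D [a] (head G a) then Rep_ell2 x \<gamma> else 0)"
    unfolding blinfun.sum_left Rep_ell2_sum by (rule sum.cong) (simp_all add: Rep_S fpa \<tau>)
  also have "\<dots> = (if \<gamma> \<in> D [] v then Rep_ell2 x \<gamma> else 0)"
  proof (cases "\<gamma> \<in> D [] v")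
    case True
    then obtain p k z where p: "p \<in> C v" "\<gamma> = (p, k, z)" "\<gamma> \<in> \<Gamma>" unfolding D_iff by auto
    have P: "p \<in> paths G" using p(1) by (rule C_paths)
    have D_iff': "\<gamma> \<in> D [a] (head G a) \<longleftrightarrow> a = p 0" if "a \<in> out_arcs G v" for a
    proof
      assume "\<gamma> \<in> D [a] (head G a)"
      then obtain q where "p = cat [a] q" unfolding D_iff p(2) by blast
      then show "a = p 0" by simp
    next
      assume a: "a = p 0"
      have "p = cat [p 0] ((\<sigma> ^^ 1) p)" using cat_pre[of p 1] by (simp add: pre_def)
      moreover have "(\<sigma> ^^ 1) p \<in> C (head G (p 0))" using shift_C[OF P, of 1] P by (simp add: paths_def)
      ultimately show "\<gamma> \<in> D [a] (head G a)" unfolding D_iff a using p by blast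
    qed
    have "p 0 \<in> out_arcs G v" using p(1) P by (auto simp: C_def paths_def)
    then have "(\<Sum>a\<in>out_arcs G v. if \<gamma> \<in> D [a] (head G a) then Rep_ell2 x \<gamma> else 0) =
        (\<Sum>a\<in>out_arcs G v. if a = p 0 then Rep_ell2 x \<gamma> else 0)"
      by (intro sum.cong) (simp_all add: D_iff')
    then show ?thesis using True \<open>p 0 \<in> out_arcs G v\<close> fin by simp
  next
    case False
    have "\<gamma> \<notin> D [a] (head G a)" if "a \<in> out_arcs G v" for a
    proof
      assume "\<gamma> \<in> D [a] (head G a)"
      then obtain q k z where q: "q \<in> C (head G a)" "\<gamma> = (cat [a] q, k, z)" "\<gamma> \<in> \<Gamma>" unfolding D_iff by blast
      have "cat [a] q \<in> C v" using cat_C[OF fpa[OF that] q(1)] that by simp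
      then show False using False q unfolding D_iff by simp
    qed
    then show ?thesis using False by simp
  qed
  also have "\<dots> = Rep_ell2 (blinfun_apply (S [] v []) x) \<gamma>"
    using v \<tau>[of "[]" v] by (simp add: Rep_S)
  finally show "Rep_ell2 (blinfun_apply (S [] v []) x) \<gamma> =
      Rep_ell2 (blinfun_apply (\<Sum>a\<in>out_arcs G v. S [a] (head G a) [a]) x) \<gamma>" by simp
qed

text \<open>Finite sets exhausting the vertices, also when there are infinitely many.\<close>

definition en :: "nat \<Rightarrow> 'v set" where
  "en n = {v \<in> verts G. to_nat_on (verts G) v < n}"

lemma finite_en: "finite (en n)"
proof (rule finite_imageD)
  show "finite (to_nat_on (verts G) ` en n)" by (rule finite_subset[of _ "{..<n}"]) (auto simp: en_def)
  show "inj_on (to_nat_on (verts G)) (en n)"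
    by (rule inj_on_subset[OF inj_on_to_nat_on[OF countable_verts]]) (auto simp: en_def)
qed

lemma en_verts: "v \<in> en n \<Longrightarrow> v \<in> verts G"
  by (simp add: en_def)

lemma en_eventually: "v \<in> verts G \<Longrightarrow> \<exists>m. \<forall>n\<ge>m. v \<in> en n"
  by (intro exI[of _ "Suc (to_nat_on (verts G) v)"]) (auto simp: en_def)

text \<open>An increasing approximate unit of invariant projections; being finite sums of vertex
  projections, they will have finite weight.\<close>

definition pe :: "nat \<Rightarrow> 'e arrow operator" where
  "pe n = (\<Sum>v\<in>en n. S [] v [])"

lemma compose_sum_left: "(\<Sum>i\<in>I. f i) o\<^sub>L b = (\<Sum>i\<in>I. f i o\<^sub>L b)"
  by (rule bounded_bilinear.sum_left[OF bounded_bilinear_blinfun_compose])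

lemma pe_S:
  assumes "fp g v" "fp f v"
  shows "pe n o\<^sub>L S g v f = (if vs g v \<in> en n then S g v f else 0)"
proof -
  have "pe n o\<^sub>L S g v f = (\<Sum>w\<in>en n. if w = vs g v then S g v f else 0)"
    unfolding pe_def compose_sum_left
    by (rule sum.cong) (use p_S p_S_zero assms en_verts in auto)
  then show ?thesis using finite_en by (simp add: sum.delta)
qed

lemma pe_adj: "adjointable (pe n) \<and> adj_op (pe n) = pe n"
proof -
  have "adjointable (\<Sum>v\<in>I. S [] v []) \<and> adj_op (\<Sum>v\<in>I. S [] v []) = (\<Sum>v\<in>I. S [] v [])"
    if "finite I" "I \<subseteq> verts G" for I
    using that
    by (induction I rule: finite_induct) (auto simp: adjointable_add adj_add adjointable_S adj_S)
  then show ?thesis unfolding pe_def using finite_en en_verts by blast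
qed

lemma pe_idem: "pe n o\<^sub>L pe n = pe n"
proof -
  have "pe n o\<^sub>L pe n = (\<Sum>v\<in>en n. pe n o\<^sub>L S [] v [])"
    by (subst (2) pe_def) (rule bounded_bilinear.sum_right[OF bounded_bilinear_blinfun_compose])
  also have "\<dots> = pe n" unfolding pe_def[of n]
    by (rule sum.cong) (auto simp: pe_S[unfolded pe_def] en_verts)
  finally show ?thesis .
qed

lemma zero_A: "0 \<in> A"
  by (rule star_algebra.zero[OF star_algebra_A])

lemma sum_in_A: "finite I \<Longrightarrow> (\<And>i. i \<in> I \<Longrightarrow> f i \<in> A) \<Longrightarrow> sum f I \<in> A"
  by (induction I rule: finite_induct) (auto intro: zero_A add)

lemma pe_in: "pe n \<in> A"
  unfolding pe_def by (intro sum_in_A finite_en p_in en_verts)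

lemma S_pe:
  assumes "fp g v" "fp f v"
  shows "S g v f o\<^sub>L pe n = (if vs f v \<in> en n then S g v f else 0)"
proof -
  have "adj_op (S g v f o\<^sub>L pe n) = pe n o\<^sub>L S f v g"
    using pe_adj by (simp add: adj_compose adjointable_S assms adj_S)
  then have "adj_op (adj_op (S g v f o\<^sub>L pe n)) = (if vs f v \<in> en n then S g v f else 0)"
    by (simp add: pe_S assms adj_S)
  then show ?thesis using pe_adj by (simp add: adj_adj adjointable_compose adjointable_S assms)
qed

lemma pe_pos: "pe n \<in> positive_part A"
  using pos_adj_compose[OF pe_in, of n] pe_adj pe_idem by simp

lemma norm_pe_le: "norm (pe n) \<le> 1"
proof (rule norm_blinfun_bound)
  fix x
  let ?y = "blinfun_apply (pe n) x"
  have "cinner_ell2 ?y ?y = cinner_ell2 x (blinfun_apply (pe n) ?y)"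
    using cinner_adj_left[of "pe n" x ?y] pe_adj by simp
  also have "blinfun_apply (pe n) ?y = ?y" using pe_idem by (metis blinfun_apply_blinfun_compose)
  finally have "cinner_ell2 x ?y = of_real ((norm ?y)\<^sup>2)" unfolding cinner_self by simp
  then have "(norm ?y)\<^sup>2 = cmod (cinner_ell2 x ?y)" by (simp add: norm_power)
  also have "\<dots> \<le> norm x * norm ?y" by (rule cmod_cinner_le)
  finally show "norm ?y \<le> 1 * norm x"
    by (cases "?y = 0") (auto simp: power2_eq_square)
qed simp

lemma pe_invariant: "invariant (pe n)"
proof -
  have "\<alpha> t (\<Sum>v\<in>I. S [] v []) = (\<Sum>v\<in>I. S [] v [])" if "finite I" "I \<subseteq> verts G" for I t
    using that
    by (induction I rule: finite_induct) (use p_invariant in \<open>auto simp: \<alpha>_zero \<alpha>_add invariant_def\<close>)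
  then show ?thesis unfolding pe_def invariant_def using finite_en en_verts by blast
qed

text \<open>A generator is fixed as soon as its initial vertex has been reached; the uniform bound
  on \<open>norm (pe n)\<close> carries the convergence to limits.\<close>

lemma pe_approx: "a \<in> A \<Longrightarrow> (\<lambda>n. pe n o\<^sub>L a) \<longlonglongrightarrow> a"
proof (induction a rule: A_induct)
  case zero
  then show ?case by (simp add: compose_zero_right)
next
  case (S g v f)
  obtain m where "\<forall>n\<ge>m. vs g v \<in> en n" using en_eventually[OF vs_verts[OF S(1)]] by blast
  then have "\<forall>\<^sub>F n in sequentially. pe n o\<^sub>L S g v f = S g v f"
    by (auto simp: eventually_sequentially pe_S S)
  then show ?case by (rule tendsto_eventually)
next
  case (add x y)
  then show ?case unfolding compose_add_right by (intro tendsto_add)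
next
  case (cscale c x)
  have "pe n o\<^sub>L cscale_op c x = cscale_op c (pe n o\<^sub>L x)" for n
    using pe_adj by (simp add: compose_cscale_right)
  then show ?case using cscale by (simp add: tendsto_cscale_op)
next
  case (limit s x)
  show ?case
  proof (rule LIMSEQ_I)
    fix \<epsilon> :: real assume \<epsilon>: "0 < \<epsilon>"
    obtain n where n: "norm (s n - x) < \<epsilon> / 3"
      using LIMSEQ_D[OF \<open>s \<longlonglongrightarrow> x\<close>, of "\<epsilon> / 3"] \<epsilon> by auto
    obtain M where M: "\<And>j. j \<ge> M \<Longrightarrow> norm ((pe j o\<^sub>L s n) - s n) < \<epsilon> / 3"
      using LIMSEQ_D[of "\<lambda>j. pe j o\<^sub>L s n" "s n" "\<epsilon> / 3"] limit \<epsilon> by auto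
    have "norm ((pe j o\<^sub>L x) - x) < \<epsilon>" if "j \<ge> M" for j
    proof -
      let ?a = "pe j o\<^sub>L (x - s n)" and ?b = "(pe j o\<^sub>L s n) - s n" and ?c = "s n - x"
      have "(pe j o\<^sub>L x) - x = (?a + ?b) + ?c"
        by (simp add: compose_diff_right)
      then have "norm ((pe j o\<^sub>L x) - x) \<le> norm ?a + norm ?b + norm ?c"
        using norm_triangle_ineq[of "?a + ?b" ?c] norm_triangle_ineq[of ?a ?b] by simp
      moreover have "norm (pe j o\<^sub>L (x - s n)) \<le> 1 * norm (x - s n)"
        by (rule order_trans[OF norm_blinfun_compose]) (intro mult_right_mono norm_pe_le norm_ge_zero)
      ultimately show ?thesis using M[OF that] n by (simp add: norm_minus_commute)
    qed
    then show "\<exists>M. \<forall>j\<ge>M. norm ((pe j o\<^sub>L x) - x) < \<epsilon>" by blast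
  qed
qed

text \<open>Convergence from the right follows from the left version for the adjoint; compressing by
  a contraction does not spoil it.\<close>

lemma pe_approx_both:
  assumes a: "a \<in> A"
  shows "(\<lambda>n. pe n o\<^sub>L a o\<^sub>L pe n) \<longlonglongrightarrow> a"
proof -
  have "(\<lambda>n. adj_op (pe n o\<^sub>L adj_op a)) \<longlonglongrightarrow> adj_op (adj_op a)"
    by (rule adjointable_limit(2)[OF pe_approx[OF adj[OF a]]])
      (use pe_adj a in \<open>simp add: adjointable_compose adjointable adj\<close>)
  moreover have "adj_op (pe n o\<^sub>L adj_op a) = a o\<^sub>L pe n" for n
    using pe_adj a by (simp add: adj_compose adjointable adj adj_adj)
  ultimately have r: "(\<lambda>n. a o\<^sub>L pe n) \<longlonglongrightarrow> a" using a by (simp add: adj_adj adjointable)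
  have "norm ((pe n o\<^sub>L a o\<^sub>L pe n) - (pe n o\<^sub>L a)) \<le> norm ((a o\<^sub>L pe n) - a)" for n
  proof -
    have "(pe n o\<^sub>L a o\<^sub>L pe n) - (pe n o\<^sub>L a) = pe n o\<^sub>L ((a o\<^sub>L pe n) - a)"
      by (simp add: compose_diff_right compose_assoc)
    then have "norm ((pe n o\<^sub>L a o\<^sub>L pe n) - (pe n o\<^sub>L a)) \<le> norm (pe n) * norm ((a o\<^sub>L pe n) - a)"
      using norm_blinfun_compose by metis
    also have "\<dots> \<le> 1 * norm ((a o\<^sub>L pe n) - a)" by (intro mult_right_mono norm_pe_le norm_ge_zero)
    finally show ?thesis by simp
  qed
  moreover have "(\<lambda>n. norm ((a o\<^sub>L pe n) - a)) \<longlonglongrightarrow> 0"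
    using r by (simp add: LIM_zero tendsto_norm_zero)
  ultimately have "(\<lambda>n. (pe n o\<^sub>L a o\<^sub>L pe n) - (pe n o\<^sub>L a)) \<longlonglongrightarrow> 0"
    by - (rule Lim_null_comparison[of _ "\<lambda>n. norm ((a o\<^sub>L pe n) - a)"], simp_all)
  from tendsto_add[OF this pe_approx[OF a]] show ?thesis by simp
qed

end

lemma (in path_graph) corner_pos: "a \<in> positive_part A \<Longrightarrow> pe n o\<^sub>L a o\<^sub>L pe n \<in> positive_part A"
  using nonneg_op_conj[of "pe n" a] pe_adj compose pe_in by (auto simp: positive_part_eq)

section \<open>What the KMS condition forces\<close>

locale kms_weight = path_graph G for G :: "('v, 'e) pre_digraph" +
  fixes \<beta> :: real and \<psi> :: "'e arrow operator \<Rightarrow> ennreal"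
  assumes kms: "KMS_weight (graph_algebra G) (gauge_action G) \<beta> \<psi>"

sublocale kms_weight \<subseteq> proper_weight_on "graph_algebra G" \<psi>
  using kms by unfold_locales (simp add: KMS_weight_def)

context kms_weight
begin

lemma \<psi>_K: "a \<in> K \<Longrightarrow> \<psi> a = ennreal (enn2real (\<psi> a))"
  by (simp add: K_def)

lemma weight_\<alpha>: "a \<in> positive_part A \<Longrightarrow> \<psi> (\<alpha> t a) = \<psi> a"
  using kms gauge_action_eq[OF pos_in, of a t] unfolding KMS_weight_def by metis

lemma twisted_trace:
  assumes a: "a \<in> N" "adj_op a \<in> N" and b: "b \<in> N" "adj_op b \<in> N"
    and deg: "\<And>t. \<alpha> t b = cscale_op (phase t k) b"
  shows "\<phi> (b o\<^sub>L a) = exp (- of_real \<beta> * of_int k) * \<phi> (a o\<^sub>L b)"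
proof -
  have A: "a \<in> A" "b \<in> A" using a b N_in by auto
  have M: "a o\<^sub>L b \<in> M" "b o\<^sub>L a \<in> M" using M_compose A a b by auto
  have "\<exists>F. continuous_on (strip \<beta>) F \<and> bounded (F ` strip \<beta>) \<and>
             F holomorphic_on interior (strip \<beta>) \<and>
             (\<forall>t::real.
                F (of_real t) = \<phi> (a o\<^sub>L gauge_action G t b) \<and>
                F (of_real t + \<i> * of_real \<beta>) = \<phi> (gauge_action G t b o\<^sub>L a))"
    using kms A a b unfolding KMS_weight_def by blast
  then obtain F where F: "continuous_on (strip \<beta>) F" "F holomorphic_on interior (strip \<beta>)"
    "\<And>t. F (of_real t) = \<phi> (a o\<^sub>L gauge_action G t b)"
    "\<And>t. F (of_real t + \<i> * of_real \<beta>) = \<phi> (gauge_action G t b o\<^sub>L a)" by blast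
  have g: "gauge_action G t b = cscale_op (phase t k) b" for t
    using gauge_action_eq[OF A(2)] deg by simp
  have F0: "F (of_real t) = phase t k * \<phi> (a o\<^sub>L b)" for t
    unfolding F(3) g compose_cscale_right[OF adjointable[OF A(1)]] functional_cscale[OF M(1)] ..
  have F1: "F (\<i> * of_real \<beta>) = \<phi> (b o\<^sub>L a)"
    using F(4)[of 0] unfolding g compose_cscale_left functional_cscale[OF M(2)] by simp
  let ?H = "\<lambda>z. F z - exp (\<i> * of_int k * z) * \<phi> (a o\<^sub>L b)"
  have "?H (\<i> * of_real \<beta>) = 0"
  proof (rule strip_identity)
    show "continuous_on (strip \<beta>) ?H" by (intro continuous_intros F)
    show "?H holomorphic_on interior (strip \<beta>)" by (intro holomorphic_intros F)
    show "?H (of_real t) = 0" for t unfolding F0 phase_def by simp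
  qed
  then show ?thesis unfolding F1 by (simp add: mult_ac)
qed

lemma trace:
  assumes "a \<in> N" "adj_op a \<in> N" "b \<in> N" "adj_op b \<in> N" "invariant b"
  shows "\<phi> (b o\<^sub>L a) = \<phi> (a o\<^sub>L b)"
  using twisted_trace[OF assms(1-4), of 0] assms(5) by (simp add: invariant_def)

text \<open>The averages of \<open>a\<close> all have the weight of \<open>a\<close>, so lower
  semi-continuity keeps their limit in \<open>K\<close>. They are contractive and fix an invariant
  \<open>x\<close>, so they come no farther from it. The gain is an approximant to which
  \<open>trace\<close> applies.\<close>

lemma invariant_approx:
  assumes a: "a \<in> K"
  shows "\<exists>d\<in>K. invariant d \<and> (\<forall>x\<in>A. invariant x \<longrightarrow> norm (d - x) \<le> norm (a - x))"
proof -
  have aP: "a \<in> positive_part A" using a by (simp add: K_def)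
  have aA: "a \<in> A" by (rule pos_in[OF aP])
  obtain d where d: "(\<lambda>m. av m a) \<longlonglongrightarrow> d" "invariant d" using av_limit[OF aA] by blast
  have "\<psi> (av m a) = \<psi> a" for m
  proof (induction m)
    case (Suc m)
    have "\<psi> (av (Suc m) a) = ennreal (1/2) * (\<psi> (av m a) + \<psi> (\<alpha> (pi / 2 ^ m) (av m a)))"
      using weight_scale0[of "av m a + \<alpha> (pi / 2 ^ m) (av m a)" "1/2"]
        weight_add[OF av_pos[OF aP] \<alpha>_pos[OF av_pos[OF aP]], of m "pi / 2 ^ m" m] pos_add av_pos \<alpha>_pos aP
      by simp
    also have "\<dots> = (ennreal (1/2) + ennreal (1/2)) * \<psi> a"
      unfolding weight_\<alpha>[OF av_pos[OF aP]] Suc by (simp only: distrib_left distrib_right)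
    also have "ennreal (1/2) + ennreal (1/2) = 1" by (subst ennreal_plus[symmetric]) auto
    finally show ?case by simp
  qed simp
  then have "\<psi> d \<le> \<psi> a" by (intro weight_lsc[OF d(1) av_pos[OF aP]]) simp
  moreover have "d \<in> positive_part A"
    unfolding positive_part_eq
    using limit[OF d(1) av_in[OF aA]] nonneg_op_limit[OF d(1)] av_pos[OF aP] positive_part_eq by blast
  ultimately have "d \<in> K" using a unfolding K_def by (auto intro: le_less_trans)
  moreover have "norm (d - x) \<le> norm (a - x)" if "x \<in> A" "invariant x" for x
  proof (rule LIMSEQ_le_const2)
    show "(\<lambda>m. norm (av m a - x)) \<longlonglongrightarrow> norm (d - x)" by (intro tendsto_intros d)
    have "norm (av m a - x) \<le> norm (a - x)" for m
      using norm_av_le[of m "a - x"] av_invariant[OF that(2)] by (simp add: av_diff)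
    then show "\<exists>M. \<forall>m\<ge>M. norm (av m a - x) \<le> norm (a - x)" by blast
  qed
  ultimately show ?thesis using d(2) by blast
qed

lemma invariant_compose: "invariant a \<Longrightarrow> invariant b \<Longrightarrow> invariant (a o\<^sub>L b)"
  by (simp add: invariant_def \<alpha>_compose)

text \<open>Let p be the projection of \<open>v\<close>. Averaging gives invariant d_n in
  \<open>K\<close> tending to p, and h is one of them close to p. It would suffice that h p lies in
  \<open>N\<close>, but \<open>N\<close> is only a left ideal, so h in \<open>N\<close> does not
  give this. The elements x_n = h p d_n do lie in \<open>N\<close> and tend to h p. By the trace
  property their squares have the same weight as the squares of their adjoints d_n p h, which are
  bounded uniformly in n because h is on the right. Lower semi-continuity bounds the weight for h p,
  and p is dominated by a multiple of its square.\<close>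

lemma p_finite:
  assumes v: "v \<in> verts G"
  shows "S [] v [] \<in> K"
proof -
  let ?p = "S [] v []"
  have pA: "?p \<in> A" by (rule p_in[OF v])
  have padj: "adj_op ?p = ?p" using v by (simp add: adj_S)
  have pp: "?p o\<^sub>L ?p = ?p" using S_source_range[of "[]" v "[]"] v by (simp add: adj_S)
  have pinv: "invariant ?p" by (rule p_invariant[OF v])
  have "?p \<in> closure K" using weight_dense p_pos[OF v] by blast
  then obtain a where a: "\<And>n. a n \<in> K" "a \<longlonglongrightarrow> ?p" unfolding closure_sequential by blast
  obtain d where d: "\<And>n. d n \<in> K" "\<And>n. invariant (d n)" "\<And>n. norm (d n - ?p) \<le> norm (a n - ?p)"
    using invariant_approx[OF a(1)] pA pinv by metis
  have dA: "d n \<in> A" and dadj: "adj_op (d n) = d n" and dN: "d n \<in> N" for n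
    using d(1)[of n] N_self_adjoint by (auto simp: K_def pos_in pos_self_adjoint)
  have "(\<lambda>n. norm (a n - ?p)) \<longlonglongrightarrow> 0" using a(2) by (simp add: LIM_zero tendsto_norm_zero)
  then have "(\<lambda>n. d n - ?p) \<longlonglongrightarrow> 0"
    using d(3) by - (rule Lim_null_comparison[of _ "\<lambda>n. norm (a n - ?p)"], simp_all)
  then have d_lim: "d \<longlonglongrightarrow> ?p" by (rule LIM_zero_cancel)
  then obtain B where B: "\<And>n. norm (d n) \<le> B"
    using Bseq_def convergent_def convergent_imp_Bseq by blast
  obtain m where m: "norm (d m - ?p) < 1/2" using LIMSEQ_D[OF d_lim, of "1/2"] by auto
  let ?h = "d m"
  define x where "x n = ?h o\<^sub>L ?p o\<^sub>L d n" for n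
  have xA: "x n \<in> A" for n unfolding x_def by (intro compose dA pA)
  have xadj: "adj_op (x n) = (d n o\<^sub>L ?p) o\<^sub>L ?h" for n
    unfolding x_def using dA pA by (simp add: adj_compose adjointable adjointable_compose dadj padj compose_assoc)
  have xN: "x n \<in> N" "adj_op (x n) \<in> N" for n
    unfolding xadj unfolding x_def by (auto intro!: N_left_ideal compose dA pA dN)
  have xinv: "invariant (x n)" for n unfolding x_def by (intro invariant_compose d pinv)
  \<comment> \<open>The trace property moves the fixed factor \<open>?h\<close> to the right, where
    the left ideal estimate can use it.\<close>
  have xx: "\<psi> (adj_op (x n) o\<^sub>L x n) = \<psi> (x n o\<^sub>L adj_op (x n))" for n
  proof -
    have k: "adj_op (x n) o\<^sub>L x n \<in> K" "x n o\<^sub>L adj_op (x n) \<in> K"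
      using xN[of n] by (auto simp: N_iff adj_adj adjointable[OF xA])
    have "\<phi> (x n o\<^sub>L adj_op (x n)) = \<phi> (adj_op (x n) o\<^sub>L x n)"
      by (rule trace) (auto simp: xN adj_adj adjointable[OF xA] xinv)
    then have "enn2real (\<psi> (x n o\<^sub>L adj_op (x n))) = enn2real (\<psi> (adj_op (x n) o\<^sub>L x n))"
      using functional_K k by simp
    then show ?thesis using \<psi>_K k by metis
  qed
  have bound: "\<psi> (adj_op (x n) o\<^sub>L x n) \<le> ennreal ((B * norm ?p)\<^sup>2) * \<psi> (?h o\<^sub>L ?h)" for n
  proof -
    have "\<psi> (x n o\<^sub>L adj_op (x n)) \<le> ennreal ((norm (d n o\<^sub>L ?p))\<^sup>2) * \<psi> (?h o\<^sub>L ?h)"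
      using weight_left_bound[OF compose[OF dA pA] dA, of n m] unfolding xadj[symmetric]
      by (simp add: adj_adj adjointable[OF xA] dadj)
    also have "\<dots> \<le> ennreal ((B * norm ?p)\<^sup>2) * \<psi> (?h o\<^sub>L ?h)"
    proof (intro mult_right_mono ennreal_leI power_mono)
      show "norm (d n o\<^sub>L ?p) \<le> B * norm ?p"
        by (rule order_trans[OF norm_blinfun_compose]) (intro mult_right_mono B norm_ge_zero)
    qed auto
    finally show ?thesis unfolding xx .
  qed
  have hh: "\<psi> (?h o\<^sub>L ?h) < \<infinity>" using dN[of m] by (simp add: N_iff K_def dadj)
  have x_lim: "x \<longlonglongrightarrow> (?h o\<^sub>L ?p)"
    unfolding x_def using tendsto_compose_op[OF tendsto_const[of "?h o\<^sub>L ?p"] d_lim]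
    by (simp add: compose_assoc pp)
  then have xx_lim: "(\<lambda>n. adj_op (x n) o\<^sub>L x n) \<longlonglongrightarrow> (adj_op (?h o\<^sub>L ?p) o\<^sub>L (?h o\<^sub>L ?p))"
    by (intro tendsto_compose_op adjointable_limit(2) adjointable xA)
  have "\<psi> (adj_op (?h o\<^sub>L ?p) o\<^sub>L (?h o\<^sub>L ?p)) \<le> ennreal ((B * norm ?p)\<^sup>2) * \<psi> (?h o\<^sub>L ?h)"
    by (rule weight_lsc[OF xx_lim pos_adj_compose[OF xA] bound])
  also have "\<dots> < \<infinity>" using hh by (simp add: ennreal_mult_less_top)
  finally have K1: "adj_op (?h o\<^sub>L ?p) o\<^sub>L (?h o\<^sub>L ?p) \<in> K"
    unfolding K_def using pos_adj_compose[OF compose[OF dA pA]] by simp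
  show ?thesis
  proof (rule K_hereditary[OF K_scale[OF K1, of 4] pA])
    show "nonneg_op ?p" using p_pos[OF v] by (simp add: positive_part_eq)
    \<comment> \<open>Since \<open>?h\<close> is within 1/2 of the projection, it shrinks vectors in
      the range of the projection at most by the factor 2; squaring gives the constant 4.\<close>
    show "nonneg_op (4 *\<^sub>R (adj_op (?h o\<^sub>L ?p) o\<^sub>L (?h o\<^sub>L ?p)) - ?p)"
      unfolding nonneg_op_def
    proof (intro allI)
      fix y
      let ?y = "blinfun_apply ?p y"
      have 1: "cinner_ell2 y (blinfun_apply (adj_op (?h o\<^sub>L ?p) o\<^sub>L (?h o\<^sub>L ?p)) y) =
          of_real ((norm (blinfun_apply ?h ?y))\<^sup>2)"
        using cinner_adj_right[OF adjointable[OF compose[OF dA pA]]] by (simp add: cinner_self)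
      have 2: "cinner_ell2 y ?y = of_real ((norm ?y)\<^sup>2)"
        using cinner_adj_right[OF adjointable[OF pA], of y ?y] pp unfolding padj
        by (metis blinfun_apply_blinfun_compose cinner_self)
      have eq: "cinner_ell2 y (blinfun_apply (4 *\<^sub>R (adj_op (?h o\<^sub>L ?p) o\<^sub>L (?h o\<^sub>L ?p)) - ?p) y) =
          of_real (4 * (norm (blinfun_apply ?h ?y))\<^sup>2 - (norm ?y)\<^sup>2)"
        unfolding blinfun.diff_left blinfun.scaleR_left cinner_diff_right cinner_scaleR_right 1 2 by simp
      have "?y = blinfun_apply ?h ?y - blinfun_apply (?h - ?p) ?y"
        using pp by (simp add: blinfun.diff_left) (metis blinfun_apply_blinfun_compose)
      then have "norm ?y \<le> norm (blinfun_apply ?h ?y) + norm (blinfun_apply (?h - ?p) ?y)"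
        by (metis norm_triangle_ineq4)
      moreover have "norm (blinfun_apply (?h - ?p) ?y) \<le> (1/2) * norm ?y"
        by (rule order_trans[OF norm_blinfun]) (intro mult_right_mono, use m in auto)
      ultimately have "norm ?y \<le> 2 * norm (blinfun_apply ?h ?y)" by linarith
      then have "(norm ?y)\<^sup>2 \<le> (2 * norm (blinfun_apply ?h ?y))\<^sup>2" by (intro power_mono) auto
      then show "Im (cinner_ell2 y (blinfun_apply (4 *\<^sub>R (adj_op (?h o\<^sub>L ?p) o\<^sub>L (?h o\<^sub>L ?p)) - ?p) y)) = 0 \<and>
          0 \<le> Re (cinner_ell2 y (blinfun_apply (4 *\<^sub>R (adj_op (?h o\<^sub>L ?p) o\<^sub>L (?h o\<^sub>L ?p)) - ?p) y))"
        unfolding eq by (simp add: power_mult_distrib)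
    qed
  qed simp
qed

text \<open>Multiplying from the right by the projection at the start of \<open>f\<close>, which has
  finite weight, changes nothing, and \<open>N\<close> is a left ideal.\<close>

lemma S_N:
  assumes "fp g v" "fp f v"
  shows "S g v f \<in> N"
proof -
  have "S g v f = S g v f o\<^sub>L S [] (vs f v) []"
    using S_compose_left[of g v "[]" f "vs f v" "[]"] assms vs_verts by simp
  moreover have "S [] (vs f v) [] \<in> N" using N_self_adjoint p_finite vs_verts assms by blast
  ultimately show ?thesis using N_left_ideal[OF S_in[OF assms]] by metis
qed

lemma S_M:
  assumes "fp g v" "fp f v"
  shows "S g v f \<in> M"
proof -
  have "S g v f = adj_op (S [] (vs g v) []) o\<^sub>L S g v f"
    using p_S[OF assms] vs_verts[OF assms(1)] by (simp add: adj_S)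
  then show ?thesis using M_adj_compose[OF S_N S_N[OF assms]] vs_verts[OF assms(1)] by (metis fpath.simps(1))
qed

text \<open>Invariance is part of the KMS condition for the weight only; it reaches the functional
  through a decomposition into four elements of \<open>K\<close>.\<close>

lemma functional_\<alpha>: "x \<in> M \<Longrightarrow> \<phi> (\<alpha> t x) = \<phi> x"
proof -
  assume "x \<in> M"
  then obtain z where z: "(x, z) \<in> quads" using quads_M by blast
  then obtain a b c d where q: "x = quad a b c d" "z = quad_val a b c d" "a \<in> K" "b \<in> K" "c \<in> K" "d \<in> K"
    unfolding quads_def by blast
  have K\<alpha>: "\<alpha> t a \<in> K \<and> \<psi> (\<alpha> t a) = \<psi> a" if "a \<in> K" for a
    using that weight_\<alpha> \<alpha>_pos unfolding K_def by auto
  have "\<alpha> t x = quad (\<alpha> t a) (\<alpha> t b) (\<alpha> t c) (\<alpha> t d)"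
    unfolding q quad_def by (simp add: \<alpha>_add \<alpha>_diff \<alpha>_cscale)
  moreover have "z = quad_val (\<alpha> t a) (\<alpha> t b) (\<alpha> t c) (\<alpha> t d)"
    unfolding q quad_val_def using K\<alpha> q by simp
  ultimately have "(\<alpha> t x, z) \<in> quads" unfolding quads_def using K\<alpha> q by blast
  then show ?thesis using functional_eqI z by metis
qed

definition \<xi> :: "'v \<Rightarrow> real" where
  "\<xi> v = enn2real (\<psi> (S [] v []))"

lemma \<psi>_p: "v \<in> verts G \<Longrightarrow> \<psi> (S [] v []) = ennreal (\<xi> v)"
  using p_finite[of v] unfolding \<xi>_def K_def by simp

lemma \<phi>_p: "v \<in> verts G \<Longrightarrow> \<phi> (S [] v []) = of_real (\<xi> v)"
  unfolding \<xi>_def by (rule functional_K[OF p_finite])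

lemma functional_S:
  assumes g: "fp g v" "fp f v"
  shows "\<phi> (S g v f) = (if g = f then of_real (exp (- \<beta> * real (length g)) * \<xi> v) else 0)"
proof -
  have v: "v \<in> verts G" using g fp_verts by blast
  let ?k = "int (length g) - int (length f)"
  consider "?k \<noteq> 0" | "?k = 0" "g \<noteq> f" | "g = f" by blast
  then show ?thesis
  proof cases
    case 1
    \<comment> \<open>At this time the gauge action is multiplication by -1 on degree
      \<open>?k\<close>, so invariance makes the value equal to its negative.\<close>
    have "phase (pi / of_int ?k) ?k = -1"
      using 1 exp_pi_i' by (simp add: phase_def)
    then have "\<alpha> (pi / of_int ?k) (S g v f) = cscale_op (-1) (S g v f)"
      using \<alpha>_S[OF g, of "pi / of_int ?k"] by simp
    then have "\<phi> (S g v f) = - \<phi> (S g v f)"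
      using functional_\<alpha>[OF S_M[OF g], of "pi / of_int ?k"] functional_cscale[OF S_M[OF g], of "-1"] by simp
    then show ?thesis using 1 by auto
  next
    case 2
    \<comment> \<open>For distinct paths of equal length the invariant range projection acts as a
      unit on the left and as zero on the right; the trace property equates the two values.\<close>
    have inv: "invariant (S g v g)" using \<alpha>_S[OF g(1,1)] by (simp add: invariant_def)
    have "\<phi> (S g v g o\<^sub>L S g v f) = \<phi> (S g v f o\<^sub>L S g v g)"
      by (rule trace) (simp_all add: S_N g adj_S inv)
    moreover have "S g v f o\<^sub>L S g v g = 0"
      by (rule S_compose_zero) (use g 2 in \<open>auto simp: cat_inject\<close>)
    moreover have "S g v g o\<^sub>L S g v f = S g v f"
      using S_compose_right[of g v g "[]" v f] g v by simp
    ultimately have "\<phi> (S g v f) = \<phi> 0" by simp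
    then show ?thesis using 2 functional_K[OF K_zero] by (simp add: weight_zero)
  next
    case 3
    \<comment> \<open>The range and the source projection of the isometry of \<open>g\<close> are
      exchanged by the twisted trace in degree \<open>length g\<close>, which produces the
      exponential.\<close>
    have "\<phi> (S g v [] o\<^sub>L S [] v g) =
        exp (- of_real \<beta> * of_int (int (length g))) * \<phi> (S [] v g o\<^sub>L S g v [])"
      by (rule twisted_trace) (use g v \<alpha>_S[of g v "[]"] in \<open>auto simp: S_N adj_S\<close>)
    moreover have "S g v [] o\<^sub>L S [] v g = S g v g"
      using S_compose_right[of g v "[]" "[]" v g] g v by simp
    moreover have "S [] v g o\<^sub>L S g v [] = S [] v []"
      using S_source_range[of g v "[]"] g v by (simp add: adj_S)
    ultimately have "\<phi> (S g v g) = exp (- of_real \<beta> * of_nat (length g)) * of_real (\<xi> v)"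
      using \<phi>_p[OF v] by simp
    then show ?thesis using 3 by (simp add: exp_of_real[symmetric])
  qed
qed

lemma \<xi>_nonneg: "0 \<le> \<xi> v"
  by (simp add: \<xi>_def)

lemma \<xi>_eigen:
  assumes v: "v \<in> verts G"
  shows "(\<Sum>\<^sub>\<infinity>w\<in>verts G. real (adjacency G v w) * \<xi> w) = exp \<beta> * \<xi> v"
proof -
  have fin: "finite (out_arcs G v)" by (rule finite_out_arcs[OF v])
  have fpa: "fp [a] (head G a)" if "a \<in> out_arcs G v" for a using that by simp
  have "complex_of_real (\<xi> v) = (\<Sum>a\<in>out_arcs G v. \<phi> (S [a] (head G a) [a]))"
    unfolding \<phi>_p[OF v, symmetric] p_sum[OF v]
    using functional_sum[OF fin, of "\<lambda>a. S [a] (head G a) [a]"] S_M fpa by blast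
  also have "\<dots> = (\<Sum>a\<in>out_arcs G v. of_real (exp (- \<beta>) * \<xi> (head G a)))"
    by (rule sum.cong) (use functional_S fpa in auto)
  also have "\<dots> = of_real (exp (- \<beta>) * (\<Sum>a\<in>out_arcs G v. \<xi> (head G a)))"
    by (simp add: sum_distrib_left)
  finally have "\<xi> v = exp (- \<beta>) * (\<Sum>a\<in>out_arcs G v. \<xi> (head G a))"
    using of_real_eq_iff by blast
  then show ?thesis unfolding adjacency_sum[OF v] by (simp add: exp_minus)
qed

lemma pe_K: "pe n \<in> K"
proof -
  have "(\<Sum>v\<in>I. S [] v []) \<in> K" if "finite I" "I \<subseteq> verts G" for I
    using that by (induction I rule: finite_induct) (auto simp: K_zero intro: K_add p_finite)
  then show ?thesis unfolding pe_def using finite_en en_verts by blast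
qed

lemma pe_N: "pe n \<in> N"
  by (rule N_self_adjoint[OF pe_K])

text \<open>Write a as the square of c and take y = c - c e with e = \<open>pe n\<close>. The trace
  property gives \<open>\<phi>\<close> the same value at e a, a e and e a e, so the nonnegative
  weight of the square of y is the difference of the weights of a and e a e.\<close>

lemma corner_le:
  assumes a: "a \<in> positive_part A"
  shows "\<psi> (pe n o\<^sub>L a o\<^sub>L pe n) \<le> \<psi> a"
proof (cases "a \<in> K")
  case False
  then have "\<psi> a = \<infinity>" using a by (auto simp: K_def less_top[symmetric])
  then show ?thesis by simp
next
  case True
  let ?e = "pe n"
  have eadj: "adj_op ?e = ?e" and eA: "?e \<in> A" using pe_adj pe_in by auto
  obtain c where c: "c \<in> N" "adj_op c = c" "c o\<^sub>L c = a" using K_root[OF True] by blast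
  have cA: "c \<in> A" and aA: "a \<in> A" using N_in c(1) pos_in a by auto
  have aN: "a \<in> N" and aadj: "adj_op a = a" using N_self_adjoint[OF True] pos_self_adjoint[OF a] by auto
  have tr: "\<phi> (?e o\<^sub>L a) = \<phi> (a o\<^sub>L ?e)"
    by (rule trace) (simp_all add: aN aadj pe_N eadj pe_invariant)
  \<comment> \<open>Since \<open>?b\<close> is killed by \<open>?e\<close> from the right, the trace
    property makes the functional vanish on \<open>?e o\<^sub>L ?b\<close>, which compares e a with
    e a e.\<close>
  let ?b = "a - (a o\<^sub>L ?e)"
  have badj: "adj_op ?b = a - (?e o\<^sub>L a)"
    using aA eA by (simp add: adj_diff adj_compose adjointable adjointable_compose aadj eadj)
  have tr2: "\<phi> (?e o\<^sub>L ?b) = \<phi> (?b o\<^sub>L ?e)"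
    by (rule trace)
      (simp_all add: badj aN aA eA N_diff N_left_ideal pe_N eadj pe_invariant)
  have be: "?b o\<^sub>L ?e = 0" by (simp add: compose_diff_left compose_assoc pe_idem)
  have M1: "?e o\<^sub>L a \<in> M" "a o\<^sub>L ?e \<in> M" "a \<in> M" "?e o\<^sub>L a o\<^sub>L ?e \<in> M"
    using M_compose[of ?e a] M_compose[of a ?e] aA eA aadj eadj aN pe_N K_in_M[OF True] corner_M[OF pe_N eadj aA]
    by auto
  have "\<phi> (?e o\<^sub>L ?b) = \<phi> (?e o\<^sub>L a) - \<phi> (?e o\<^sub>L a o\<^sub>L ?e)"
    using functional_diff[OF M1(1,4)] by (simp add: compose_diff_right compose_assoc)
  then have ea: "\<phi> (?e o\<^sub>L a) = \<phi> (?e o\<^sub>L a o\<^sub>L ?e)"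
    using tr2 be functional_K[OF K_zero] by (simp add: weight_zero)
  define y where "y = c - (c o\<^sub>L ?e)"
  have yN: "y \<in> N" unfolding y_def by (intro N_diff N_left_ideal c cA pe_N)
  then have yK: "adj_op y o\<^sub>L y \<in> K" by (simp add: N_iff)
  have "adj_op y o\<^sub>L y = ((a - (a o\<^sub>L ?e)) - (?e o\<^sub>L a)) + (?e o\<^sub>L a o\<^sub>L ?e)"
    unfolding y_def using cA eA
    by (simp add: adj_diff adj_compose adjointable adjointable_compose c(2) eadj compose_diff_left
        compose_diff_right c(3)[symmetric] compose_assoc)
  then have "\<phi> (adj_op y o\<^sub>L y) = \<phi> a - \<phi> (a o\<^sub>L ?e) - \<phi> (?e o\<^sub>L a) + \<phi> (?e o\<^sub>L a o\<^sub>L ?e)"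
    using M1 by (simp add: functional_add functional_diff M_diff)
  then have eq: "\<phi> (adj_op y o\<^sub>L y) = \<phi> a - \<phi> (?e o\<^sub>L a o\<^sub>L ?e)" using tr ea by simp
  have eaeK: "?e o\<^sub>L a o\<^sub>L ?e \<in> K"
  proof -
    have "?e o\<^sub>L a o\<^sub>L ?e = adj_op (c o\<^sub>L ?e) o\<^sub>L (c o\<^sub>L ?e)"
      using cA eA by (simp add: adj_compose adjointable c(2) eadj c(3)[symmetric] compose_assoc)
    then show ?thesis using N_left_ideal[OF cA pe_N] by (simp add: N_iff)
  qed
  have "enn2real (\<psi> (adj_op y o\<^sub>L y)) = enn2real (\<psi> a) - enn2real (\<psi> (?e o\<^sub>L a o\<^sub>L ?e))"
    using eq unfolding functional_K[OF yK] functional_K[OF True] functional_K[OF eaeK]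
    by (simp flip: of_real_diff)
  then have "enn2real (\<psi> (?e o\<^sub>L a o\<^sub>L ?e)) \<le> enn2real (\<psi> a)"
    using enn2real_nonneg[of "\<psi> (adj_op y o\<^sub>L y)"] by linarith
  then have "ennreal (enn2real (\<psi> (?e o\<^sub>L a o\<^sub>L ?e))) \<le> ennreal (enn2real (\<psi> a))" by (rule ennreal_leI)
  then show ?thesis using \<psi>_K[OF True] \<psi>_K[OF eaeK] by simp
qed

lemma corner_K:
  assumes a: "a \<in> positive_part A"
  shows "pe n o\<^sub>L a o\<^sub>L pe n \<in> K"
proof -
  obtain c where c: "c \<in> A" "adj_op c = c" "c o\<^sub>L c = a"
    using square_root a unfolding positive_part_eq by blast
  have "pe n o\<^sub>L a o\<^sub>L pe n = adj_op (c o\<^sub>L pe n) o\<^sub>L (c o\<^sub>L pe n)"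
    using c pe_adj[of n] by (simp add: adj_compose adjointable compose_assoc flip: c(3))
  then show ?thesis using N_left_ideal[OF c(1) pe_N] by (simp add: N_iff)
qed

text \<open>If every vertex had weight zero, so would every \<open>pe n\<close>;
  \<open>corner_bound\<close> then annihilates all corners and lower semi-continuity the whole
  weight.\<close>

lemma \<xi>_nonzero: "\<exists>v\<in>verts G. \<xi> v \<noteq> 0"
proof (rule ccontr)
  assume "\<not> (\<exists>v\<in>verts G. \<xi> v \<noteq> 0)"
  then have 0: "\<psi> (S [] v []) = 0" if "v \<in> verts G" for v using \<psi>_p that by simp
  have "\<psi> (\<Sum>v\<in>I. S [] v []) = 0 \<and> (\<Sum>v\<in>I. S [] v []) \<in> positive_part A" if "finite I" "I \<subseteq> verts G" for I
    using that
    by (induction I rule: finite_induct) (auto simp: weight_zero weight_add 0 p_pos pos_add pos_zero)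
  then have e0: "\<psi> (pe n) = 0" for n unfolding pe_def using finite_en en_verts by blast
  obtain a where a: "a \<in> positive_part A" "\<psi> a \<noteq> 0"
    using proper unfolding proper_weight_def by blast
  have "\<psi> (pe n o\<^sub>L a o\<^sub>L pe n) \<le> 0" for n
  proof -
    have "cmod (\<phi> (pe n o\<^sub>L a o\<^sub>L pe n)) \<le> 0"
      using corner_bound[OF pe_K pe_idem pos_in[OF a(1)], of n] e0 by simp
    then have "enn2real (\<psi> (pe n o\<^sub>L a o\<^sub>L pe n)) = 0"
      using functional_K[OF corner_K[OF a(1)], of n] enn2real_nonneg[of "\<psi> (pe n o\<^sub>L a o\<^sub>L pe n)"] by simp
    then show ?thesis using \<psi>_K[OF corner_K[OF a(1)], of n] by simp
  qed
  then have "\<psi> a \<le> 0" by (rule weight_lsc[OF pe_approx_both[OF pos_in[OF a(1)]] corner_pos[OF a(1)]])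
  with a(2) show False by simp
qed

end

text \<open>On corners the two functionals agree, by \<open>A_induct\<close> and
  \<open>functional_S\<close>. The corner of \<open>a\<close> thus has the same weight for both, at
  most \<open>\<psi>' a\<close> by \<open>corner_le\<close>, and letting the corner grow uses lower
  semi-continuity of \<psi>. Only an inequality results, but the hypotheses are symmetric.\<close>

lemma (in path_graph) kms_weight_le:
  assumes 1: "kms_weight G \<beta> \<psi>" and 2: "kms_weight G \<beta> \<psi>'"
    and eq: "\<And>v. v \<in> verts G \<Longrightarrow> \<psi> (S [] v []) = \<psi>' (S [] v [])"
    and a: "a \<in> positive_part A"
  shows "\<psi> a \<le> \<psi>' a"
proof -
  interpret k1: kms_weight G \<beta> \<psi> by (rule 1)
  interpret k2: kms_weight G \<beta> \<psi>' by (rule 2)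
  have \<xi>: "k1.\<xi> v = k2.\<xi> v" if "v \<in> verts G" for v
    unfolding k1.\<xi>_def k2.\<xi>_def eq[OF that] ..
  have corner: "k1.\<phi> (pe n o\<^sub>L x o\<^sub>L pe n) = k2.\<phi> (pe n o\<^sub>L x o\<^sub>L pe n)" if "x \<in> A" for x n
    using that
  proof (induction x rule: A_induct)
    case zero
    then show ?case
      using k1.functional_K[OF k1.K_zero] k2.functional_K[OF k2.K_zero]
      by (simp add: compose_zero_left compose_zero_right k1.weight_zero k2.weight_zero)
  next
    case (S g v f)
    have "pe n o\<^sub>L S g v f o\<^sub>L pe n = (if vs g v \<in> en n \<and> vs f v \<in> en n then S g v f else 0)"
      using pe_S[OF S] S_pe[OF S] by (simp add: compose_zero_left)
    moreover have "k1.\<phi> (S g v f) = k2.\<phi> (S g v f)"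
      unfolding k1.functional_S[OF S] k2.functional_S[OF S] using \<xi>[of v] fp_verts[OF S(1)] by simp
    ultimately show ?case
      using k1.functional_K[OF k1.K_zero] k2.functional_K[OF k2.K_zero]
      by (simp add: k1.weight_zero k2.weight_zero)
  next
    case (add x y)
    then show ?case
      using k1.corner_M[OF k1.pe_N] k2.corner_M[OF k2.pe_N] pe_adj
      by (simp add: compose_add_left compose_add_right k1.functional_add k2.functional_add)
  next
    case (cscale c x)
    then show ?case
      using k1.corner_M[OF k1.pe_N] k2.corner_M[OF k2.pe_N] pe_adj
      by (simp add: compose_cscale_left compose_cscale_right k1.functional_cscale k2.functional_cscale)
  next
    case (limit s x)
    have xA: "x \<in> A" using star_algebra.limit[OF star_algebra_A limit(2)] limit(1) by blast
    \<comment> \<open>The functionals need not be norm continuous on \<open>M\<close>; the linear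
      bound on the corner is what allows passage to the limit.\<close>
    have lim: "(\<lambda>i. w (pe n o\<^sub>L s i o\<^sub>L pe n)) \<longlonglongrightarrow> w (pe n o\<^sub>L x o\<^sub>L pe n)"
      if diff: "\<And>y z. y \<in> A \<Longrightarrow> z \<in> A \<Longrightarrow> w (pe n o\<^sub>L (y - z) o\<^sub>L pe n) = w (pe n o\<^sub>L y o\<^sub>L pe n) - w (pe n o\<^sub>L z o\<^sub>L pe n)"
        and bd: "\<And>y. y \<in> A \<Longrightarrow> cmod (w (pe n o\<^sub>L y o\<^sub>L pe n)) \<le> 2 * norm y * b" for w :: "'e arrow operator \<Rightarrow> complex" and b
    proof -
      have "norm (w (pe n o\<^sub>L s i o\<^sub>L pe n) - w (pe n o\<^sub>L x o\<^sub>L pe n)) \<le> 2 * norm (s i - x) * b" for i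
        using bd[OF star_algebra.diff[OF star_algebra_A limit(1) xA], of i] diff[OF limit(1) xA] by simp
      moreover have "(\<lambda>i. 2 * norm (s i - x) * b) \<longlonglongrightarrow> 2 * norm (x - x) * b"
        by (intro tendsto_intros limit)
      ultimately have "(\<lambda>i. w (pe n o\<^sub>L s i o\<^sub>L pe n) - w (pe n o\<^sub>L x o\<^sub>L pe n)) \<longlonglongrightarrow> 0"
        by - (rule Lim_null_comparison[of _ "\<lambda>i. 2 * norm (s i - x) * b"], simp_all)
      then show ?thesis by (rule LIM_zero_cancel)
    qed
    have "(\<lambda>i. k1.\<phi> (pe n o\<^sub>L s i o\<^sub>L pe n)) \<longlonglongrightarrow> k1.\<phi> (pe n o\<^sub>L x o\<^sub>L pe n)"
      by (rule lim[OF _ k1.corner_bound[OF k1.pe_K pe_idem]])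
        (use k1.corner_M[OF k1.pe_N] pe_adj in \<open>simp add: compose_diff_left compose_diff_right k1.functional_diff\<close>)
    moreover have "(\<lambda>i. k2.\<phi> (pe n o\<^sub>L s i o\<^sub>L pe n)) \<longlonglongrightarrow> k2.\<phi> (pe n o\<^sub>L x o\<^sub>L pe n)"
      by (rule lim[OF _ k2.corner_bound[OF k2.pe_K pe_idem]])
        (use k2.corner_M[OF k2.pe_N] pe_adj in \<open>simp add: compose_diff_left compose_diff_right k2.functional_diff\<close>)
    ultimately show ?case using limit(3) LIMSEQ_unique by simp
  qed
  have "\<psi> (pe n o\<^sub>L a o\<^sub>L pe n) \<le> \<psi>' a" for n
  proof -
    have "complex_of_real (enn2real (\<psi> (pe n o\<^sub>L a o\<^sub>L pe n))) = of_real (enn2real (\<psi>' (pe n o\<^sub>L a o\<^sub>L pe n)))"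
      using corner[OF pos_in[OF a], of n] k1.functional_K[OF k1.corner_K[OF a]] k2.functional_K[OF k2.corner_K[OF a]]
      by simp
    then have "\<psi> (pe n o\<^sub>L a o\<^sub>L pe n) = \<psi>' (pe n o\<^sub>L a o\<^sub>L pe n)"
      using k1.corner_K[OF a, of n] k2.corner_K[OF a, of n] unfolding k1.K_def k2.K_def
      by (metis (no_types, lifting) ennreal_enn2real mem_Collect_eq of_real_eq_iff infinity_ennreal_def)
    then show ?thesis using k2.corner_le[OF a] by simp
  qed
  then show ?thesis by (rule k1.weight_lsc[OF pe_approx_both[OF pos_in[OF a]] corner_pos[OF a]])
qed

lemma (in path_graph) kms_weight_unique:
  assumes 1: "kms_weight G \<beta> \<psi>" and 2: "kms_weight G \<beta> \<psi>'"
    and eq: "\<And>v. v \<in> verts G \<Longrightarrow> \<psi> (S [] v []) = \<psi>' (S [] v [])"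
  shows "\<psi> = \<psi>'"
proof
  fix a
  have ext: "\<psi> \<in> extensional (positive_part A)" "\<psi>' \<in> extensional (positive_part A)"
    using 1 2 unfolding kms_weight_def kms_weight_axioms_def KMS_weight_def proper_weight_def weight_def by auto
  show "\<psi> a = \<psi>' a"
  proof (cases "a \<in> positive_part A")
    case True
    then show ?thesis
      using kms_weight_le[OF 1 2 eq] kms_weight_le[OF 2 1 eq[symmetric]] by (intro antisym) auto
  next
    case False
    then show ?thesis using ext by (simp add: extensional_def)
  qed
qed

section \<open>The measure of an eigenvector\<close>

lemma emeasure_density_cmult_indicator:
  assumes "B \<in> sets M" "Y \<in> sets M"
  shows "emeasure (density M (\<lambda>x. c * indicator B x)) Y = c * emeasure M (B \<inter> Y)"
proof -
  have "emeasure (density M (\<lambda>x. c * indicator B x)) Y = (\<integral>\<^sup>+x. c * indicator (B \<inter> Y) x \<partial>M)"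
    using assms by (subst emeasure_density) (simp_all add: indicator_inter_arith mult.assoc)
  also have "\<dots> = c * emeasure M (B \<inter> Y)"
    using assms by (intro nn_integral_cmult_indicator) simp
  finally show ?thesis .
qed

section \<open>Cylinders and the sigma-algebra they generate\<close>

context path_graph
begin

definition cyl :: "'e list \<Rightarrow> 'v \<Rightarrow> 'e path set" where
  "cyl g w = cat g ` C w"

lemma cyl_iff: "fp g w \<Longrightarrow> x \<in> cyl g w \<longleftrightarrow> x \<in> paths G \<and> pre x (length g) = g \<and> tail G (x (length g)) = w"
proof
  assume "fp g w" "x \<in> cyl g w"
  then obtain p where p: "p \<in> C w" "x = cat g p" unfolding cyl_def by blast
  then show "x \<in> paths G \<and> pre x (length g) = g \<and> tail G (x (length g)) = w"
    using cat_paths[OF \<open>fp g w\<close> p(1)] by (simp add: pre_cat) (simp add: cat_nth C_def)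
next
  assume x: "x \<in> paths G \<and> pre x (length g) = g \<and> tail G (x (length g)) = w"
  then have "x = cat g ((\<sigma> ^^ length g) x)" using cat_pre[of x "length g"] by simp
  moreover have "(\<sigma> ^^ length g) x \<in> C w" using shift_C[of x "length g"] x by simp
  ultimately show "x \<in> cyl g w" unfolding cyl_def by blast
qed

lemma cyl_Nil [simp]: "cyl [] v = C v"
  by (simp add: cyl_def)

lemma cyl_paths: "fp g w \<Longrightarrow> cyl g w \<subseteq> paths G"
  by (auto simp: cyl_iff)

lemma cyl_source: "fp g w \<Longrightarrow> x \<in> cyl g w \<Longrightarrow> x \<in> C (vs g w)"
  using cat_C unfolding cyl_def by auto

lemma cyl_extend: "fp h w \<Longrightarrow> cyl (g @ h) w \<subseteq> cyl g (vs h w)"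
  using cat_C unfolding cyl_def by (auto simp: cat_append)

lemma cyl_nested:
  assumes "fp g w" "fp g' w'" "length g \<le> length g'" "cyl g w \<inter> cyl g' w' \<noteq> {}"
  shows "cyl g' w' \<subseteq> cyl g w"
proof -
  obtain p p' where p: "p \<in> C w" "p' \<in> C w'" "cat g p = cat g' p'"
    using assms(4) unfolding cyl_def by auto
  obtain h where h: "g' = g @ h" "p = cat h p'" using cat_eq_longer[OF p(3) assms(3)] by blast
  have fh: "fp h w'" using assms(2) h(1) by (simp add: fp_append)
  have "vs h w' = w" using cat_C[OF fh p(2)] p(1) h(2) C_eq by blast
  then show ?thesis using cyl_extend[OF fh, of g] h(1) by simp
qed

text \<open>Two cylinders are nested or disjoint, so adding the empty set makes the family stable
  under intersections. The path of length 0 contributes the sets \<open>C v\<close>.\<close>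

definition gens_cyl :: "'e path set set" where
  "gens_cyl = insert {} {cyl g w | g w. fp g w}"

definition Bor :: "'e path measure" where
  "Bor = sigma (paths G) gens_cyl"

lemma gens_cyl_sub: "gens_cyl \<subseteq> Pow (paths G)"
  using cyl_paths by (auto simp: gens_cyl_def)

lemma space_Bor [simp]: "space Bor = paths G"
  unfolding Bor_def by (rule space_measure_of[OF gens_cyl_sub])

lemma sets_Bor: "sets Bor = sigma_sets (paths G) gens_cyl"
  unfolding Bor_def by (rule sets_measure_of[OF gens_cyl_sub])

lemma sets_cyl [measurable]: "fp g w \<Longrightarrow> cyl g w \<in> sets Bor"
  unfolding sets_Bor by (rule sigma_sets.Basic) (auto simp: gens_cyl_def)

lemma sets_C: "v \<in> verts G \<Longrightarrow> C v \<in> sets Bor"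
  using sets_cyl[of "[]" v] by simp

lemma Int_stable_cyl: "Int_stable gens_cyl"
proof (rule Int_stableI)
  fix a b assume ab: "a \<in> gens_cyl" "b \<in> gens_cyl"
  show "a \<inter> b \<in> gens_cyl"
  proof (cases "a \<inter> b = {}")
    case False
    then obtain g w g' w' where g: "a = cyl g w" "fp g w" "b = cyl g' w'" "fp g' w'"
      using ab unfolding gens_cyl_def by auto
    have "a \<inter> b = a \<or> a \<inter> b = b"
    proof (cases "length g \<le> length g'")
      case True
      then show ?thesis using cyl_nested[OF g(2,4)] False g by auto
    next
      case le: False
      then show ?thesis using cyl_nested[OF g(4,2)] False g by auto
    qed
    then show ?thesis using ab by metis
  qed (simp add: gens_cyl_def)
qed

lemma paths_cover: "\<Union>(C ` verts G) = paths G"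
proof -
  have "p \<in> paths G \<Longrightarrow> tail G (p 0) \<in> verts G" for p by (auto simp: paths_def)
  then show ?thesis using paths_C C_paths by auto
qed

text \<open>The countably many sets \<open>C v\<close> cover the path space and have finite measure,
  so agreement on the generating family suffices even for measures of infinite mass.\<close>

lemma measure_eqI_cyl:
  assumes "\<And>g w. fp g w \<Longrightarrow> emeasure \<mu> (cyl g w) = emeasure \<nu> (cyl g w)"
    and "sets \<mu> = sets Bor" "sets \<nu> = sets Bor"
    and "\<And>v. v \<in> verts G \<Longrightarrow> emeasure \<mu> (C v) \<noteq> \<infinity>"
  shows "\<mu> = \<nu>"
proof (rule measure_eqI_generator_eq_countable[OF Int_stable_cyl gens_cyl_sub])
  show "C ` verts G \<subseteq> gens_cyl"
    unfolding gens_cyl_def by (auto intro!: exI[of _ "[]"])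
  show "countable (C ` verts G)" using countable_verts by simp
qed (use assms sets_Bor paths_cover in \<open>auto simp: gens_cyl_def\<close>)

lemma countable_fp_lists: "countable {(g, w) | g w. fp g w}"
proof -
  have arcs: "fp g w \<Longrightarrow> set g \<subseteq> arcs G" for g w
    by (induction g) auto
  have "{(g, w) | g w. fp g w} \<subseteq> lists (arcs G) \<times> verts G"
    using arcs fp_verts by blast
  then show ?thesis
    by (rule countable_subset) (simp add: countable_arcs countable_verts)
qed

text \<open>The preimage of a cylinder is a union of cylinders over all prefixes of length
  \<open>n\<close>; these may be infinitely many, but they are countable.\<close>

lemma measurable_shift [measurable]: "(\<sigma> ^^ n) \<in> Bor \<rightarrow>\<^sub>M Bor"
  unfolding Bor_def
proof (rule measurable_measure_of[OF gens_cyl_sub], fold Bor_def)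
  show "\<sigma> ^^ n \<in> space Bor \<rightarrow> paths G" using shift_paths by auto
  fix Y assume "Y \<in> gens_cyl"
  then consider "Y = {}" | g w where "Y = cyl g w" "fp g w" unfolding gens_cyl_def by blast
  then show "(\<sigma> ^^ n) -` Y \<inter> space Bor \<in> sets Bor"
  proof cases
    case 2
    let ?H = "{(h, u). fp h u \<and> u = vs g w \<and> length h = n}"
    have "(\<sigma> ^^ n) -` Y \<inter> space Bor = (\<Union>(h, u)\<in>?H. cyl (h @ g) w)"
    proof (intro equalityI subsetI)
      fix x assume x: "x \<in> (\<sigma> ^^ n) -` Y \<inter> space Bor"
      then have P: "x \<in> paths G" and "(\<sigma> ^^ n) x \<in> cyl g w" using 2 by auto
      then obtain p where p: "p \<in> C w" "(\<sigma> ^^ n) x = cat g p" unfolding cyl_def by blast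
      have "x = cat (pre x n @ g) p" using cat_pre[of x n] p(2) by (simp add: cat_append)
      moreover have "tail G (x n) = vs g w" using cat_C[OF 2(2) p(1)] shift_C[OF P, of n] p(2) C_eq by metis
      then have "(pre x n, vs g w) \<in> ?H" using fp_pre(1)[OF P, of n] by simp
      ultimately show "x \<in> (\<Union>(h, u)\<in>?H. cyl (h @ g) w)" unfolding cyl_def using p(1) by blast
    next
      fix x assume "x \<in> (\<Union>(h, u)\<in>?H. cyl (h @ g) w)"
      then obtain h p where h: "fp h (vs g w)" "length h = n" "p \<in> C w" "x = cat h (cat g p)"
        unfolding cyl_def by (auto simp: cat_append)
      have "x \<in> paths G" unfolding h(4) by (intro cat_paths[OF h(1)] cat_C 2 h)
      moreover have "(\<sigma> ^^ n) x = cat g p" using h(2,4) shift_cat by blast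
      ultimately show "x \<in> (\<sigma> ^^ n) -` Y \<inter> space Bor" using 2(1) h(3) unfolding cyl_def by auto
    qed
    moreover have "countable ?H" by (rule countable_subset[OF _ countable_fp_lists]) auto
    ultimately show ?thesis
      using 2 by (auto simp: fp_append intro!: sets.countable_UN' sets_cyl)
  qed simp
qed

end

section \<open>The Markov chain of an eigenvector\<close>

locale eigenvector = path_graph G for G :: "('v, 'e) pre_digraph" +
  fixes \<beta> :: real and \<xi> :: "'v \<Rightarrow> real"
  assumes \<xi>_nonneg: "\<And>v. v \<in> verts G \<Longrightarrow> 0 \<le> \<xi> v"
    and \<xi>_sum: "\<And>v. v \<in> verts G \<Longrightarrow> (\<Sum>a\<in>out_arcs G v. \<xi> (head G a)) = exp \<beta> * \<xi> v"
begin

definition ch :: "'v \<Rightarrow> 'e" where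
  "ch v = (SOME a. a \<in> out_arcs G v)"

lemma ch: "v \<in> verts G \<Longrightarrow> ch v \<in> out_arcs G v"
  using no_sinks unfolding no_sinks_def ch_def by (metis some_in_eq)

text \<open>The eigenvalue equation says exactly that the transition weights at a vertex with
  positive \<xi> sum to 1. Writing the transition property as a product avoids dividing by zero
  elsewhere.\<close>

lemma ex_transition:
  "\<exists>q :: 'e pmf. v \<in> verts G \<longrightarrow> set_pmf q \<subseteq> out_arcs G v \<and>
     (\<forall>a\<in>out_arcs G v. \<xi> v * pmf q a = exp (- \<beta>) * \<xi> (head G a))"
proof (cases "v \<in> verts G \<and> \<xi> v \<noteq> 0")
  case True
  then have v: "v \<in> verts G" and pos: "0 < \<xi> v" using \<xi>_nonneg[of v] by auto
  let ?f = "\<lambda>a. if a \<in> out_arcs G v then exp (- \<beta>) * \<xi> (head G a) / \<xi> v else 0"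
  have fin: "finite (out_arcs G v)" by (rule finite_out_arcs[OF v])
  have nn: "0 \<le> ?f a" for a using \<xi>_nonneg[of "head G a"] pos by auto
  have "(\<integral>\<^sup>+a. ennreal (?f a) \<partial>count_space UNIV) = (\<Sum>a\<in>out_arcs G v. ennreal (?f a))"
    by (rule nn_integral_count_space'[OF fin]) auto
  also have "\<dots> = ennreal (\<Sum>a\<in>out_arcs G v. ?f a)" by (rule sum_ennreal) (rule nn)
  also have "(\<Sum>a\<in>out_arcs G v. ?f a) = exp (- \<beta>) / \<xi> v * (\<Sum>a\<in>out_arcs G v. \<xi> (head G a))"
    by (simp add: sum_distrib_left)
  also have "\<dots> = 1" unfolding \<xi>_sum[OF v] using pos by (simp add: exp_minus)
  finally have one: "(\<integral>\<^sup>+a. ennreal (?f a) \<partial>count_space UNIV) = 1" by simp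
  have pmf: "pmf (embed_pmf ?f) a = ?f a" for a by (rule pmf_embed_pmf[OF nn one])
  show ?thesis
  proof (rule exI[of _ "embed_pmf ?f"], intro impI conjI ballI)
    show "set_pmf (embed_pmf ?f) \<subseteq> out_arcs G v"
    proof
      fix a assume "a \<in> set_pmf (embed_pmf ?f)"
      then have "?f a \<noteq> 0" unfolding set_pmf_iff pmf .
      then show "a \<in> out_arcs G v" by (auto split: if_splits)
    qed
    show "\<xi> v * pmf (embed_pmf ?f) a = exp (- \<beta>) * \<xi> (head G a)" if "a \<in> out_arcs G v" for a
      unfolding pmf using that pos by simp
  qed
next
  case False
  show ?thesis
  \<comment> \<open>Where \<xi> vanishes, the equation and nonnegativity force it to vanish at all
    heads, so both sides are 0 whatever distribution on the outgoing edges is chosen.\<close>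
  proof (rule exI[of _ "return_pmf (ch v)"], intro impI conjI ballI)
    assume v: "v \<in> verts G"
    then have z: "\<xi> v = 0" using False by simp
    show "set_pmf (return_pmf (ch v)) \<subseteq> out_arcs G v" using ch[OF v] by simp
    have "\<forall>a\<in>out_arcs G v. \<xi> (head G a) = 0"
      using \<xi>_sum[OF v] z sum_nonneg_eq_0_iff[OF finite_out_arcs[OF v], of "\<lambda>a. \<xi> (head G a)"] \<xi>_nonneg by auto
    then show "\<xi> v * pmf (return_pmf (ch v)) a = exp (- \<beta>) * \<xi> (head G a)" if "a \<in> out_arcs G v" for a
      using z that by simp
  qed
qed

definition tr :: "'v \<Rightarrow> 'e pmf" where
  "tr = (SOME q. \<forall>v. v \<in> verts G \<longrightarrow> set_pmf (q v) \<subseteq> out_arcs G v \<and>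
     (\<forall>a\<in>out_arcs G v. \<xi> v * pmf (q v) a = exp (- \<beta>) * \<xi> (head G a)))"

lemma tr:
  assumes "v \<in> verts G"
  shows "set_pmf (tr v) \<subseteq> out_arcs G v"
    and "a \<in> out_arcs G v \<Longrightarrow> \<xi> v * pmf (tr v) a = exp (- \<beta>) * \<xi> (head G a)"
proof -
  have "\<exists>q. \<forall>v. v \<in> verts G \<longrightarrow> set_pmf (q v) \<subseteq> out_arcs G v \<and>
     (\<forall>a\<in>out_arcs G v. \<xi> v * pmf (q v) a = exp (- \<beta>) * \<xi> (head G a))"
    by (rule choice) (blast intro: ex_transition)
  from someI_ex[OF this, folded tr_def] assms
  show "set_pmf (tr v) \<subseteq> out_arcs G v"
    and "a \<in> out_arcs G v \<Longrightarrow> \<xi> v * pmf (tr v) a = exp (- \<beta>) * \<xi> (head G a)" by auto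
qed

text \<open>The Markov chain of edges, driven by independent choices of an edge for every time and
  every vertex. Choices of probability zero that are not edges out of the vertex are corrected,
  so that every trajectory is a path.\<close>

definition \<Omega> :: "(nat \<times> 'v \<Rightarrow> 'e) measure" where
  "\<Omega> = (\<Pi>\<^sub>M j\<in>UNIV. measure_pmf (tr (snd j)))"

lemma space_\<Omega> [simp]: "space \<Omega> = UNIV"
  by (simp add: \<Omega>_def space_PiM)

sublocale coin: product_prob_space "\<lambda>j :: nat \<times> 'v. measure_pmf (tr (snd j))" UNIV
  by unfold_locales

lemma prob_space_\<Omega>: "prob_space \<Omega>"
  unfolding \<Omega>_def by (rule coin.P.prob_space_axioms)

definition nxt :: "'e \<Rightarrow> 'v \<Rightarrow> 'e" where
  "nxt a v = (if a \<in> out_arcs G v then a else ch v)"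

primrec X :: "'v \<Rightarrow> (nat \<times> 'v \<Rightarrow> 'e) \<Rightarrow> 'e path" where
  "X v \<omega> 0 = nxt (\<omega> (0, v)) v"
| "X v \<omega> (Suc n) = nxt (\<omega> (Suc n, head G (X v \<omega> n))) (head G (X v \<omega> n))"

lemma nxt: "v \<in> verts G \<Longrightarrow> nxt a v \<in> out_arcs G v"
  using ch by (simp add: nxt_def)

lemma X_C:
  assumes "v \<in> verts G"
  shows "X v \<omega> \<in> C v"
proof -
  have a: "X v \<omega> n \<in> arcs G" for n
  proof (induction n)
    case 0
    then show ?case using nxt[OF assms] by auto
  next
    case (Suc n)
    then show ?case using nxt[of "head G (X v \<omega> n)"] by auto
  qed
  have "tail G (X v \<omega> (Suc n)) = head G (X v \<omega> n)" for n
    using nxt[of "head G (X v \<omega> n)"] a[of n] by auto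
  moreover have "tail G (X v \<omega> 0) = v" using nxt[OF assms] by auto
  ultimately show ?thesis using a by (simp add: C_def paths_def)
qed

text \<open>Following \<open>g\<close> constrains one coordinate of \<open>\<omega>\<close> for each
  time, at the vertex that \<open>g\<close> occupies then. The event is thus a finite product event,
  and the product formula applies.\<close>

lemma X_cyl:
  assumes g: "fp g w"
  shows "X (vs g w) \<omega> \<in> cyl g w \<longleftrightarrow> (\<forall>i<length g. nxt (\<omega> (i, tail G (g ! i))) (tail G (g ! i)) = g ! i)"
    (is "_ \<longleftrightarrow> ?R")
proof -
  let ?v = "vs g w"
  have v: "?v \<in> verts G" by (rule vs_verts[OF g])
  have P: "X ?v \<omega> \<in> paths G" using X_C[OF v] C_paths by blast
  have arcs: "g ! i \<in> arcs G" "Suc i < length g \<Longrightarrow> head G (g ! i) = tail G (g ! Suc i)"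
    "Suc i = length g \<Longrightarrow> head G (g ! i) = w" if "i < length g" for i
  proof -
    have "fp (take (Suc i) g @ drop (Suc i) g) w" using g by simp
    then have f: "fp (take (Suc i) g) (vs (drop (Suc i) g) w)" unfolding fp_append ..
    have "take (Suc i) g = take i g @ [g ! i]" by (rule take_Suc_conv_app_nth[OF that])
    with f have "fp [g ! i] (vs (drop (Suc i) g) w)" by (simp add: fp_append)
    then have *: "g ! i \<in> arcs G" "head G (g ! i) = vs (drop (Suc i) g) w" by auto
    show "g ! i \<in> arcs G" by (rule *)
    show "head G (g ! i) = tail G (g ! Suc i)" if "Suc i < length g"
      using * that by (simp add: vsrc_def hd_drop_conv_nth)
    show "head G (g ! i) = w" if "Suc i = length g" using * that by simp
  qed
  have v0: "?v = tail G (g ! 0)" if "0 < length g"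
    using that by (simp add: vsrc_def hd_conv_nth)
  have iff: "(\<forall>i<n. X ?v \<omega> i = g ! i) \<longleftrightarrow> (\<forall>i<n. nxt (\<omega> (i, tail G (g ! i))) (tail G (g ! i)) = g ! i)"
    if "n \<le> length g" for n
    using that
  proof (induction n)
    case (Suc n)
    have "X ?v \<omega> n = nxt (\<omega> (n, tail G (g ! n))) (tail G (g ! n))" if "\<forall>i<n. X ?v \<omega> i = g ! i"
    proof (cases n)
      case 0
      then have "0 < length g" using Suc.prems by linarith
      then show ?thesis using v0 0 by simp
    next
      case (Suc m)
      then have "X ?v \<omega> m = g ! m" "head G (g ! m) = tail G (g ! n)"
        using that arcs(2)[of m] Suc.prems \<open>Suc n \<le> length g\<close> by auto
      then show ?thesis using Suc by simp
    qed
    then show ?case using Suc by (auto simp: less_Suc_eq)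
  qed simp
  have "X ?v \<omega> \<in> cyl g w \<longleftrightarrow> (\<forall>i<length g. X ?v \<omega> i = g ! i)"
  proof
    assume "X ?v \<omega> \<in> cyl g w"
    then have "pre (X ?v \<omega>) (length g) = g" using cyl_iff[OF g] by blast
    then show "\<forall>i<length g. X ?v \<omega> i = g ! i" by (metis nth_pre)
  next
    assume eq: "\<forall>i<length g. X ?v \<omega> i = g ! i"
    then have "pre (X ?v \<omega>) (length g) = g" by (intro nth_equalityI) auto
    moreover have "tail G (X ?v \<omega> (length g)) = w"
    proof (cases "length g")
      case 0
      then show ?thesis using X_C[OF v] by (simp add: C_def)
    next
      case (Suc n)
      have "head G (X ?v \<omega> n) = tail G (X ?v \<omega> (Suc n))" using P unfolding paths_def by blast
      then have "tail G (X ?v \<omega> (Suc n)) = head G (g ! n)"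
        using eq Suc by (simp del: X.simps)
      moreover have "head G (g ! n) = w" by (rule arcs(3)) (simp_all add: Suc)
      ultimately show ?thesis unfolding Suc by simp
    qed
    ultimately show "X ?v \<omega> \<in> cyl g w" using P cyl_iff[OF g] by blast
  qed
  then show ?thesis using iff[of "length g"] by simp
qed

lemma X_event:
  assumes g: "fp g w"
  defines "J \<equiv> (\<lambda>i. (i, tail G (g ! i))) ` {..<length g}"
  shows "{\<omega>. X (vs g w) \<omega> \<in> cyl g w} =
      {\<omega> \<in> space (PiM UNIV (\<lambda>j :: nat \<times> 'v. measure_pmf (tr (snd j)))). \<forall>j\<in>J. \<omega> j \<in> {a. nxt a (snd j) = g ! fst j}}"
  unfolding J_def using X_cyl[OF g] by (auto simp: space_PiM)

lemma measurable_X [measurable]: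
  assumes "v \<in> verts G"
  shows "X v \<in> \<Omega> \<rightarrow>\<^sub>M Bor"
  unfolding Bor_def
proof (rule measurable_measure_of[OF gens_cyl_sub])
  show "X v \<in> space \<Omega> \<rightarrow> paths G" using X_C[OF assms] C_paths by auto
  fix Y assume "Y \<in> gens_cyl"
  then consider "Y = {}" | g w where "Y = cyl g w" "fp g w" unfolding gens_cyl_def by blast
  then show "X v -` Y \<inter> space \<Omega> \<in> sets \<Omega>"
  proof cases
    case 2
    show ?thesis
    proof (cases "v = vs g w")
      case True
      have "{\<omega>. X (vs g w) \<omega> \<in> cyl g w} \<in> sets \<Omega>"
        unfolding X_event[OF 2(2)] \<Omega>_def
      proof (rule sets.sets_Collect_finite_All)
        fix j :: "nat \<times> 'v"
        let ?P = "PiM UNIV (\<lambda>j :: nat \<times> 'v. measure_pmf (tr (snd j)))"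
        have "(\<lambda>\<omega>. \<omega> j) -` {a. nxt a (snd j) = g ! fst j} \<inter> space ?P \<in> sets ?P"
          by (rule measurable_sets[OF measurable_component_singleton]) auto
        then show "{\<omega> \<in> space ?P. \<omega> j \<in> {a. nxt a (snd j) = g ! fst j}} \<in> sets ?P"
          by (simp add: vimage_def Int_def conj_commute)
      qed simp
      then show ?thesis using True 2 by (simp add: vimage_def)
    next
      case False
      then have "X v \<omega> \<notin> cyl g w" for \<omega>
        using cyl_source[OF 2(2)] X_C[OF assms, of \<omega>] C_eq by blast
      then have "X v -` Y \<inter> space \<Omega> = {}" using 2 by auto
      then show ?thesis by simp
    qed
  qed simp
qed

text \<open>The product telescopes: each transition probability replaces the value of \<xi> at the
  tail of an edge by the value at its head, at the price of one factor exp (- \<beta>).\<close>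

lemma pmf_chain:
  "fp g w \<Longrightarrow> \<xi> (vs g w) * (\<Prod>i<length g. pmf (tr (tail G (g ! i))) (g ! i)) = exp (- \<beta> * real (length g)) * \<xi> w"
proof (induction g)
  case (Cons a g)
  then have a: "a \<in> out_arcs G (tail G a)" "tail G a \<in> verts G" "fp g w" "head G a = vs g w" by auto
  have "\<xi> (tail G a) * (\<Prod>i<length (a # g). pmf (tr (tail G ((a # g) ! i))) ((a # g) ! i)) =
      (\<xi> (tail G a) * pmf (tr (tail G a)) a) * (\<Prod>i<length g. pmf (tr (tail G (g ! i))) (g ! i))"
    by (simp add: prod.lessThan_Suc_shift mult.assoc del: prod.lessThan_Suc)
  also have "\<dots> = exp (- \<beta>) * (\<xi> (vs g w) * (\<Prod>i<length g. pmf (tr (tail G (g ! i))) (g ! i)))"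
    using tr(2)[OF a(2,1)] a(4) by simp
  also have "\<dots> = exp (- \<beta>) * (exp (- \<beta> * real (length g)) * \<xi> w)" using Cons a by simp
  also have "\<dots> = exp (- \<beta> * real (length (a # g))) * \<xi> w"
    by (simp add: exp_add[symmetric] algebra_simps)
  finally show ?case by simp
qed simp

lemma prob_X:
  assumes g: "fp g w"
  shows "ennreal (\<xi> (vs g w)) * emeasure \<Omega> {\<omega>. X (vs g w) \<omega> \<in> cyl g w} =
     ennreal (exp (- \<beta> * real (length g)) * \<xi> w)"
proof -
  let ?h = "\<lambda>i. (i, tail G (g ! i))"
  have arcs: "g ! i \<in> arcs G" if "i < length g" for i
  proof -
    have "fp h w \<Longrightarrow> set h \<subseteq> arcs G" for h by (induction h) auto
    then show ?thesis using g that by (meson nth_mem subsetD)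
  qed
  have one: "emeasure (measure_pmf (tr (tail G (g ! i)))) {a. nxt a (tail G (g ! i)) = g ! i} =
      ennreal (pmf (tr (tail G (g ! i))) (g ! i))" if "i < length g" for i
  proof -
    let ?v = "tail G (g ! i)"
    have v: "?v \<in> verts G" "g ! i \<in> out_arcs G ?v" using arcs[OF that] by auto
    \<comment> \<open>On the support of \<open>tr ?v\<close>, which consists of edges out of
      \<open>?v\<close>, the correction \<open>nxt\<close> does nothing.\<close>
    have "{a. nxt a ?v = g ! i} \<inter> set_pmf (tr ?v) = {g ! i} \<inter> set_pmf (tr ?v)"
      using tr(1)[OF v(1)] by (auto simp: nxt_def)
    then have "emeasure (measure_pmf (tr ?v)) {a. nxt a ?v = g ! i} = emeasure (measure_pmf (tr ?v)) {g ! i}"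
      using emeasure_Int_set_pmf by metis
    then show ?thesis by (simp add: emeasure_pmf_single)
  qed
  have "emeasure \<Omega> {\<omega>. X (vs g w) \<omega> \<in> cyl g w} =
      (\<Prod>j\<in>?h ` {..<length g}. emeasure (measure_pmf (tr (snd j))) {a. nxt a (snd j) = g ! fst j})"
    unfolding X_event[OF g] \<Omega>_def by (rule coin.emeasure_PiM_Collect) auto
  also have "\<dots> = (\<Prod>i<length g. emeasure (measure_pmf (tr (tail G (g ! i)))) {a. nxt a (tail G (g ! i)) = g ! i})"
    by (subst prod.reindex) (auto simp: inj_on_def)
  also have "\<dots> = (\<Prod>i<length g. ennreal (pmf (tr (tail G (g ! i))) (g ! i)))"
    by (rule prod.cong) (auto simp: one)
  also have "\<dots> = ennreal (\<Prod>i<length g. pmf (tr (tail G (g ! i))) (g ! i))"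
    by (rule prod_ennreal) simp
  finally show ?thesis
    using pmf_chain[OF g] \<xi>_nonneg[OF vs_verts[OF g]] by (simp add: ennreal_mult[symmetric] prod_nonneg)
qed

text \<open>The initial vertex carries the mass \<xi>, whose total may be infinite, and the chain is
  then run from it; hence a push-forward of a product and not a probability.\<close>

definition \<mu> :: "'e path measure" where
  "\<mu> = distr (density (count_space (verts G)) (\<lambda>v. ennreal (\<xi> v)) \<Otimes>\<^sub>M \<Omega>) Bor (\<lambda>(v, \<omega>). X v \<omega>)"

lemma sets_\<mu> [simp, measurable_cong]: "sets \<mu> = sets Bor"
  by (simp add: \<mu>_def)

lemma space_\<mu> [simp]: "space \<mu> = paths G"
  by (simp add: \<mu>_def)

lemma emeasure_\<mu>:
  assumes g: "fp g w"
  shows "emeasure \<mu> (cyl g w) = ennreal (exp (- \<beta> * real (length g)) * \<xi> w)"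
proof -
  interpret P: prob_space \<Omega> by (rule prob_space_\<Omega>)
  let ?V = "density (count_space (verts G)) (\<lambda>v. ennreal (\<xi> v))"
  have "(\<lambda>(v, \<omega>). X v \<omega>) \<in> count_space (verts G) \<Otimes>\<^sub>M \<Omega> \<rightarrow>\<^sub>M Bor"
    by (rule measurable_pair_measure_countable1[OF countable_verts]) simp
  moreover have "sets (?V \<Otimes>\<^sub>M \<Omega>) = sets (count_space (verts G) \<Otimes>\<^sub>M \<Omega>)" by (rule sets_pair_measure_cong) auto
  ultimately have m: "(\<lambda>(v, \<omega>). X v \<omega>) \<in> ?V \<Otimes>\<^sub>M \<Omega> \<rightarrow>\<^sub>M Bor"
    by (simp cong: measurable_cong_sets)
  let ?E = "(\<lambda>(v, \<omega>). X v \<omega>) -` cyl g w \<inter> space (?V \<Otimes>\<^sub>M \<Omega>)"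
  have "emeasure \<mu> (cyl g w) = emeasure (?V \<Otimes>\<^sub>M \<Omega>) ?E"
    unfolding \<mu>_def by (rule emeasure_distr[OF m sets_cyl[OF g]])
  also have "\<dots> = (\<integral>\<^sup>+v. emeasure \<Omega> (Pair v -` ?E) \<partial>?V)"
    by (rule P.emeasure_pair_measure_alt) (rule measurable_sets[OF m sets_cyl[OF g]])
  also have "\<dots> = (\<integral>\<^sup>+v. ennreal (\<xi> v) * emeasure \<Omega> (Pair v -` ?E) \<partial>count_space (verts G))"
    by (rule nn_integral_density) auto
  \<comment> \<open>A trajectory never leaves the paths from its initial vertex, so only the initial
    vertex of \<open>g\<close> contributes.\<close>
  also have "\<dots> = (\<Sum>v\<in>{vs g w}. ennreal (\<xi> v) * emeasure \<Omega> (Pair v -` ?E))"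
  proof (rule nn_integral_count_space')
    fix v assume v: "v \<in> verts G" "v \<notin> {vs g w}"
    then have "X v \<omega> \<notin> cyl g w" for \<omega> using cyl_source[OF g] X_C[OF v(1), of \<omega>] C_eq by blast
    then have "Pair v -` ?E = {}" by auto
    then show "ennreal (\<xi> v) * emeasure \<Omega> (Pair v -` ?E) = 0" by simp
  qed (use vs_verts[OF g] in auto)
  also have "\<dots> = ennreal (\<xi> (vs g w)) * emeasure \<Omega> (Pair (vs g w) -` ?E)" by simp
  also have "Pair (vs g w) -` ?E = {\<omega>. X (vs g w) \<omega> \<in> cyl g w}"
    using vs_verts[OF g] by (auto simp: space_pair_measure)
  finally show ?thesis using prob_X[OF g] by simp
qed

lemma emeasure_\<mu>_C: "v \<in> verts G \<Longrightarrow> emeasure \<mu> (C v) = ennreal (\<xi> v)"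
  using emeasure_\<mu>[of "[]" v] by simp

text \<open>Conformality of the measure: prefixing \<open>g\<close> scales it by exp (- \<beta>
  \<open>length g\<close>). The two integrals are taken against measures that agree on cylinders,
  because lengths add under concatenation.\<close>

lemma nn_integral_shift:
  assumes g: "fp g w" and h: "h \<in> borel_measurable Bor"
  shows "(\<integral>\<^sup>+x. indicator (cyl g w) x * h ((\<sigma> ^^ length g) x) \<partial>\<mu>) =
     ennreal (exp (- \<beta> * real (length g))) * (\<integral>\<^sup>+p. indicator (C w) p * h p \<partial>\<mu>)"
proof -
  let ?n = "length g"
  have w: "w \<in> verts G" by (rule fp_verts[OF g])
  \<comment> \<open>The restriction to the cylinder carries a factor 1 so that one lemma on
    densities serves both measures.\<close>
  let ?\<nu>1 = "distr (density \<mu> (\<lambda>x. 1 * indicator (cyl g w) x)) Bor (\<sigma> ^^ ?n)"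
  let ?\<nu>2 = "density \<mu> (\<lambda>p. ennreal (exp (- \<beta> * real ?n)) * indicator (C w) p)"
  have Cw [measurable]: "C w \<in> sets Bor" by (rule sets_C[OF w])
  have cg [measurable]: "cyl g w \<in> sets Bor" by (rule sets_cyl[OF g])
  have "?\<nu>1 = ?\<nu>2"
  proof (rule measure_eqI_cyl)
    fix g' w' assume g': "fp g' w'"
    then have c' [measurable]: "cyl g' w' \<in> sets Bor" by (rule sets_cyl)
    have 1: "emeasure ?\<nu>1 (cyl g' w') = emeasure \<mu> (cyl g w \<inter> ((\<sigma> ^^ ?n) -` cyl g' w' \<inter> paths G))"
    proof -
      have m: "(\<sigma> ^^ ?n) -` cyl g' w' \<inter> paths G \<in> sets \<mu>"
        using measurable_sets[OF measurable_shift c'] by simp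
      have "(\<sigma> ^^ ?n) \<in> density \<mu> (\<lambda>x. 1 * indicator (cyl g w) x) \<rightarrow>\<^sub>M Bor"
        using measurable_shift by (simp cong: measurable_cong_sets)
      then have "emeasure ?\<nu>1 (cyl g' w') =
          emeasure (density \<mu> (\<lambda>x. 1 * indicator (cyl g w) x)) ((\<sigma> ^^ ?n) -` cyl g' w' \<inter> paths G)"
        by (subst emeasure_distr) (use c' in simp_all)
      then show ?thesis using emeasure_density_cmult_indicator[of "cyl g w" \<mu> _ 1] m cg by simp
    qed
    have 2: "emeasure ?\<nu>2 (cyl g' w') = ennreal (exp (- \<beta> * real ?n)) * emeasure \<mu> (C w \<inter> cyl g' w')"
      by (rule emeasure_density_cmult_indicator) (use Cw c' in simp_all)
    show "emeasure ?\<nu>1 (cyl g' w') = emeasure ?\<nu>2 (cyl g' w')"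
    proof (cases "vs g' w' = w")
      case True
      have gg: "fp (g @ g') w'" using g g' True by (simp add: fp_append)
      have "cyl g w \<inter> ((\<sigma> ^^ ?n) -` cyl g' w' \<inter> paths G) = cyl (g @ g') w'"
      proof (intro equalityI subsetI)
        fix x assume "x \<in> cyl g w \<inter> ((\<sigma> ^^ ?n) -` cyl g' w' \<inter> paths G)"
        then obtain p p' where "x = cat g p" "(\<sigma> ^^ ?n) x = cat g' p'" "p' \<in> C w'" unfolding cyl_def by auto
        then have "x = cat (g @ g') p'" by (simp add: cat_append shift_cat)
        then show "x \<in> cyl (g @ g') w'" using \<open>p' \<in> C w'\<close> unfolding cyl_def by blast
      next
        fix x assume x: "x \<in> cyl (g @ g') w'"
        then obtain p where p: "x = cat g (cat g' p)" "p \<in> C w'" unfolding cyl_def by (auto simp: cat_append)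
        have "x \<in> cyl g w" using x cyl_extend[OF g', of g] True by auto
        moreover have "(\<sigma> ^^ ?n) x \<in> cyl g' w'" unfolding p(1) shift_cat cyl_def using p(2) by blast
        ultimately show "x \<in> cyl g w \<inter> ((\<sigma> ^^ ?n) -` cyl g' w' \<inter> paths G)" using cyl_paths[OF g] by blast
      qed
      moreover have "C w \<inter> cyl g' w' = cyl g' w'" using cyl_source[OF g'] True by blast
      moreover have "exp (- \<beta> * real (length (g @ g'))) = exp (- \<beta> * real ?n) * exp (- \<beta> * real (length g'))"
        by (simp add: exp_add[symmetric] algebra_simps)
      ultimately show ?thesis
        unfolding 1 2 using emeasure_\<mu>[OF gg] emeasure_\<mu>[OF g'] by (simp add: ennreal_mult' mult.assoc)
    next
      case False
      have "cyl g w \<inter> ((\<sigma> ^^ ?n) -` cyl g' w' \<inter> paths G) = {}"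
      proof (rule ccontr)
        assume "cyl g w \<inter> ((\<sigma> ^^ ?n) -` cyl g' w' \<inter> paths G) \<noteq> {}"
        then obtain p where "p \<in> C w" "(\<sigma> ^^ ?n) (cat g p) \<in> cyl g' w'" unfolding cyl_def by auto
        then show False using False cyl_source[OF g'] C_eq unfolding shift_cat by blast
      qed
      moreover have "C w \<inter> cyl g' w' = {}" using False cyl_source[OF g'] C_eq by blast
      ultimately show ?thesis unfolding 1 2 by simp
    qed
  next
    fix v assume v: "v \<in> verts G"
    have m: "(\<sigma> ^^ ?n) \<in> density \<mu> (\<lambda>x. 1 * indicator (cyl g w) x) \<rightarrow>\<^sub>M Bor"
      using measurable_shift by (simp cong: measurable_cong_sets)
    have "emeasure ?\<nu>1 (C v) \<le> emeasure (density \<mu> (\<lambda>x. 1 * indicator (cyl g w) x)) (space \<mu>)"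
      unfolding emeasure_distr[OF m sets_C[OF v]] using sets.top[of \<mu>] by (intro emeasure_mono) auto
    also have "\<dots> = emeasure \<mu> (cyl g w \<inter> space \<mu>)"
      using emeasure_density_cmult_indicator[OF _ sets.top, of "cyl g w" \<mu> 1] cg by simp
    also have "\<dots> \<le> emeasure \<mu> (cyl g w)"
      using cg by (intro emeasure_mono) auto
    also have "\<dots> < \<infinity>" unfolding emeasure_\<mu>[OF g] by simp
    finally show "emeasure ?\<nu>1 (C v) \<noteq> \<infinity>" by simp
  qed auto
  then have "(\<integral>\<^sup>+p. h p \<partial>?\<nu>1) = (\<integral>\<^sup>+p. h p \<partial>?\<nu>2)" by simp
  moreover have "(\<integral>\<^sup>+p. h p \<partial>?\<nu>1) = (\<integral>\<^sup>+x. indicator (cyl g w) x * h ((\<sigma> ^^ ?n) x) \<partial>\<mu>)"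
  proof -
    have m: "(\<sigma> ^^ ?n) \<in> density \<mu> (\<lambda>x. 1 * indicator (cyl g w) x) \<rightarrow>\<^sub>M Bor"
      using measurable_shift by (simp cong: measurable_cong_sets)
    have hs: "(\<lambda>x. h ((\<sigma> ^^ ?n) x)) \<in> borel_measurable \<mu>"
      using measurable_compose[OF measurable_shift h] by (simp cong: measurable_cong_sets)
    have "(\<integral>\<^sup>+p. h p \<partial>?\<nu>1) = (\<integral>\<^sup>+x. h ((\<sigma> ^^ ?n) x) \<partial>density \<mu> (\<lambda>x. 1 * indicator (cyl g w) x))"
      by (rule nn_integral_distr[OF m]) (use h in simp)
    also have "\<dots> = (\<integral>\<^sup>+x. 1 * indicator (cyl g w) x * h ((\<sigma> ^^ ?n) x) \<partial>\<mu>)"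
      by (rule nn_integral_density) (use hs cg in simp_all)
    finally show ?thesis by simp
  qed
  moreover have "(\<integral>\<^sup>+p. h p \<partial>?\<nu>2) = ennreal (exp (- \<beta> * real ?n)) * (\<integral>\<^sup>+p. indicator (C w) p * h p \<partial>\<mu>)"
  proof -
    have "(\<integral>\<^sup>+p. h p \<partial>?\<nu>2) = (\<integral>\<^sup>+p. ennreal (exp (- \<beta> * real ?n)) * (indicator (C w) p * h p) \<partial>\<mu>)"
      using h by (subst nn_integral_density) (auto simp: mult.assoc)
    also have "\<dots> = ennreal (exp (- \<beta> * real ?n)) * (\<integral>\<^sup>+p. indicator (C w) p * h p \<partial>\<mu>)"
      using h by (intro nn_integral_cmult) auto
    finally show ?thesis .
  qed
  ultimately show ?thesis by simp
qed

end

section \<open>Matrix coefficients\<close>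

text \<open>A bridge between the sums of the Hilbert space and integrals over a counting measure,
  for which Tonelli's theorem is at hand.\<close>

lemma nn_integral_count_space_infsum:
  fixes f :: "'a \<Rightarrow> real"
  assumes "f summable_on A" "\<And>x. x \<in> A \<Longrightarrow> 0 \<le> f x"
  shows "(\<integral>\<^sup>+x. ennreal (f x) \<partial>count_space A) = ennreal (infsum f A)"
proof -
  have "(\<lambda>x. norm (f x)) summable_on A"
    using assms by (subst summable_on_cong[where g = f]) auto
  then have abs: "Infinite_Set_Sum.abs_summable_on f A" by (rule abs_summable_equivalent[THEN iffD1])
  show ?thesis
    using nn_integral_conv_infsetsum[OF abs assms(2)] infsetsum_infsum[OF abs] by simp
qed

lemma summable_on_nn_integral_count_space:
  fixes f :: "'a \<Rightarrow> real"
  assumes "\<And>x. x \<in> A \<Longrightarrow> 0 \<le> f x" "(\<integral>\<^sup>+x. ennreal (f x) \<partial>count_space A) < \<infinity>"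
  shows "f summable_on A"
proof -
  have "integrable (count_space A) f"
    using assms by (intro integrableI_nonneg) (auto simp: AE_count_space)
  then have "Infinite_Set_Sum.abs_summable_on f A" unfolding Infinite_Set_Sum.abs_summable_on_def .
  then have "(\<lambda>x. norm (f x)) summable_on A" by (rule abs_summable_equivalent[THEN iffD2])
  then show ?thesis by (rule abs_summable_summable)
qed

section \<open>The coefficient function of an operator\<close>

context path_graph
begin

definition unit :: "'e path \<Rightarrow> 'e arrow" where
  "unit x = (x, 0, x)"

text \<open>The standard map from a reduced groupoid algebra to functions on the groupoid: the
  column of the operator at the source unit, read at the arrow. On a generator it returns the
  indicator of the bisection.\<close>

definition j :: "'e arrow operator \<Rightarrow> 'e arrow \<Rightarrow> complex" where
  "j c \<gamma> = Rep_ell2 (blinfun_apply c (ket (unit (arrow_source \<gamma>)))) \<gamma>"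

lemma arrow_source_th [simp]: "arrow_source (th g f p) = cat f p"
  by (simp add: th_def)

lemma arrow_source_unit [simp]: "arrow_source (unit x) = x"
  by (simp add: unit_def)

lemma arrow_inv_th: "arrow_inv (th g f p) = th f g p"
  by (simp add: th_def)

lemma unit_groupoid: "x \<in> paths G \<Longrightarrow> unit x \<in> \<Gamma>"
  unfolding unit_def groupoid_def by auto

lemma Rep_le_norm: "cmod (Rep_ell2 x i) \<le> norm x"
  using cmod_cinner_le[of "ket i" x] by (simp add: cinner_ket_left)

lemma j_le_norm: "cmod (j c \<gamma>) \<le> norm c"
proof -
  have "cmod (j c \<gamma>) \<le> norm (blinfun_apply c (ket (unit (arrow_source \<gamma>))))"
    unfolding j_def by (rule Rep_le_norm)
  also have "\<dots> \<le> norm c * norm (ket (unit (arrow_source \<gamma>)))" by (rule norm_blinfun)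
  finally show ?thesis by simp
qed

lemma Rep_S_unit:
  assumes g: "fp g v" "fp f v" and x: "x \<in> paths G"
  shows "Rep_ell2 (blinfun_apply (S g v f) (ket (unit x))) \<gamma> =
    (if \<gamma> \<in> ZZ g v f \<and> arrow_source \<gamma> = x then 1 else 0)"
proof -
  have "(\<gamma> \<in> D g v \<and> \<tau> g f \<gamma> = unit x) \<longleftrightarrow> (\<gamma> \<in> ZZ g v f \<and> arrow_source \<gamma> = x)"
  proof
    assume "\<gamma> \<in> D g v \<and> \<tau> g f \<gamma> = unit x"
    then obtain p k z where p: "p \<in> C v" "\<gamma> = (cat g p, k, z)" "\<tau> g f \<gamma> = unit x" unfolding D_iff by blast
    then have "cat f p = x" "z = x" "k = int (length g) - int (length f)"
      by (auto simp: \<tau>_cat unit_def)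
    then have "\<gamma> = th g f p" using p(2) by (simp add: th_def)
    with p(1) \<open>cat f p = x\<close> show "\<gamma> \<in> ZZ g v f \<and> arrow_source \<gamma> = x" unfolding Z_def by auto
  next
    assume a: "\<gamma> \<in> ZZ g v f \<and> arrow_source \<gamma> = x"
    then obtain p where p: "p \<in> C v" "\<gamma> = th g f p" unfolding Z_def by blast
    then have "\<gamma> \<in> D g v" unfolding D_iff using th_groupoid[OF g p(1)] by (auto simp: th_def)
    moreover have "\<tau> g f \<gamma> = unit x" using p a by (simp add: th_def \<tau>_cat unit_def)
    ultimately show "\<gamma> \<in> D g v \<and> \<tau> g f \<gamma> = unit x" ..
  qed
  then show ?thesis by (auto simp: Rep_S g Rep_ket)
qed

text \<open>The algebra acts by left convolution and so preserves the source fibres; generators show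
  this directly and coordinates pass to the limit.\<close>

lemma Rep_unit_eq_0:
  "c \<in> A \<Longrightarrow> x \<in> paths G \<Longrightarrow> \<not> (\<gamma> \<in> \<Gamma> \<and> arrow_source \<gamma> = x) \<Longrightarrow>
     Rep_ell2 (blinfun_apply c (ket (unit x))) \<gamma> = 0"
proof (induction c rule: A_induct)
  case (S g v f)
  then show ?case using Z_groupoid[OF S(1,2)] by (auto simp: Rep_S_unit)
next
  case (limit s c)
  have "(\<lambda>n. cinner_ell2 (ket \<gamma>) (blinfun_apply (s n) (ket (unit x)))) \<longlonglongrightarrow>
      cinner_ell2 (ket \<gamma>) (blinfun_apply c (ket (unit x)))"
    by (intro tendsto_cinner tendsto_apply_op limit tendsto_const)
  then show ?case using limit by (simp add: cinner_ket_left LIMSEQ_const_iff)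
qed (simp_all add: zero_ell2.rep_eq blinfun.add_left plus_ell2.rep_eq cscale_op_apply cscale_ell2.rep_eq)

text \<open>Left convolution commutes with right translation, here by the arrow
  \<open>(x, - k, y)\<close>. This allows \<open>j_adj\<close> to express the coefficients of an
  adjoint by those of the inverse arrow.\<close>

lemma Rep_right_invariant:
  "c \<in> A \<Longrightarrow> (y, k, x) \<in> \<Gamma> \<Longrightarrow>
     Rep_ell2 (blinfun_apply c (ket (y, k, x))) (unit x) = Rep_ell2 (blinfun_apply c (ket (unit y))) (x, - k, y)"
proof (induction c rule: A_induct)
  case (S g v f)
  have xy: "x \<in> paths G" "y \<in> paths G" using S(3) by (auto simp: groupoid_def)
  have inv: "(x, - k, y) \<in> \<Gamma>"
    using S(3) unfolding groupoid_def by auto (metis minus_diff_eq)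
  have "(unit x \<in> D g v \<and> \<tau> g f (unit x) = (y, k, x)) \<longleftrightarrow>
      ((x, - k, y) \<in> D g v \<and> \<tau> g f (x, - k, y) = unit y)"
    using inv unit_groupoid[OF xy(1)] by (auto simp: D_def \<tau>_def unit_def)
  then show ?case by (auto simp: Rep_S S Rep_ket)
next
  case (limit s c)
  have 1: "(\<lambda>n. cinner_ell2 (ket (unit x)) (blinfun_apply (s n) (ket (y, k, x)))) \<longlonglongrightarrow>
      cinner_ell2 (ket (unit x)) (blinfun_apply c (ket (y, k, x)))"
    by (intro tendsto_cinner tendsto_apply_op limit tendsto_const)
  have 2: "(\<lambda>n. cinner_ell2 (ket (x, - k, y)) (blinfun_apply (s n) (ket (unit y)))) \<longlonglongrightarrow>
      cinner_ell2 (ket (x, - k, y)) (blinfun_apply c (ket (unit y)))"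
    by (intro tendsto_cinner tendsto_apply_op limit tendsto_const)
  show ?case using LIMSEQ_unique[OF 1] 2 limit unfolding cinner_ket_left by simp
qed (simp_all add: zero_ell2.rep_eq blinfun.add_left plus_ell2.rep_eq cscale_op_apply cscale_ell2.rep_eq)

lemma j_adj:
  assumes c: "c \<in> A" and \<gamma>: "\<gamma> \<in> \<Gamma>"
  shows "j (adj_op c) \<gamma> = cnj (j c (arrow_inv \<gamma>))"
proof -
  obtain y k x where g: "\<gamma> = (y, k, x)" by (cases \<gamma>)
  have "j (adj_op c) \<gamma> = cinner_ell2 (ket \<gamma>) (blinfun_apply (adj_op c) (ket (unit x)))"
    by (simp add: j_def g cinner_ket_left)
  also have "\<dots> = cnj (cinner_ell2 (ket (unit x)) (blinfun_apply c (ket \<gamma>)))"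
    unfolding cinner_adj_right[OF adjointable[OF c]] by (rule cinner_commute)
  also have "cinner_ell2 (ket (unit x)) (blinfun_apply c (ket \<gamma>)) = j c (arrow_inv \<gamma>)"
    using Rep_right_invariant[OF c, of y k x] \<gamma> by (simp add: cinner_ket_left g j_def)
  finally show ?thesis .
qed

lemma j_\<alpha>: "j (\<alpha> t c) \<gamma> = phase t (deg \<gamma>) * j c \<gamma>"
proof -
  have "blinfun_apply (U (- t)) (ket (unit x)) = ket (unit x)" for x
    by (rule ell2_eqI) (auto simp: Rep_U Rep_ket deg_def unit_def)
  then show ?thesis by (simp add: j_def \<alpha>_def Rep_U)
qed

lemma j_add: "j (c + d) \<gamma> = j c \<gamma> + j d \<gamma>"
  by (simp add: j_def blinfun.add_left plus_ell2.rep_eq)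

lemma j_cscale: "j (cscale_op w c) \<gamma> = w * j c \<gamma>"
  by (simp add: j_def cscale_op_apply cscale_ell2.rep_eq)

lemma tendsto_j: "s \<longlonglongrightarrow> c \<Longrightarrow> (\<lambda>n. j (s n) \<gamma>) \<longlonglongrightarrow> j c \<gamma>"
  unfolding j_def cinner_ket_left[symmetric]
  by (intro tendsto_cinner tendsto_apply_op tendsto_const)

lemma j_S:
  assumes "fp g v" "fp f v" "\<gamma> \<in> \<Gamma>"
  shows "j (S g v f) \<gamma> = indicator (ZZ g v f) \<gamma>"
proof -
  have "arrow_source \<gamma> \<in> paths G" using assms(3) by (cases \<gamma>) (auto simp: groupoid_def)
  then show ?thesis by (simp add: j_def Rep_S_unit assms indicator_def)
qed

text \<open>For a generator the set of tails whose arrow falls into the other bisection is empty, a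
  cylinder, or all of \<open>C w\<close>, by nesting; limits preserve measurability.\<close>

lemma measurable_j:
  assumes g: "fp g w" "fp f w"
  shows "c \<in> A \<Longrightarrow> (\<lambda>p. indicator (C w) p * j c (th g f p)) \<in> borel_measurable Bor"
proof (induction c rule: A_induct)
  case zero
  then show ?case by (simp add: j_def zero_ell2.rep_eq)
next
  case (S g' v' f')
  let ?B = "{p \<in> C w. th g f p \<in> ZZ g' v' f'}"
  have "?B \<in> sets Bor"
  proof (cases "?B = {}")
    case False
    then obtain p0 where p0: "p0 \<in> C w" "th g f p0 \<in> ZZ g' v' f'" by blast
    have p0': "th g f p0 \<in> ZZ g w f" using p0(1) unfolding Z_def by blast
    show ?thesis
    proof (cases "length g \<le> length g'")
      case True
      obtain h where h: "g' = g @ h" "f' = f @ h" "fp h v'" "vs h v' = w"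
        using Z_nested[OF p0' p0(2) True S(1)] by blast
      have "?B = cyl h v'"
      proof (intro equalityI subsetI)
        fix p assume "p \<in> ?B"
        then obtain q where "q \<in> C v'" "th g f p = th g f (cat h q)"
          unfolding h(1,2) Z_def th_append by auto
        then show "p \<in> cyl h v'" using inj_th[of g f] unfolding cyl_def inj_def by auto
      next
        fix p assume "p \<in> cyl h v'"
        then show "p \<in> ?B" using cat_C[OF h(3)] h(4) unfolding h(1,2) cyl_def Z_def th_append by auto
      qed
      then show ?thesis using sets_cyl[OF h(3)] by simp
    next
      case False
      then have "length g' \<le> length g" by simp
      from Z_nested[OF p0(2) p0' this g(1)] have "ZZ g w f \<subseteq> ZZ g' v' f'" using Z_extend by blast
      then have "?B = C w" unfolding Z_def by auto
      then show ?thesis using sets_C fp_verts[OF g(1)] by simp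
    qed
  next
    case True
    show ?thesis unfolding True by (rule sets.empty_sets)
  qed
  then have "(\<lambda>p. indicator ?B p :: complex) \<in> borel_measurable Bor" by (rule borel_measurable_indicator)
  moreover have "indicator (C w) p * j (S g' v' f') (th g f p) = indicator ?B p" for p
    by (cases "p \<in> C w") (auto simp: j_S[OF S th_groupoid[OF g]] indicator_def)
  ultimately show ?case by simp
next
  case (add x y)
  then show ?case by (simp add: j_add distrib_left borel_measurable_add)
next
  case (cscale a x)
  have eq: "(\<lambda>p. indicator (C w) p * j (cscale_op a x) (th g f p)) =
      (\<lambda>p. a * (indicator (C w) p * j x (th g f p)))"
    by (rule ext) (simp add: j_cscale)
  show ?case unfolding eq by (rule borel_measurable_times[OF borel_measurable_const cscale(2)])
next
  case (limit s x)
  show ?case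
  proof (rule borel_measurable_LIMSEQ_metric)
    show "(\<lambda>p. indicator (C w) p * j (s n) (th g f p)) \<in> borel_measurable Bor" for n by (rule limit)
    show "(\<lambda>n. indicator (C w) p * j (s n) (th g f p)) \<longlonglongrightarrow> indicator (C w) p * j x (th g f p)" for p
      by (intro tendsto_mult tendsto_const tendsto_j limit)
  qed
qed

lemma unit_th: "unit x = th [] [] x"
  by (simp add: unit_def th_def)

lemma measurable_diag:
  assumes c: "c \<in> A"
  shows "(\<lambda>x. j c (unit x)) \<in> borel_measurable Bor"
proof (rule measurable_piecewise_restrict)
  show "countable (C ` verts G)" using countable_verts by simp
  show "space Bor \<subseteq> \<Union>(C ` verts G)" using paths_cover by simp
  show "Y \<inter> space Bor \<in> sets Bor" if "Y \<in> C ` verts G" for Y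
    using that sets_C sets.Int sets.top by blast
  fix Y assume "Y \<in> C ` verts G"
  then obtain v where v: "v \<in> verts G" "Y = C v" by blast
  have "(\<lambda>p. indicator (C v) p * j c (th [] [] p)) \<in> borel_measurable (restrict_space Bor Y)"
    by (rule measurable_restrict_space1[OF measurable_j]) (use v c in auto)
  then show "(\<lambda>x. j c (unit x)) \<in> borel_measurable (restrict_space Bor Y)"
    by (rule measurable_cong[THEN iffD1, rotated])
      (use v in \<open>auto simp: unit_th space_restrict_space\<close>)
qed

subsection \<open>Reduced representations of arrows\<close>

text \<open>Pairs of paths in lowest terms. The vertex is recorded because two empty paths do not
  determine it.\<close>

definition R :: "('e list \<times> 'v \<times> 'e list) set" where
  "R = {(g, w, f). fp g w \<and> fp f w \<and> (g = [] \<or> f = [] \<or> last g \<noteq> last f)}"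

lemma countable_R: "countable R"
proof -
  let ?P = "{(g, w) | g w. fp g w}"
  have "R \<subseteq> (\<lambda>((g, w), (f, _)). (g, w, f)) ` (?P \<times> ?P)"
  proof (rule subsetI)
    fix r assume "r \<in> R"
    then obtain g w f where "r = (g, w, f)" "fp g w" "fp f w" unfolding R_def by blast
    then show "r \<in> (\<lambda>((g, w), (f, _)). (g, w, f)) ` (?P \<times> ?P)"
      by (intro image_eqI[of _ _ "((g, w), (f, w))"]) auto
  qed
  then show ?thesis
    by (rule countable_subset) (intro countable_image countable_SIGMA countable_fp_lists)
qed

lemma R_swap: "(g, w, f) \<in> R \<longleftrightarrow> (f, w, g) \<in> R"
  unfolding R_def by auto

text \<open>A common last edge is moved to the tail without changing the arrow; this shortens the
  paths and must stop.\<close>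

lemma reduced_exists:
  assumes "\<gamma> \<in> \<Gamma>"
  shows "\<exists>g w f p. (g, w, f) \<in> R \<and> p \<in> C w \<and> \<gamma> = th g f p"
proof -
  obtain g0 w0 f0 p0 where "fp g0 w0" "fp f0 w0" "p0 \<in> C w0" "\<gamma> = th g0 f0 p0"
    by (rule groupoid_eq_th[OF assms])
  then show ?thesis
  proof (induction "length g0" arbitrary: g0 w0 f0 p0 rule: less_induct)
    case less
    show ?case
    proof (cases "(g0, w0, f0) \<in> R")
      case False
      then have ne: "g0 \<noteq> []" "f0 \<noteq> []" "last g0 = last f0" using less.prems unfolding R_def by auto
      then obtain a g1 f1 where gf: "g0 = g1 @ [a]" "f0 = f1 @ [a]" by (metis append_butlast_last_id)
      have fp1: "fp g1 (tail G a)" "fp f1 (tail G a)" and a: "fp [a] w0"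
        using less.prems(1,2) unfolding gf fp_append by auto
      have "cat [a] p0 \<in> C (tail G a)" using cat_C[OF a less.prems(3)] by simp
      moreover have "\<gamma> = th g1 f1 (cat [a] p0)" using less.prems(4) unfolding gf th_append .
      moreover have "length g1 < length g0" using gf by simp
      ultimately show ?thesis using less.hyps fp1 by blast
    qed (use less.prems in blast)
  qed
qed

text \<open>Two representations of one arrow differ by a common suffix; a non-empty one would give
  the longer pair a common last edge.\<close>

lemma reduced_unique_le:
  assumes "(g, w, f) \<in> R" "(g', w', f') \<in> R" "p \<in> C w" "p' \<in> C w'" "th g f p = th g' f' p'"
    and "length g \<le> length g'"
  shows "(g, w, f) = (g', w', f')"
proof -
  have "th g f p \<in> ZZ g w f" unfolding Z_def using assms(3) by (rule imageI)
  moreover have "th g f p \<in> ZZ g' w' f'" unfolding assms(5) Z_def using assms(4) by (rule imageI)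
  moreover have "fp g' w'" using assms(2) unfolding R_def by simp
  ultimately obtain h where h: "g' = g @ h" "f' = f @ h" "fp h w'" "vs h w' = w"
    using Z_nested[OF _ _ assms(6)] by blast
  have "h = []"
  proof (rule ccontr)
    assume "h \<noteq> []"
    then have "g' \<noteq> []" "f' \<noteq> []" "last g' = last f'" unfolding h by auto
    then show False using assms(2) unfolding R_def by auto
  qed
  then show ?thesis using h by simp
qed

lemma reduced_unique:
  assumes "(g, w, f) \<in> R" "(g', w', f') \<in> R" "p \<in> C w" "p' \<in> C w'" "th g f p = th g' f' p'"
  shows "(g, w, f) = (g', w', f')"
  using reduced_unique_le[OF assms] reduced_unique_le[OF assms(2,1,4,3) assms(5)[symmetric]]
  by (cases "length g \<le> length g'") auto

text \<open>The tail is recovered from the source by deleting \<open>f\<close>, so a source fibre is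
  indexed by reduced pairs alone. Norms in the fibre become sums over an index set that does not
  depend on \<open>x\<close>.\<close>

lemma fibre_bij:
  assumes x: "x \<in> paths G"
  shows "bij_betw (\<lambda>(g, w, f). th g f ((\<sigma> ^^ length f) x)) {(g, w, f). (g, w, f) \<in> R \<and> x \<in> cyl f w}
     {\<gamma> \<in> \<Gamma>. arrow_source \<gamma> = x}"
proof (rule bij_betw_imageI)
  let ?R = "{(g, w, f). (g, w, f) \<in> R \<and> x \<in> cyl f w}"
  have cyl: "(\<sigma> ^^ length f) x \<in> C w" "cat f ((\<sigma> ^^ length f) x) = x" if cyl_x: "x \<in> cyl f w" for f w
  proof -
    obtain p where p: "p \<in> C w" "x = cat f p" using cyl_x unfolding cyl_def by (rule imageE)
    show "(\<sigma> ^^ length f) x \<in> C w" "cat f ((\<sigma> ^^ length f) x) = x" using p by (simp_all add: shift_cat)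
  qed
  show "inj_on (\<lambda>(g, w, f). th g f ((\<sigma> ^^ length f) x)) ?R"
  proof (rule inj_onI)
    fix r r'
    assume r: "r \<in> ?R" and r': "r' \<in> ?R"
      and eq: "(\<lambda>(g, w, f). th g f ((\<sigma> ^^ length f) x)) r = (\<lambda>(g, w, f). th g f ((\<sigma> ^^ length f) x)) r'"
    obtain g w f where rd: "r = (g, w, f)" by (cases r)
    obtain g' w' f' where rd': "r' = (g', w', f')" by (cases r')
    have "(g, w, f) \<in> R" "x \<in> cyl f w" using r unfolding rd by simp_all
    moreover have "(g', w', f') \<in> R" "x \<in> cyl f' w'" using r' unfolding rd' by simp_all
    moreover have "th g f ((\<sigma> ^^ length f) x) = th g' f' ((\<sigma> ^^ length f') x)"
      using eq unfolding rd rd' prod.case .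
    ultimately show "r = r'" unfolding rd rd' using cyl(1) reduced_unique by metis
  qed
  show "(\<lambda>(g, w, f). th g f ((\<sigma> ^^ length f) x)) ` ?R = {\<gamma> \<in> \<Gamma>. arrow_source \<gamma> = x}"
  proof (rule subset_antisym)
    show "(\<lambda>(g, w, f). th g f ((\<sigma> ^^ length f) x)) ` ?R \<subseteq> {\<gamma> \<in> \<Gamma>. arrow_source \<gamma> = x}"
    proof (rule image_subsetI)
      fix r assume "r \<in> ?R"
      moreover obtain g w f where rd: "r = (g, w, f)" by (cases r)
      ultimately have r: "(g, w, f) \<in> R" "x \<in> cyl f w" by simp_all
      then have fp: "fp g w" "fp f w" unfolding R_def by simp_all
      have "th g f ((\<sigma> ^^ length f) x) \<in> \<Gamma>" by (rule th_groupoid[OF fp cyl(1)[OF r(2)]])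
      then show "(\<lambda>(g, w, f). th g f ((\<sigma> ^^ length f) x)) r \<in> {\<gamma> \<in> \<Gamma>. arrow_source \<gamma> = x}"
        using cyl(2)[OF r(2)] by (simp add: rd)
    qed
    show "{\<gamma> \<in> \<Gamma>. arrow_source \<gamma> = x} \<subseteq> (\<lambda>(g, w, f). th g f ((\<sigma> ^^ length f) x)) ` ?R"
    proof (rule subsetI)
      fix \<gamma> assume "\<gamma> \<in> {\<gamma> \<in> \<Gamma>. arrow_source \<gamma> = x}"
      then have \<gamma>: "\<gamma> \<in> \<Gamma>" "arrow_source \<gamma> = x" by simp_all
      from reduced_exists[OF \<gamma>(1)] obtain g w f p where r: "(g, w, f) \<in> R" "p \<in> C w" "\<gamma> = th g f p"
        by (elim exE conjE)
      have x_eq: "x = cat f p" using \<gamma>(2) unfolding r(3) by simp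
      have "x \<in> cyl f w" unfolding x_eq cyl_def using r(2) by (rule imageI)
      moreover have "(\<sigma> ^^ length f) x = p" unfolding x_eq by (rule shift_cat)
      ultimately have "(g, w, f) \<in> ?R" "\<gamma> = (\<lambda>(g, w, f). th g f ((\<sigma> ^^ length f) x)) (g, w, f)"
        using r by simp_all
      then show "\<gamma> \<in> (\<lambda>(g, w, f). th g f ((\<sigma> ^^ length f) x)) ` ?R" by (rule rev_image_eqI)
    qed
  qed
qed

lemma norm_unit_expansion:
  assumes c: "c \<in> A" and x: "x \<in> paths G"
  shows "ennreal ((norm (blinfun_apply c (ket (unit x))))\<^sup>2) =
    (\<integral>\<^sup>+r. (case r of (g, w, f) \<Rightarrow> indicator (cyl f w) x *
        ennreal ((cmod (j c (th g f ((\<sigma> ^^ length f) x))))\<^sup>2)) \<partial>count_space R)"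
proof -
  let ?y = "blinfun_apply c (ket (unit x))"
  let ?F = "{\<gamma> \<in> \<Gamma>. arrow_source \<gamma> = x}"
  let ?R = "{(g, w, f). (g, w, f) \<in> R \<and> x \<in> cyl f w}"
  let ?b = "\<lambda>(g, w, f). th g f ((\<sigma> ^^ length f) x)"
  have ss: "(\<lambda>\<gamma>. (cmod (Rep_ell2 ?y \<gamma>))\<^sup>2) summable_on UNIV"
    using square_summable_Rep_ell2 unfolding square_summable_def by blast
  then have sF: "(\<lambda>\<gamma>. (cmod (Rep_ell2 ?y \<gamma>))\<^sup>2) summable_on ?F"
    by (rule summable_on_subset_banach) simp
  have "(norm ?y)\<^sup>2 = (\<Sum>\<^sub>\<infinity>\<gamma>\<in>?F. (cmod (Rep_ell2 ?y \<gamma>))\<^sup>2)"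
    unfolding norm_ell2_sq by (rule infsum_cong_neutral) (use Rep_unit_eq_0[OF c x] in auto)
  then have "ennreal ((norm ?y)\<^sup>2) = (\<integral>\<^sup>+\<gamma>. ennreal ((cmod (Rep_ell2 ?y \<gamma>))\<^sup>2) \<partial>count_space ?F)"
    using nn_integral_count_space_infsum[OF sF] by simp
  also have "\<dots> = (\<integral>\<^sup>+r. ennreal ((cmod (Rep_ell2 ?y (?b r)))\<^sup>2) \<partial>count_space ?R)"
    by (rule nn_integral_bij_count_space[OF fibre_bij[OF x], symmetric])
  also have "\<dots> = (\<integral>\<^sup>+r. (case r of (g, w, f) \<Rightarrow> indicator (cyl f w) x *
        ennreal ((cmod (j c (th g f ((\<sigma> ^^ length f) x))))\<^sup>2)) \<partial>count_space ?R)"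
  proof (rule nn_integral_cong)
    fix r assume "r \<in> space (count_space ?R)"
    then obtain g w f where r: "r = (g, w, f)" "x \<in> cyl f w" by auto
    then have "cat f ((\<sigma> ^^ length f) x) = x" unfolding cyl_def by (auto simp: shift_cat)
    then show "ennreal ((cmod (Rep_ell2 ?y (?b r)))\<^sup>2) = (case r of (g, w, f) \<Rightarrow> indicator (cyl f w) x *
        ennreal ((cmod (j c (th g f ((\<sigma> ^^ length f) x))))\<^sup>2))"
      using r by (simp add: j_def)
  qed
  also have "\<dots> = (\<integral>\<^sup>+r. (case r of (g, w, f) \<Rightarrow> indicator (cyl f w) x *
        ennreal ((cmod (j c (th g f ((\<sigma> ^^ length f) x))))\<^sup>2)) \<partial>count_space R)"
    by (rule nn_integral_count_space_eq) (auto simp: indicator_def)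
  finally show ?thesis .
qed

end

section \<open>The weight of an eigenvector\<close>

lemma (in path_graph) j_unit:
  "j c (unit x) = cinner_ell2 (ket (unit x)) (blinfun_apply c (ket (unit x)))"
  by (simp add: j_def cinner_ket_left)

lemma (in path_graph) j_unit_nonneg: "c \<in> positive_part A \<Longrightarrow> 0 \<le> Re (j c (unit x))"
  unfolding j_unit positive_part_eq nonneg_op_def by simp

lemma (in path_graph) j_unit_adj_compose:
  assumes "c \<in> A"
  shows "j (adj_op c o\<^sub>L c) (unit x) = of_real ((norm (blinfun_apply c (ket (unit x))))\<^sup>2)"
  using cinner_adj_right[OF adjointable[OF assms]] by (simp add: j_unit cinner_self)

lemma (in path_graph) closed_positive_part: "closed (positive_part A)"
  unfolding closed_sequential_limits positive_part_eq using nonneg_op_limit limit by blast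

section \<open>The weight as an integral of diagonal coefficients\<close>

context eigenvector
begin

definition \<Psi> :: "'e arrow operator \<Rightarrow> ennreal" where
  "\<Psi> a = (if a \<in> positive_part A then \<integral>\<^sup>+x. ennreal (Re (j a (unit x))) \<partial>\<mu> else undefined)"

lemma measurable_Re_j: "a \<in> A \<Longrightarrow> (\<lambda>x. ennreal (Re (j a (unit x)))) \<in> borel_measurable \<mu>"
  using measurable_diag[of a] by (simp add: measurable_cong_sets[OF sets_\<mu> refl])

lemma \<Psi>_add:
  assumes "a \<in> positive_part A" "b \<in> positive_part A"
  shows "\<Psi> (a + b) = \<Psi> a + \<Psi> b"
proof -
  have "ennreal (Re (j (a + b) (unit x))) = ennreal (Re (j a (unit x))) + ennreal (Re (j b (unit x)))" for x
    using assms by (simp add: j_add j_unit_nonneg ennreal_plus)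
  then show ?thesis
    using assms pos_add by (simp add: \<Psi>_def nn_integral_add measurable_Re_j pos_in)
qed

lemma \<Psi>_scaleR:
  assumes a: "a \<in> positive_part A" and r: "0 \<le> r"
  shows "\<Psi> (r *\<^sub>R a) = ennreal r * \<Psi> a"
proof -
  have "j (r *\<^sub>R a) \<gamma> = of_real r * j a \<gamma>" for \<gamma>
    using j_cscale[of "of_real r" a \<gamma>] by (simp add: cscale_op_of_real)
  then have "ennreal (Re (j (r *\<^sub>R a) (unit x))) = ennreal r * ennreal (Re (j a (unit x)))" for x
    using r a by (simp add: ennreal_mult j_unit_nonneg)
  then show ?thesis
    using a r pos_scaleR by (simp add: \<Psi>_def nn_integral_cmult measurable_Re_j pos_in)
qed

lemma \<Psi>_adj_compose:
  assumes c: "c \<in> A"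
  shows "\<Psi> (adj_op c o\<^sub>L c) = (\<integral>\<^sup>+x. ennreal ((norm (blinfun_apply c (ket (unit x))))\<^sup>2) \<partial>\<mu>)"
  unfolding \<Psi>_def j_unit_adj_compose[OF c] using pos_adj_compose[OF c] by simp

lemma \<Psi>_p:
  assumes v: "v \<in> verts G"
  shows "\<Psi> (S [] v []) = ennreal (\<xi> v)"
proof -
  have fp: "fp [] v" using v by simp
  have "\<Psi> (S [] v []) = (\<integral>\<^sup>+x. indicator (C v) x \<partial>\<mu>)"
    unfolding \<Psi>_def if_P[OF p_pos[OF v]]
  proof (rule nn_integral_cong)
    fix x assume "x \<in> space \<mu>"
    then have x: "unit x \<in> \<Gamma>" by (simp add: unit_groupoid)
    have "unit x \<in> ZZ [] v [] \<longleftrightarrow> x \<in> C v" by (auto simp: Z_def th_def unit_def)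
    then show "ennreal (Re (j (S [] v []) (unit x))) = indicator (C v) x"
      by (simp add: j_S[OF fp fp x] indicator_def)
  qed
  then show ?thesis using v by (simp add: sets_C emeasure_\<mu>_C)
qed

lemma \<Psi>_pe: "\<Psi> (pe n) < \<infinity>"
proof -
  have "(\<Sum>v\<in>I. S [] v []) \<in> positive_part A \<and> \<Psi> (\<Sum>v\<in>I. S [] v []) < \<infinity>"
    if "finite I" "I \<subseteq> verts G" for I
    using that
  proof (induction I rule: finite_induct)
    case empty
    have "\<Psi> 0 = 0" using \<Psi>_scaleR[OF pos_zero, of 0] by simp
    then show ?case by (simp add: pos_zero)
  next
    case (insert v I)
    then show ?case by (simp add: pos_add p_pos \<Psi>_add \<Psi>_p)
  qed
  then show ?thesis unfolding pe_def using finite_en en_verts by blast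
qed

text \<open>The square root of the corner factors through \<open>pe n\<close>, so its integrand is
  at most a constant times the diagonal of \<open>pe n\<close>, whose weight is finite. Corners of
  this kind prove that the weight is densely defined.\<close>

lemma \<Psi>_corner:
  assumes a: "a \<in> positive_part A"
  shows "\<Psi> (pe n o\<^sub>L a o\<^sub>L pe n) < \<infinity>"
proof -
  obtain d where d: "d \<in> A" "a = adj_op d o\<^sub>L d" using a unfolding positive_part_def by blast
  have dpe: "d o\<^sub>L pe n \<in> A" using d(1) pe_in by (rule compose)
  have "pe n o\<^sub>L a o\<^sub>L pe n = adj_op (d o\<^sub>L pe n) o\<^sub>L (d o\<^sub>L pe n)"
    using d(1) pe_adj[of n] by (simp add: d(2) adj_compose adjointable compose_assoc)
  then have "\<Psi> (pe n o\<^sub>L a o\<^sub>L pe n) = (\<integral>\<^sup>+x. ennreal ((norm (blinfun_apply (d o\<^sub>L pe n) (ket (unit x))))\<^sup>2) \<partial>\<mu>)"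
    by (simp only: \<Psi>_adj_compose[OF dpe])
  also have "\<dots> \<le> (\<integral>\<^sup>+x. ennreal ((norm d)\<^sup>2) * ennreal (Re (j (pe n) (unit x))) \<partial>\<mu>)"
  proof (rule nn_integral_mono)
    fix x
    have "(norm (blinfun_apply (d o\<^sub>L pe n) (ket (unit x))))\<^sup>2 \<le> (norm d * norm (blinfun_apply (pe n) (ket (unit x))))\<^sup>2"
      by (intro power_mono) (simp_all add: norm_blinfun)
    also have "\<dots> = (norm d)\<^sup>2 * Re (j (pe n) (unit x))"
      using j_unit_adj_compose[OF pe_in, of n x] pe_adj pe_idem by (simp add: power_mult_distrib)
    finally show "ennreal ((norm (blinfun_apply (d o\<^sub>L pe n) (ket (unit x))))\<^sup>2)
        \<le> ennreal ((norm d)\<^sup>2) * ennreal (Re (j (pe n) (unit x)))"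
      using j_unit_nonneg[OF pe_pos] by (simp add: ennreal_leI flip: ennreal_mult)
  qed
  also have "\<dots> = ennreal ((norm d)\<^sup>2) * \<Psi> (pe n)"
    by (simp add: \<Psi>_def pe_pos nn_integral_cmult measurable_Re_j pe_in)
  also have "\<dots> < \<infinity>" using \<Psi>_pe by (simp add: ennreal_mult_less_top)
  finally show ?thesis .
qed

text \<open>Norm convergence gives pointwise convergence of the diagonal coefficients, and lower
  semi-continuity is then Fatou's lemma.\<close>

lemma \<Psi>_sublevel_closed: "closed {a \<in> positive_part A. \<Psi> a \<le> c}"
  unfolding closed_sequential_limits
proof (intro allI impI)
  fix f a
  assume "(\<forall>n. f n \<in> {a \<in> positive_part A. \<Psi> a \<le> c}) \<and> f \<longlonglongrightarrow> a"
  then have lim: "f \<longlonglongrightarrow> a" and f: "\<And>n. f n \<in> positive_part A" "\<And>n. \<Psi> (f n) \<le> c" by auto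
  have a: "a \<in> positive_part A" using closed_sequentially[OF closed_positive_part f(1) lim] .
  have "\<Psi> a = (\<integral>\<^sup>+x. liminf (\<lambda>n. ennreal (Re (j (f n) (unit x)))) \<partial>\<mu>)"
    unfolding \<Psi>_def if_P[OF a]
  proof (rule nn_integral_cong)
    fix x
    have "(\<lambda>n. ennreal (Re (j (f n) (unit x)))) \<longlonglongrightarrow> ennreal (Re (j a (unit x)))"
      by (intro tendsto_ennrealI tendsto_Re tendsto_j lim)
    then show "ennreal (Re (j a (unit x))) = liminf (\<lambda>n. ennreal (Re (j (f n) (unit x))))"
      by (simp add: lim_imp_Liminf)
  qed
  also have "\<dots> \<le> liminf (\<lambda>n. \<integral>\<^sup>+x. ennreal (Re (j (f n) (unit x))) \<partial>\<mu>)"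
    by (rule nn_integral_liminf) (rule measurable_Re_j[OF pos_in[OF f(1)]])
  also have "\<dots> = liminf (\<lambda>n. \<Psi> (f n))" by (simp add: \<Psi>_def f(1))
  also have "\<dots> \<le> c"
    using Liminf_mono[of "\<lambda>n. \<Psi> (f n)" "\<lambda>_. c" sequentially] f(2) by (simp add: Liminf_const)
  finally show "a \<in> {a \<in> positive_part A. \<Psi> a \<le> c}" using a by simp
qed

lemma \<Psi>_\<alpha>: "a \<in> positive_part A \<Longrightarrow> \<Psi> (\<alpha> t a) = \<Psi> a"
  using \<alpha>_pos by (simp add: \<Psi>_def j_\<alpha> unit_def deg_def)

lemma proper_\<Psi>:
  assumes nz: "\<exists>v\<in>verts G. \<xi> v \<noteq> 0"
  shows "proper_weight A \<Psi>"
  unfolding proper_weight_def weight_def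
proof (intro conjI ballI allI impI)
  show "\<Psi> \<in> extensional (positive_part A)" unfolding extensional_def \<Psi>_def by simp
  show "\<Psi> (a + b) = \<Psi> a + \<Psi> b" if "a \<in> positive_part A" "b \<in> positive_part A" for a b
    using that by (rule \<Psi>_add)
  show "\<Psi> (c *\<^sub>R a) = ennreal c * \<Psi> a" if "a \<in> positive_part A" "0 < c" for a c
    using \<Psi>_scaleR that by simp
  obtain v where v: "v \<in> verts G" "\<xi> v \<noteq> 0" using nz by blast
  then have "\<Psi> (S [] v []) \<noteq> 0" using \<xi>_nonneg[OF v(1)] by (simp add: \<Psi>_p)
  then show "\<exists>a\<in>positive_part A. \<Psi> a \<noteq> 0" using p_pos[OF v(1)] by blast
  show "closed {a \<in> positive_part A. \<Psi> a \<le> ennreal c}" for c by (rule \<Psi>_sublevel_closed)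
  show "positive_part A \<subseteq> closure {a \<in> positive_part A. \<Psi> a < \<infinity>}"
  proof (rule subsetI)
    fix a assume a: "a \<in> positive_part A"
    show "a \<in> closure {a \<in> positive_part A. \<Psi> a < \<infinity>}"
      unfolding closure_sequential
      by (rule exI[of _ "\<lambda>n. pe n o\<^sub>L a o\<^sub>L pe n"]) (use a pe_approx_both pos_in corner_pos \<Psi>_corner in simp)
  qed
qed

end

section \<open>The KMS condition\<close>

text \<open>The exponential has modulus exp (- k Im z), which lies between its values 1 and exp (- k
  \<beta>) on the two edges of the strip. The sum of the two edge series therefore dominates
  uniformly, and the Weierstrass test applies.\<close>

lemma strip_series:
  fixes c :: "'a \<Rightarrow> complex" and k :: "'a \<Rightarrow> int"
  assumes s: "(\<lambda>r. cmod (c r)) summable_on I" "(\<lambda>r. cmod (c r) * exp (- \<beta> * of_int (k r))) summable_on I"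
  defines "F \<equiv> \<lambda>z. \<Sum>\<^sub>\<infinity>r\<in>I. c r * exp (\<i> * of_int (k r) * z)"
  shows "continuous_on (strip \<beta>) F" "bounded (F ` strip \<beta>)" "F holomorphic_on interior (strip \<beta>)"
proof -
  let ?M = "\<lambda>r. cmod (c r) + cmod (c r) * exp (- \<beta> * of_int (k r))"
  have M: "?M summable_on I" by (rule summable_on_add[OF s])
  have le: "norm (c r * exp (\<i> * of_int (k r) * z)) \<le> ?M r" if z: "z \<in> strip \<beta>" for r z
  proof -
    have "- (of_int (k r) * Im z) \<le> 0 \<or> - (of_int (k r) * Im z) \<le> - (of_int (k r) * \<beta>)"
    proof (cases "0 \<le> \<beta>")
      case True
      then have "0 \<le> Im z" "Im z \<le> \<beta>" using z unfolding strip_def by auto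
      then show ?thesis
        by (cases "0 \<le> k r") (simp_all add: mult_nonneg_nonneg mult_left_mono_neg)
    next
      case False
      then have "\<beta> \<le> Im z" "Im z \<le> 0" using z unfolding strip_def by auto
      then show ?thesis
        by (cases "0 \<le> k r") (simp_all add: mult_nonpos_nonpos mult_left_mono)
    qed
    then have "exp (- (of_int (k r) * Im z)) \<le> 1 + exp (- \<beta> * of_int (k r))"
    proof
      assume "- (of_int (k r) * Im z) \<le> 0"
      then have "exp (- (of_int (k r) * Im z)) \<le> 1" by simp
      then show ?thesis by (simp add: add_increasing2)
    next
      assume "- (of_int (k r) * Im z) \<le> - (of_int (k r) * \<beta>)"
      then have "exp (- (of_int (k r) * Im z)) \<le> exp (- \<beta> * of_int (k r))" by (simp add: mult.commute)
      then show ?thesis by (rule add_increasing[OF zero_le_one])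
    qed
    then have "cmod (c r) * exp (- (of_int (k r) * Im z)) \<le> cmod (c r) * (1 + exp (- \<beta> * of_int (k r)))"
      by (rule mult_left_mono) simp
    then show ?thesis by (simp add: norm_mult distrib_left)
  qed
  have u: "uniform_limit (strip \<beta>) (\<lambda>X z. \<Sum>r\<in>X. c r * exp (\<i> * of_int (k r) * z)) F (finite_subsets_at_top I)"
    unfolding F_def by (rule Weierstrass_m_test_general[OF le M])
  have cont: "continuous_on T (\<lambda>z. \<Sum>r\<in>X. c r * exp (\<i> * of_int (k r) * z))" for X T
    by (intro continuous_intros)
  show "continuous_on (strip \<beta>) F"
    by (rule uniform_limit_theorem[OF _ u]) (simp_all add: cont)
  show "bounded (F ` strip \<beta>)"
  proof (rule boundedI)
    fix y assume "y \<in> F ` strip \<beta>"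
    then obtain z where z: "z \<in> strip \<beta>" "y = F z" by blast
    have sz: "(\<lambda>r. norm (c r * exp (\<i> * of_int (k r) * z))) summable_on I"
      by (rule summable_on_comparison_test[OF M]) (use le[OF z(1)] in simp_all)
    have "norm y \<le> (\<Sum>\<^sub>\<infinity>r\<in>I. norm (c r * exp (\<i> * of_int (k r) * z)))"
      unfolding z(2) F_def by (rule norm_infsum_bound[OF sz])
    also have "\<dots> \<le> infsum ?M I" by (rule infsum_mono[OF sz M le[OF z(1)]])
    finally show "norm y \<le> infsum ?M I" .
  qed
  show "F holomorphic_on interior (strip \<beta>)"
    unfolding holomorphic_on_def
  proof
    fix z assume z: "z \<in> interior (strip \<beta>)"
    then obtain e where e: "0 < e" "cball z e \<subseteq> interior (strip \<beta>)"
      using open_contains_cball[of "interior (strip \<beta>)"] by auto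
    then have "cball z e \<subseteq> strip \<beta>" using interior_subset by blast
    then have uz: "uniform_limit (cball z e) (\<lambda>X z. \<Sum>r\<in>X. c r * exp (\<i> * of_int (k r) * z)) F (finite_subsets_at_top I)"
      by (rule uniform_limit_on_subset[OF u])
    have "(\<lambda>z. \<Sum>r\<in>X. c r * exp (\<i> * of_int (k r) * z)) holomorphic_on ball z e" for X
      by (intro holomorphic_intros)
    then have "F holomorphic_on ball z e"
      using holomorphic_uniform_limit[OF _ uz] cont by (metis (no_types, lifting) always_eventually finite_subsets_at_top_neq_bot)
    then have "F field_differentiable at z within ball z e"
      using e(1) unfolding holomorphic_on_def by simp
    then have "F field_differentiable at z"
      using e(1) by (simp add: at_within_open[of z "ball z e"])
    then show "F field_differentiable at z within interior (strip \<beta>)"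
      by (rule field_differentiable_at_within)
  qed
qed

section \<open>The weight as a series over reduced pairs, and the KMS function\<close>

context eigenvector
begin

text \<open>The triple \<open>r = (g, w, f)\<close> stands for the arrows \<open>th g f p\<close> with \<open>p \<in> C w\<close>; the source map
  \<open>p \<mapsto> cat f p\<close> of this bisection scales \<open>\<mu>\<close> by \<open>wr r\<close>.\<close>

definition wr :: "'e list \<times> 'v \<times> 'e list \<Rightarrow> real" where
  "wr = (\<lambda>(g, w, f). exp (- \<beta> * real (length f)))"

definition jr :: "'e arrow operator \<Rightarrow> 'e list \<times> 'v \<times> 'e list \<Rightarrow> 'e path \<Rightarrow> complex" where
  "jr c = (\<lambda>(g, w, f) p. indicator (C w) p * j c (th g f p))"

definition B :: "'e list \<times> 'v \<times> 'e list \<Rightarrow> 'e arrow operator \<Rightarrow> 'e arrow operator \<Rightarrow> complex" where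
  "B r c d = (LINT p|\<mu>. cnj (jr c r p) * jr d r p)"

lemma measurable_jr:
  assumes "c \<in> A" "r \<in> R"
  shows "jr c r \<in> borel_measurable \<mu>"
proof -
  obtain g w f where r: "r = (g, w, f)" by (cases r)
  then have "fp g w" "fp f w" using assms(2) unfolding R_def by simp_all
  from measurable_j[OF this assms(1)] show ?thesis
    unfolding r jr_def by (simp add: measurable_cong_sets[OF sets_\<mu> refl])
qed

lemma integrable_jr:
  assumes c: "c \<in> A" and d: "d \<in> A" and r: "r \<in> R"
  shows "integrable \<mu> (\<lambda>p. cnj (jr c r p) * jr d r p)"
proof -
  obtain g w f where rd: "r = (g, w, f)" by (cases r)
  then have w: "w \<in> verts G" using r unfolding R_def by (auto intro: fp_verts)
  show ?thesis
  proof (rule Bochner_Integration.integrable_bound[where f = "\<lambda>p. (norm c * norm d) *\<^sub>R indicat_real (C w) p"])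
    show "integrable \<mu> (\<lambda>p. (norm c * norm d) *\<^sub>R indicat_real (C w) p)"
      using w by (intro integrable_scaleR_right integrable_real_indicator) (simp_all add: sets_C emeasure_\<mu>_C)
    show "(\<lambda>p. cnj (jr c r p) * jr d r p) \<in> borel_measurable \<mu>"
      by (intro borel_measurable_times measurable_jr d r
          measurable_compose[OF measurable_jr[OF c r] borel_measurable_continuous_onI] continuous_intros)
    show "AE p in \<mu>. norm (cnj (jr c r p) * jr d r p) \<le> norm ((norm c * norm d) *\<^sub>R indicat_real (C w) p)"
      by (rule AE_I2) (simp add: rd jr_def norm_mult indicator_def mult_mono j_le_norm)
  qed
qed

lemma B_diag:
  assumes c: "c \<in> A" and r: "r \<in> R"
  shows "B r c c = of_real (LINT p|\<mu>. (cmod (jr c r p))\<^sup>2)"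
    and "0 \<le> Re (B r c c)"
    and "(\<integral>\<^sup>+p. ennreal ((cmod (jr c r p))\<^sup>2) \<partial>\<mu>) = ennreal (Re (B r c c))"
proof -
  have eq: "cnj (jr c r p) * jr c r p = of_real ((cmod (jr c r p))\<^sup>2)" for p
    using complex_norm_square[of "jr c r p"] by (simp add: mult.commute)
  show 1: "B r c c = of_real (LINT p|\<mu>. (cmod (jr c r p))\<^sup>2)"
    unfolding B_def eq by (rule integral_complex_of_real)
  show "0 \<le> Re (B r c c)" unfolding 1 by simp
  have "integrable \<mu> (\<lambda>p. Re (cnj (jr c r p) * jr c r p))"
    by (rule integrable_Re[OF integrable_jr[OF c c r]])
  then have "integrable \<mu> (\<lambda>p. (cmod (jr c r p))\<^sup>2)" unfolding eq by simp
  then show "(\<integral>\<^sup>+p. ennreal ((cmod (jr c r p))\<^sup>2) \<partial>\<mu>) = ennreal (Re (B r c c))"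
    unfolding 1 by (simp add: nn_integral_eq_integral)
qed

text \<open>The square of the norm is expanded in each source fibre, Tonelli exchanges the integral
  with the countable sum, and substituting the tail for the source brings in the factor
  \<open>wr\<close>.\<close>

lemma \<Psi>_expansion:
  assumes c: "c \<in> A"
  shows "\<Psi> (adj_op c o\<^sub>L c) = (\<integral>\<^sup>+r. ennreal (wr r * Re (B r c c)) \<partial>count_space R)"
proof -
  let ?h = "\<lambda>r x. case r of (g, w, f) \<Rightarrow> indicator (cyl f w) x * ennreal ((cmod (jr c r ((\<sigma> ^^ length f) x)))\<^sup>2)"
  have h: "?h r \<in> borel_measurable \<mu> \<and> (\<integral>\<^sup>+x. ?h r x \<partial>\<mu>) = ennreal (wr r * Re (B r c c))" if r: "r \<in> R" for r
  proof -
    obtain g w f where rd: "r = (g, w, f)" by (cases r)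
    have fp: "fp f w" using r unfolding rd R_def by simp
    have m: "(\<lambda>p. ennreal ((cmod (jr c r p))\<^sup>2)) \<in> borel_measurable Bor"
      using measurable_jr[OF c r] by (simp add: measurable_cong_sets[OF sets_\<mu> refl])
    have "(\<lambda>x. ennreal ((cmod (jr c r ((\<sigma> ^^ length f) x)))\<^sup>2)) \<in> borel_measurable Bor"
      by (rule measurable_compose[OF measurable_shift m])
    then have "(\<lambda>x. indicator (cyl f w) x * ennreal ((cmod (jr c r ((\<sigma> ^^ length f) x)))\<^sup>2)) \<in> borel_measurable Bor"
      using sets_cyl[OF fp] by (intro borel_measurable_times_ennreal borel_measurable_indicator)
    then have 1: "?h r \<in> borel_measurable \<mu>"
      unfolding rd prod.case by (simp add: measurable_cong_sets[OF sets_\<mu> refl])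
    have "(\<integral>\<^sup>+x. ?h r x \<partial>\<mu>) = ennreal (exp (- \<beta> * real (length f))) *
        (\<integral>\<^sup>+p. indicator (C w) p * ennreal ((cmod (jr c r p))\<^sup>2) \<partial>\<mu>)"
      unfolding rd prod.case by (rule nn_integral_shift[OF fp m[unfolded rd]])
    also have "(\<integral>\<^sup>+p. indicator (C w) p * ennreal ((cmod (jr c r p))\<^sup>2) \<partial>\<mu>) = (\<integral>\<^sup>+p. ennreal ((cmod (jr c r p))\<^sup>2) \<partial>\<mu>)"
      by (rule nn_integral_cong) (simp add: rd jr_def indicator_def)
    also have "\<dots> = ennreal (Re (B r c c))" by (rule B_diag(3)[OF c r])
    also have "ennreal (exp (- \<beta> * real (length f))) * \<dots> = ennreal (wr r * Re (B r c c))"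
      using B_diag(2)[OF c r] unfolding wr_def by (simp only: rd prod.case ennreal_mult exp_ge_zero)
    finally show ?thesis using 1 by blast
  qed
  have "\<Psi> (adj_op c o\<^sub>L c) = (\<integral>\<^sup>+x. \<integral>\<^sup>+r. ?h r x \<partial>count_space R \<partial>\<mu>)"
    unfolding \<Psi>_adj_compose[OF c]
  proof (rule nn_integral_cong)
    fix x assume "x \<in> space \<mu>"
    then have x: "x \<in> paths G" by simp
    show "ennreal ((norm (blinfun_apply c (ket (unit x))))\<^sup>2) = (\<integral>\<^sup>+r. ?h r x \<partial>count_space R)"
      unfolding norm_unit_expansion[OF c x]
    proof (rule nn_integral_cong)
      fix r :: "'e list \<times> 'v \<times> 'e list"
      obtain g w f where rd: "r = (g, w, f)" by (cases r)
      have "(\<sigma> ^^ length f) x \<in> C w" if xf: "x \<in> cyl f w"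
      proof -
        obtain p where p: "p \<in> C w" "x = cat f p" using xf unfolding cyl_def by (rule imageE)
        then show ?thesis by (simp add: shift_cat)
      qed
      then show "(case r of (g, w, f) \<Rightarrow> indicator (cyl f w) x *
          ennreal ((cmod (j c (th g f ((\<sigma> ^^ length f) x))))\<^sup>2)) = ?h r x"
        unfolding rd prod.case jr_def by (cases "x \<in> cyl f w") simp_all
    qed
  qed
  also have "\<dots> = (\<integral>\<^sup>+r. \<integral>\<^sup>+x. ?h r x \<partial>\<mu> \<partial>count_space R)"
    by (rule nn_integral_count_space_nn_integral[OF countable_R]) (use h in blast)
  also have "\<dots> = (\<integral>\<^sup>+r. ennreal (wr r * Re (B r c c)) \<partial>count_space R)"
    by (rule nn_integral_cong) (use h in simp)
  finally show ?thesis .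
qed

end

lemma has_sum_eq: "(f has_sum s) I \<Longrightarrow> (\<And>x. x \<in> I \<Longrightarrow> f x = g x) \<Longrightarrow> (g has_sum s) I"
  using has_sum_cong by blast

locale nonzero_eigenvector = eigenvector G \<beta> \<xi>
  for G :: "('v, 'e) pre_digraph" and \<beta> \<xi> +
  assumes \<xi>_nonzero: "\<exists>v\<in>verts G. \<xi> v \<noteq> 0"

sublocale nonzero_eigenvector \<subseteq> proper_weight_on "graph_algebra G" \<Psi>
  using proper_\<Psi>[OF \<xi>_nonzero] by unfold_locales

context nonzero_eigenvector
begin

lemma has_sum_diag:
  assumes c: "c \<in> N"
  shows "((\<lambda>r. wr r * Re (B r c c)) has_sum enn2real (\<Psi> (adj_op c o\<^sub>L c))) R"
proof -
  have cA: "c \<in> A" and fin: "\<Psi> (adj_op c o\<^sub>L c) < \<infinity>" using c unfolding weight_N_def by simp_all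
  have nn: "0 \<le> wr r * Re (B r c c)" if "r \<in> R" for r
    using B_diag(2)[OF cA that] by (cases r) (simp add: wr_def)
  have s: "(\<lambda>r. wr r * Re (B r c c)) summable_on R"
    by (rule summable_on_nn_integral_count_space[OF nn]) (use fin in \<open>simp_all add: \<Psi>_expansion[OF cA]\<close>)
  have "\<Psi> (adj_op c o\<^sub>L c) = ennreal (\<Sum>\<^sub>\<infinity>r\<in>R. wr r * Re (B r c c))"
    unfolding \<Psi>_expansion[OF cA] by (rule nn_integral_count_space_infsum[OF s nn])
  moreover have "0 \<le> (\<Sum>\<^sub>\<infinity>r\<in>R. wr r * Re (B r c c))" by (rule infsum_nonneg[OF nn])
  ultimately have "enn2real (\<Psi> (adj_op c o\<^sub>L c)) = (\<Sum>\<^sub>\<infinity>r\<in>R. wr r * Re (B r c c))" by simp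
  then show ?thesis using s by (simp add: has_sum_infsum)
qed

lemma jr_add: "jr (c + d) r p = jr c r p + jr d r p"
  by (cases r) (simp add: jr_def j_add distrib_left)

lemma jr_cscale: "jr (cscale_op z c) r p = z * jr c r p"
  by (cases r) (simp add: jr_def j_cscale)

text \<open>The same polarization as in \<open>polar_val\<close>, so that the expansion of squares
  carries over to mixed products term by term.\<close>

lemma B_polarization:
  assumes a: "a \<in> A" and b: "b \<in> A" and r: "r \<in> R"
  shows "(\<Sum>k<4. \<i> ^ k / 4 * B r (polar a b k) (polar a b k)) = B r a b"
proof -
  have polar_in: "polar a b k \<in> A" for k unfolding polar_def by (intro add cscale a b)
  have pt: "(\<Sum>k<4. \<i> ^ k / 4 * (cnj (y + \<i> ^ k * x) * (y + \<i> ^ k * x))) = cnj x * y" for x y :: complex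
    by (simp add: numeral_eq_Suc algebra_simps)
  have "(\<Sum>k<4. \<i> ^ k / 4 * B r (polar a b k) (polar a b k)) =
      (\<Sum>k<4. (LINT p|\<mu>. \<i> ^ k / 4 * (cnj (jr (polar a b k) r p) * jr (polar a b k) r p)))"
    unfolding B_def by (simp add: integrable_jr polar_in r)
  also have "\<dots> = (LINT p|\<mu>. (\<Sum>k<4. \<i> ^ k / 4 * (cnj (jr (polar a b k) r p) * jr (polar a b k) r p)))"
    by (rule Bochner_Integration.integral_sum[symmetric]) (intro integrable_mult_right integrable_jr polar_in r)
  also have "\<dots> = B r a b"
    unfolding B_def polar_def jr_add jr_cscale pt ..
  finally show ?thesis .
qed

text \<open>Both the functional and the forms \<open>B r\<close> are recovered from their values on
  the four squares, for which the expansion is already known.\<close>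

lemma has_sum_functional:
  assumes a: "a \<in> N" and b: "b \<in> N"
  shows "((\<lambda>r. of_real (wr r) * B r a b) has_sum \<phi> (adj_op a o\<^sub>L b)) R"
proof -
  let ?p = "polar a b"
  have k: "((\<lambda>r. \<i> ^ k / 4 * (of_real (wr r) * B r (?p k) (?p k))) has_sum
      \<i> ^ k / 4 * of_real (enn2real (\<Psi> (adj_op (?p k) o\<^sub>L ?p k)))) R" for k
  proof (rule has_sum_cmult_right)
    have pN: "?p k \<in> N" by (rule polar_N[OF a b])
    have "((\<lambda>r. complex_of_real (wr r * Re (B r (?p k) (?p k)))) has_sum
        of_real (enn2real (\<Psi> (adj_op (?p k) o\<^sub>L ?p k)))) R"
      using has_sum_diag[OF pN] by (simp only: has_sum_of_real_iff)
    moreover have "complex_of_real (wr r * Re (B r (?p k) (?p k))) = of_real (wr r) * B r (?p k) (?p k)" if "r \<in> R" for r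
      using B_diag(1)[OF N_in[OF pN] that] by simp
    ultimately show "((\<lambda>r. of_real (wr r) * B r (?p k) (?p k)) has_sum
        of_real (enn2real (\<Psi> (adj_op (?p k) o\<^sub>L ?p k)))) R"
      by (rule has_sum_eq)
  qed
  have "((\<lambda>r. \<Sum>k<n. \<i> ^ k / 4 * (of_real (wr r) * B r (?p k) (?p k))) has_sum
      (\<Sum>k<n. \<i> ^ k / 4 * of_real (enn2real (\<Psi> (adj_op (?p k) o\<^sub>L ?p k))))) R" for n :: nat
  proof (induction n)
    case (Suc n)
    show ?case unfolding sum.lessThan_Suc by (rule has_sum_add[OF Suc k])
  qed simp
  from this[of 4] have "((\<lambda>r. \<Sum>k<4. \<i> ^ k / 4 * (of_real (wr r) * B r (?p k) (?p k))) has_sum \<phi> (adj_op a o\<^sub>L b)) R"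
    unfolding functional_adj_compose[OF a b] polar_val_def .
  moreover have "(\<Sum>k<4. \<i> ^ k / 4 * (of_real (wr r) * B r (?p k) (?p k))) = of_real (wr r) * B r a b" if "r \<in> R" for r
    unfolding B_polarization[OF N_in[OF a] N_in[OF b] that, symmetric] sum_distrib_left
    by (simp add: mult_ac)
  ultimately show ?thesis by (rule has_sum_eq)
qed

definition kr :: "'e list \<times> 'v \<times> 'e list \<Rightarrow> int" where
  "kr = (\<lambda>(g, w, f). int (length g) - int (length f))"

text \<open>Inversion of arrows, seen on reduced pairs.\<close>

definition sw :: "'e list \<times> 'v \<times> 'e list \<Rightarrow> 'e list \<times> 'v \<times> 'e list" where
  "sw = (\<lambda>(g, w, f). (f, w, g))"

lemma sw_bij: "bij_betw sw R R"
proof (rule bij_betw_byWitness[of _ sw])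
  have sw: "sw r \<in> R" if "r \<in> R" for r
    using that by (cases r) (use R_swap in \<open>simp add: sw_def\<close>)
  then show "sw ` R \<subseteq> R" "sw ` R \<subseteq> R" by blast+
qed (simp_all add: sw_def split_beta)

text \<open>The modular cocycle of the measure: inversion changes the weight by the value at i
  \<beta> of exp (i k z), k being the degree. This is the source of the KMS condition.\<close>

lemma wr_sw: "wr (sw r) = wr r * exp (- \<beta> * of_int (kr r))"
  by (cases r) (simp add: wr_def sw_def kr_def algebra_simps flip: exp_add)

text \<open>Coefficients of adjoints are conjugates at inverse arrows, so exchanging the two paths
  exchanges the two factors under the integral, over the same tails.\<close>

lemma B_sw:
  assumes a: "a \<in> A" and b: "b \<in> A" and r: "r \<in> R"
  shows "B (sw r) (adj_op b) a = B r (adj_op a) b"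
proof -
  obtain g w f where rd: "r = (g, w, f)" by (cases r)
  have fp: "fp g w" "fp f w" using r unfolding rd R_def by simp_all
  have "cnj (jr (adj_op b) (sw r) p) * jr a (sw r) p = cnj (jr (adj_op a) r p) * jr b r p" for p
  proof (cases "p \<in> C w")
    case True
    then have "th f g p \<in> \<Gamma>" "th g f p \<in> \<Gamma>" using th_groupoid fp by blast+
    then show ?thesis
      using True by (simp add: rd sw_def jr_def j_adj a b arrow_inv_th)
  qed (simp add: rd sw_def jr_def)
  then show ?thesis unfolding B_def by simp
qed

lemma B_\<alpha>:
  assumes r: "r \<in> R"
  shows "B r a (\<alpha> t b) = phase t (kr r) * B r a b"
proof -
  have "jr (\<alpha> t b) r p = phase t (kr r) * jr b r p" for p
    by (cases r) (simp add: jr_def kr_def j_\<alpha> deg_def th_def)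
  then have "cnj (jr a r p) * jr (\<alpha> t b) r p = phase t (kr r) * (cnj (jr a r p) * jr b r p)" for p
    by simp
  then show ?thesis unfolding B_def by (simp only: integral_mult_right_zero)
qed

lemma \<alpha>_N: "b \<in> N \<Longrightarrow> \<alpha> t b \<in> N"
  unfolding weight_N_def
  by (simp add: \<alpha>_in \<alpha>_adj adjointable \<Psi>_\<alpha> pos_adj_compose flip: \<alpha>_compose)

lemma has_sum_KMS:
  assumes ab: "a \<in> N" "adj_op a \<in> N" "b \<in> N" "adj_op b \<in> N"
  shows "((\<lambda>r. of_real (wr r) * B r (adj_op a) b * exp (\<i> * of_int (kr r) * of_real t)) has_sum
      \<phi> (a o\<^sub>L \<alpha> t b)) R"
    and "((\<lambda>r. of_real (wr r) * B r (adj_op a) b * exp (\<i> * of_int (kr r) * (of_real t + \<i> * of_real \<beta>))) has_sum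
      \<phi> (\<alpha> t b o\<^sub>L a)) R"
proof -
  have A: "a \<in> A" "b \<in> A" using ab N_in by blast+
  have aa: "adj_op (adj_op a) = a" using A by (simp add: adj_adj adjointable)
  have bb: "adj_op (adj_op (\<alpha> t b)) = \<alpha> t b" using A by (simp add: adj_adj adjointable \<alpha>_in)
  have abN: "adj_op (\<alpha> t b) \<in> N" using \<alpha>_N[OF ab(4)] A by (simp add: \<alpha>_adj adjointable)
  have phase: "exp (\<i> * of_int k * of_real t) = phase t k" for k by (simp add: phase_def)
  have "((\<lambda>r. of_real (wr r) * B r (adj_op a) (\<alpha> t b)) has_sum \<phi> (a o\<^sub>L \<alpha> t b)) R"
    using has_sum_functional[OF ab(2) \<alpha>_N[OF ab(3)]] unfolding aa .
  then show "((\<lambda>r. of_real (wr r) * B r (adj_op a) b * exp (\<i> * of_int (kr r) * of_real t)) has_sum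
      \<phi> (a o\<^sub>L \<alpha> t b)) R"
    by (rule has_sum_eq) (simp add: B_\<alpha> phase)
  have "((\<lambda>r. of_real (wr r) * B r (adj_op (\<alpha> t b)) a) has_sum \<phi> (\<alpha> t b o\<^sub>L a)) R"
    using has_sum_functional[OF abN ab(1)] unfolding bb .
  then have "((\<lambda>r. of_real (wr (sw r)) * B (sw r) (adj_op (\<alpha> t b)) a) has_sum \<phi> (\<alpha> t b o\<^sub>L a)) R"
    using has_sum_reindex_bij_betw[OF sw_bij, of "\<lambda>r. of_real (wr r) * B r (adj_op (\<alpha> t b)) a"] by simp
  moreover have "of_real (wr (sw r)) * B (sw r) (adj_op (\<alpha> t b)) a =
      of_real (wr r) * B r (adj_op a) b * exp (\<i> * of_int (kr r) * (of_real t + \<i> * of_real \<beta>))" if r: "r \<in> R" for r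
  proof -
    have "exp (\<i> * of_int (kr r) * (of_real t + \<i> * of_real \<beta>)) =
        phase t (kr r) * of_real (exp (- \<beta> * of_int (kr r)))"
      unfolding phase_def exp_of_real[symmetric] exp_add[symmetric] by (simp add: algebra_simps)
    then show ?thesis
      using B_sw[OF A(1) \<alpha>_in[OF A(2)] r] by (simp add: wr_sw B_\<alpha>[OF r])
  qed
  ultimately show "((\<lambda>r. of_real (wr r) * B r (adj_op a) b * exp (\<i> * of_int (kr r) * (of_real t + \<i> * of_real \<beta>))) has_sum
      \<phi> (\<alpha> t b o\<^sub>L a)) R"
    by (rule has_sum_eq)
qed

lemma kms_\<Psi>: "KMS_weight (graph_algebra G) (gauge_action G) \<beta> \<Psi>"
  unfolding KMS_weight_def
proof (intro conjI allI ballI impI)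
  show "proper_weight A \<Psi>" by (rule proper)
  show "\<Psi> (gauge_action G t a) = \<Psi> a" if "a \<in> positive_part A" for t a
    using \<Psi>_\<alpha>[OF that] gauge_action_eq[OF pos_in[OF that]] by simp
  fix a b assume A: "a \<in> A" "b \<in> A" and N: "a \<in> N" "adj_op a \<in> N" "b \<in> N" "adj_op b \<in> N"
  define c where "c r = of_real (wr r) * B r (adj_op a) b" for r
  define F where "F z = (\<Sum>\<^sub>\<infinity>r\<in>R. c r * exp (\<i> * of_int (kr r) * z))" for z
  have "c summable_on R"
    using has_sum_functional[OF N(2,3)] unfolding c_def by (rule has_sum_imp_summable)
  then have s1: "(\<lambda>r. cmod (c r)) summable_on R" by (simp only: summable_on_iff_abs_summable_on_complex)
  \<comment> \<open>Summability on the other edge of the strip comes from the product in the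
    opposite order, reindexed by \<open>sw\<close>; here \<open>adj_op b\<close> and
    \<open>a\<close> have to lie in \<open>N\<close>.\<close>
  have "(\<lambda>r. of_real (wr r) * B r (adj_op b) a) summable_on R"
    using has_sum_functional[OF N(4,1)] by (rule has_sum_imp_summable)
  then have "(\<lambda>r. cmod (of_real (wr r) * B r (adj_op b) a)) summable_on R"
    by (simp only: summable_on_iff_abs_summable_on_complex)
  then have "(\<lambda>r. cmod (of_real (wr (sw r)) * B (sw r) (adj_op b) a)) summable_on R"
    using summable_on_reindex_bij_betw[OF sw_bij, of "\<lambda>r. cmod (of_real (wr r) * B r (adj_op b) a)"] by simp
  moreover have "cmod (of_real (wr (sw r)) * B (sw r) (adj_op b) a) = cmod (c r) * exp (- \<beta> * of_int (kr r))"
    if "r \<in> R" for r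
    unfolding c_def B_sw[OF A that] wr_sw by (simp add: norm_mult)
  ultimately have s2: "(\<lambda>r. cmod (c r) * exp (- \<beta> * of_int (kr r))) summable_on R"
    by (rule summable_on_cong[THEN iffD1, rotated])
  show "\<exists>F. continuous_on (strip \<beta>) F \<and> bounded (F ` strip \<beta>) \<and> F holomorphic_on interior (strip \<beta>) \<and>
      (\<forall>t::real. F (of_real t) = \<phi> (a o\<^sub>L gauge_action G t b) \<and>
        F (of_real t + \<i> * of_real \<beta>) = \<phi> (gauge_action G t b o\<^sub>L a))"
  proof (intro exI[of _ F] conjI allI)
    show "continuous_on (strip \<beta>) F" "bounded (F ` strip \<beta>)" "F holomorphic_on interior (strip \<beta>)"
      unfolding F_def by (rule strip_series[OF s1 s2])+
    show "F (of_real t) = \<phi> (a o\<^sub>L gauge_action G t b)"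
      "F (of_real t + \<i> * of_real \<beta>) = \<phi> (gauge_action G t b o\<^sub>L a)" for t
      using has_sum_KMS[OF N, of t, THEN infsumI] by (simp_all add: F_def c_def gauge_action_eq[OF A(2)])
  qed
qed

end

theorem theorem4p6:
  fixes G :: "('v, 'e) pre_digraph" and \<beta> :: real
  assumes "wf_digraph G"
    and "countable (verts G)" and "countable (arcs G)"
    and "row_finite G" and "no_sinks G"
  shows "\<exists>\<Phi>. bij_betw \<Phi> {\<psi>. KMS_weight (graph_algebra G) (gauge_action G) \<beta> \<psi>}
                {\<xi> \<in> extensional (verts G).
                   (\<exists>v\<in>verts G. \<xi> v \<noteq> 0) \<and>
                   (\<forall>v\<in>verts G. 0 \<le> \<xi> v \<and>
                      (\<Sum>\<^sub>\<infinity>w\<in>verts G. real (adjacency G v w) * \<xi> w) = exp \<beta> * \<xi> v)} \<and>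
             (\<forall>\<psi>. KMS_weight (graph_algebra G) (gauge_action G) \<beta> \<psi> \<longrightarrow>
                (\<forall>v\<in>verts G. \<psi> (vertex_projection G v) = ennreal (\<Phi> \<psi> v)))"
proof -
  interpret path_graph G
    using assms by (intro path_graph.intro path_graph_axioms.intro)
  have kmsI: "kms_weight G \<beta> \<psi>" if "KMS_weight (graph_algebra G) (gauge_action G) \<beta> \<psi>" for \<psi>
    using that by unfold_locales
  \<comment> \<open>Restricting to the vertices makes the value extensional; the conversion to reals
    is faithful because KMS weights are finite on vertex projections.\<close>
  define \<Phi> :: "('e arrow operator \<Rightarrow> ennreal) \<Rightarrow> 'v \<Rightarrow> real"
    where "\<Phi> \<psi> = (\<lambda>v\<in>verts G. enn2real (\<psi> (vertex_projection G v)))" for \<psi>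
  have \<Phi>: "\<psi> (S [] v []) = ennreal (\<Phi> \<psi> v)"
    if k: "KMS_weight (graph_algebra G) (gauge_action G) \<beta> \<psi>" and v: "v \<in> verts G" for \<psi> v
  proof -
    interpret kms_weight G \<beta> \<psi> by (rule kmsI[OF k])
    show ?thesis using \<psi>_p[OF v] v by (simp add: \<Phi>_def vertex_projection_eq \<xi>_def)
  qed
  let ?K = "{\<psi>. KMS_weight (graph_algebra G) (gauge_action G) \<beta> \<psi>}"
  let ?E = "{\<xi> \<in> extensional (verts G). (\<exists>v\<in>verts G. \<xi> v \<noteq> 0) \<and> (\<forall>v\<in>verts G. 0 \<le> \<xi> v \<and>
      (\<Sum>\<^sub>\<infinity>w\<in>verts G. real (adjacency G v w) * \<xi> w) = exp \<beta> * \<xi> v)}"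
  have bij: "bij_betw \<Phi> ?K ?E"
  proof (rule bij_betw_imageI)
    show "inj_on \<Phi> ?K"
    proof (rule inj_onI)
      fix \<psi> \<psi>' assume "\<psi> \<in> ?K" "\<psi>' \<in> ?K" and eq: "\<Phi> \<psi> = \<Phi> \<psi>'"
      then have k: "KMS_weight (graph_algebra G) (gauge_action G) \<beta> \<psi>"
        "KMS_weight (graph_algebra G) (gauge_action G) \<beta> \<psi>'" by simp_all
      show "\<psi> = \<psi>'"
        by (rule kms_weight_unique[OF kmsI[OF k(1)] kmsI[OF k(2)]]) (simp only: \<Phi>[OF k(1)] \<Phi>[OF k(2)] eq)
    qed
    show "\<Phi> ` ?K = ?E"
    proof (rule subset_antisym)
      show "\<Phi> ` ?K \<subseteq> ?E"
      proof (rule image_subsetI)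
        fix \<psi> assume "\<psi> \<in> ?K"
        then have k: "KMS_weight (graph_algebra G) (gauge_action G) \<beta> \<psi>" by simp
        interpret kms_weight G \<beta> \<psi> by (rule kmsI[OF k])
        have eq: "\<Phi> \<psi> v = \<xi> v" if "v \<in> verts G" for v
          using that by (simp add: \<Phi>_def vertex_projection_eq \<xi>_def)
        have "(\<Sum>\<^sub>\<infinity>w\<in>verts G. real (adjacency G v w) * \<Phi> \<psi> w) = exp \<beta> * \<Phi> \<psi> v" if "v \<in> verts G" for v
          using \<xi>_eigen[OF that] eq[OF that] by (simp add: eq cong: infsum_cong)
        moreover have "\<exists>v\<in>verts G. \<Phi> \<psi> v \<noteq> 0" using \<xi>_nonzero eq by auto
        moreover have "\<Phi> \<psi> \<in> extensional (verts G)" unfolding \<Phi>_def by simp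
        ultimately show "\<Phi> \<psi> \<in> ?E" using eq \<xi>_nonneg by simp
      qed
      show "?E \<subseteq> \<Phi> ` ?K"
      proof (rule subsetI)
        fix \<xi> assume \<xi>: "\<xi> \<in> ?E"
        then have ex: "\<exists>v\<in>verts G. \<xi> v \<noteq> 0" and \<xi>_ext: "\<xi> \<in> extensional (verts G)" by simp_all
        have nn: "0 \<le> \<xi> v" and sum: "(\<Sum>a\<in>out_arcs G v. \<xi> (head G a)) = exp \<beta> * \<xi> v" if "v \<in> verts G" for v
          using \<xi> that adjacency_sum[OF that, of \<xi>] by simp_all
        interpret nonzero_eigenvector G \<beta> \<xi>
          using nn sum ex by unfold_locales
        \<comment> \<open>Away from the vertices both functions are \<open>undefined\<close>, as
          extensionality of \<xi> requires.\<close>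
        have "\<Phi> \<Psi> v = \<xi> v" for v
          using \<Psi>_p[of v] nn[of v] extensional_arb[OF \<xi>_ext, of v]
          by (cases "v \<in> verts G") (simp_all add: \<Phi>_def vertex_projection_eq)
        then have "\<xi> = \<Phi> \<Psi>" by (simp add: fun_eq_iff)
        then show "\<xi> \<in> \<Phi> ` ?K" using kms_\<Psi> by blast
      qed
    qed
  qed
  show ?thesis
  proof (intro exI[of _ \<Phi>] conjI allI impI ballI)
    show "bij_betw \<Phi> ?K ?E" by (rule bij)
    show "\<psi> (vertex_projection G v) = ennreal (\<Phi> \<psi> v)"
      if "KMS_weight (graph_algebra G) (gauge_action G) \<beta> \<psi>" "v \<in> verts G" for \<psi> v
      unfolding vertex_projection_eq by (rule \<Phi>[OF that])
  qed
qed

end
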